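(* Let $A = (a_1\ \cdots\ a_n) \in \mathbb{Z}^{d \times n}$ be such that $\operatorname{rank}(A) = d$. Let $P_A \subset \mathbb{R}^d$ be the polytope obtained as the convex hull of the lattice points $\{\pm a_1, \ldots, \pm a_n\} \subset \mathbb{Z}^d$. For any $b \in \mathbb{C}^n$, we have $$\deg(\mathcal{L}_{A,b}) = \frac{d!\, \operatorname{vol}(P_A)}{\deg \pi_{A,b} \cdot [\mathbb{Z}^d : \mathbb{Z}A]},$$ where $\operatorname{vol}(\cdot)$ denotes the Euclidean volume and $\pi_{A,b} : \mathcal{Y}_{A,b} \to \mathcal{L}_{A,b}$ is the coordinate projection $(x,y)\mapsto x$ defined in the context.
   Context: For $A \in \mathbb{Z}^{d\times n}$ and $b \in \mathbb{C}^n$, let $\operatorname{Row}(A) \subseteq \mathbb{C}^n$ be the $\mathbb{C}$-span of the rows of $A$. The Lissajous variety $\mathcal{L}_{A,b} \subseteq \mathbb{C}^n$ is the image of $\operatorname{Row}(A) - \frac{\pi}{2}b$ under the coordinate-wise cosine map $\mathbb{C}^n \to \mathbb{C}^n$; it is an irreducible Zariski closed subset of $\mathbb{C}^n$ of dimension $\operatorname{rank}(A)$. Its degree is the number of intersection points with a generic affine-linear space of complementary dimension. $\mathbb{Z}A\subseteq \mathbb{Z}^d$ is the lattice generated by the columns of $A$, and $[\mathbb{Z}^d:\mathbb{Z}A]$ is its index. The affine toric variety $Y_A \subseteq \mathbb{C}^n$ is the Zariski closure of the image of $(\mathbb{C}^* )^d \to \mathbb{C}^n$, $v \mapsto (v^{a_1},\dots,v^{a_n})$,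 where $v^{a_j} = \prod_{k=1}^d v_k^{a_{kj}}$. For $\beta \in (\mathbb{C}^* )^n$, $Y_{A,\beta} = \{(\beta_1 y_1,\dots,\beta_n y_n) : y \in Y_A\}$. With $\beta_j = e^{-i b_j \pi/2}$, set $$\mathcal{Y}_{A,b} = \{(x,y) \in \mathbb{C}^n \times (\mathbb{C}^* )^n : y \in Y_{A,\beta},\ x_j = \tfrac12(y_j + y_j^{-1}) \text{ for } j=1,\dots,n\}.$$ The projection $\pi_{A,b}: (x,y)\mapsto x$ maps $\mathcal{Y}_{A,b}$ onto $\mathcal{L}_{A,b}$. The degree $\deg\phi$ of a dominant morphism $\phi : X \to Y$ between irreducible varieties of dimension $d$ is the cardinality of a generic fiber. *)

theory Defs
  imports "HOL-Analysis.Analysis"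
begin

section \<open>Polynomial functions, Zariski topology, genericity\<close>

text \<open>
  Polynomials over the infinite field of complex numbers are represented by the functions that
  they induce. Relative to a set \<open>F\<close> of coordinate functions on a type, the polynomial functions
  are the members of the \<open>\<complex>\<close>-algebra of functions generated by \<open>F\<close>. Keeping \<open>F\<close> as a parameter
  makes the same notions available on \<open>\<complex>\<close>-spaces of vectors, of tuples of varying length, and of
  coefficients of linear equations.
\<close>

inductive_set poly_funs :: "('a \<Rightarrow> complex) set \<Rightarrow> ('a \<Rightarrow> complex) set"
  for F :: "('a \<Rightarrow> complex) set" where
  coord: "f \<in> F \<Longrightarrow> f \<in> poly_funs F"
| const: "(\<lambda>_. c) \<in> poly_funs F"
| add: "p \<in> poly_funs F \<Longrightarrow> q \<in> poly_funs F \<Longrightarrow> (\<lambda>x. p x + q x) \<in> poly_funs F"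
| mult: "p \<in> poly_funs F \<Longrightarrow> q \<in> poly_funs F \<Longrightarrow> (\<lambda>x. p x * q x) \<in> poly_funs F"

definition zariski_closed :: "('a \<Rightarrow> complex) set \<Rightarrow> 'a set \<Rightarrow> bool" where
  "zariski_closed F Z \<longleftrightarrow> (\<exists>P \<subseteq> poly_funs F. Z = {x. \<forall>p\<in>P. p x = 0})"

text \<open>\<open>P\<close> holds for a generic point of \<open>Y\<close>: it holds on a nonempty relatively Zariski open
  subset of \<open>Y\<close>. The notion is meaningful for irreducible \<open>Y\<close>.\<close>

definition generic_on :: "('a \<Rightarrow> complex) set \<Rightarrow> 'a set \<Rightarrow> ('a \<Rightarrow> bool) \<Rightarrow> bool" where
  "generic_on F Y P \<longleftrightarrow> (\<exists>Z. zariski_closed F Z \<and> Y - Z \<noteq> {} \<and> (\<forall>y \<in> Y - Z. P y))"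

definition vec_coords :: "(complex ^ 'n \<Rightarrow> complex) set" where
  "vec_coords = range (\<lambda>j x. x $ j)"

definition tuple_coords :: "nat \<Rightarrow> ((nat \<Rightarrow> complex) \<Rightarrow> complex) set" where
  "tuple_coords k = (\<lambda>i t. t i) ` {..<k}"

section \<open>Dimension and degree\<close>

text \<open>\<open>f 0, \<dots>, f (k - 1)\<close> are algebraically independent over \<open>\<complex>\<close> as functions on \<open>X\<close>.\<close>

definition alg_independent_on :: "'a set \<Rightarrow> nat \<Rightarrow> (nat \<Rightarrow> 'a \<Rightarrow> complex) \<Rightarrow> bool" where
  "alg_independent_on X k f \<longleftrightarrow>
     (\<forall>p \<in> poly_funs (tuple_coords k). (\<forall>x\<in>X. p (\<lambda>i. f i x) = 0) \<longrightarrow> (\<forall>t. p t = 0))"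

text \<open>The dimension of an irreducible closed \<open>X \<subseteq> \<complex>\<^sup>n\<close>: the transcendence degree over \<open>\<complex>\<close> of
  its coordinate ring (equivalently, of its function field).\<close>

definition variety_dim :: "(complex ^ 'n) set \<Rightarrow> nat" where
  "variety_dim X =
     (GREATEST k. \<exists>f. (\<forall>i<k. f i \<in> poly_funs vec_coords) \<and> alg_independent_on X k f)"

text \<open>The affine-linear space cut out by the first \<open>k\<close> equations \<open>M i \<cdot> x = c i\<close>. For a generic
  choice of the \<open>k (n + 1)\<close> coefficients and \<open>k \<le> n\<close> it has codimension \<open>k\<close>.\<close>

definition affine_space ::
    "nat \<Rightarrow> (nat \<Rightarrow> complex ^ 'n) \<times> (nat \<Rightarrow> complex) \<Rightarrow> (complex ^ 'n) set" where
  "affine_space k = (\<lambda>(M, c). {x. \<forall>i<k. (\<Sum>j\<in>UNIV. M i $ j * x $ j) = c i})"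

definition equation_coords ::
    "nat \<Rightarrow> ((nat \<Rightarrow> complex ^ 'n) \<times> (nat \<Rightarrow> complex) \<Rightarrow> complex) set" where
  "equation_coords k =
     {(\<lambda>(M, c). M i $ j) | i j. i < k} \<union> {(\<lambda>(M, c). c i) | i. i < k}"

definition variety_degree :: "(complex ^ 'n) set \<Rightarrow> nat" where
  "variety_degree X = (THE m. generic_on (equation_coords (variety_dim X)) UNIV
     (\<lambda>e. finite (X \<inter> affine_space (variety_dim X) e) \<and>
          card (X \<inter> affine_space (variety_dim X) e) = m))"

text \<open>The degree of a map onto a dense subset of \<open>Y \<subseteq> \<complex>\<^sup>n\<close>: the cardinality of a generic fiber.\<close>

definition map_degree :: "('a \<Rightarrow> complex ^ 'n) \<Rightarrow> 'a set \<Rightarrow> (complex ^ 'n) set \<Rightarrow> nat" where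
  "map_degree \<phi> X Y = (THE m. generic_on vec_coords Y
     (\<lambda>y. finite {x \<in> X. \<phi> x = y} \<and> card {x \<in> X. \<phi> x = y} = m))"

section \<open>Lissajous varieties\<close>

definition Row :: "int ^ 'n ^ 'd \<Rightarrow> (complex ^ 'n) set" where
  "Row A = vec.span (rows (map_matrix of_int A))"

definition lissajous :: "int ^ 'n ^ 'd \<Rightarrow> complex ^ 'n \<Rightarrow> (complex ^ 'n) set" where
  "lissajous A b = (\<lambda>w. \<chi> j. cos (w $ j - of_real pi / 2 * b $ j)) ` Row A"

definition toric :: "int ^ 'n ^ 'd \<Rightarrow> (complex ^ 'n) set" where
  "toric A = zariski_closed vec_coords hull
     ((\<lambda>v. \<chi> j. \<Prod>k\<in>UNIV. (v $ k) powi (A $ k $ j)) ` {v :: complex ^ 'd. \<forall>k. v $ k \<noteq> 0})"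

definition scaled_toric :: "int ^ 'n ^ 'd \<Rightarrow> complex ^ 'n \<Rightarrow> (complex ^ 'n) set" where
  "scaled_toric A \<beta> = (\<lambda>y. \<chi> j. \<beta> $ j * y $ j) ` toric A"

definition lissajous_cover ::
    "int ^ 'n ^ 'd \<Rightarrow> complex ^ 'n \<Rightarrow> ((complex ^ 'n) \<times> (complex ^ 'n)) set" where
  "lissajous_cover A b =
     {(x, y). (\<forall>j. y $ j \<noteq> 0) \<and>
        y \<in> scaled_toric A (\<chi> j. exp (- \<i> * b $ j * of_real pi / 2)) \<and>
        (\<forall>j. x $ j = (y $ j + inverse (y $ j)) / 2)}"

definition col_polytope :: "int ^ 'n ^ 'd \<Rightarrow> (real ^ 'd) set" where
  "col_polytope A =
     convex hull (columns (map_matrix of_int A) \<union> uminus ` columns (map_matrix of_int A))"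

definition col_lattice :: "int ^ 'n ^ 'd \<Rightarrow> (int ^ 'd) set" where
  "col_lattice A = {\<Sum>j\<in>UNIV. c j *s column j A | c. True}"

definition col_lattice_index :: "int ^ 'n ^ 'd \<Rightarrow> nat" where
  "col_lattice_index A = card (UNIV // {(u, v). u - v \<in> col_lattice A})"

end

theory Submission
  imports Defs "HOL-Library.Function_Algebras" "HOL-Complex_Analysis.Complex_Analysis"
    "HOL-Computational_Algebra.Fundamental_Theorem_Algebra"
begin

text \<open>
  Points of the torus are written as \<open>y\<^sub>j = \<beta>\<^sub>j exp (\<i> \<langle>a\<^sub>j, u\<rangle>)\<close> with \<open>u \<in> \<complex>\<^sup>d\<close>, so that regular functions become
  exponential sums with frequencies in the lattice of the columns. Filter them by the number of
  columns \<open>\<plusminus>a\<^sub>j\<close> needed to reach a frequency: the \<open>k\<close>-th step has dimension asymptotic to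
  \<open>k\<^sup>d vol(P\<^sub>A) / [\<int>\<^sup>d : \<int>A]\<close>. By Noether normalization the ring is finite over the polynomials in \<open>d\<close> generic
  linear forms \<open>z\<^sub>i\<close> in the coordinates \<open>x\<^sub>j = (y\<^sub>j + 1 / y\<^sub>j) / 2\<close>, and comparing Hilbert functions its rank
  is \<open>d! vol(P\<^sub>A) / [\<int>\<^sup>d : \<int>A]\<close>. For generic coefficients the system \<open>z\<^sub>i = c\<^sub>i\<close> has a nonvanishing Jacobian at all its
  solutions, its ideal is therefore reduced, and it has exactly as many solutions as the rank. The
  projection to \<open>x\<close> groups these solutions into classes of size equal to its degree.
\<close>

section \<open>Linear algebra in spaces of functions\<close>

text \<open>Two kinds of genericity meet here. For a fixed matrix \<open>M\<close> of forms, a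
  module basis becomes a basis of the fiber algebra for all \<open>c\<close> off the zeros of a
  polynomial \<Delta>; but basis and \<Delta> depend on \<open>M\<close>, while the degree asks for
  one open set of pairs \<open>(M, c)\<close>. Spanning is the property that spreads: modulo the
  fiber ideal it is decided in a finite-dimensional step of the filtration, where it is an open
  condition on a matrix with polynomial entries. Independence is not transported but recovered: a
  spanning family smaller than the rank would still span for the same \<open>M\<close> and generic
  \<open>c\<close>. That the fiber avoids the zeros of the Jacobian and of a given function
  \<open>h\<close> is phrased as spanning, too: multiples of their product span the fiber algebra.
  Point derivations replace local rings: a nonreduced fiber algebra would yield a nonzero one that
  kills the ideal, and the Jacobian excludes it. That the ring of exponential sums has no zero
  divisors takes the place of irreducibility.\<close>

definition fscale :: "complex \<Rightarrow> ('a \<Rightarrow> complex) \<Rightarrow> 'a \<Rightarrow> complex" where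
  "fscale c f = (\<lambda>x. c * f x)"

lemma fscale_apply [simp]: "fscale c f x = c * f x"
  by (simp add: fscale_def)

interpretation fs: vector_space fscale
  by standard (auto simp: fscale_def fun_eq_iff algebra_simps)

lemma sum_fun_apply [simp]: "(\<Sum>i\<in>I. f i) x = (\<Sum>i\<in>I. f i x)"
  for f :: "'i \<Rightarrow> 'a \<Rightarrow> 'b::comm_monoid_add"
  by (induction I rule: infinite_finite_induct) auto

lemma prod_fun_apply [simp]: "(\<Prod>i\<in>I. f i) x = (\<Prod>i\<in>I. f i x)"
  for f :: "'i \<Rightarrow> 'a \<Rightarrow> 'b::comm_monoid_mult"
  by (induction I rule: infinite_finite_induct) auto

lemma power_fun_apply [simp]: "(f ^ n) x = f x ^ n"
  for f :: "'a \<Rightarrow> 'b::monoid_mult"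
  by (induction n) auto

text \<open>Induction on the equations: one with a nonzero coefficient at \<open>j\<close>
  eliminates the unknown \<open>j\<close> from the others, and dropping both keeps the unknowns in
  the majority.\<close>

lemma homogeneous_system:
  fixes m :: "'i \<Rightarrow> 'v \<Rightarrow> 'k::field"
  assumes "finite V" "finite I" "card V < card I"
  shows "\<exists>c. (\<exists>i\<in>I. c i \<noteq> 0) \<and> (\<forall>v\<in>V. (\<Sum>i\<in>I. c i * m i v) = 0)"
  using assms
proof (induction V arbitrary: I m rule: finite_induct)
  case empty
  then obtain i where "i \<in> I" by fastforce
  then show ?case by (intro exI[of _ "\<lambda>_. 1"]) auto
next
  case (insert v V)
  show ?case
  proof (cases "\<forall>i\<in>I. m i v = 0")
    case True
    have "card V < card I" using insert by simp
    from insert.IH[OF insert.prems(1) this, of m] True show ?thesis by auto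
  next
    case False
    then obtain j where j: "j \<in> I" "m j v \<noteq> 0" by auto
    define m' where "m' = (\<lambda>i w. m i w - m i v / m j v * m j w)"
    have "card V < card (I - {j})" using insert j by simp
    from insert.IH[OF _ this, of m'] insert.prems obtain c
      where c: "\<exists>i\<in>I - {j}. c i \<noteq> 0" "\<forall>w\<in>V. (\<Sum>i\<in>I-{j}. c i * m' i w) = 0" by auto
    define c' where "c' = (\<lambda>i. if i = j then - (\<Sum>i\<in>I-{j}. c i * m i v / m j v) else c i)"
    have *: "(\<Sum>i\<in>I. c' i * m i w) = (\<Sum>i\<in>I-{j}. c i * m' i w)" for w
    proof -
      have "(\<Sum>i\<in>I. c' i * m i w) = c' j * m j w + (\<Sum>i\<in>I-{j}. c' i * m i w)"
        using j insert.prems by (simp add: sum.remove)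
      also have "(\<Sum>i\<in>I-{j}. c' i * m i w) = (\<Sum>i\<in>I-{j}. c i * m i w)"
        by (intro sum.cong) (auto simp: c'_def)
      also have "c' j * m j w = - (\<Sum>i\<in>I-{j}. c i * (m i v / m j v * m j w))"
        by (simp add: c'_def sum_distrib_right mult.assoc)
      finally show ?thesis by (simp add: m'_def right_diff_distrib sum_subtractf)
    qed
    have "m' i v = 0" for i using j by (simp add: m'_def)
    with * c(2) have "\<forall>w\<in>insert v V. (\<Sum>i\<in>I. c' i * m i w) = 0" by simp
    moreover have "\<exists>i\<in>I. c' i \<noteq> 0" using c(1) by (auto simp: c'_def)
    ultimately show ?thesis by blast
  qed
qed

text \<open>Steinitz bound in the quotient by \<open>W\<close>, stated with representatives so that
  no quotient space has to be formed. All comparisons of codimensions rest on it.\<close>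

lemma dependent_mod_subspace:
  assumes W: "fs.subspace W" and "finite V" "finite I" "card V < card I"
    and red: "\<And>i. i \<in> I \<Longrightarrow> \<exists>m. f i - (\<Sum>v\<in>V. fscale (m v) (g v)) \<in> W"
  obtains c where "\<exists>i\<in>I. c i \<noteq> 0" "(\<Sum>i\<in>I. fscale (c i) (f i)) \<in> W"
proof -
  obtain m where m: "\<And>i. i \<in> I \<Longrightarrow> f i - (\<Sum>v\<in>V. fscale (m i v) (g v)) \<in> W"
    using red by metis
  obtain c where c: "\<exists>i\<in>I. c i \<noteq> 0" "\<forall>v\<in>V. (\<Sum>i\<in>I. c i * m i v) = 0"
    using homogeneous_system[OF assms(2-4)] by blast
  have "(\<Sum>i\<in>I. fscale (c i) (\<Sum>v\<in>V. fscale (m i v) (g v)))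
      = (\<Sum>v\<in>V. fscale (\<Sum>i\<in>I. c i * m i v) (g v))"
    by (subst fs.scale_sum_right, subst sum.swap)
       (simp add: fs.scale_sum_left)
  also have "\<dots> = 0" using c(2) by simp
  finally have "(\<Sum>i\<in>I. fscale (c i) (f i)) =
      (\<Sum>i\<in>I. fscale (c i) (f i - (\<Sum>v\<in>V. fscale (m i v) (g v))))"
    by (simp add: fs.scale_right_diff_distrib sum_subtractf)
  also have "\<dots> \<in> W"
    using m W by (intro fs.subspace_sum fs.subspace_scale) auto
  finally show ?thesis using c(1) that by blast
qed

lemma span_image_finite_iff:
  assumes "finite V"
  shows "f \<in> fs.span (g ` V) \<longleftrightarrow> (\<exists>m. f = (\<Sum>v\<in>V. fscale (m v) (g v)))"
proof
  assume "f \<in> fs.span (g ` V)"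
  then show "\<exists>m. f = (\<Sum>v\<in>V. fscale (m v) (g v))"
  proof (induction rule: fs.span_induct_alt)
    case base
    show ?case by (intro exI[of _ "\<lambda>_. 0"]) simp
  next
    case (step c x y)
    from step(1) obtain v where v: "v \<in> V" "x = g v" by blast
    from step(2) obtain m where m: "y = (\<Sum>v\<in>V. fscale (m v) (g v))" by blast
    have "fscale c x = (\<Sum>w\<in>V. if w = v then fscale c (g v) else 0)"
      using v assms by (subst sum.delta) auto
    then have "fscale c x + y = (\<Sum>w\<in>V. fscale ((if w = v then c else 0) + m w) (g w))"
      by (simp add: m sum.distrib[symmetric] fs.scale_left_distrib if_distrib[where f="\<lambda>c. fscale c _"] cong: if_cong)
    then show ?case by (intro exI)
  qed
next
  assume "\<exists>m. f = (\<Sum>v\<in>V. fscale (m v) (g v))"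
  then show "f \<in> fs.span (g ` V)"
    by (fast intro: fs.span_sum fs.span_scale fs.span_base)
qed

section \<open>Polynomial functions\<close>

lemma poly_funs_sum:
  assumes "\<And>i. i \<in> I \<Longrightarrow> p i \<in> poly_funs F"
  shows "(\<lambda>x. \<Sum>i\<in>I. p i x) \<in> poly_funs F"
  using assms by (induction I rule: infinite_finite_induct) (auto intro: poly_funs.intros)

lemma poly_funs_prod:
  assumes "\<And>i. i \<in> I \<Longrightarrow> p i \<in> poly_funs F"
  shows "(\<lambda>x. \<Prod>i\<in>I. p i x) \<in> poly_funs F"
  using assms by (induction I rule: infinite_finite_induct) (auto intro: poly_funs.intros)

lemma poly_funs_power: "p \<in> poly_funs F \<Longrightarrow> (\<lambda>x. p x ^ k) \<in> poly_funs F"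
  by (induction k) (auto intro: poly_funs.intros)

lemma poly_funs_cmult: "p \<in> poly_funs F \<Longrightarrow> (\<lambda>x. c * p x) \<in> poly_funs F"
  by (intro poly_funs.mult poly_funs.const)

lemma poly_funs_diff:
  assumes "p \<in> poly_funs F" "q \<in> poly_funs F"
  shows "(\<lambda>x. p x - q x) \<in> poly_funs F"
  using poly_funs.add[OF assms(1) poly_funs_cmult[OF assms(2), of "-1"]] by simp

lemmas poly_funs_intros = poly_funs_diff poly_funs_sum poly_funs_prod poly_funs_power
  poly_funs_cmult poly_funs.add poly_funs.mult poly_funs.const

lemma poly_funs_compose:
  assumes "p \<in> poly_funs F" "\<And>f. f \<in> F \<Longrightarrow> (\<lambda>x. f (\<phi> x)) \<in> poly_funs G"
  shows "(\<lambda>x. p (\<phi> x)) \<in> poly_funs G"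
  using assms(1) by induction (auto intro: assms(2) poly_funs.intros)

text \<open>Substitute for irreducibility of affine space: any two points lie on a curve along which
  the coordinates are univariate polynomials.\<close>

definition line_coords :: "('a \<Rightarrow> complex) set \<Rightarrow> bool" where
  "line_coords F \<longleftrightarrow> (\<forall>x y. \<exists>L. L 0 = x \<and> L 1 = y \<and>
     (\<forall>f\<in>F. \<exists>q. \<forall>T::complex. f (L T) = poly q T))"

lemma poly_funs_line:
  assumes "p \<in> poly_funs F" "\<And>f. f \<in> F \<Longrightarrow> \<exists>q. \<forall>T. f (L T) = poly q T"
  shows "\<exists>q. \<forall>T. p (L T) = poly q T"
  using assms(1)
proof induction
  case (const c)
  show ?case by (intro exI[of _ "[:c:]"]) simp
next
  case (add p q)
  then obtain P Q where "\<forall>T. p (L T) = poly P T" "\<forall>T. q (L T) = poly Q T" by blast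
  then show ?case by (intro exI[of _ "P + Q"]) simp
next
  case (mult p q)
  then obtain P Q where "\<forall>T. p (L T) = poly P T" "\<forall>T. q (L T) = poly Q T" by blast
  then show ?case by (intro exI[of _ "P * Q"]) simp
qed (use assms(2) in blast)

text \<open>Along a line through \<open>x\<close> and \<open>y\<close> both functions are nonzero
  univariate polynomials, and their product has only finitely many roots.\<close>

lemma poly_funs_nonzero_common:
  assumes F: "line_coords F" and p: "p \<in> poly_funs F" "p x \<noteq> 0" and q: "q \<in> poly_funs F" "q y \<noteq> 0"
  obtains z where "p z \<noteq> 0" "q z \<noteq> 0"
proof -
  from F obtain L where L: "L 0 = x" "L 1 = y" "\<forall>f\<in>F. \<exists>q. \<forall>T::complex. f (L T) = poly q T"
    unfolding line_coords_def by blast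
  from poly_funs_line[OF p(1), of L] L(3) obtain P where P: "\<And>T. p (L T) = poly P T" by blast
  from poly_funs_line[OF q(1), of L] L(3) obtain Q where Q: "\<And>T. q (L T) = poly Q T" by blast
  note PQ = P Q
  have "P * Q \<noteq> 0" using PQ(1)[of 0] PQ(2)[of 1] L p q by auto
  then have "finite {T. poly (P * Q) T = 0}" by (rule poly_roots_finite)
  then obtain T where "poly (P * Q) T \<noteq> 0" using ex_new_if_finite[OF infinite_UNIV_char_0] by blast
  then show ?thesis using PQ that[of "L T"] by simp
qed

lemma line_coords_tuple: "line_coords (tuple_coords k)"
  unfolding line_coords_def tuple_coords_def
  by (intro allI exI[of _ "\<lambda>T i. x i + T * (y i - x i)" for x y])
     (auto intro!: exI[of _ "[:x i, y i - x i:]" for x y i])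

lemma line_coords_equation: "line_coords (equation_coords k :: ((nat \<Rightarrow> complex ^ 'n) \<times> (nat \<Rightarrow> complex) \<Rightarrow> complex) set)"
  unfolding line_coords_def
proof (intro allI)
  fix x y :: "(nat \<Rightarrow> complex ^ 'n) \<times> (nat \<Rightarrow> complex)"
  let ?L = "\<lambda>T. (\<lambda>i. \<chi> j. fst x i $ j + T * (fst y i $ j - fst x i $ j), \<lambda>i. snd x i + T * (snd y i - snd x i))"
  have "?L 0 = x" "?L 1 = y" by (auto simp: vec_eq_iff prod_eq_iff)
  moreover have "\<exists>q. \<forall>T. f (?L T) = poly q T" if "f \<in> equation_coords k" for f
  proof -
    from that consider (M) i j where "f = (\<lambda>(M, c). M i $ j)" | (c) i where "f = (\<lambda>(M, c). c i)"
      unfolding equation_coords_def by blast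
    then show ?thesis
    proof cases
      case M
      then show ?thesis by (intro exI[of _ "[:fst x i $ j, fst y i $ j - fst x i $ j:]"]) simp
    next
      case c
      then show ?thesis by (intro exI[of _ "[:snd x i, snd y i - snd x i:]"]) simp
    qed
  qed
  ultimately show "\<exists>L. L 0 = x \<and> L 1 = y \<and> (\<forall>f\<in>equation_coords k. \<exists>q. \<forall>T. f (L T) = poly q T)"
    by (intro exI[of _ ?L]) auto
qed

subsection \<open>Monomials\<close>

definition exps :: "nat \<Rightarrow> nat \<Rightarrow> (nat \<Rightarrow> nat) set" where
  "exps m k = {\<alpha>. (\<forall>i\<ge>m. \<alpha> i = 0) \<and> (\<Sum>i<m. \<alpha> i) \<le> k}"

definition mon :: "nat \<Rightarrow> (nat \<Rightarrow> 'r) \<Rightarrow> (nat \<Rightarrow> nat) \<Rightarrow> 'r::comm_ring_1" where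
  "mon m t \<alpha> = (\<Prod>i<m. t i ^ \<alpha> i)"

lemma mon_apply: "mon m \<zeta> \<alpha> u = mon m (\<lambda>i. \<zeta> i u) \<alpha>"
  by (simp add: mon_def)

lemma mon_add: "mon m t (\<lambda>i. \<alpha> i + \<beta> i) = mon m t \<alpha> * mon m t \<beta>"
  by (simp add: mon_def power_add prod.distrib)

lemma mon_Suc: "mon (Suc m) t \<alpha> = mon m t \<alpha> * t m ^ \<alpha> m"
  by (simp add: mon_def)

lemma exps_0: "exps 0 k = {\<lambda>_. 0}"
  by (auto simp: exps_def)

lemma exps_Suc_0: "exps (Suc m) 0 = exps m 0"
  by (auto simp: exps_def le_Suc_eq) (metis le_antisym not_less_eq_eq)+

text \<open>Pascal's rule on the level of exponents: either the variable \<open>m\<close> is absent,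
  or one factor of it can be split off.\<close>

lemma exps_Suc_Suc:
  "exps (Suc m) (Suc k) = exps m (Suc k) \<union> (\<lambda>\<alpha>. \<alpha>(m := Suc (\<alpha> m))) ` exps (Suc m) k" (is "?L = ?R")
proof (intro equalityI subsetI)
  fix \<alpha> assume a: "\<alpha> \<in> ?L"
  show "\<alpha> \<in> ?R"
  proof (cases "\<alpha> m")
    case 0
    then have "\<forall>i\<ge>m. \<alpha> i = 0" using a by (simp add: exps_def) (metis le_antisym not_less_eq_eq)
    then have "\<alpha> \<in> exps m (Suc k)" using a 0 by (simp add: exps_def)
    then show ?thesis by simp
  next
    case (Suc j)
    have "\<alpha>(m := j) \<in> exps (Suc m) k" using a Suc
      by (auto simp: exps_def)
    moreover have "\<alpha> = (\<lambda>\<alpha>. \<alpha>(m := Suc (\<alpha> m))) (\<alpha>(m := j))" using Suc by auto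
    ultimately show ?thesis by blast
  qed
next
  fix \<alpha> assume "\<alpha> \<in> ?R"
  then show "\<alpha> \<in> ?L" by (auto simp: exps_def)
qed

lemma finite_card_exps: "finite (exps m k) \<and> card (exps m k) = (k + m) choose m"
proof (induction m arbitrary: k)
  case 0
  then show ?case by (simp add: exps_0)
next
  case (Suc m)
  note IH = Suc
  show ?case
  proof (induction k)
    case 0
    show ?case using IH[of 0] by (simp add: exps_Suc_0)
  next
    case (Suc k)
    let ?g = "\<lambda>\<alpha>. \<alpha>(m := Suc (\<alpha> m))"
    have inj: "inj_on ?g (exps (Suc m) k)"
      by (rule inj_on_inverseI[where g = "\<lambda>\<alpha>. \<alpha>(m := \<alpha> m - 1)"]) auto
    have "exps m (Suc k) \<inter> ?g ` exps (Suc m) k = {}"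
      by (auto simp: exps_def)
    moreover have "finite (exps m (Suc k))" "card (exps m (Suc k)) = (Suc k + m) choose m"
      using IH[of "Suc k"] by auto
    moreover have "finite (exps (Suc m) k)" "card (exps (Suc m) k) = (k + Suc m) choose Suc m"
      using Suc by auto
    ultimately show ?case using inj
      by (simp add: exps_Suc_Suc card_Un_disjoint card_image)
  qed
qed

lemmas finite_exps = finite_card_exps[THEN conjunct1]
lemmas card_exps = finite_card_exps[THEN conjunct2]

lemma exps_mono: "k \<le> l \<Longrightarrow> exps m k \<subseteq> exps m l"
  by (auto simp: exps_def)

lemma zero_in_exps: "(\<lambda>_. 0) \<in> exps m k"
  by (auto simp: exps_def)

lemma exps_add: "\<alpha> \<in> exps m k \<Longrightarrow> \<beta> \<in> exps m l \<Longrightarrow> (\<lambda>i. \<alpha> i + \<beta> i) \<in> exps m (k + l)"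
  by (auto simp: exps_def sum.distrib)

text \<open>Collect the terms by the exponent of the last variable. As a polynomial in that variable
  the sum vanishes identically, so each coefficient does, and the coefficients involve one variable
  less.\<close>

lemma mon_independent:
  assumes "finite X" "\<And>\<alpha>. \<alpha> \<in> X \<Longrightarrow> \<forall>i\<ge>m. \<alpha> i = 0"
    and "\<And>t::nat \<Rightarrow> complex. (\<Sum>\<alpha>\<in>X. c \<alpha> * mon m t \<alpha>) = 0" and "\<alpha> \<in> X"
  shows "c \<alpha> = 0"
  using assms
proof (induction m arbitrary: X c \<alpha>)
  case 0
  have "\<beta> = (\<lambda>_. 0)" if "\<beta> \<in> X" for \<beta> using 0(2)[OF that] by auto
  then have X: "X = {\<alpha>}" using 0(4) by auto
  show ?case using 0(3)[of "\<lambda>_. 0"] unfolding X by (simp add: mon_def)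
next
  case (Suc m)
  define N where "N = Max ((\<lambda>\<beta>. \<beta> m) ` X)"
  have N: "\<beta> m \<le> N" if "\<beta> \<in> X" for \<beta> using that Suc.prems(1) by (auto simp: N_def)
  let ?X = "\<lambda>j. {\<beta>\<in>X. \<beta> m = j}"
  have coeff: "(\<Sum>\<beta>\<in>?X j. c \<beta> * mon m t \<beta>) = 0" if "j \<le> N" for j and t :: "nat \<Rightarrow> complex"
  proof -
    have "(\<Sum>j\<le>N. (\<Sum>\<beta>\<in>?X j. c \<beta> * mon m t \<beta>) * T ^ j) = 0" for T
    proof -
      have "(\<Sum>j\<le>N. (\<Sum>\<beta>\<in>?X j. c \<beta> * mon m t \<beta>) * T ^ j)
          = (\<Sum>j\<le>N. (\<Sum>\<beta>\<in>?X j. c \<beta> * mon (Suc m) (t(m := T)) \<beta>))"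
        by (auto intro!: sum.cong simp: sum_distrib_right mon_Suc mult.assoc mon_def)
      also have "\<dots> = (\<Sum>\<beta>\<in>X. c \<beta> * mon (Suc m) (t(m := T)) \<beta>)"
        using N Suc.prems(1) by (intro sum.group) auto
      finally show ?thesis using Suc.prems(3) by simp
    qed
    then show ?thesis using that polyfun_eq_0[of "\<lambda>j. \<Sum>\<beta>\<in>?X j. c \<beta> * mon m t \<beta>" N] by auto
  qed
  let ?j = "\<alpha> m" and ?f = "\<lambda>\<beta>::nat\<Rightarrow>nat. \<beta>(m := 0)"
  have inj: "inj_on ?f (?X ?j)"
    by (rule inj_on_inverseI[where g = "\<lambda>\<beta>. \<beta>(m := ?j)"]) auto
  define c' where "c' = (\<lambda>\<beta>. c (\<beta>(m := ?j)))"
  have "c' (?f \<alpha>) = 0"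
  proof (rule Suc.IH[of "?f ` ?X ?j" c' "?f \<alpha>"])
    show "finite (?f ` ?X ?j)" using Suc.prems(1) by simp
    show "\<forall>i\<ge>m. \<beta> i = 0" if "\<beta> \<in> ?f ` ?X ?j" for \<beta>
    proof (intro allI impI)
      fix i assume "m \<le> i"
      from that obtain \<gamma> where "\<gamma> \<in> X" "\<beta> = \<gamma>(m := 0)" by auto
      then show "\<beta> i = 0" using Suc.prems(2)[of \<gamma>] \<open>m \<le> i\<close> by (cases "i = m") auto
    qed
    show "(\<Sum>\<beta>\<in>?f ` ?X ?j. c' \<beta> * mon m t \<beta>) = 0" for t :: "nat \<Rightarrow> complex"
    proof -
      have "(\<Sum>\<beta>\<in>?f ` ?X ?j. c' \<beta> * mon m t \<beta>) = (\<Sum>\<beta>\<in>?X ?j. c \<beta> * mon m t \<beta>)"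
        unfolding sum.reindex[OF inj] by (intro sum.cong) (auto simp: c'_def mon_def fun_upd_idem)
      then show ?thesis using coeff[of ?j t] N[OF Suc.prems(4)] by simp
    qed
    show "?f \<alpha> \<in> ?f ` ?X ?j" using Suc.prems(4) by auto
  qed
  then show ?case by (simp add: c'_def)
qed

lemma exps_independent:
  assumes "\<And>t::nat \<Rightarrow> complex. (\<Sum>\<alpha>\<in>exps m k. c \<alpha> * mon m t \<alpha>) = 0" "\<alpha> \<in> exps m k"
  shows "c \<alpha> = 0"
  using mon_independent[OF finite_exps, of m k m c \<alpha>] assms by (auto simp: exps_def)

lemma mon_in_poly_funs: "(\<lambda>t. mon m t \<alpha>) \<in> poly_funs (tuple_coords m)"
  unfolding mon_def by (intro poly_funs_intros poly_funs.coord) (auto simp: tuple_coords_def)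

lemma exps_extend:
  assumes "k \<le> l"
  shows "(\<Sum>\<alpha>\<in>exps m k. c \<alpha> * f \<alpha>) = (\<Sum>\<alpha>\<in>exps m l. (if \<alpha> \<in> exps m k then c \<alpha> else 0) * (f \<alpha> :: complex))"
  using exps_mono[OF assms, of m]
  by (intro sum.mono_neutral_cong_left finite_exps) auto

lemma poly_funs_tuple_expand:
  assumes "p \<in> poly_funs (tuple_coords m)"
  shows "\<exists>k c. \<forall>t. p t = (\<Sum>\<alpha>\<in>exps m k. c \<alpha> * mon m t \<alpha>)"
  using assms
proof induction
  case (coord f)
  then obtain i where i: "i < m" "f = (\<lambda>t. t i)" by (auto simp: tuple_coords_def)
  let ?e = "\<lambda>j. if j = i then 1 else 0"
  have e: "?e \<in> exps m 1" using i by (auto simp: exps_def)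
  have "mon m t ?e = t i" for t :: "nat \<Rightarrow> complex"
  proof -
    have "mon m t ?e = (\<Prod>j<m. if j = i then t i else 1)"
      unfolding mon_def by (intro prod.cong) auto
    then show ?thesis using i by simp
  qed
  then have "f t = (\<Sum>\<alpha>\<in>exps m 1. (if \<alpha> = ?e then 1 else 0) * mon m t \<alpha>)" for t
    using e finite_exps[of m 1] i by (simp add: if_distrib[where f="\<lambda>x. x * _"] sum.delta' cong: if_cong)
  then show ?case by (intro exI allI)
next
  case (const c)
  have "c = (\<Sum>\<alpha>\<in>exps m 0. (if \<alpha> = (\<lambda>_. 0) then c else 0) * mon m t \<alpha>)" for t :: "nat \<Rightarrow> complex"
    using zero_in_exps[of m 0] finite_exps[of m 0]
    by (simp add: if_distrib[where f="\<lambda>x. x * _"] sum.delta' mon_def cong: if_cong)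
  then show ?case by (intro exI allI)
next
  case (add p q)
  then obtain k c l d where p: "\<forall>t. p t = (\<Sum>\<alpha>\<in>exps m k. c \<alpha> * mon m t \<alpha>)"
    and q: "\<forall>t. q t = (\<Sum>\<alpha>\<in>exps m l. d \<alpha> * mon m t \<alpha>)" by blast
  have "p t + q t = (\<Sum>\<alpha>\<in>exps m (k + l). ((if \<alpha> \<in> exps m k then c \<alpha> else 0)
      + (if \<alpha> \<in> exps m l then d \<alpha> else 0)) * mon m t \<alpha>)" for t
    unfolding p[rule_format] q[rule_format] distrib_right sum.distrib
    by (subst exps_extend[of k "k+l"], simp, subst exps_extend[of l "k+l"], auto)
  then show ?case by (intro exI allI)
next
  case (mult p q)
  then obtain k c l d where p: "\<forall>t. p t = (\<Sum>\<alpha>\<in>exps m k. c \<alpha> * mon m t \<alpha>)"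
    and q: "\<forall>t. q t = (\<Sum>\<alpha>\<in>exps m l. d \<alpha> * mon m t \<alpha>)" by blast
  let ?S = "exps m k \<times> exps m l" and ?h = "\<lambda>(\<alpha>,\<beta>). (\<lambda>i. \<alpha> i + \<beta> i :: nat)"
  have "p t * q t = (\<Sum>\<gamma>\<in>exps m (k + l). (\<Sum>x\<in>{x\<in>?S. ?h x = \<gamma>}. c (fst x) * d (snd x)) * mon m t \<gamma>)" for t
  proof -
    have "p t * q t = (\<Sum>x\<in>?S. c (fst x) * d (snd x) * mon m t (?h x))"
      unfolding p[rule_format] q[rule_format] sum_product sum.cartesian_product
      by (intro sum.cong) (auto simp: mon_add mult_ac)
    also have "\<dots> = (\<Sum>\<gamma>\<in>exps m (k + l). \<Sum>x\<in>{x\<in>?S. ?h x = \<gamma>}. c (fst x) * d (snd x) * mon m t (?h x))"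
      by (rule sum.group[symmetric]) (auto simp: finite_exps intro: exps_add)
    also have "\<dots> = (\<Sum>\<gamma>\<in>exps m (k + l). (\<Sum>x\<in>{x\<in>?S. ?h x = \<gamma>}. c (fst x) * d (snd x)) * mon m t \<gamma>)"
      unfolding sum_distrib_right by (intro sum.cong) auto
    finally show ?thesis .
  qed
  then show ?case by (intro exI allI)
qed

section \<open>Spanning is a Zariski open condition\<close>

text \<open>The matrix with rows \<open>I\<close> and columns \<open>X\<close> has full column rank:
  its rows span all functions on \<open>X\<close>. No determinant is chosen, so the pivots can be
  found one by one.\<close>

definition coord_span :: "'i set \<Rightarrow> 'x set \<Rightarrow> ('i \<Rightarrow> 'x \<Rightarrow> complex) \<Rightarrow> bool" where
  "coord_span I X W \<longleftrightarrow> (\<forall>h. \<exists>c. \<forall>x\<in>X. h x = (\<Sum>i\<in>I. c i * W i x))"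

text \<open>Gaussian elimination of one coordinate at a time, pivoting on an entry that is nonzero at \<open>e0\<close>.\<close>

lemma coord_span_open:
  assumes "finite X" "finite I" "\<And>i x. i \<in> I \<Longrightarrow> x \<in> X \<Longrightarrow> (\<lambda>e. w i e x) \<in> poly_funs F"
    and "coord_span I X (\<lambda>i. w i e0)"
  obtains Q where "Q \<in> poly_funs F" "Q e0 \<noteq> 0" "\<And>e. Q e \<noteq> 0 \<Longrightarrow> coord_span I X (\<lambda>i. w i e)"
  using assms
proof (induction X arbitrary: w thesis rule: finite_induct)
  case empty
  show ?case by (rule empty(1)[of "\<lambda>_. 1"]) (auto simp: coord_span_def intro: poly_funs.const)
next
  case (insert x0 X)
  from insert.prems(4)[unfolded coord_span_def, rule_format, of "\<lambda>_. 1"]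
  obtain c where "(1::complex) = (\<Sum>i\<in>I. c i * w i e0 x0)" by blast
  then have "\<exists>j\<in>I. w j e0 x0 \<noteq> 0" by (rule_tac ccontr) simp
  then obtain j where j: "j \<in> I" "w j e0 x0 \<noteq> 0" by blast
  \<comment> \<open>Elimination without division: multiplying by the pivot keeps the entries
    polynomial in \<open>e\<close>, and \<open>w'\<close> vanishes in the column
    \<open>x0\<close>.\<close>
  define w' where "w' = (\<lambda>i e x. w j e x0 * w i e x - w i e x0 * w j e x)"
  have w'_sum: "(\<Sum>i\<in>I. c i * w' i e x) =
      w j e x0 * (\<Sum>i\<in>I. c i * w i e x) - (\<Sum>i\<in>I. c i * w i e x0) * w j e x" for c e x
    by (simp add: w'_def right_diff_distrib sum_subtractf sum_distrib_left sum_distrib_right mult_ac)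
  have poly: "(\<lambda>e. w' i e x) \<in> poly_funs F" if "i \<in> I" "x \<in> X" for i x
    unfolding w'_def using that insert.prems(3) j by (intro poly_funs_intros) simp_all
  have "coord_span I X (\<lambda>i. w' i e0)" unfolding coord_span_def
  proof
    fix h :: "_ \<Rightarrow> complex"
    obtain c where c: "\<forall>x\<in>insert x0 X. (h(x0 := 0)) x = (\<Sum>i\<in>I. c i * w i e0 x)"
      using insert.prems(4) unfolding coord_span_def by blast
    have "h x = (\<Sum>i\<in>I. c i / w j e0 x0 * w' i e0 x)" if "x \<in> X" for x
    proof -
      have "(\<Sum>i\<in>I. c i / w j e0 x0 * w' i e0 x) = (\<Sum>i\<in>I. c i * w' i e0 x) / w j e0 x0"
        by (simp add: sum_divide_distrib)
      also have "\<dots> = (\<Sum>i\<in>I. c i * w i e0 x)" using c j unfolding w'_sum by auto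
      also have "\<dots> = h x" using c that insert.hyps by (metis fun_upd_apply insertCI)
      finally show ?thesis by simp
    qed
    then show "\<exists>c. \<forall>x\<in>X. h x = (\<Sum>i\<in>I. c i * w' i e0 x)" by (intro exI[of _ "\<lambda>i. c i / w j e0 x0"]) blast
  qed
  from insert.IH[OF _ insert.prems(2) poly this] obtain Q where
    Q: "Q \<in> poly_funs F" "Q e0 \<noteq> 0" "\<And>e. Q e \<noteq> 0 \<Longrightarrow> coord_span I X (\<lambda>i. w' i e)" by blast
  show ?case
  proof (rule insert.prems(1)[of "\<lambda>e. Q e * w j e x0"])
    show "(\<lambda>e. Q e * w j e x0) \<in> poly_funs F" using Q insert.prems(3) j by (intro poly_funs.mult) auto
    show "Q e0 * w j e0 x0 \<noteq> 0" using Q j by simp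
    fix e assume "Q e * w j e x0 \<noteq> 0"
    then have e: "Q e \<noteq> 0" and a: "w j e x0 \<noteq> 0" by auto
    show "coord_span I (insert x0 X) (\<lambda>i. w i e)" unfolding coord_span_def
    proof
      fix h :: "_ \<Rightarrow> complex"
      obtain c where c: "\<forall>x\<in>X. h x - h x0 / w j e x0 * w j e x = (\<Sum>i\<in>I. c i * w' i e x)"
        using Q(3)[OF e, unfolded coord_span_def, rule_format, of "\<lambda>x. h x - h x0 / w j e x0 * w j e x"] by blast
      \<comment> \<open>The extra weight on row \<open>j\<close> that restores the value of
        \<open>h\<close> at \<open>x0\<close> after the other columns are matched by
        \<open>w'\<close>.\<close>
      let ?s = "h x0 / w j e x0 - (\<Sum>i\<in>I. c i * w i e x0)"
      let ?c = "\<lambda>i. c i * w j e x0 + (if i = j then ?s else 0)"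
      have "(\<Sum>i\<in>I. ?c i * w i e x) = w j e x0 * (\<Sum>i\<in>I. c i * w i e x) + ?s * w j e x" for x
      proof -
        have "(\<Sum>i\<in>I. ?c i * w i e x) = (\<Sum>i\<in>I. w j e x0 * (c i * w i e x)) + (\<Sum>i\<in>I. if i = j then ?s * w j e x else 0)"
          unfolding sum.distrib[symmetric] by (intro sum.cong) (auto simp: algebra_simps)
        then show ?thesis using j insert.prems(2) by (simp add: sum_distrib_left)
      qed
      note csum = this
      have "h x = w j e x0 * (\<Sum>i\<in>I. c i * w i e x) + ?s * w j e x" if "x \<in> insert x0 X" for x
      proof (cases "x = x0")
        case True
        then show ?thesis using a by (simp add: field_simps)
      next
        case False
        with that c have "h x - h x0 / w j e x0 * w j e x = (\<Sum>i\<in>I. c i * w' i e x)" by auto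
        then show ?thesis unfolding w'_sum by (simp add: algebra_simps)
      qed
      then have "h x = (\<Sum>i\<in>I. ?c i * w i e x)" if "x \<in> insert x0 X" for x
        using that unfolding csum by blast
      then show "\<exists>c. \<forall>x\<in>insert x0 X. h x = (\<Sum>i\<in>I. c i * w i e x)"
        by (intro exI[of _ ?c] ballI)
    qed
  qed
qed

section \<open>Zeros of ideals of finite codimension\<close>

definition subalgebra :: "('u \<Rightarrow> complex) set \<Rightarrow> bool" where
  "subalgebra S \<longleftrightarrow> fs.subspace S \<and> 1 \<in> S \<and> (\<forall>f\<in>S. \<forall>g\<in>S. f * g \<in> S)"

definition ideal_of :: "('u \<Rightarrow> complex) set \<Rightarrow> ('u \<Rightarrow> complex) set \<Rightarrow> bool" where
  "ideal_of S I \<longleftrightarrow> fs.subspace I \<and> I \<subseteq> S \<and> (\<forall>f\<in>S. \<forall>g\<in>I. f * g \<in> I)"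

lemma subalgebra_closed:
  assumes "subalgebra S"
  shows "1 \<in> S" "0 \<in> S" "f \<in> S \<Longrightarrow> g \<in> S \<Longrightarrow> f + g \<in> S" "f \<in> S \<Longrightarrow> g \<in> S \<Longrightarrow> f - g \<in> S"
    "f \<in> S \<Longrightarrow> fscale c f \<in> S" "f \<in> S \<Longrightarrow> g \<in> S \<Longrightarrow> f * g \<in> S" "f \<in> S \<Longrightarrow> f ^ k \<in> S"
    "(\<And>i. i \<in> A \<Longrightarrow> h i \<in> S) \<Longrightarrow> (\<Sum>i\<in>A. h i) \<in> S"
    "(\<And>i. i \<in> A \<Longrightarrow> h i \<in> S) \<Longrightarrow> (\<Prod>i\<in>A. h i) \<in> S"
proof -
  show "f ^ k \<in> S" if "f \<in> S" for f k
    using assms that by (induction k) (auto simp: subalgebra_def)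
  show "(\<Prod>i\<in>A. h i) \<in> S" if "\<And>i. i \<in> A \<Longrightarrow> h i \<in> S" for A :: "'c set" and h
    using assms that by (induction A rule: infinite_finite_induct) (auto simp: subalgebra_def)
qed (use assms in \<open>auto simp: subalgebra_def intro: fs.subspace_0 fs.subspace_add fs.subspace_diff
       fs.subspace_scale fs.subspace_sum\<close>)

lemma ideal_closed:
  assumes "ideal_of S I"
  shows "0 \<in> I" "f \<in> I \<Longrightarrow> g \<in> I \<Longrightarrow> f + g \<in> I" "f \<in> I \<Longrightarrow> g \<in> I \<Longrightarrow> f - g \<in> I"
    "f \<in> I \<Longrightarrow> - f \<in> I" "f \<in> I \<Longrightarrow> fscale c f \<in> I" "f \<in> S \<Longrightarrow> g \<in> I \<Longrightarrow> f * g \<in> I"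
    "f \<in> I \<Longrightarrow> f \<in> S"
  using assms by (auto simp: ideal_of_def fs.subspace_0 fs.subspace_add fs.subspace_diff
    fs.subspace_scale fs.subspace_neg)

lemma interpolation:
  assumes S: "subalgebra S" and "finite P" "u \<in> P"
    and sep: "\<And>u'. u' \<in> P \<Longrightarrow> u' \<noteq> u \<Longrightarrow> \<exists>f\<in>S. f u \<noteq> f u'"
  obtains e where "e \<in> S" "e u = 1" "\<And>u'. u' \<in> P \<Longrightarrow> u' \<noteq> u \<Longrightarrow> e u' = 0"
proof -
  obtain f where f: "\<And>u'. u' \<in> P \<Longrightarrow> u' \<noteq> u \<Longrightarrow> f u' \<in> S \<and> f u' u \<noteq> f u' u'"
    using sep by metis
  define h where "h = (\<lambda>u'. fscale (1 / (f u' u - f u' u')) (f u' - fscale (f u' u') 1))"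
  define e where "e = (\<Prod>u'\<in>P - {u}. h u')"
  have "e \<in> S" unfolding e_def h_def using f by (auto intro!: subalgebra_closed[OF S])
  moreover have "e u = 1" unfolding e_def h_def using f by auto
  moreover have "e u' = 0" if "u' \<in> P" "u' \<noteq> u" for u'
    unfolding e_def h_def using that assms(2) by (auto intro!: bexI[of _ u'] prod_zero)
  ultimately show ?thesis using that by blast
qed

text \<open>A proper ideal \<open>Q\<close> of \<open>N\<close> containing an ideal of finite codimension: over the complex numbers
  every operator on the finite-dimensional space \<open>N / Q\<close> has an eigenvalue, so maximality of
  \<open>Q\<close> makes the algebra act on \<open>N / Q\<close> by scalars.\<close>

lemma maximal_subideal:
  fixes r :: nat
  assumes I: "ideal_of S I" and N: "ideal_of S N" and IN: "I \<subseteq> N" "I \<noteq> N"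
    and span: "\<And>f. f \<in> S \<Longrightarrow> \<exists>a. f - (\<Sum>l<r. fscale (a l) (g l)) \<in> I"
  obtains Q where "ideal_of S Q" "I \<subseteq> Q" "Q \<subseteq> N" "Q \<noteq> N"
    "\<And>Q'. ideal_of S Q' \<Longrightarrow> Q \<subseteq> Q' \<Longrightarrow> Q' \<subseteq> N \<Longrightarrow> Q' = Q \<or> Q' = N"
proof -
  let ?R = "\<lambda>Q. ideal_of S Q \<and> I \<subseteq> Q \<and> Q \<subseteq> N \<and> Q \<noteq> N"
  \<comment> \<open>\<open>?P m\<close> holds if some admissible ideal has \<open>m\<close> elements
    independent modulo \<open>I\<close>. Finite codimension bounds \<open>m\<close>, and an ideal
    attaining the maximum cannot be enlarged within the proper subideals of
    \<open>N\<close>.\<close>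
  let ?P = "\<lambda>m::nat. \<exists>Q n. ?R Q \<and> (\<forall>i<m. n i \<in> Q)
     \<and> (\<forall>c. (\<Sum>i<m. fscale (c i) (n i)) \<in> I \<longrightarrow> (\<forall>i<m. c i = 0))"
  have bound: "m \<le> r" if "?P m" for m
  proof (rule ccontr)
    assume "\<not> m \<le> r"
    then have "card {..<r} < card {..<m}" by simp
    obtain Q n where Q: "ideal_of S Q" "\<forall>i<m. n i \<in> Q"
      "\<forall>c. (\<Sum>i<m. fscale (c i) (n i)) \<in> I \<longrightarrow> (\<forall>i<m. c i = 0)" using \<open>?P m\<close> by blast
    have "\<exists>a. n i - (\<Sum>l\<in>{..<r}. fscale (a l) (g l)) \<in> I" if "i \<in> {..<m}" for i
      using span Q that by (auto simp: ideal_of_def)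
    from dependent_mod_subspace[where f = n, OF _ _ _ \<open>card _ < _\<close> this] I Q(3) show False
      by (auto simp: ideal_of_def)
  qed
  have "?P 0" using I IN by (intro exI[of _ I]) auto
  define m where "m = (GREATEST m. ?P m)"
  have "?P m" unfolding m_def using \<open>?P 0\<close> bound by (intro GreatestI_nat[of ?P 0 r]) blast+
  have max: "k \<le> m" if "?P k" for k
    unfolding m_def using that bound by (intro Greatest_le_nat[of ?P k r]) blast+
  from \<open>?P m\<close> obtain Q n where Q: "?R Q" and n: "\<forall>i<m. n i \<in> Q"
    and ind: "\<And>c. (\<Sum>i<m. fscale (c i) (n i)) \<in> I \<Longrightarrow> (\<forall>i<m. c i = 0)" by blast
  have "Q' = Q" if Q': "ideal_of S Q'" "Q \<subseteq> Q'" "Q' \<subseteq> N" "Q' \<noteq> N" for Q'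
  proof (rule ccontr)
    assume "Q' \<noteq> Q"
    then obtain q where q: "q \<in> Q'" "q \<notin> Q" using Q' by blast
    define n' where "n' = n(m := q)"
    have sum_n': "(\<Sum>i<Suc m. fscale (c i) (n' i)) = (\<Sum>i<m. fscale (c i) (n i)) + fscale (c m) q" for c
      by (simp add: n'_def)
    have "\<forall>i<Suc m. c i = 0" if "(\<Sum>i<Suc m. fscale (c i) (n' i)) \<in> I" for c
    proof -
      have "(\<Sum>i<m. fscale (c i) (n i)) \<in> Q"
        using n Q by (intro fs.subspace_sum fs.subspace_scale) (auto simp: ideal_of_def)
      moreover have "(\<Sum>i<m. fscale (c i) (n i)) + fscale (c m) q \<in> Q"
        using that Q unfolding sum_n' by blast
      ultimately have "fscale (c m) q \<in> Q" using ideal_closed(3)[of S Q] Q by (metis add_diff_cancel_left')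
      then have "c m = 0"
      proof (rule contrapos_pp)
        assume c: "c m \<noteq> 0"
        show "fscale (c m) q \<notin> Q"
        proof
          assume "fscale (c m) q \<in> Q"
          then have "fscale (1 / c m) (fscale (c m) q) \<in> Q" using Q ideal_closed(5)[of S Q] by blast
          then show False using c q by simp
        qed
      qed
      with that ind[of c] show ?thesis unfolding sum_n' by (auto simp: less_Suc_eq)
    qed
    moreover have "\<forall>i<Suc m. n' i \<in> Q'" using n q Q'(2) by (auto simp: n'_def less_Suc_eq)
    moreover have "?R Q'" using Q' Q by blast
    ultimately have "?P (Suc m)" by blast
    from max[OF this] show False by simp
  qed
  then show ?thesis using that[of Q] Q by blast
qed

text \<open>Without an eigenvalue, each \<open>s - \<mu>\<close> has nonzero image on
  \<open>N / Q\<close>, hence is surjective by maximality, and so is every nonzero polynomial in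
  \<open>s\<close>. But the powers of \<open>s\<close> up to \<open>r\<close> are dependent modulo
  \<open>I\<close>, so some nonzero polynomial in \<open>s\<close> annihilates
  \<open>N / Q\<close>.\<close>

lemma eigenvalue_mod_maximal_subideal:
  fixes r :: nat
  assumes S: "subalgebra S" and I: "ideal_of S I" and N: "ideal_of S N" and Q: "ideal_of S Q"
    and IQ: "I \<subseteq> Q" and QN: "Q \<subseteq> N" "Q \<noteq> N"
    and max: "\<And>Q'. ideal_of S Q' \<Longrightarrow> Q \<subseteq> Q' \<Longrightarrow> Q' \<subseteq> N \<Longrightarrow> Q' = Q \<or> Q' = N"
    and span: "\<And>f. f \<in> S \<Longrightarrow> \<exists>a. f - (\<Sum>l<r. fscale (a l) (g l)) \<in> I"
    and s: "s \<in> S"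
  shows "\<exists>\<mu>. \<forall>n\<in>N. s * n - fscale \<mu> n \<in> Q"
proof (rule ccontr)
  assume no: "\<not> ?thesis"
  have surj: "\<exists>m\<in>N. \<exists>q\<in>Q. n = s * m - fscale \<mu> m + q" if n: "n \<in> N" for n \<mu>
  proof -
    let ?Q' = "{s * m - fscale \<mu> m + q | m q. m \<in> N \<and> q \<in> Q}"
    have Q': "ideal_of S ?Q'" unfolding ideal_of_def
    proof (intro conjI ballI subsetI fs.subspaceI)
      have "0 = s * 0 - fscale \<mu> 0 + 0" by simp
      then show "0 \<in> ?Q'" using ideal_closed(1)[OF N] ideal_closed(1)[OF Q] by blast
      show "f \<in> S" if "f \<in> ?Q'" for f
        using that ideal_closed(7)[OF N] ideal_closed(7)[OF Q] s
        by (auto intro!: subalgebra_closed[OF S])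
      show "f + h \<in> ?Q'" if "f \<in> ?Q'" "h \<in> ?Q'" for f h
      proof -
        from that obtain m q m' q' where mem: "m \<in> N" "q \<in> Q" "m' \<in> N" "q' \<in> Q"
          and eq: "f = s * m - fscale \<mu> m + q" "h = s * m' - fscale \<mu> m' + q'" by blast
        have "f + h = s * (m + m') - fscale \<mu> (m + m') + (q + q')"
          unfolding eq by (auto simp: fun_eq_iff algebra_simps)
        moreover have "m + m' \<in> N" "q + q' \<in> Q"
          using mem ideal_closed(2)[OF N] ideal_closed(2)[OF Q] by auto
        ultimately show ?thesis by blast
      qed
      show "fscale c f \<in> ?Q'" if "f \<in> ?Q'" for c f
      proof -
        from that obtain m q where mem: "m \<in> N" "q \<in> Q" and eq: "f = s * m - fscale \<mu> m + q" by blast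
        have "fscale c f = s * fscale c m - fscale \<mu> (fscale c m) + fscale c q"
          unfolding eq by (auto simp: fun_eq_iff algebra_simps)
        moreover have "fscale c m \<in> N" "fscale c q \<in> Q"
          using mem ideal_closed(5)[OF N] ideal_closed(5)[OF Q] by auto
        ultimately show ?thesis by blast
      qed
      show "f * h \<in> ?Q'" if "f \<in> S" "h \<in> ?Q'" for f h
      proof -
        from that obtain m q where mem: "m \<in> N" "q \<in> Q" and eq: "h = s * m - fscale \<mu> m + q" by blast
        have "f * h = s * (f * m) - fscale \<mu> (f * m) + f * q"
          unfolding eq by (auto simp: fun_eq_iff algebra_simps)
        moreover have "f * m \<in> N" "f * q \<in> Q"
          using mem ideal_closed(6)[OF N] ideal_closed(6)[OF Q] \<open>f \<in> S\<close> by auto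
        ultimately show ?thesis by blast
      qed
    qed
    have "?Q' = N"
    proof -
      have "Q \<subseteq> ?Q'" using ideal_closed(1)[OF N] by force
      moreover have "?Q' \<subseteq> N"
        using QN(1) s by (auto intro!: ideal_closed(2,3,5,6)[OF N])
      moreover have "?Q' \<noteq> Q"
      proof
        assume "?Q' = Q"
        moreover obtain n where "n \<in> N" "s * n - fscale \<mu> n \<notin> Q" using no by blast
        moreover have "s * n - fscale \<mu> n + 0 \<in> ?Q'" if "n \<in> N" for n
          using that ideal_closed(1)[OF Q] by blast
        ultimately show False by (metis add.right_neutral)
      qed
      ultimately show ?thesis using max[OF Q'] by blast
    qed
    then show ?thesis using n by blast
  qed
  \<comment> \<open>Over the complex numbers \<open>p\<close> splits into linear factors, and each
    factor is surjective on \<open>N / Q\<close> by \<open>surj\<close>.\<close>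
  have surj_poly: "\<exists>m\<in>N. \<exists>q\<in>Q. n = (\<lambda>u. poly p (s u)) * m + q" if "p \<noteq> 0" "n \<in> N" for n p
    using that
  proof (induction "degree p" arbitrary: p n)
    case 0
    then obtain c where p: "p = [:c:]" "c \<noteq> 0" by (metis degree_eq_zeroE pCons_0_0)
    then have "n = (\<lambda>u. poly p (s u)) * fscale (1 / c) n + 0" by (auto simp: fun_eq_iff)
    moreover have "fscale (1 / c) n \<in> N" "0 \<in> Q"
      using 0 ideal_closed[OF N] ideal_closed[OF Q] by auto
    ultimately show ?case by blast
  next
    case (Suc k)
    then obtain z where "poly p z = 0" using alg_closed_imp_poly_has_root[of p] by auto
    then obtain p' where p': "p = [:-z, 1:] * p'" by (metis dvdE poly_eq_0_iff_dvd)
    with Suc have "p' \<noteq> 0" by auto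
    moreover have "k = degree p'" using Suc(2) \<open>p' \<noteq> 0\<close> unfolding p' by (subst (asm) degree_mult_eq) auto
    moreover obtain m q where m: "m \<in> N" "q \<in> Q" "n = s * m - fscale z m + q"
      using surj Suc.prems by blast
    ultimately obtain m' q' where m': "m' \<in> N" "q' \<in> Q" "m = (\<lambda>u. poly p' (s u)) * m' + q'"
      using Suc.hyps(1) by blast
    have "n = (\<lambda>u. poly p (s u)) * m' + ((s * q' - fscale z q') + q)"
      unfolding m(3) m'(3) p' by (auto simp: fun_eq_iff algebra_simps)
    moreover have "(s * q' - fscale z q') + q \<in> Q" using m(2) m'(2) s ideal_closed[OF Q] by simp
    ultimately show ?case using m' by blast
  qed
  have "\<exists>a. s ^ k - (\<Sum>l\<in>{..<r}. fscale (a l) (g l)) \<in> I" if "k \<in> {..r}" for k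
    using span subalgebra_closed(7)[OF S s] by simp
  from dependent_mod_subspace[where f = "\<lambda>k. s ^ k" and I = "{..r}", OF _ _ _ _ this] obtain c where
    c: "\<exists>k\<in>{..r}. c k \<noteq> 0" "(\<Sum>k\<le>r. fscale (c k) (s ^ k)) \<in> I"
    using I by (auto simp: ideal_of_def)
  define p where "p = (\<Sum>k\<le>r. monom (c k) k)"
  have "coeff p k = c k" if "k \<le> r" for k
    using that by (simp add: p_def coeff_sum)
  with c(1) have "p \<noteq> 0" by auto
  have ps: "(\<lambda>u. poly p (s u)) = (\<Sum>k\<le>r. fscale (c k) (s ^ k))"
    by (auto simp: fun_eq_iff p_def poly_sum poly_monom)
  obtain n where n: "n \<in> N" "n \<notin> Q" using QN by blast
  from surj_poly[OF \<open>p \<noteq> 0\<close> n(1)] obtain m q where m: "m \<in> N" "q \<in> Q" "n = (\<lambda>u. poly p (s u)) * m + q" by blast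
  have "m * (\<lambda>u. poly p (s u)) \<in> I"
    unfolding ps using c(2) m ideal_closed(6)[OF I] ideal_closed(7)[OF N] by blast
  then have "n \<in> Q" unfolding m(3) using m IQ ideal_closed(2)[OF Q] by (auto simp: mult.commute)
  then show False using n by blast
qed

text \<open>\<open>homs\<close> is the Nullstellensatz for \<open>S\<close> and \<open>der\<close>
  is reducedness of every zero, both as hypotheses. Interpolation bounds the number of zeros by
  \<open>r\<close>. Equality needs that \<open>I\<close> is the full vanishing ideal
  \<open>N\<close> of its zeros: otherwise a simple quotient \<open>N / Q\<close> yields a character
  of \<open>S\<close>, thus a zero \<open>u\<close>, and then a nonzero derivation at
  \<open>u\<close> that kills \<open>I\<close>.\<close>

theorem card_zeros_eq_codimension:
  fixes S I :: "('u \<Rightarrow> complex) set" and Y :: "'u \<Rightarrow> 'y"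
  assumes S: "subalgebra S" and I: "ideal_of S I"
    and g: "\<And>l. l < r \<Longrightarrow> g l \<in> S"
    and span: "\<And>f. f \<in> S \<Longrightarrow> \<exists>a. f - (\<Sum>l<r. fscale (a l) (g l)) \<in> I"
    and indep: "\<And>a. (\<Sum>l<r. fscale (a l) (g l)) \<in> I \<Longrightarrow> \<forall>l<r. a l = 0"
    and homs: "\<And>\<psi>. \<psi> 1 = 1 \<Longrightarrow> (\<And>f h. f \<in> S \<Longrightarrow> h \<in> S \<Longrightarrow> \<psi> (f + h) = \<psi> f + \<psi> h) \<Longrightarrow>
       (\<And>c f. f \<in> S \<Longrightarrow> \<psi> (fscale c f) = c * \<psi> f) \<Longrightarrow>
       (\<And>f h. f \<in> S \<Longrightarrow> h \<in> S \<Longrightarrow> \<psi> (f * h) = \<psi> f * \<psi> h) \<Longrightarrow> \<exists>u. \<forall>f\<in>S. \<psi> f = f u"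
    and Y: "\<And>u u'. Y u = Y u' \<longleftrightarrow> (\<forall>f\<in>S. f u = f u')"
    and der: "\<And>u \<delta>. (\<forall>f\<in>I. f u = 0) \<Longrightarrow>
       (\<And>f h. f \<in> S \<Longrightarrow> h \<in> S \<Longrightarrow> \<delta> (f + h) = \<delta> f + \<delta> h) \<Longrightarrow>
       (\<And>c f. f \<in> S \<Longrightarrow> \<delta> (fscale c f) = c * \<delta> f) \<Longrightarrow>
       (\<And>f h. f \<in> S \<Longrightarrow> h \<in> S \<Longrightarrow> \<delta> (f * h) = f u * \<delta> h + h u * \<delta> f) \<Longrightarrow>
       (\<forall>f\<in>I. \<delta> f = 0) \<Longrightarrow> (\<forall>f\<in>S. \<delta> f = 0)"
  shows "finite (Y ` {u. \<forall>f\<in>I. f u = 0}) \<and> card (Y ` {u. \<forall>f\<in>I. f u = 0}) = r"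
proof -
  define Z where "Z = {u. \<forall>f\<in>I. f u = 0}"
  have bound: "card P \<le> r" if P: "finite P" "P \<subseteq> Z" "inj_on Y P" for P
  proof (rule ccontr)
    assume "\<not> card P \<le> r"
    then have less: "card {..<r} < card P" by simp
    have "\<exists>e\<in>S. \<forall>u'\<in>P. e u' = (if u' = u then 1 else 0)" if u: "u \<in> P" for u
    proof -
      have "\<exists>f\<in>S. f u \<noteq> f u'" if "u' \<in> P" "u' \<noteq> u" for u'
        using Y[of u u'] that u P(3) by (auto dest: inj_onD)
      then obtain e where "e \<in> S" "e u = 1" "\<And>u'. u' \<in> P \<Longrightarrow> u' \<noteq> u \<Longrightarrow> e u' = 0"
        using interpolation[OF S P(1) u] by blast
      then show ?thesis by auto
    qed
    then obtain e where e: "\<And>u. u \<in> P \<Longrightarrow> e u \<in> S"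
        "\<And>u u'. u \<in> P \<Longrightarrow> u' \<in> P \<Longrightarrow> e u u' = (if u' = u then 1 else 0)" by metis
    have "\<exists>a. e u - (\<Sum>l\<in>{..<r}. fscale (a l) (g l)) \<in> I" if "u \<in> P" for u
      using span e that by blast
    from dependent_mod_subspace[where f = e, OF _ _ _ less this] I P obtain c where
      c: "\<exists>u\<in>P. c u \<noteq> 0" "(\<Sum>u\<in>P. fscale (c u) (e u)) \<in> I" by (auto simp: ideal_of_def)
    have "c u = 0" if u: "u \<in> P" for u
    proof -
      have "(\<Sum>v\<in>P. fscale (c v) (e v)) u = 0" using c(2) u P unfolding Z_def by blast
      then have "0 = (\<Sum>v\<in>P. c v * e v u)" by simp
      also have "\<dots> = (\<Sum>v\<in>P. if v = u then c v else 0)"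
        using e(2) u by (intro sum.cong) auto
      finally show ?thesis using u P by simp
    qed
    then show False using c(1) by blast
  qed
  have fin: "finite (Y ` Z) \<and> card (Y ` Z) \<le> r"
  proof (rule finite_if_finite_subsets_card_bdd)
    fix G assume G: "G \<subseteq> Y ` Z" "finite G"
    then obtain P where "P \<subseteq> Z" "inj_on Y P" "Y ` P = G" by (metis subset_image_inj)
    then show "card G \<le> r" using bound[of P] G(2) by (metis card_image finite_imageD)
  qed
  obtain R where R: "R \<subseteq> Z" "inj_on Y R" "Y ` Z = Y ` R" using subset_image_inj[of "Y ` Z" Y Z] by auto
  have finR: "finite R" using fin R by (metis finite_imageD)
  have cardR: "card (Y ` Z) = card R" using R by (simp add: card_image)
  define N where "N = {f\<in>S. \<forall>u\<in>Z. f u = 0}"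
  have N: "ideal_of S N" using S unfolding ideal_of_def N_def subalgebra_def
    by (auto intro!: fs.subspaceI intro: fs.subspace_0 fs.subspace_add fs.subspace_scale)
  have IN: "I \<subseteq> N" using I by (auto simp: N_def Z_def ideal_of_def)
  have "I = N"
  proof (rule ccontr)
    assume "I \<noteq> N"
    from maximal_subideal[OF I N IN this span] obtain Q where
      Q: "ideal_of S Q" "I \<subseteq> Q" "Q \<subseteq> N" "Q \<noteq> N"
      and max: "\<And>Q'. ideal_of S Q' \<Longrightarrow> Q \<subseteq> Q' \<Longrightarrow> Q' \<subseteq> N \<Longrightarrow> Q' = Q \<or> Q' = N" by blast
    note eig = eigenvalue_mod_maximal_subideal[OF S I N Q max span]
    note Scl = subalgebra_closed[OF S] and Qcl = ideal_closed[OF Q(1)] and Ncl = ideal_closed[OF N]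
    obtain n0 where n0: "n0 \<in> N" "n0 \<notin> Q" using Q by blast
    have n0_S: "n0 \<in> S" using n0 Ncl(7) by blast
    have scale0: "c = 0" if "fscale c n0 \<in> Q" for c
    proof (rule ccontr)
      assume "c \<noteq> 0"
      then have "fscale (1 / c) (fscale c n0) = n0" by (auto simp: fun_eq_iff)
      then show False using Qcl(5)[OF that, of "1 / c"] n0 by simp
    qed
    have scale_eq: "c = d" if "f - fscale c n0 \<in> Q" "f - fscale d n0 \<in> Q" for c d f
    proof -
      have "fscale (d - c) n0 = (f - fscale c n0) - (f - fscale d n0)"
        by (auto simp: fun_eq_iff algebra_simps)
      then show ?thesis using Qcl(3)[OF that] scale0[of "d - c"] by simp
    qed
    have "\<forall>s\<in>S. \<exists>\<mu>. \<forall>n\<in>N. s * n - fscale \<mu> n \<in> Q" using eig by blast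
    from bchoice[OF this] obtain \<psi> where
      \<psi>: "\<And>s n. s \<in> S \<Longrightarrow> n \<in> N \<Longrightarrow> s * n - fscale (\<psi> s) n \<in> Q" by blast
    have \<psi>_eq: "\<psi> s = c" if "s \<in> S" "s * n0 - fscale c n0 \<in> Q" for s c
      using scale_eq[OF \<psi>[OF that(1) n0(1)] that(2)] .
    have "\<exists>u. \<forall>f\<in>S. \<psi> f = f u"
    proof (rule homs)
      show "\<psi> 1 = 1" by (rule \<psi>_eq) (use Scl(1) Qcl(1) in auto)
      show "\<psi> (f + h) = \<psi> f + \<psi> h" if "f \<in> S" "h \<in> S" for f h
      proof (rule \<psi>_eq[OF Scl(3)[OF that]])
        have "(f + h) * n0 - fscale (\<psi> f + \<psi> h) n0 = (f * n0 - fscale (\<psi> f) n0) + (h * n0 - fscale (\<psi> h) n0)"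
          by (auto simp: fun_eq_iff algebra_simps)
        then show "(f + h) * n0 - fscale (\<psi> f + \<psi> h) n0 \<in> Q"
          using Qcl(2)[OF \<psi>[OF that(1) n0(1)] \<psi>[OF that(2) n0(1)]] by simp
      qed
      show "\<psi> (fscale c f) = c * \<psi> f" if "f \<in> S" for c f
      proof (rule \<psi>_eq[OF Scl(5)[OF that]])
        have "fscale c f * n0 - fscale (c * \<psi> f) n0 = fscale c (f * n0 - fscale (\<psi> f) n0)"
          by (auto simp: fun_eq_iff algebra_simps)
        then show "fscale c f * n0 - fscale (c * \<psi> f) n0 \<in> Q"
          using Qcl(5)[OF \<psi>[OF that(1) n0(1)]] by simp
      qed
      show "\<psi> (f * h) = \<psi> f * \<psi> h" if "f \<in> S" "h \<in> S" for f h
      proof (rule \<psi>_eq[OF Scl(6)[OF that]])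
        have "f * h * n0 - fscale (\<psi> f * \<psi> h) n0 =
          f * (h * n0 - fscale (\<psi> h) n0) + fscale (\<psi> h) (f * n0 - fscale (\<psi> f) n0)"
          by (auto simp: fun_eq_iff algebra_simps)
        then show "f * h * n0 - fscale (\<psi> f * \<psi> h) n0 \<in> Q"
          using Qcl(2)[OF Qcl(6)[OF that(1) \<psi>[OF that(2) n0(1)]] Qcl(5)[OF \<psi>[OF that(1) n0(1)]]] by simp
      qed
    qed
    then obtain u where u: "\<And>f. f \<in> S \<Longrightarrow> \<psi> f = f u" by blast
    have "f u = 0" if "f \<in> I" for f
    proof -
      have "n0 * f \<in> Q" using ideal_closed(6)[OF I n0_S that] Q by blast
      then have "\<psi> f = 0" using that I by (intro \<psi>_eq) (auto simp: ideal_of_def mult.commute)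
      then show ?thesis using u that ideal_closed(7)[OF I] by simp
    qed
    then have uZ: "u \<in> Z" by (simp add: Z_def)
    then obtain u1 where u1: "u1 \<in> R" "Y u1 = Y u" using R by (metis imageE imageI)
    \<comment> \<open>The function \<open>e\<close> obtained from this is 1 at all zeros with the
      image of \<open>u\<close> and 0 at all others; multiplying by it localizes at
      \<open>u\<close>.\<close>
    have "\<exists>f\<in>S. f u1 \<noteq> f u'" if "u' \<in> R" "u' \<noteq> u1" for u'
        using Y[of u1 u'] that u1 R(2) by (auto dest: inj_onD)
    then obtain e where e: "e \<in> S" "e u1 = 1" "\<And>u'. u' \<in> R \<Longrightarrow> u' \<noteq> u1 \<Longrightarrow> e u' = 0"
      using interpolation[OF S finR u1(1)] by blast
    have e_val: "e u' = (if Y u' = Y u then 1 else 0)" if u': "u' \<in> Z" for u'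
    proof -
      obtain u2 where u2: "u2 \<in> R" "Y u2 = Y u'" using R u' by (metis imageE imageI)
      then have "e u' = e u2" using Y[of u2 u'] e(1) by auto
      moreover have "u2 = u1 \<longleftrightarrow> Y u' = Y u" using u1 u2 R(2) by (metis inj_onD)
      ultimately show ?thesis using e(2,3) u2 by auto
    qed
    \<comment> \<open>The difference \<open>e * f - f(u) e\<close> vanishes at every zero, hence
      lies in \<open>N\<close>; and \<open>N / Q\<close> is spanned by \<open>n0\<close>, because
      adding the multiples of \<open>n0\<close> to \<open>Q\<close> gives an ideal larger than
      \<open>Q\<close>. The coordinate along \<open>n0\<close> is the derivation.\<close>
    have "\<exists>\<delta>. e * f - fscale (f u) e - fscale \<delta> n0 \<in> Q" if f: "f \<in> S" for f
    proof -
      have "e * f - fscale (f u) e \<in> N"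
      proof -
        have "(e * f - fscale (f u) e) u' = 0" if "u' \<in> Z" for u'
          using e_val[OF that] Y[of u' u] f by auto
        then show ?thesis unfolding N_def using Scl(4,5,6) e f by simp
      qed
      moreover have "{q + fscale c n0 | q c. q \<in> Q} = N" (is "?Q' = N")
      proof -
        have "ideal_of S ?Q'" unfolding ideal_of_def
        proof (intro conjI ballI subsetI fs.subspaceI)
          have "0 + fscale 0 n0 \<in> ?Q'" using Qcl(1) by blast
          then show "0 \<in> ?Q'" by simp
          show "f \<in> S" if "f \<in> ?Q'" for f using that Qcl(7) n0_S by (auto intro!: Scl)
          show "f + h \<in> ?Q'" if "f \<in> ?Q'" "h \<in> ?Q'" for f h
          proof -
            from that obtain q c q' c' where mem: "q \<in> Q" "q' \<in> Q"
              and eq: "f = q + fscale c n0" "h = q' + fscale c' n0" by blast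
            have "f + h = (q + q') + fscale (c + c') n0"
              unfolding eq by (auto simp: fun_eq_iff algebra_simps)
            moreover have "q + q' \<in> Q" using mem Qcl(2) by simp
            ultimately show ?thesis by blast
          qed
          show "fscale k f \<in> ?Q'" if "f \<in> ?Q'" for k f
          proof -
            from that obtain q c where mem: "q \<in> Q" and eq: "f = q + fscale c n0" by blast
            have "fscale k f = fscale k q + fscale (k * c) n0"
              unfolding eq by (auto simp: fun_eq_iff algebra_simps)
            moreover have "fscale k q \<in> Q" using mem Qcl(5) by simp
            ultimately show ?thesis by blast
          qed
          show "h * f \<in> ?Q'" if "h \<in> S" "f \<in> ?Q'" for h f
          proof -
            from that obtain q c where q: "q \<in> Q" "f = q + fscale c n0" by blast
            have "h * f = (h * q + fscale c (h * n0 - fscale (\<psi> h) n0)) + fscale (c * \<psi> h) n0"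
              unfolding q by (auto simp: fun_eq_iff algebra_simps)
            moreover have "h * q + fscale c (h * n0 - fscale (\<psi> h) n0) \<in> Q"
              using Qcl(2,5,6) q that \<psi> n0 by simp
            ultimately show ?thesis by blast
          qed
        qed
        moreover have "Q \<subseteq> ?Q'"
        proof
          fix q assume "q \<in> Q"
          then have "q + fscale 0 n0 \<in> ?Q'" by blast
          then show "q \<in> ?Q'" by simp
        qed
        moreover have "?Q' \<subseteq> N" using Q(3) n0 by (auto intro!: Ncl(2,5))
        moreover have "?Q' \<noteq> Q"
        proof -
          have "0 + fscale 1 n0 \<in> ?Q'" using Qcl(1) by blast
          then show ?thesis using n0 by auto
        qed
        ultimately show ?thesis using max by blast
      qed
      ultimately obtain q c where "q \<in> Q" "e * f - fscale (f u) e = q + fscale c n0" by blast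
      then have "e * f - fscale (f u) e - fscale c n0 \<in> Q" by simp
      then show ?thesis by blast
    qed
    then have "\<forall>f\<in>S. \<exists>\<delta>. e * f - fscale (f u) e - fscale \<delta> n0 \<in> Q" by blast
    from bchoice[OF this] obtain \<delta> where
      \<delta>: "\<And>f. f \<in> S \<Longrightarrow> e * f - fscale (f u) e - fscale (\<delta> f) n0 \<in> Q" by blast
    have \<delta>_eq: "\<delta> f = c" if "f \<in> S" "e * f - fscale (f u) e - fscale c n0 \<in> Q" for f c
      using scale_eq[OF \<delta>[OF that(1)] that(2)] .
    have a: "e * n0 - n0 \<in> Q"
    proof -
      have "e u = 1" using e_val uZ by simp
      then show ?thesis using \<psi>[OF e(1) n0(1)] u[OF e(1)] by simp
    qed
    have n0u: "n0 u = 0" using n0(1) uZ by (simp add: N_def)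
    have b: "n0 * n0 \<in> Q" using \<psi>[OF n0_S n0(1)] u[OF n0_S] n0u by simp
    have "\<forall>f\<in>S. \<delta> f = 0"
    proof (rule der)
      show "\<forall>f\<in>I. f u = 0" using uZ by (simp add: Z_def)
      show "\<delta> (f + h) = \<delta> f + \<delta> h" if "f \<in> S" "h \<in> S" for f h
      proof (rule \<delta>_eq[OF Scl(3)[OF that]])
        have "e * (f + h) - fscale ((f + h) u) e - fscale (\<delta> f + \<delta> h) n0 =
          (e * f - fscale (f u) e - fscale (\<delta> f) n0) + (e * h - fscale (h u) e - fscale (\<delta> h) n0)"
          by (auto simp: fun_eq_iff algebra_simps)
        then show "e * (f + h) - fscale ((f + h) u) e - fscale (\<delta> f + \<delta> h) n0 \<in> Q"
          using Qcl(2)[OF \<delta>[OF that(1)] \<delta>[OF that(2)]] by simp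
      qed
      show "\<delta> (fscale c f) = c * \<delta> f" if "f \<in> S" for c f
      proof (rule \<delta>_eq[OF Scl(5)[OF that]])
        have "e * fscale c f - fscale (fscale c f u) e - fscale (c * \<delta> f) n0 =
          fscale c (e * f - fscale (f u) e - fscale (\<delta> f) n0)"
          by (auto simp: fun_eq_iff algebra_simps)
        then show "e * fscale c f - fscale (fscale c f u) e - fscale (c * \<delta> f) n0 \<in> Q"
          using Qcl(5)[OF \<delta>[OF that(1)]] by simp
      qed
      show "\<delta> (f * h) = f u * \<delta> h + h u * \<delta> f" if fh: "f \<in> S" "h \<in> S" for f h
      proof -
        define q1 where "q1 = e * f - fscale (f u) e - fscale (\<delta> f) n0"
        define q2 where "q2 = e * h - fscale (h u) e - fscale (\<delta> h) n0"
        define q3 where "q3 = e * (f * h) - fscale (f u * h u) e - fscale (\<delta> (f * h)) n0"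
        have q: "q1 \<in> Q" "q2 \<in> Q" "q3 \<in> Q"
          unfolding q1_def q2_def q3_def using \<delta>[OF fh(1)] \<delta>[OF fh(2)] \<delta>[OF Scl(6)[OF fh]] by auto
        let ?c = "f u * \<delta> h + h u * \<delta> f - \<delta> (f * h)"
        \<comment> \<open>Compare the product of \<open>e * f\<close> and \<open>e * h\<close> with
          \<open>e\<close> times \<open>e * (f * h)\<close>. Since \<open>e * n0\<close> is
          \<open>n0\<close> and \<open>n0 * n0\<close> is 0 modulo \<open>Q\<close>, only the defect
          of the product rule remains in front of \<open>n0\<close>.\<close>
        have "fscale ?c n0 = e * q3 - fscale ?c (e * n0 - n0) - fscale (\<delta> f * \<delta> h) (n0 * n0)
          - (e * h) * q1 - (fscale (f u) e + fscale (\<delta> f) n0) * q2"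
          unfolding q1_def q2_def q3_def by (auto simp: fun_eq_iff algebra_simps)
        also have "\<dots> \<in> Q" using q e(1) fh n0_S by (intro Qcl(3) Qcl(5)[OF a] Qcl(5)[OF b] Qcl(6) Scl) auto
        finally have "?c = 0" by (rule scale0)
        then show ?thesis by simp
      qed
      show "\<forall>f\<in>I. \<delta> f = 0"
      proof
        fix f assume f: "f \<in> I"
        then have "e * f \<in> Q" using ideal_closed(6)[OF I e(1)] Q by blast
        moreover have "f u = 0" using f uZ by (simp add: Z_def)
        ultimately show "\<delta> f = 0" using ideal_closed(7)[OF I f] by (intro \<delta>_eq) auto
      qed
    qed
    \<comment> \<open>Here \<open>n0\<close> vanishes at \<open>u\<close> and \<open>e * n0\<close>
      agrees with \<open>n0\<close> modulo \<open>Q\<close>. This contradicts \<open>der\<close>,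
      which makes the derivation zero.\<close>
    moreover have "\<delta> n0 = 1" using a n0u by (intro \<delta>_eq n0_S) auto
    ultimately show False using n0_S by auto
  qed
  \<comment> \<open>With fewer than \<open>r\<close> zeros some nontrivial combination of the
    \<open>g l\<close> vanishes at all of them, hence lies in \<open>N = I\<close>, against
    independence.\<close>
  have "\<not> card R < r"
  proof
    assume "card R < r"
    then have "\<exists>c. (\<exists>l\<in>{..<r}. c l \<noteq> 0) \<and> (\<forall>u\<in>R. (\<Sum>l\<in>{..<r}. c l * g l u) = 0)"
      using homogeneous_system[of R "{..<r}" g] finR by auto
    then obtain c where c: "\<exists>l<r. c l \<noteq> 0" "\<And>u. u \<in> R \<Longrightarrow> (\<Sum>l<r. c l * g l u) = 0" by auto
    let ?f = "\<Sum>l<r. fscale (c l) (g l)"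
    have fS: "?f \<in> S" using g by (intro subalgebra_closed[OF S]) auto
    have "?f u = 0" if "u \<in> Z" for u
    proof -
      have "Y u \<in> Y ` R" unfolding R(3)[symmetric] using that by (rule imageI)
      then obtain u' where u': "u' \<in> R" "Y u' = Y u" by auto
      from u'(2) have "\<forall>f\<in>S. f u' = f u" using Y[of u' u] by blast
      then have "?f u' = ?f u" using fS by (rule bspec)
      then show ?thesis using c(2)[OF u'(1)] by simp
    qed
    with fS have "?f \<in> I" unfolding \<open>I = N\<close> N_def by blast
    with indep c(1) show False by blast
  qed
  then show ?thesis using fin cardR unfolding Z_def by auto
qed

section \<open>Exponential functions with integer frequencies\<close>

text \<open>The Laurent monomial with exponent \<open>v\<close> at the torus point with coordinates
  \<open>exp (\<i> * u $ k)\<close>. Pulling back to \<open>\<complex>\<^sup>d\<close> makes all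
  functions entire and every torus point a value of the parametrization.\<close>

definition expo :: "int ^ 'd \<Rightarrow> complex ^ 'd \<Rightarrow> complex" where
  "expo v u = exp (\<i> * (\<Sum>k\<in>UNIV. of_int (v $ k) * u $ k))"

lemma expo_0 [simp]: "expo 0 = 1"
  by (auto simp: expo_def fun_eq_iff)

lemma expo_add: "expo (v + w) = expo v * expo w"
  by (auto simp: expo_def fun_eq_iff algebra_simps sum.distrib exp_add)

lemma expo_nonzero [simp]: "expo v u \<noteq> 0"
  by (simp add: expo_def)

lemma expo_minus: "expo (- v) u = inverse (expo v u)"
  by (simp add: expo_def sum_negf exp_minus)

lemma expo_diff: "expo (v - w) u = expo v u / expo w u"
  using expo_add[of v "- w"] by (simp add: expo_minus divide_inverse fun_eq_iff)

lemma expo_scale: "expo (m *s v) u = expo v u powi m"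
proof -
  have "expo (m *s v) u = exp (of_int m * (\<i> * (\<Sum>k\<in>UNIV. of_int (v $ k) * u $ k)))"
    by (simp add: expo_def sum_distrib_left mult_ac)
  then show ?thesis by (simp add: exp_power_int expo_def mult_ac)
qed

lemma expo_sum: "expo (\<Sum>i\<in>I. v i) u = (\<Prod>i\<in>I. expo (v i) u)"
  by (induction I rule: infinite_finite_induct) (auto simp: expo_add)

lemma expo_neq:
  assumes "v \<noteq> w"
  obtains u where "expo v u \<noteq> expo w u"
proof -
  obtain k where k: "v $ k \<noteq> w $ k" using assms by (auto simp: vec_eq_iff)
  \<comment> \<open>Chosen so that \<open>expo (v - w) u = exp (\<i> * pi) = -1\<close>.\<close>
  define u :: "complex ^ 'a" where "u = axis k (of_real pi / of_int (v $ k - w $ k))"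
  have "(\<Sum>i\<in>UNIV. of_int ((v - w) $ i) * u $ i) = (\<Sum>i\<in>UNIV. if i = k then of_real pi else 0)"
    using k by (intro sum.cong) (auto simp: u_def axis_def)
  then have "expo (v - w) u = exp (\<i> * of_real pi)" by (simp add: expo_def)
  then have "expo v u / expo w u \<noteq> 1" by (simp add: expo_diff exp_Euler flip: )
  then show ?thesis using that by auto
qed

text \<open>Independence of characters: translate the relation by a point separating
  \<open>v\<close> from \<open>w\<close> and subtract the multiple that cancels \<open>w\<close>; a
  shorter relation remains.\<close>

lemma expo_independent:
  assumes "finite V" "(\<Sum>v\<in>V. fscale (c v) (expo v)) = 0" "v \<in> V"
  shows "c v = 0"
  using assms
proof (induction V arbitrary: c v rule: finite_induct)
  case (insert w V)
  have zero: "(\<Sum>v\<in>insert w V. c v * expo v u) = 0" for u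
    using fun_cong[OF insert.prems(1), of u] by simp
  have V0: "c v = 0" if v: "v \<in> V" for v
  proof -
    have "v \<noteq> w" using v insert by auto
    then obtain u0 where u0: "expo v u0 \<noteq> expo w u0" by (rule expo_neq)
    have "(\<Sum>v\<in>V. fscale (c v * (expo v u0 - expo w u0)) (expo v)) = 0"
    proof
      fix u
      have "expo v (u + u0) = expo v u * expo v u0" for v :: "int ^ 'a"
        by (simp add: expo_def algebra_simps sum.distrib exp_add)
      then have "(\<Sum>v\<in>insert w V. c v * (expo v u0 - expo w u0) * expo v u)
          = (\<Sum>v\<in>insert w V. c v * expo v (u + u0)) - expo w u0 * (\<Sum>v\<in>insert w V. c v * expo v u)"
        by (simp only: sum_distrib_left flip: sum_subtractf) (auto intro!: sum.cong simp: algebra_simps)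
      then show "(\<Sum>v\<in>V. fscale (c v * (expo v u0 - expo w u0)) (expo v)) u = 0 u"
        unfolding zero using insert.hyps by simp
    qed
    from insert.IH[OF this v] u0 show ?thesis by simp
  qed
  show ?case
  proof (cases "v = w")
    case True
    then show ?thesis using zero[of 0] V0 insert.hyps by simp
  qed (use V0 insert.prems in auto)
qed simp

section \<open>The algebra of exponential sums is an integral domain\<close>

definition exp_span :: "(complex ^ 'd \<Rightarrow> complex) set" where
  "exp_span = fs.span (range expo)"

lemma exp_span_holomorphic_on_lines:
  assumes "f \<in> exp_span"
  shows "(\<lambda>T. f (a + T *s w)) holomorphic_on UNIV"
  using assms unfolding exp_span_def
proof (induction rule: fs.span_induct_alt)
  case base
  show ?case by simp
next
  case (step c x y)
  then obtain v where "x = expo v" by auto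
  then have "(\<lambda>T. (fscale c x + y) (a + T *s w)) =
      (\<lambda>T. c * exp (\<i> * (\<Sum>k\<in>UNIV. of_int (v $ k) * (a $ k + T * w $ k))) + y (a + T *s w))"
    by (simp add: fun_eq_iff expo_def)
  then show ?case using step by (auto intro!: holomorphic_intros)
qed

text \<open>On the complex line joining a point where \<open>f\<close> is nonzero to one where
  \<open>g\<close> is nonzero both are entire. Near the second point \<open>f\<close> would have to
  vanish, hence along the whole line by the identity theorem.\<close>

lemma exp_span_domain:
  assumes f: "f \<in> exp_span" and g: "g \<in> exp_span" and fg: "f * g = 0"
  shows "f = 0 \<or> g = 0"
proof (rule ccontr)
  assume "\<not> ?thesis"
  then obtain a c where a: "f a \<noteq> 0" and c: "g c \<noteq> 0" by (auto simp: fun_eq_iff)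
  define F where "F = (\<lambda>T. f (a + T *s (c - a)))"
  define G where "G = (\<lambda>T. g (a + T *s (c - a)))"
  have hol: "F holomorphic_on UNIV" "G holomorphic_on UNIV"
    unfolding F_def G_def by (rule exp_span_holomorphic_on_lines f g)+
  have F0: "F 0 \<noteq> 0" using a by (simp add: F_def)
  have G1: "G 1 \<noteq> 0" using c by (simp add: G_def)
  have FG: "F T * G T = 0" for T
    using fun_cong[OF fg] by (simp add: F_def G_def)
  let ?U = "G -` (- {0})"
  have "continuous_on UNIV G" using hol by (rule_tac holomorphic_on_imp_continuous_on)
  then have "open ?U" by (intro open_vimage) auto
  then have "1 islimpt ?U" using G1 by (intro interior_limit_point) (auto simp: interior_open)
  then have "F 0 = 0"
    using FG by (intro analytic_continuation[OF hol(1), of ?U 1 0]) auto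
  then show False using F0 by simp
qed

lemma span_mult_right:
  assumes W: "fs.subspace W" and B: "\<And>x. x \<in> B \<Longrightarrow> x * g \<in> W" and f: "f \<in> fs.span B"
  shows "f * g \<in> W"
proof -
  have "fs.subspace {f. f * g \<in> W}"
  proof (rule fs.subspaceI)
    show "0 \<in> {f. f * g \<in> W}" using fs.subspace_0[OF W] by simp
    show "x + y \<in> {f. f * g \<in> W}" if "x \<in> {f. f * g \<in> W}" "y \<in> {f. f * g \<in> W}" for x y
      using that fs.subspace_add[OF W] by (simp add: distrib_right)
    show "fscale c x \<in> {f. f * g \<in> W}" if "x \<in> {f. f * g \<in> W}" for c x
    proof -
      have "fscale c x * g = fscale c (x * g)" by (simp add: fun_eq_iff)
      then show ?thesis using that fs.subspace_scale[OF W] by simp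
    qed
  qed
  then have "fs.span B \<subseteq> {f. f * g \<in> W}" using B by (intro fs.span_minimal) auto
  then show ?thesis using f by blast
qed

lemma span_mult:
  assumes W: "fs.subspace W" and "\<And>x y. x \<in> B \<Longrightarrow> y \<in> C \<Longrightarrow> x * y \<in> W"
    and "f \<in> fs.span B" "g \<in> fs.span C"
  shows "f * g \<in> W"
proof (rule span_mult_right[OF W _ assms(3)])
  fix x assume "x \<in> B"
  then have "y * x \<in> W" if "y \<in> C" for y using assms(2) that mult.commute[of x y] by metis
  from span_mult_right[OF W this assms(4)] show "x * g \<in> W" by (metis mult.commute)
qed

lemma exp_span_mult:
  assumes "f \<in> exp_span" "g \<in> exp_span"
  shows "f * g \<in> exp_span"
  using assms unfolding exp_span_def
proof (rule span_mult[rotated 2])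
  show "x * y \<in> fs.span (range expo)" if "x \<in> range expo" "y \<in> range expo" for x y :: "complex ^ 'a \<Rightarrow> complex"
  proof -
    from that obtain v w where "x = expo v" "y = expo w" by blast
    then have "x * y = expo (v + w)" by (simp add: expo_add)
    then show ?thesis by (metis fs.span_base rangeI)
  qed
qed (rule fs.subspace_span)

lemma subalgebra_exp_span: "subalgebra exp_span"
  unfolding subalgebra_def
proof (intro conjI ballI exp_span_mult)
  have "expo 0 \<in> (exp_span :: (complex ^ 'a \<Rightarrow> complex) set)"
    unfolding exp_span_def by (intro fs.span_base rangeI)
  then show "1 \<in> (exp_span :: (complex ^ 'a \<Rightarrow> complex) set)" by simp
  show "fs.subspace (exp_span :: (complex ^ 'a \<Rightarrow> complex) set)"
    unfolding exp_span_def by (rule fs.subspace_span)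
qed

lemma exp_span_prod_nonzero:
  assumes "finite I" "\<And>i. i \<in> I \<Longrightarrow> f i \<in> exp_span" "\<And>i. i \<in> I \<Longrightarrow> f i \<noteq> 0"
  shows "(\<Prod>i\<in>I. f i) \<in> exp_span \<and> (\<Prod>i\<in>I. f i) \<noteq> 0"
  using assms
proof (induction I rule: finite_induct)
  case empty
  show ?case unfolding prod.empty
    by (intro conjI subalgebra_closed(1)[OF subalgebra_exp_span] one_neq_zero)
next
  case (insert i I)
  have IH: "(\<Prod>i\<in>I. f i) \<in> exp_span \<and> (\<Prod>i\<in>I. f i) \<noteq> 0"
    by (rule insert.IH; rule insert.prems; erule insertI2)
  note IH = conjunct1[OF IH] conjunct2[OF IH]
  have i: "f i \<in> exp_span" "f i \<noteq> 0" by (rule insert.prems; rule insertI1)+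
  have "f i * (\<Prod>i\<in>I. f i) \<noteq> 0" using exp_span_domain[OF i(1) IH(1)] i(2) IH(2) by blast
  then show ?case
    unfolding prod.insert[OF insert.hyps] using exp_span_mult[OF i(1) IH(1)] by blast
qed

subsection \<open>Extending characters from sublattices\<close>

lemma subgroup_scale:
  fixes H :: "(int ^ 'd) set"
  assumes "0 \<in> H" "\<And>v w. v \<in> H \<Longrightarrow> w \<in> H \<Longrightarrow> v + w \<in> H" "\<And>v. v \<in> H \<Longrightarrow> - v \<in> H" "v \<in> H"
  shows "m *s v \<in> H"
proof -
  have nat: "of_nat k *s v \<in> H" for k
    using assms by (induction k) (auto simp: algebra_simps vector_sadd_rdistrib)
  show ?thesis
  proof (cases m)
    case (nonneg k)
    then show ?thesis using nat by simp
  next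
    case (neg k)
    then have "m *s v = - (of_nat (Suc k) *s v)" by (simp add: vec_eq_iff)
    then show ?thesis using nat assms(3) by metis
  qed
qed

lemma character_scale:
  fixes H :: "(int ^ 'd) set" and \<psi> :: "int ^ 'd \<Rightarrow> complex"
  assumes H: "0 \<in> H" "\<And>v w. v \<in> H \<Longrightarrow> w \<in> H \<Longrightarrow> v + w \<in> H" "\<And>v. v \<in> H \<Longrightarrow> - v \<in> H"
    and \<psi>: "\<And>v w. v \<in> H \<Longrightarrow> w \<in> H \<Longrightarrow> \<psi> (v + w) = \<psi> v * \<psi> w" "\<And>v. v \<in> H \<Longrightarrow> \<psi> v \<noteq> 0"
    and v: "v \<in> H"
  shows "\<psi> (m *s v) = \<psi> v powi m"
proof -
  have \<psi>0: "\<psi> 0 = 1" using \<psi>(1)[OF H(1) H(1)] \<psi>(2)[OF H(1)] by simp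
  note sc = subgroup_scale[OF H v]
  have nat: "\<psi> (of_nat k *s v) = \<psi> v ^ k" for k
  proof (induction k)
    case (Suc k)
    have "\<psi> (of_nat (Suc k) *s v) = \<psi> (v + of_nat k *s v)" by (simp add: vector_sadd_rdistrib)
    then show ?case using Suc \<psi>(1)[OF v sc] by simp
  qed (simp add: \<psi>0)
  show ?thesis
  proof (cases m)
    case (nonneg k)
    then show ?thesis using nat by simp
  next
    case (neg k)
    have "of_nat (Suc k) *s v + m *s v = 0" unfolding neg by (simp add: vec_eq_iff)
    then have "\<psi> (of_nat (Suc k) *s v) * \<psi> (m *s v) = 1" using \<psi>(1)[OF sc sc] \<psi>0 by metis
    then have "\<psi> v ^ Suc k * \<psi> (m *s v) = 1" unfolding nat .
    then have "inverse (\<psi> v ^ Suc k) = \<psi> (m *s v)" by (rule inverse_unique)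
    moreover have "\<psi> v powi m = inverse (\<psi> v ^ Suc k)"
      unfolding neg by (simp only: power_int_minus power_int_of_nat)
    ultimately show ?thesis by simp
  qed
qed

text \<open>The nonzero complex numbers form a divisible group, so characters extend from subgroups
  of the lattice, and those of the full lattice are evaluations. Induction on the coordinates in
  use: an element \<open>v0\<close> with least positive entry at \<open>k\<close> generates
  \<open>H\<close> together with the part where entry \<open>k\<close> is 0.\<close>

lemma character_extension:
  fixes H :: "(int ^ 'd) set" and \<psi> :: "int ^ 'd \<Rightarrow> complex"
  assumes H: "0 \<in> H" "\<And>v w. v \<in> H \<Longrightarrow> w \<in> H \<Longrightarrow> v + w \<in> H" "\<And>v. v \<in> H \<Longrightarrow> - v \<in> H"
    and \<psi>: "\<And>v w. v \<in> H \<Longrightarrow> w \<in> H \<Longrightarrow> \<psi> (v + w) = \<psi> v * \<psi> w" "\<And>v. v \<in> H \<Longrightarrow> \<psi> v \<noteq> 0"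
  shows "\<exists>u. \<forall>v\<in>H. \<psi> v = expo v u"
proof -
  have "\<exists>u. \<forall>v\<in>H. \<psi> v = expo v u" if "finite K" "\<forall>v\<in>H. \<forall>k. k \<notin> K \<longrightarrow> v $ k = 0" for K
    using that H \<psi>
  proof (induction K arbitrary: H rule: finite_induct)
    case empty
    have "\<psi> 0 = 1" using empty(5)[OF empty(2,2)] empty(6)[OF empty(2)] by simp
    then have "\<forall>v\<in>H. \<psi> v = expo v 0" using empty(1) by (auto simp: expo_def vec_eq_iff)
        (metis (mono_tags, lifting) vec_eq_iff zero_index)
    then show ?case by blast
  next
    case (insert k K)
    note H = insert.prems(2-4) and \<psi> = insert.prems(5,6)
    have sc: "m *s v \<in> H" if "v \<in> H" for m v using H that by (rule subgroup_scale)
    show ?case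
    proof (cases "\<forall>v\<in>H. v $ k = 0")
      case True
      have "\<forall>v\<in>H. \<forall>i. i \<notin> K \<longrightarrow> v $ i = 0"
        using True insert.prems(1) by (metis insertE)
      then show ?thesis by (rule insert.IH[OF _ H \<psi>])
    next
      case False
      define P where "P = (\<lambda>m. m > 0 \<and> (\<exists>v\<in>H. v $ k = int m))"
      obtain w where w: "w \<in> H" "w $ k \<noteq> 0" using False by blast
      have "P (nat \<bar>w $ k\<bar>)"
      proof (cases "w $ k > 0")
        case True
        then show ?thesis using w by (auto simp: P_def)
      next
        case False
        then show ?thesis using w H(3)[OF w(1)] by (auto simp: P_def intro!: bexI[of _ "- w"])
      qed
      then have "P (Least P)" by (rule LeastI)
      then obtain v0 where v0: "v0 \<in> H" "v0 $ k > 0" "v0 $ k = int (Least P)" by (auto simp: P_def)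
      have div: "v - (v $ k div v0 $ k) *s v0 \<in> H \<and> (v - (v $ k div v0 $ k) *s v0) $ k = 0"
        if v: "v \<in> H" for v
      proof -
        let ?r = "v - (v $ k div v0 $ k) *s v0"
        have r: "?r \<in> H" using H(2)[OF v H(3)[OF sc[OF v0(1)], of "v $ k div v0 $ k"]] by simp
        have rk: "?r $ k = v $ k mod v0 $ k" by (simp add: minus_div_mult_eq_mod)
        have "?r $ k = 0"
        proof (rule ccontr)
          assume "?r $ k \<noteq> 0"
          then have pos: "?r $ k > 0" using rk v0(2) by (simp add: order_less_le)
          then have "P (nat (?r $ k))" unfolding P_def by (intro conjI bexI[OF _ r]) simp_all
          then have "Least P \<le> nat (?r $ k)" by (rule Least_le)
          moreover have "?r $ k < v0 $ k" unfolding rk using v0(2) by simp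
          ultimately show False using v0(3) pos by linarith
        qed
        with r show ?thesis by blast
      qed
      let ?H = "{v\<in>H. v $ k = 0}"
      have "\<exists>u. \<forall>v\<in>?H. \<psi> v = expo v u"
      proof (rule insert.IH)
        show "\<forall>v\<in>?H. \<forall>i. i \<notin> K \<longrightarrow> v $ i = 0"
          using insert.prems(1) by (metis (mono_tags, lifting) insertE mem_Collect_eq)
      qed (use H \<psi> in auto)
      then obtain u' where u': "\<And>v. v \<in> H \<Longrightarrow> v $ k = 0 \<Longrightarrow> \<psi> v = expo v u'" by blast
      \<comment> \<open>Solves \<open>expo v0 u = \<psi> v0\<close> for the coordinate
        \<open>k\<close> of \<open>u\<close>, the others being given by \<open>u'\<close>; the
        logarithm supplies the root.\<close>
      define s where "s = (Ln (\<psi> v0) / \<i> - (\<Sum>i\<in>UNIV - {k}. of_int (v0 $ i) * u' $ i)) / of_int (v0 $ k)"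
      define u where "u = (\<chi> i. if i = k then s else u' $ i)"
      have split: "(\<Sum>i\<in>UNIV. of_int (v $ i) * u $ i)
          = of_int (v $ k) * s + (\<Sum>i\<in>UNIV - {k}. of_int (v $ i) * u' $ i)" for v :: "int ^ 'd"
        by (subst sum.remove[of _ k]) (auto simp: u_def)
      have "(\<Sum>i\<in>UNIV. of_int (v0 $ i) * u $ i) = Ln (\<psi> v0) / \<i>"
        unfolding split s_def using v0(2) by simp
      then have e0: "expo v0 u = \<psi> v0" using \<psi>(2)[OF v0(1)] by (simp add: expo_def)
      have eH: "expo v u = expo v u'" if "v $ k = 0" for v
        using that unfolding expo_def split by (subst sum.remove[of _ k]) auto
      have "\<psi> v = expo v u" if v: "v \<in> H" for v
      proof -
        let ?m = "v $ k div v0 $ k" and ?r = "v - (v $ k div v0 $ k) *s v0"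
        have r: "?r \<in> H" "?r $ k = 0" using div[OF v] by blast+
        have "\<psi> v = \<psi> (?r + ?m *s v0)" by simp
        also have "\<dots> = \<psi> ?r * \<psi> (?m *s v0)" by (rule \<psi>(1)[OF r(1) sc[OF v0(1)]])
        finally have 1: "\<psi> v = \<psi> ?r * \<psi> (?m *s v0)" .
        have 2: "\<psi> (?m *s v0) = expo (?m *s v0) u"
          unfolding expo_scale e0 by (rule character_scale[OF H \<psi> v0(1)])
        have 3: "\<psi> ?r = expo ?r u" unfolding eH[OF r(2)] by (rule u'[OF r])
        have "expo v u = expo (?r + ?m *s v0) u" by simp
        then show ?thesis unfolding 1 2 3 expo_add by simp
      qed
      then show ?thesis by blast
    qed
  qed
  from this[of UNIV] show ?thesis by simp
qed

section \<open>The column lattice and its layers\<close>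

lemma det_of_int:
  fixes M :: "int ^ 'd ^ 'd"
  shows "det ((\<chi> i j. of_int (M $ i $ j)) :: 'a::comm_ring_1 ^ 'd ^ 'd) = of_int (det M)"
  by (simp add: det_def)

locale full_rank_matrix =
  fixes A :: "int ^ 'n ^ 'd"
  assumes full_rank: "rank (map_matrix complex_of_int A) = CARD('d)"
begin

definition comb :: "('n \<Rightarrow> int) \<Rightarrow> int ^ 'd" where
  "comb l = (\<Sum>j\<in>UNIV. l j *s column j A)"

definition layer :: "nat \<Rightarrow> (int ^ 'd) set" where
  "layer k = {comb l | l. (\<Sum>j\<in>UNIV. nat \<bar>l j\<bar>) \<le> k}"

lemma comb_nth: "comb l $ i = (\<Sum>j\<in>UNIV. l j * A $ i $ j)"
  by (simp add: comb_def column_def)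

lemma col_lattice_eq: "col_lattice A = range comb"
  by (auto simp: col_lattice_def comb_def)

lemma comb_add: "comb (\<lambda>j. l j + m j) = comb l + comb m"
  by (simp add: vec_eq_iff comb_nth algebra_simps sum.distrib)

lemma comb_diff: "comb (\<lambda>j. l j - m j) = comb l - comb m"
  by (simp add: vec_eq_iff comb_nth algebra_simps sum_subtractf)

lemma comb_scale: "comb (\<lambda>j. c * l j) = c *s comb l"
  by (simp add: vec_eq_iff comb_nth sum_distrib_left mult_ac)

lemma comb_zero: "comb (\<lambda>_. 0) = 0"
  by (simp add: vec_eq_iff comb_nth)

lemma comb_unit: "comb (\<lambda>i. if i = j then c else 0) = c *s column j A"
  unfolding comb_def by (subst sum.remove[of _ j]) auto

lemma col_lattice_closed:
  shows "0 \<in> col_lattice A" "v \<in> col_lattice A \<Longrightarrow> w \<in> col_lattice A \<Longrightarrow> v + w \<in> col_lattice A"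
    "v \<in> col_lattice A \<Longrightarrow> w \<in> col_lattice A \<Longrightarrow> v - w \<in> col_lattice A"
    "v \<in> col_lattice A \<Longrightarrow> - v \<in> col_lattice A"
    "v \<in> col_lattice A \<Longrightarrow> c *s v \<in> col_lattice A" "column j A \<in> col_lattice A"
proof -
  show z: "0 \<in> col_lattice A" unfolding col_lattice_eq comb_zero[symmetric] by (rule rangeI)
  show "v + w \<in> col_lattice A" if "v \<in> col_lattice A" "w \<in> col_lattice A" for v w
    using that unfolding col_lattice_eq by (auto simp flip: comb_add)
  show d: "v - w \<in> col_lattice A" if "v \<in> col_lattice A" "w \<in> col_lattice A" for v w
    using that unfolding col_lattice_eq by (auto simp flip: comb_diff)
  show "- v \<in> col_lattice A" if "v \<in> col_lattice A" using d[OF z that] by simp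
  show "c *s v \<in> col_lattice A" if "v \<in> col_lattice A"
    using that unfolding col_lattice_eq by (auto simp flip: comb_scale)
  have "1 *s column j A \<in> col_lattice A" unfolding col_lattice_eq comb_unit[symmetric] by (rule rangeI)
  then show "column j A \<in> col_lattice A" by simp
qed

lemma finite_layer: "finite (layer k)"
proof -
  let ?L = "{l :: 'n \<Rightarrow> int. \<forall>j. (j \<in> UNIV \<longrightarrow> l j \<in> {- int k..int k}) \<and> (j \<notin> UNIV \<longrightarrow> l j = 0)}"
  have fin: "finite ?L"
    by (rule finite_set_of_finite_funs) auto
  have "l j \<in> {- int k..int k}" if "(\<Sum>j\<in>UNIV. nat \<bar>l j\<bar>) \<le> k" for l :: "'n \<Rightarrow> int" and j
  proof -
    have "nat \<bar>l j\<bar> \<le> (\<Sum>j\<in>UNIV. nat \<bar>l j\<bar>)" by (rule member_le_sum) auto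
    then show ?thesis using that by auto
  qed
  then have "layer k \<subseteq> comb ` ?L" by (auto simp: layer_def)
  then show ?thesis by (rule finite_subset[OF _ finite_imageI[OF fin]])
qed

lemma layer_mono: "k \<le> l \<Longrightarrow> layer k \<subseteq> layer l"
  unfolding layer_def by auto

lemma layer_0: "0 \<in> layer k"
  unfolding layer_def using comb_zero by (auto intro!: exI[of _ "\<lambda>_. 0"])

lemma layer_add:
  assumes "v \<in> layer k" "w \<in> layer l"
  shows "v + w \<in> layer (k + l)"
proof -
  obtain a b where a: "v = comb a" "(\<Sum>j\<in>UNIV. nat \<bar>a j\<bar>) \<le> k"
    and b: "w = comb b" "(\<Sum>j\<in>UNIV. nat \<bar>b j\<bar>) \<le> l"
    using assms by (auto simp: layer_def)
  have "(\<Sum>j\<in>UNIV. nat \<bar>a j + b j\<bar>) \<le> (\<Sum>j\<in>UNIV. nat \<bar>a j\<bar> + nat \<bar>b j\<bar>)"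
    by (intro sum_mono) auto
  then have "(\<Sum>j\<in>UNIV. nat \<bar>a j + b j\<bar>) \<le> k + l" using a b by (simp add: sum.distrib)
  moreover have "v + w = comb (\<lambda>j. a j + b j)" using a b by (simp add: comb_add)
  ultimately show ?thesis unfolding layer_def by blast
qed

lemma scaled_col_in_layer: "nat \<bar>c\<bar> \<le> k \<Longrightarrow> c *s column j A \<in> layer k"
proof -
  assume c: "nat \<bar>c\<bar> \<le> k"
  have "(\<Sum>i\<in>UNIV. nat \<bar>if i = j then c else 0\<bar>) = nat \<bar>c\<bar>"
    by (subst sum.remove[of _ j]) auto
  then show ?thesis unfolding comb_unit[symmetric] layer_def using c by auto
qed

lemma col_in_layer: "column j A \<in> layer 1" "- column j A \<in> layer 1"
proof -
  have "- column j A = (- 1) *s column j A" by (simp add: vec_eq_iff)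
  then show "column j A \<in> layer 1" "- column j A \<in> layer 1"
    using scaled_col_in_layer[of 1 1 j] scaled_col_in_layer[of "- 1" 1 j] by auto
qed

lemma layer_Suc_cases:
  assumes "v \<in> layer (Suc k)"
  obtains "v \<in> layer k" | w j where "w \<in> layer k" "v = w + column j A" | w j where "w \<in> layer k" "v = w - column j A"
proof -
  obtain l where l: "v = comb l" "(\<Sum>j\<in>UNIV. nat \<bar>l j\<bar>) \<le> Suc k"
    using assms by (auto simp: layer_def)
  show ?thesis
  proof (cases "\<forall>j. l j = 0")
    case True
    then have "l = (\<lambda>_. 0)" by auto
    then show ?thesis using that(1) l layer_0 by (simp add: comb_zero)
  next
    case False
    then obtain j where j: "l j \<noteq> 0" by auto
    define l' where "l' = (\<lambda>i. l i - (if i = j then sgn (l j) else 0))"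
    have "(\<Sum>i\<in>UNIV. nat \<bar>l i\<bar>) = nat \<bar>l j\<bar> + (\<Sum>i\<in>UNIV - {j}. nat \<bar>l i\<bar>)"
      by (simp add: sum.remove)
    moreover have "(\<Sum>i\<in>UNIV. nat \<bar>l' i\<bar>) = nat \<bar>l' j\<bar> + (\<Sum>i\<in>UNIV - {j}. nat \<bar>l' i\<bar>)"
      by (simp add: sum.remove)
    moreover have "(\<Sum>i\<in>UNIV - {j}. nat \<bar>l' i\<bar>) = (\<Sum>i\<in>UNIV - {j}. nat \<bar>l i\<bar>)"
      by (intro sum.cong) (auto simp: l'_def)
    moreover have "Suc (nat \<bar>l' j\<bar>) = nat \<bar>l j\<bar>" using j by (auto simp: l'_def sgn_if)
    ultimately have "(\<Sum>i\<in>UNIV. nat \<bar>l' i\<bar>) \<le> k" using l(2) by linarith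
    then have in_k: "comb l' \<in> layer k" by (auto simp: layer_def)
    have v: "v = comb l' + sgn (l j) *s column j A"
      unfolding l l'_def comb_diff comb_unit by simp
    show ?thesis
    proof (cases "l j > 0")
      case True
      then show ?thesis using that(2)[OF in_k] v by simp
    next
      case False
      then have "sgn (l j) *s column j A = - column j A" using j by (simp add: vec_eq_iff)
      then show ?thesis using that(3)[OF in_k, of j] v by simp
    qed
  qed
qed

lemma col_lattice_layer: "v \<in> col_lattice A \<longleftrightarrow> (\<exists>k. v \<in> layer k)"
  unfolding col_lattice_eq layer_def by auto

subsection \<open>Full rank\<close>

text \<open>Full rank makes the rows independent, which gives a right inverse, so the columns span.
  A basis selected among them is the required square submatrix.\<close>

lemma minor_exists: "\<exists>J::'d \<Rightarrow> 'n. det (\<chi> i k. A $ i $ J k) \<noteq> 0"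
proof -
  let ?A = "map_matrix complex_of_int A"
  have A_nth: "?A $ i $ j = of_int (A $ i $ j)" for i j by (simp add: map_matrix_def)
  have dim: "vec.dim (rows ?A) = CARD('d)" using full_rank by (simp add: row_rank_def_gen)
  have rows: "rows ?A = range (\<lambda>i. row i ?A)" by (auto simp: rows_def)
  have fin: "finite (rows ?A)" unfolding rows by simp
  have "vec.dim (rows ?A) \<le> card (rows ?A)" using vec.dim_le_card[OF _ fin, of "rows ?A"] by (simp add: vec.span_superset)
  moreover have "card (rows ?A) \<le> CARD('d)" unfolding rows by (rule card_image_le) simp
  ultimately have card: "card (rows ?A) = CARD('d)" using dim by simp
  then have inj: "inj (\<lambda>i. row i ?A)" unfolding rows by (intro eq_card_imp_inj_on) simp_all
  have ind: "vec.independent (rows ?A)"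
    by (rule vec.card_le_dim_spanning[of _ "rows ?A"]) (use fin dim card in \<open>auto simp: vec.span_superset\<close>)
  have "\<exists>B. ?A ** B = (mat 1 :: complex ^ 'd ^ 'd)"
    unfolding matrix_right_invertible_independent_rows
  proof (intro allI impI)
    fix c i assume c: "(\<Sum>i\<in>UNIV. c i *s row i ?A) = 0"
    have ti: "the_inv (\<lambda>i. row i ?A) (row i ?A) = i" for i
      using the_inv_f_f[OF inj, of i] by simp
    have "(\<Sum>x\<in>rows ?A. c (the_inv (\<lambda>i. row i ?A) x) *s x) = 0"
      unfolding rows sum.reindex[OF inj] using c by (simp add: ti)
    from vec.independentD[OF ind fin subset_refl this, of "row i ?A"]
    show "c i = 0" by (auto simp: rows ti)
  qed
  then have sp: "vec.span (columns ?A) = UNIV" unfolding matrix_right_invertible_span_columns .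
  obtain B where B: "B \<subseteq> columns ?A" "vec.independent B" "vec.span B = UNIV" 
    using vec.maximal_independent_subset[of "columns ?A"] sp 
    by (metis top.extremum_uniqueI vec.span_minimal vec.subspace_span)
  have finB: "finite B" using B vec.finiteI_independent by blast
  have "card B = CARD('d)" using vec.dim_eq_card_independent[OF B(2)] vec.dim_span[of B] B(3)
    by (simp add: vec_dim_card del: vec.dim_UNIV)
  then obtain f :: "'d \<Rightarrow> _" where f: "bij_betw f UNIV B" using finB
    by (metis finite_class.finite_UNIV finite_same_card_bij)
  have "\<forall>k. \<exists>j. f k = column j ?A"
    using f B(1) by (auto simp: columns_def bij_betw_def)
  then obtain J where J: "\<And>k. f k = column (J k) ?A" by metis
  define M where "M = (\<chi> i k. complex_of_int (A $ i $ J k))"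
  have colM: "column k M = f k" for k
    unfolding J by (simp add: M_def column_def vec_eq_iff A_nth)
  have "columns M = B" using f unfolding columns_def colM bij_betw_def by auto
  then have "\<exists>B. M ** B = mat 1" unfolding matrix_right_invertible_span_columns using B by simp
  then have "invertible M" by (metis invertible_right_inverse)
  then have "det M \<noteq> 0" by (simp add: invertible_det_nz)
  moreover have "det M = of_int (det (\<chi> i k. A $ i $ J k))"
    unfolding M_def det_of_int[symmetric] by simp
  ultimately show ?thesis by (intro exI[of _ J]) auto
qed

text \<open>By Cramer's rule for a nonsingular square submatrix \<open>M\<close>,
  \<open>det M\<close> times any integer vector is an integer combination of its columns. This is
  the finiteness of the index in usable form.\<close>

lemma multiple_in_lattice: "\<exists>N::nat. N > 0 \<and> (\<forall>v. int N *s v \<in> col_lattice A)"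
proof -
  obtain J :: "'d \<Rightarrow> 'n" where J: "det (\<chi> i k. A $ i $ J k) \<noteq> 0" using minor_exists by blast
  define M where "M = (\<chi> i k. A $ i $ J k)"
  define Mc where "Mc = (\<chi> i k. complex_of_int (M $ i $ k))"
  have detMc: "det Mc = of_int (det M)" unfolding Mc_def by (rule det_of_int)
  have "det M *s v \<in> col_lattice A" for v
  proof -
    define l where "l = (\<lambda>k. det (\<chi> i j. if j = k then v $ i else M $ i $ j))"
    define b where "b = (\<chi> i. complex_of_int (v $ i))"
    define x where "x = (\<chi> k. det (\<chi> i j. if j = k then b $ i else Mc $ i $ j) / det Mc)"
    have "Mc *v x = b" unfolding x_def by (subst cramer) (use J in \<open>auto simp: detMc M_def\<close>)
    moreover have xk: "x $ k = of_int (l k) / of_int (det M)" for k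
    proof -
      have "(\<chi> i j. if j = k then b $ i else Mc $ i $ j) = (\<chi> i j. complex_of_int ((\<chi> i j. if j = k then v $ i else M $ i $ j) $ i $ j))"
        by (simp add: vec_eq_iff b_def Mc_def)
      then have "det (\<chi> i j. if j = k then b $ i else Mc $ i $ j) = of_int (l k)"
        unfolding l_def by (simp only: det_of_int)
      then show ?thesis unfolding x_def detMc by simp
    qed
    ultimately have "(\<Sum>k\<in>UNIV. of_int (M $ i $ k) * (of_int (l k) / of_int (det M))) = complex_of_int (v $ i)" for i
      unfolding b_def by (simp add: vec_eq_iff matrix_vector_mult_def Mc_def)
    then have "(\<Sum>k\<in>UNIV. of_int (M $ i $ k) * of_int (l k)) = complex_of_int (det M) * of_int (v $ i)" for i
      using J by (simp add: sum_divide_distrib[symmetric] M_def field_simps)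
    then have "complex_of_int (\<Sum>k\<in>UNIV. M $ i $ k * l k) = of_int (det M * v $ i)" for i
      by simp
    then have "(\<Sum>k\<in>UNIV. M $ i $ k * l k) = det M * v $ i" for i
      unfolding of_int_eq_iff .
    then have "det M *s v = (\<Sum>k\<in>UNIV. l k *s column (J k) A)"
      by (simp add: vec_eq_iff M_def column_def mult.commute)
    also have "\<dots> \<in> col_lattice A"
    proof -
      have "(\<Sum>k\<in>K. l k *s column (J k) A) \<in> col_lattice A" for K
        by (induction K rule: infinite_finite_induct) (auto intro: col_lattice_closed)
      then show ?thesis .
    qed
    finally show ?thesis .
  qed
  then have "int (nat \<bar>det M\<bar>) *s v \<in> col_lattice A" for v
  proof (cases "det M \<ge> 0")
    case False
    then have "int (nat \<bar>det M\<bar>) *s v = - (det M *s v)" by (simp add: vec_eq_iff)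
    then show ?thesis using \<open>\<And>v. det M *s v \<in> _\<close> col_lattice_closed(4) by metis
  qed simp
  then show ?thesis using J by (intro exI[of _ "nat \<bar>det M\<bar>"]) (auto simp: M_def)
qed

end

unbundle no fps_syntax
no_notation fps_nth (infixl \<open>$\<close> 75)

section \<open>Volume of the polytope and growth of the layers\<close>

definition real_vec :: "int ^ 'd \<Rightarrow> real ^ 'd" where
  "real_vec v = (\<chi> i. real_of_int (v $ i))"

lemma real_vec_nth [simp]: "real_vec v $ i = real_of_int (v $ i)"
  by (simp add: real_vec_def)

lemma real_vec_diff: "real_vec (v - w) = real_vec v - real_vec w"
  by (auto simp: vec_eq_iff)

definition unit_cube :: "int ^ 'd \<Rightarrow> (real ^ 'd) set" where
  "unit_cube w = cbox (real_vec w) (real_vec w + 1)"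

lemma mem_unit_cube: "x \<in> unit_cube w \<longleftrightarrow> (\<forall>i. real_of_int (w $ i) \<le> x $ i \<and> x $ i \<le> real_of_int (w $ i) + 1)"
  by (simp add: unit_cube_def mem_box_cart)

lemma measure_unit_cube: "measure lebesgue (unit_cube w) = 1"
  unfolding unit_cube_def by (subst measure_completion) (auto simp: content_cbox_if_cart interval_eq_empty_cart)

lemma measure_union_unit_cubes:
  fixes B :: "(int ^ 'd) set"
  assumes "finite B"
  shows "measure lebesgue (\<Union>w\<in>B. unit_cube w) = card B"
proof -
  have "negligible (unit_cube v \<inter> unit_cube w)" if "v \<noteq> w" for v w :: "int ^ 'd"
  proof -
    have half: "negligible (unit_cube v \<inter> unit_cube w)" if "v $ i < w $ i" for v w :: "int ^ 'd" and i
    proof (rule negligible_subset)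
      show "negligible {x :: real ^ 'd. x \<bullet> axis i 1 = real_of_int (w $ i)}"
        by (rule negligible_standard_hyperplane) (auto simp: axis_in_Basis_iff)
      show "unit_cube v \<inter> unit_cube w \<subseteq> {x. x \<bullet> axis i 1 = real_of_int (w $ i)}"
      proof
        fix x assume x: "x \<in> unit_cube v \<inter> unit_cube w"
        then have "x $ i \<le> real_of_int (v $ i) + 1" "real_of_int (w $ i) \<le> x $ i"
          by (auto simp: mem_unit_cube)
        moreover have "real_of_int (v $ i) + 1 \<le> real_of_int (w $ i)" using that by linarith
        ultimately show "x \<in> {x. x \<bullet> axis i 1 = real_of_int (w $ i)}" by (simp add: inner_axis)
      qed
    qed
    from that obtain i where "v $ i < w $ i \<or> w $ i < v $ i" by (metis linorder_neqE vec_eq_iff)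
    then show ?thesis using half[of v i w] half[of w i v] by (auto simp: Int_commute)
  qed
  then have "pairwise (\<lambda>v w. negligible (unit_cube v \<inter> unit_cube w)) B" by (simp add: pairwise_def)
  then show ?thesis
    by (subst measure_negligible_finite_Union_image[OF assms])
       (simp_all add: measure_unit_cube, simp add: unit_cube_def)
qed

section \<open>Dilates of the polytope and the lattice points in them\<close>

context full_rank_matrix
begin

definition real_col :: "'n \<Rightarrow> real ^ 'd" where
  "real_col j = real_vec (column j A)"

text \<open>The polytope scaled by \<kappa>, described as the image of the cross-polytope. This is
  the real counterpart of \<open>layer\<close>: integer coefficients are replaced by real ones under
  the same bound on their absolute sum.\<close>

definition dilate :: "real \<Rightarrow> (real ^ 'd) set" where
  "dilate \<kappa> = {\<Sum>j\<in>UNIV. \<mu> j *\<^sub>R real_col j | \<mu>. (\<Sum>j\<in>UNIV. \<bar>\<mu> j\<bar>) \<le> \<kappa>}"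

lemma dilateI: "(\<Sum>j\<in>UNIV. \<bar>\<mu> j\<bar>) \<le> \<kappa> \<Longrightarrow> (\<Sum>j\<in>UNIV. \<mu> j *\<^sub>R real_col j) \<in> dilate \<kappa>"
  by (auto simp: dilate_def)

lemma dilate_mono: "\<kappa> \<le> \<kappa>' \<Longrightarrow> dilate \<kappa> \<subseteq> dilate \<kappa>'"
  unfolding dilate_def by force

lemma dilate_add:
  assumes "x \<in> dilate \<kappa>" "y \<in> dilate \<kappa>'"
  shows "x + y \<in> dilate (\<kappa> + \<kappa>')"
proof -
  obtain \<mu> \<mu>' where \<mu>: "x = (\<Sum>j\<in>UNIV. \<mu> j *\<^sub>R real_col j)" "(\<Sum>j\<in>UNIV. \<bar>\<mu> j\<bar>) \<le> \<kappa>"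
    and \<mu>': "y = (\<Sum>j\<in>UNIV. \<mu>' j *\<^sub>R real_col j)" "(\<Sum>j\<in>UNIV. \<bar>\<mu>' j\<bar>) \<le> \<kappa>'"
    using assms unfolding dilate_def by blast
  have "x + y = (\<Sum>j\<in>UNIV. (\<mu> j + \<mu>' j) *\<^sub>R real_col j)"
    unfolding \<mu> \<mu>' by (simp add: scaleR_add_left sum.distrib)
  moreover have "(\<Sum>j\<in>UNIV. \<bar>\<mu> j + \<mu>' j\<bar>) \<le> (\<Sum>j\<in>UNIV. \<bar>\<mu> j\<bar> + \<bar>\<mu>' j\<bar>)" by (intro sum_mono) auto
  ultimately show ?thesis using \<mu> \<mu>' by (auto simp: sum.distrib intro!: dilateI)
qed

lemma dilate_scale:
  assumes "x \<in> dilate \<kappa>"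
  shows "c *\<^sub>R x \<in> dilate (\<bar>c\<bar> * \<kappa>)"
proof -
  obtain \<mu> where \<mu>: "x = (\<Sum>j\<in>UNIV. \<mu> j *\<^sub>R real_col j)" "(\<Sum>j\<in>UNIV. \<bar>\<mu> j\<bar>) \<le> \<kappa>"
    using assms unfolding dilate_def by blast
  have "c *\<^sub>R x = (\<Sum>j\<in>UNIV. (c * \<mu> j) *\<^sub>R real_col j)" unfolding \<mu> by (simp add: scaleR_sum_right)
  moreover have "(\<Sum>j\<in>UNIV. \<bar>c * \<mu> j\<bar>) \<le> \<bar>c\<bar> * \<kappa>"
    using \<mu>(2) by (simp add: abs_mult sum_distrib_left[symmetric] mult_left_mono)
  ultimately show ?thesis by (auto intro!: dilateI)
qed

lemma zero_in_dilate: "0 \<le> \<kappa> \<Longrightarrow> 0 \<in> dilate \<kappa>"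
  using dilateI[of "\<lambda>_. 0" \<kappa>] by simp

lemma dilate_minus: "x \<in> dilate \<kappa> \<Longrightarrow> - x \<in> dilate \<kappa>"
  using dilate_scale[of x \<kappa> "-1"] by simp

lemma dilate_sum:
  assumes "finite I" "\<And>i. i \<in> I \<Longrightarrow> x i \<in> dilate (\<kappa> i)"
  shows "(\<Sum>i\<in>I. x i) \<in> dilate (\<Sum>i\<in>I. \<kappa> i)"
  using assms by (induction I rule: finite_induct) (auto intro: dilate_add zero_in_dilate)

lemma real_col_columns: "columns (map_matrix real_of_int A) = range real_col"
  by (auto simp: columns_def real_col_def real_vec_def column_def map_matrix_def)

lemma dilate_1: "dilate 1 = col_polytope A"
proof
  have conv: "convex (col_polytope A)" by (simp add: col_polytope_def)
  have gen: "real_col j \<in> col_polytope A" "- real_col j \<in> col_polytope A" for j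
    unfolding col_polytope_def real_col_columns by (auto intro!: hull_inc)
  have zero: "0 \<in> col_polytope A"
  proof -
    \<comment> \<open>Any column will do: the origin is the midpoint of the column and its
      negative.\<close>
    have "(1/2) *\<^sub>R real_col undefined + (1/2) *\<^sub>R (- real_col undefined) \<in> col_polytope A"
      by (intro convexD[OF conv] gen) auto
    then show ?thesis by simp
  qed
  show "dilate 1 \<subseteq> col_polytope A"
  proof
    fix x assume "x \<in> dilate 1"
    then obtain \<mu> where \<mu>: "x = (\<Sum>j\<in>UNIV. \<mu> j *\<^sub>R real_col j)" "(\<Sum>j\<in>UNIV. \<bar>\<mu> j\<bar>) \<le> 1"
      unfolding dilate_def by blast
    define s where "s = (\<Sum>j\<in>UNIV. \<bar>\<mu> j\<bar>)"
    show "x \<in> col_polytope A"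
    proof (cases "s = 0")
      case True
      then have "\<forall>j. \<mu> j = 0" by (auto simp: s_def sum_nonneg_eq_0_iff)
      then show ?thesis using \<mu> zero by simp
    next
      case False
      then have s: "0 < s" "s \<le> 1" using \<mu>(2) by (auto simp: s_def sum_nonneg order_less_le)
      have "(\<Sum>j\<in>UNIV. (\<bar>\<mu> j\<bar> / s) *\<^sub>R (sgn (\<mu> j) *\<^sub>R real_col j)) \<in> col_polytope A"
      proof (rule convex_sum[OF _ conv])
        show "(\<Sum>j\<in>UNIV. \<bar>\<mu> j\<bar> / s) = 1" using s by (simp add: sum_divide_distrib[symmetric] s_def[symmetric])
        show "sgn (\<mu> j) *\<^sub>R real_col j \<in> col_polytope A" for j
          using gen[of j] zero by (auto simp: sgn_if)
      qed (use s in auto)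
      then have "s *\<^sub>R (\<Sum>j\<in>UNIV. (\<bar>\<mu> j\<bar> / s) *\<^sub>R (sgn (\<mu> j) *\<^sub>R real_col j)) + (1 - s) *\<^sub>R 0 \<in> col_polytope A"
        using s zero by (intro convexD[OF conv]) auto
      also have "s *\<^sub>R (\<Sum>j\<in>UNIV. (\<bar>\<mu> j\<bar> / s) *\<^sub>R (sgn (\<mu> j) *\<^sub>R real_col j)) + (1 - s) *\<^sub>R 0 = x"
        using s unfolding \<mu> by (simp add: scaleR_sum_right abs_mult_sgn mult.commute)
      finally show ?thesis .
    qed
  qed
  have "convex (dilate 1)"
  proof (rule convexI)
    fix x y and u v :: real assume "x \<in> dilate 1" "y \<in> dilate 1" "0 \<le> u" "0 \<le> v" "u + v = 1"
    then show "u *\<^sub>R x + v *\<^sub>R y \<in> dilate 1"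
      using dilate_add[OF dilate_scale[of x 1 u] dilate_scale[of y 1 v]] by simp
  qed
  moreover have "real_col j \<in> dilate 1" for j
    using dilateI[of "\<lambda>i. if i = j then 1 else 0" 1]
    by (simp add: if_distrib[where f=abs] if_distrib[where f="\<lambda>x. x *\<^sub>R _"] cong: if_cong)
  ultimately show "col_polytope A \<subseteq> dilate 1"
    unfolding col_polytope_def real_col_columns using dilate_minus by (intro hull_minimal) auto
qed

lemma dilate_eq:
  assumes "0 < \<kappa>"
  shows "dilate \<kappa> = (\<lambda>x. \<kappa> *\<^sub>R x + 0) ` col_polytope A"
proof (intro equalityI subsetI)
  fix x assume "x \<in> dilate \<kappa>"
  then have "(1 / \<kappa>) *\<^sub>R x \<in> dilate 1" using dilate_scale[of x \<kappa> "1 / \<kappa>"] assms by simp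
  then show "x \<in> (\<lambda>x. \<kappa> *\<^sub>R x + 0) ` col_polytope A"
    using assms unfolding dilate_1 by (intro image_eqI[of _ _ "(1 / \<kappa>) *\<^sub>R x"]) auto
next
  fix x assume "x \<in> (\<lambda>x. \<kappa> *\<^sub>R x + 0) ` col_polytope A"
  then show "x \<in> dilate \<kappa>" using dilate_scale[of _ 1 \<kappa>] assms unfolding dilate_1[symmetric] by auto
qed

lemma compact_polytope: "compact (col_polytope A)"
  unfolding col_polytope_def real_col_columns by (intro finite_imp_compact_convex_hull) auto

lemma dilate_measurable: "0 < \<kappa> \<Longrightarrow> dilate \<kappa> \<in> lmeasurable"
  unfolding dilate_eq using compact_polytope
  by (auto intro!: lmeasurable_compact compact_scaling)

lemma measure_dilate:
  "0 < \<kappa> \<Longrightarrow> measure lebesgue (dilate \<kappa>) = \<kappa> ^ CARD('d) * measure lebesgue (col_polytope A)"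
  unfolding dilate_eq by (subst measure_lebesgue_affine) simp

lemma real_vec_comb: "real_vec (comb l) = (\<Sum>j\<in>UNIV. real_of_int (l j) *\<^sub>R real_col j)"
  by (simp add: vec_eq_iff comb_nth real_col_def column_def)

lemma layer_dilate: "v \<in> layer k \<Longrightarrow> real_vec v \<in> dilate (real k)"
proof -
  assume "v \<in> layer k"
  then obtain l where l: "v = comb l" "(\<Sum>j\<in>UNIV. nat \<bar>l j\<bar>) \<le> k" by (auto simp: layer_def)
  have "(\<Sum>j\<in>UNIV. \<bar>real_of_int (l j)\<bar>) = real (\<Sum>j\<in>UNIV. nat \<bar>l j\<bar>)" by simp
  also have "\<dots> \<le> real k" using l(2) by (simp only: of_nat_le_iff)
  finally show ?thesis unfolding l(1) real_vec_comb by (rule dilateI)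
qed

text \<open>The origin is interior to the polytope: a multiple of each unit vector lies in the
  lattice, hence in some layer. This gives positive volume and lets bounded displacements be
  absorbed into a larger dilate.\<close>

lemma bounded_in_dilate:
  obtains C where "C > 0" "\<And>x r. (\<And>i. \<bar>x $ i\<bar> \<le> r) \<Longrightarrow> x \<in> dilate (C * r)"
proof -
  obtain N where N: "N > 0" "\<And>v. int N *s v \<in> col_lattice A" using multiple_in_lattice by blast
  have "\<forall>i. \<exists>L. int N *s axis i 1 \<in> layer L" using N col_lattice_layer by blast
  then obtain L where L: "\<And>i. int N *s axis i 1 \<in> layer (L i)" by metis
  define D where "D = (\<Sum>i\<in>UNIV. real (L i) / real N)"
  have ax: "axis i 1 \<in> dilate (real (L i) / real N)" for i
  proof -
    have "(1 / real N) *\<^sub>R real_vec (int N *s axis i 1) \<in> dilate (\<bar>1 / real N\<bar> * real (L i))"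
      by (intro dilate_scale layer_dilate L)
    moreover have "(1 / real N) *\<^sub>R real_vec (int N *s axis i 1) = axis i 1"
      using N by (auto simp: vec_eq_iff axis_def)
    ultimately show ?thesis by simp
  qed
  have "x \<in> dilate ((D + 1) * r)" if x: "\<And>i. \<bar>x $ i\<bar> \<le> r" for x r
  proof -
    have r: "0 \<le> r" using x[of undefined] by linarith
    have m1: "(\<Sum>i\<in>UNIV. (x $ i) *\<^sub>R axis i 1) \<in> dilate (\<Sum>i\<in>UNIV. \<bar>x $ i\<bar> * (real (L i) / real N))"
      by (intro dilate_sum dilate_scale ax) auto
    have m2: "(\<Sum>i\<in>UNIV. (x $ i) *\<^sub>R axis i 1) = x"
      by (simp add: vec_eq_iff axis_def if_distrib[where f="\<lambda>y. _ * y"] cong: if_cong)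
    have m3: "(\<Sum>i\<in>UNIV. \<bar>x $ i\<bar> * (real (L i) / real N)) \<le> (\<Sum>i\<in>UNIV. r * (real (L i) / real N))"
      using x by (intro sum_mono mult_right_mono) auto
    have m4: "(\<Sum>i\<in>UNIV. r * (real (L i) / real N)) \<le> (D + 1) * r"
    proof -
      have "(\<Sum>i\<in>UNIV. r * (real (L i) / real N)) = r * D" unfolding D_def sum_distrib_left ..
      then show ?thesis using r by (simp add: algebra_simps)
    qed
    show ?thesis using subsetD[OF dilate_mono[OF order_trans[OF m3 m4]] m1] unfolding m2 .
  qed
  moreover have "D + 1 > 0" by (auto simp: D_def intro!: add_nonneg_pos sum_nonneg)
  ultimately show ?thesis using that by blast
qed

lemma polytope_volume_pos: "measure lebesgue (col_polytope A) > 0"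
proof -
  obtain C where C: "C > 0" "\<And>x r. (\<And>i. \<bar>x $ i\<bar> \<le> r) \<Longrightarrow> x \<in> dilate (C * r)" using bounded_in_dilate by metis
  let ?B = "cbox (\<chi> i. - (1 / C)) (\<chi> i. 1 / C) :: (real ^ 'd) set"
  have "?B \<subseteq> dilate 1"
  proof
    fix x assume "x \<in> ?B"
    then have "\<bar>x $ i\<bar> \<le> 1 / C" for i by (simp add: mem_box_cart abs_le_iff minus_le_iff)
    from C(2)[OF this] show "x \<in> dilate 1" using C(1) by simp
  qed
  then have "measure lebesgue ?B \<le> measure lebesgue (dilate 1)"
    by (intro measure_mono_fmeasurable dilate_measurable) auto
  moreover have "measure lebesgue ?B = (2 / C) ^ CARD('d)"
    using C(1) by (subst measure_completion) (auto simp: content_cbox_if_cart interval_eq_empty_cart)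
  moreover have "(2 / C) ^ CARD('d) > 0" using C(1) by simp
  ultimately show ?thesis unfolding dilate_1 by linarith
qed

lemma finite_int_box: "finite {v :: int ^ 'd. \<forall>i. \<bar>v $ i\<bar> \<le> m}"
proof -
  have "finite {f :: 'd \<Rightarrow> int. \<forall>i. (i \<in> UNIV \<longrightarrow> f i \<in> {-m..m}) \<and> (i \<notin> UNIV \<longrightarrow> f i = 0)}"
    by (rule finite_set_of_finite_funs) auto
  then have "finite ((\<lambda>f. \<chi> i. f i) ` {f :: 'd \<Rightarrow> int. \<forall>i. (i \<in> UNIV \<longrightarrow> f i \<in> {-m..m}) \<and> (i \<notin> UNIV \<longrightarrow> f i = 0)})"
    by (rule finite_imageI)
  moreover have "{v :: int ^ 'd. \<forall>i. \<bar>v $ i\<bar> \<le> m} \<subseteq> (\<lambda>f. \<chi> i. f i) ` {f :: 'd \<Rightarrow> int. \<forall>i. (i \<in> UNIV \<longrightarrow> f i \<in> {-m..m}) \<and> (i \<notin> UNIV \<longrightarrow> f i = 0)}"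
  proof
    fix v :: "int ^ 'd" assume "v \<in> {v. \<forall>i. \<bar>v $ i\<bar> \<le> m}"
    then show "v \<in> (\<lambda>f. \<chi> i. f i) ` {f :: 'd \<Rightarrow> int. \<forall>i. (i \<in> UNIV \<longrightarrow> f i \<in> {-m..m}) \<and> (i \<notin> UNIV \<longrightarrow> f i = 0)}"
      by (intro image_eqI[of _ _ "\<lambda>i. v $ i"]) (auto simp: abs_le_iff minus_le_iff)
  qed
  ultimately show ?thesis by (rule finite_subset[rotated])
qed

lemma dilate_coord_bound:
  obtains a where "\<And>x \<kappa> i. x \<in> dilate \<kappa> \<Longrightarrow> \<bar>x $ i\<bar> \<le> a * \<kappa>"
proof -
  define a where "a = (\<Sum>j\<in>UNIV. \<Sum>i\<in>UNIV. \<bar>real_col j $ i\<bar>)"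
  have le_a: "\<bar>real_col j $ i\<bar> \<le> a" for i j
  proof -
    have "\<bar>real_col j $ i\<bar> \<le> (\<Sum>i\<in>UNIV. \<bar>real_col j $ i\<bar>)" by (rule member_le_sum) auto
    also have "\<dots> \<le> a" unfolding a_def
      by (rule member_le_sum[where f="\<lambda>j. \<Sum>i\<in>UNIV. \<bar>real_col j $ i\<bar>"]) (auto intro: sum_nonneg)
    finally show ?thesis .
  qed
  have "\<bar>x $ i\<bar> \<le> a * \<kappa>" if x: "x \<in> dilate \<kappa>" for x \<kappa> i
  proof -
    obtain \<mu> where \<mu>: "x = (\<Sum>j\<in>UNIV. \<mu> j *\<^sub>R real_col j)" "(\<Sum>j\<in>UNIV. \<bar>\<mu> j\<bar>) \<le> \<kappa>"
      using x unfolding dilate_def by blast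
    have "\<bar>x $ i\<bar> \<le> (\<Sum>j\<in>UNIV. \<bar>\<mu> j * real_col j $ i\<bar>)" unfolding \<mu> by (simp add: sum_abs)
    also have "\<dots> \<le> (\<Sum>j\<in>UNIV. \<bar>\<mu> j\<bar> * a)" by (intro sum_mono) (simp add: abs_mult le_a mult_left_mono)
    also have "\<dots> = a * (\<Sum>j\<in>UNIV. \<bar>\<mu> j\<bar>)" by (simp add: sum_distrib_left mult.commute)
    also have "\<dots> \<le> a * \<kappa>" using \<mu>(2) le_a[of undefined undefined]
      by (intro mult_left_mono) auto
    finally show ?thesis .
  qed
  then show ?thesis using that by blast
qed

text \<open>Converse of \<open>layer_dilate\<close> up to a constant loss. A lattice point may have
  real coefficients of small sum but only costly integer ones; rounding leaves a lattice vector in a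
  fixed bounded dilate, and these finitely many remainders lie in a common layer
  \<open>c\<close>.\<close>

lemma lattice_dilate_layer:
  obtains c :: nat where "\<And>v \<kappa> k. v \<in> col_lattice A \<Longrightarrow> real_vec v \<in> dilate \<kappa> \<Longrightarrow> \<kappa> + real c \<le> real k \<Longrightarrow> v \<in> layer k"
proof -
  obtain a where a: "\<And>x \<kappa> i. x \<in> dilate \<kappa> \<Longrightarrow> \<bar>x $ i\<bar> \<le> a * \<kappa>" using dilate_coord_bound by metis
  define F where "F = {w \<in> col_lattice A. real_vec w \<in> dilate (real CARD('n))}"
  have "F \<subseteq> {w. \<forall>i. \<bar>w $ i\<bar> \<le> \<lceil>a * real CARD('n)\<rceil>}"
  proof
    fix w assume "w \<in> F"
    then have "\<bar>real_of_int (w $ i)\<bar> \<le> a * real CARD('n)" for i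
      using a[of "real_vec w" "real CARD('n)" i] by (simp add: F_def)
    then have "real_of_int \<bar>w $ i\<bar> \<le> of_int \<lceil>a * real CARD('n)\<rceil>" for i
      unfolding of_int_abs by (rule order_trans[OF _ le_of_int_ceiling])
    then show "w \<in> {w. \<forall>i. \<bar>w $ i\<bar> \<le> \<lceil>a * real CARD('n)\<rceil>}" unfolding of_int_le_iff mem_Collect_eq by blast
  qed
  then have finF: "finite F" using finite_int_box finite_subset by blast
  have "\<forall>w\<in>F. \<exists>k. w \<in> layer k" using col_lattice_layer by (auto simp: F_def)
  then obtain L where L: "\<And>w. w \<in> F \<Longrightarrow> w \<in> layer (L w)" by metis
  define c where "c = Max (insert 0 (L ` F))"
  have c: "w \<in> layer c" if "w \<in> F" for w
  proof -
    have "L w \<le> c" unfolding c_def using finF that by (intro Max_ge) auto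
    then show ?thesis using L[OF that] layer_mono by blast
  qed
  have "v \<in> layer k" if v: "v \<in> col_lattice A" "real_vec v \<in> dilate \<kappa>" and k: "\<kappa> + real c \<le> real k" for v \<kappa> k
  proof -
    obtain \<mu> where \<mu>: "real_vec v = (\<Sum>j\<in>UNIV. \<mu> j *\<^sub>R real_col j)" "(\<Sum>j\<in>UNIV. \<bar>\<mu> j\<bar>) \<le> \<kappa>"
      using v unfolding dilate_def by blast
    \<comment> \<open>Rounding toward zero: the absolute sum of the coefficients does not increase,
      and each remainder is at most 1.\<close>
    define m where "m = (\<lambda>j. if \<mu> j \<ge> 0 then \<lfloor>\<mu> j\<rfloor> else \<lceil>\<mu> j\<rceil>)"
    have m: "\<bar>real_of_int (m j)\<bar> \<le> \<bar>\<mu> j\<bar>" "\<bar>\<mu> j - real_of_int (m j)\<bar> \<le> 1" for j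
    proof -
      have "(\<mu> j \<ge> 0 \<and> real_of_int (m j) \<le> \<mu> j \<and> \<mu> j < real_of_int (m j) + 1 \<and> 0 \<le> real_of_int (m j)) \<or>
        (\<mu> j \<le> 0 \<and> \<mu> j \<le> real_of_int (m j) \<and> real_of_int (m j) < \<mu> j + 1 \<and> real_of_int (m j) \<le> 0)"
        using floor_correct[of "\<mu> j"] ceiling_correct[of "\<mu> j"] by (auto simp: m_def)
      then show "\<bar>real_of_int (m j)\<bar> \<le> \<bar>\<mu> j\<bar>" "\<bar>\<mu> j - real_of_int (m j)\<bar> \<le> 1" by linarith+
    qed
    have "real_vec (v - comb m) = (\<Sum>j\<in>UNIV. (\<mu> j - real_of_int (m j)) *\<^sub>R real_col j)"
      unfolding real_vec_diff \<mu> real_vec_comb by (simp add: scaleR_diff_left sum_subtractf)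
    also have "\<dots> \<in> dilate (real CARD('n))"
    proof (rule dilateI)
      have "(\<Sum>j\<in>UNIV. \<bar>\<mu> j - real_of_int (m j)\<bar>) \<le> (\<Sum>j\<in>(UNIV::'n set). 1)" by (intro sum_mono m)
      then show "(\<Sum>j\<in>UNIV. \<bar>\<mu> j - real_of_int (m j)\<bar>) \<le> real CARD('n)" by simp
    qed
    finally have "v - comb m \<in> F" unfolding F_def using v col_lattice_closed(3)[OF v(1), of "comb m"]
      by (simp add: col_lattice_eq)
    from c[OF this] have "v - comb m \<in> layer c" .
    moreover have "comb m \<in> layer (\<Sum>j\<in>UNIV. nat \<bar>m j\<bar>)" by (auto simp: layer_def)
    ultimately have "v \<in> layer (c + (\<Sum>j\<in>UNIV. nat \<bar>m j\<bar>))" using layer_add by fastforce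
    moreover have "c + (\<Sum>j\<in>UNIV. nat \<bar>m j\<bar>) \<le> k"
    proof -
      have "real (\<Sum>j\<in>UNIV. nat \<bar>m j\<bar>) = (\<Sum>j\<in>UNIV. \<bar>real_of_int (m j)\<bar>)" by simp
      also have "\<dots> \<le> (\<Sum>j\<in>UNIV. \<bar>\<mu> j\<bar>)" by (intro sum_mono m)
      finally have "real (\<Sum>j\<in>UNIV. nat \<bar>m j\<bar>) \<le> \<kappa>" using \<mu>(2) by linarith
      then show ?thesis using k by linarith
    qed
    ultimately show ?thesis using layer_mono by blast
  qed
  then show ?thesis using that by blast
qed

text \<open>Modulo \<open>N\<close> times the full lattice, which lies in the column lattice, every
  vector has a representative in a finite box; so there are finitely many cosets.\<close>

lemma lattice_representatives:
  obtains R where "finite R" "card R = col_lattice_index A" "col_lattice_index A > 0"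
    "\<And>z. \<exists>\<rho>\<in>R. z - \<rho> \<in> col_lattice A"
    "\<And>\<rho> \<rho>'. \<rho> \<in> R \<Longrightarrow> \<rho>' \<in> R \<Longrightarrow> \<rho> - \<rho>' \<in> col_lattice A \<Longrightarrow> \<rho> = \<rho>'"
proof -
  define r where "r = {(u, v). u - v \<in> col_lattice A}"
  have eq: "equiv UNIV r"
  proof (rule equivI)
    show "refl r" by (auto simp: r_def refl_on_def col_lattice_closed)
    show "sym r" unfolding r_def sym_def using col_lattice_closed(4) by fastforce
    show "trans r" unfolding r_def trans_def using col_lattice_closed(2) by fastforce
  qed simp
  obtain N where N: "N > 0" "\<And>v. int N *s v \<in> col_lattice A" using multiple_in_lattice by blast
  have "UNIV // r \<subseteq> (\<lambda>v. r `` {v}) ` {v. \<forall>i. \<bar>v $ i\<bar> \<le> int N}"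
  proof
    fix C assume "C \<in> UNIV // r"
    then obtain v where v: "C = r `` {v}" by (auto simp: quotient_def)
    define w where "w = (\<chi> i. v $ i mod int N)"
    have "v - w = int N *s (\<chi> i. v $ i div int N)" by (simp add: w_def vec_eq_iff minus_mod_eq_mult_div)
    then have "(v, w) \<in> r" using N by (simp add: r_def)
    then have "C = r `` {w}" unfolding v using eq by (rule equiv_class_eq[rotated])
    moreover have "\<forall>i. \<bar>w $ i\<bar> \<le> int N" using N(1) by (simp add: w_def less_imp_le)
    ultimately show "C \<in> (\<lambda>v. r `` {v}) ` {v. \<forall>i. \<bar>v $ i\<bar> \<le> int N}" by blast
  qed
  then have fin: "finite (UNIV // r)" using finite_int_box finite_surj by blast
  define f where "f = (\<lambda>C :: (int ^ 'd) set. SOME v. v \<in> C)"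
  have f: "f C \<in> C" if "C \<in> UNIV // r" for C
    unfolding f_def using in_quotient_imp_non_empty[OF eq that] by (simp add: some_in_eq)
  have cls: "C = r `` {f C}" if "C \<in> UNIV // r" for C
    using that f[OF that] eq by (metis Image_singleton_iff equiv_class_eq quotientE)
  have inj: "inj_on f (UNIV // r)" by (rule inj_onI) (metis cls)
  show ?thesis
  proof (rule that[of "f ` (UNIV // r)"])
    show "finite (f ` (UNIV // r))" using fin by simp
    show "card (f ` (UNIV // r)) = col_lattice_index A"
      unfolding col_lattice_index_def r_def[symmetric] using inj by (rule card_image)
    have "r `` {0} \<in> UNIV // r" by (auto simp: quotient_def)
    then show "col_lattice_index A > 0"
      unfolding col_lattice_index_def r_def[symmetric] using fin by (auto simp: card_gt_0_iff)
    show "\<exists>\<rho>\<in>f ` (UNIV // r). z - \<rho> \<in> col_lattice A" for z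
    proof -
      have C: "r `` {z} \<in> UNIV // r" by (auto simp: quotient_def)
      then have "(z, f (r `` {z})) \<in> r" using f by blast
      then show ?thesis using C by (auto simp: r_def)
    qed
    show "\<rho> = \<rho>'" if "\<rho> \<in> f ` (UNIV // r)" "\<rho>' \<in> f ` (UNIV // r)" "\<rho> - \<rho>' \<in> col_lattice A" for \<rho> \<rho>'
    proof -
      from that(1) obtain C where C1: "\<rho> = f C" "C \<in> UNIV // r" by (auto elim: imageE)
      from that(2) obtain C' where C2: "\<rho>' = f C'" "C' \<in> UNIV // r" by (auto elim: imageE)
      note C = C1(2) C2(2) C1(1) C2(1)
      have "(f C, f C') \<in> r" using that C by (simp add: r_def)
      then have "r `` {f C} = r `` {f C'}" using eq by (metis equiv_class_eq)
      then have "C = C'" using cls C by metis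
      then show ?thesis using C by simp
    qed
  qed
qed

text \<open>Translating the layer by representatives of the cosets gives \<open>index * card\<close>
  distinct integer points. The unit cubes at these points cover the dilate by \<open>k - c\<close>
  and stay inside the one by \<open>k + c\<close>, so their total volume is squeezed.\<close>

lemma layer_bounds:
  obtains c :: nat where
    "\<And>k. real (col_lattice_index A * card (layer k)) \<le> (real k + real c) ^ CARD('d) * measure lebesgue (col_polytope A)"
    "\<And>k. k > c \<Longrightarrow> (real k - real c) ^ CARD('d) * measure lebesgue (col_polytope A) \<le> real (col_lattice_index A * card (layer k))"
proof -
  obtain R where R: "finite R" "card R = col_lattice_index A"
    "\<And>z. \<exists>\<rho>\<in>R. z - \<rho> \<in> col_lattice A"
    "\<And>\<rho> \<rho>'. \<rho> \<in> R \<Longrightarrow> \<rho>' \<in> R \<Longrightarrow> \<rho> - \<rho>' \<in> col_lattice A \<Longrightarrow> \<rho> = \<rho>'"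
    using lattice_representatives by metis
  obtain C where C: "C > 0" "\<And>x r. (\<And>i. \<bar>x $ i\<bar> \<le> r) \<Longrightarrow> x \<in> dilate (C * r)" using bounded_in_dilate by metis
  obtain c1 where c1: "\<And>v \<kappa> k. v \<in> col_lattice A \<Longrightarrow> real_vec v \<in> dilate \<kappa> \<Longrightarrow> \<kappa> + real c1 \<le> real k \<Longrightarrow> v \<in> layer k"
    using lattice_dilate_layer by metis
  define m where "m = (\<Sum>\<rho>\<in>R. \<Sum>i\<in>UNIV. \<bar>real_of_int (\<rho> $ i)\<bar>)"
  have m: "\<bar>real_of_int (\<rho> $ i)\<bar> \<le> m" if "\<rho> \<in> R" for \<rho> i
  proof -
    have "\<bar>real_of_int (\<rho> $ i)\<bar> \<le> (\<Sum>i\<in>UNIV. \<bar>real_of_int (\<rho> $ i)\<bar>)" by (rule member_le_sum) auto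
    also have "\<dots> \<le> m" unfolding m_def
      by (rule member_le_sum[where f="\<lambda>\<rho>. \<Sum>i\<in>UNIV. \<bar>real_of_int (\<rho> $ i)\<bar>"]) (use that R(1) in \<open>auto intro: sum_nonneg\<close>)
    finally show ?thesis .
  qed
  have shift: "x - real_vec v \<in> dilate (C * (m + 1))" if "x \<in> unit_cube (v + \<rho>)" "\<rho> \<in> R" for x v \<rho>
  proof (rule C(2))
    fix i
    have "real_of_int (v $ i) + real_of_int (\<rho> $ i) \<le> x $ i" "x $ i \<le> real_of_int (v $ i) + real_of_int (\<rho> $ i) + 1"
      using that(1) unfolding mem_unit_cube by (auto simp del: of_int_add simp flip: of_int_add)
    then show "\<bar>(x - real_vec v) $ i\<bar> \<le> m + 1" using m[OF that(2), of i] by (auto simp: abs_le_iff)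
  qed
  \<comment> \<open>Loss \<open>c1\<close> from the rounding of coefficients plus
    \<open>C * (m + 1)\<close> for a coset representative and a unit cube. The final 1 keeps all
    dilation factors positive, also for \<open>k = 0\<close>.\<close>
  define c where "c = c1 + nat \<lceil>C * (m + 1)\<rceil> + 1"
  have cC: "C * (m + 1) + real c1 \<le> real c" "c > 0" unfolding c_def by (auto, linarith)
  define B where "B = (\<lambda>k. (\<lambda>(v, \<rho>). v + \<rho>) ` (layer k \<times> R))"
  have finB: "finite (B k)" for k using R(1) finite_layer by (simp add: B_def)
  have cardB: "card (B k) = col_lattice_index A * card (layer k)" for k
  proof -
    have "inj_on (\<lambda>(v, \<rho>). v + \<rho>) (layer k \<times> R)"
    proof (rule inj_onI)
      fix p q assume p: "p \<in> layer k \<times> R" and q: "q \<in> layer k \<times> R" and eq: "(\<lambda>(v, \<rho>). v + \<rho>) p = (\<lambda>(v, \<rho>). v + \<rho>) q"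
      have "snd p - snd q = fst q - fst p" using eq by (auto simp: case_prod_beta algebra_simps)
      moreover have "fst q - fst p \<in> col_lattice A"
        using p q by (intro col_lattice_closed(3)) (auto simp: col_lattice_layer)
      ultimately have "snd p = snd q" using R(4) p q by (metis mem_Times_iff)
      then show "p = q" using eq by (auto simp: case_prod_beta prod_eq_iff)
    qed
    then show ?thesis unfolding B_def by (subst card_image) (auto simp: card_cartesian_product R(2))
  qed
  have upper: "real (card (B k)) \<le> measure lebesgue (dilate (real k + real c))" for k
  proof -
    have "(\<Union>w\<in>B k. unit_cube w) \<subseteq> dilate (real k + real c)"
    proof
      fix x assume "x \<in> (\<Union>w\<in>B k. unit_cube w)"
      then obtain v \<rho> where v: "v \<in> layer k" "\<rho> \<in> R" "x \<in> unit_cube (v + \<rho>)" by (auto simp: B_def)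
      have "real_vec v + (x - real_vec v) \<in> dilate (real k + C * (m + 1))"
        by (intro dilate_add layer_dilate shift[OF v(3,2)] v)
      then show "x \<in> dilate (real k + real c)"
        using dilate_mono[of "real k + C * (m + 1)" "real k + real c"] cC by auto
    qed
    then have "measure lebesgue (\<Union>w\<in>B k. unit_cube w) \<le> measure lebesgue (dilate (real k + real c))"
      using finB cC by (intro measure_mono_fmeasurable dilate_measurable) (auto simp: unit_cube_def)
    then show ?thesis by (simp add: measure_union_unit_cubes finB)
  qed
  have lower: "measure lebesgue (dilate (real k - real c)) \<le> real (card (B k))" if "k > c" for k
  proof -
    have "dilate (real k - real c) \<subseteq> (\<Union>w\<in>B k. unit_cube w)"
    proof
      fix x assume x: "x \<in> dilate (real k - real c)"
      define z where "z = (\<chi> i. \<lfloor>x $ i\<rfloor>)"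
      have xz: "x \<in> unit_cube z" unfolding mem_unit_cube z_def by (simp add: real_of_int_floor_add_one_ge)
      obtain \<rho> where \<rho>: "\<rho> \<in> R" "z - \<rho> \<in> col_lattice A" using R(3) by blast
      have "x - real_vec (z - \<rho>) \<in> dilate (C * (m + 1))" using xz \<rho> by (intro shift) auto
      from dilate_add[OF x dilate_minus[OF this]]
      have "real_vec (z - \<rho>) \<in> dilate (real k - real c + C * (m + 1))" by simp
      from c1[OF \<rho>(2) this] have "z - \<rho> \<in> layer k" using cC by simp
      then have "z \<in> B k" unfolding B_def using \<rho> by (intro image_eqI[of _ _ "(z - \<rho>, \<rho>)"]) auto
      then show "x \<in> (\<Union>w\<in>B k. unit_cube w)" using xz by blast
    qed
    then have "measure lebesgue (dilate (real k - real c)) \<le> measure lebesgue (\<Union>w\<in>B k. unit_cube w)"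
      using finB that by (intro measure_mono_fmeasurable) (auto intro!: fmeasurableD dilate_measurable fmeasurable.finite_UN simp: unit_cube_def)
    then show ?thesis by (simp add: measure_union_unit_cubes finB)
  qed
  show ?thesis
    by (rule that[of c]) (use upper lower cC in \<open>auto simp: cardB measure_dilate\<close>)
qed

text \<open>The leading coefficient of the number of points in a layer; multiplied by the factorial
  of the dimension it becomes the rank of the coordinate ring.\<close>

definition growth :: real where
  "growth = measure lebesgue (col_polytope A) / real (col_lattice_index A)"

lemma col_lattice_index_pos: "col_lattice_index A > 0"
  using lattice_representatives by metis

lemma growth_pos: "growth > 0"
  unfolding growth_def using polytope_volume_pos col_lattice_index_pos by simp

lemma layer_growth: "(\<lambda>k. real (card (layer k)) / real k ^ CARD('d)) \<longlonglongrightarrow> growth"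
proof -
  let ?I = "real (col_lattice_index A)" and ?V = "measure lebesgue (col_polytope A)"
  have I: "?I > 0" using col_lattice_index_pos by simp
  obtain c :: nat where
    up: "\<And>k. real (col_lattice_index A * card (layer k)) \<le> (real k + real c) ^ CARD('d) * ?V" and
    lo: "\<And>k. k > c \<Longrightarrow> (real k - real c) ^ CARD('d) * ?V \<le> real (col_lattice_index A * card (layer k))"
    using layer_bounds by metis
  have up': "real (card (layer k)) / real k ^ CARD('d) \<le> ((real k + real c) / real k) ^ CARD('d) * growth" if "k > c" for k
    using up[of k] I that by (simp add: growth_def field_simps power_divide)
  have lo': "((real k - real c) / real k) ^ CARD('d) * growth \<le> real (card (layer k)) / real k ^ CARD('d)" if "k > c" for k
    using lo[OF that] I that by (simp add: growth_def field_simps power_divide)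
  have lim1: "(\<lambda>k. ((real k + real c) / real k) ^ CARD('d) * growth) \<longlonglongrightarrow> 1 ^ CARD('d) * growth"
    by (intro tendsto_intros) real_asymp
  have lim2: "(\<lambda>k. ((real k - real c) / real k) ^ CARD('d) * growth) \<longlonglongrightarrow> 1 ^ CARD('d) * growth"
    by (intro tendsto_intros) real_asymp
  have ev: "eventually (\<lambda>k. k > c) sequentially" by (rule eventually_gt_at_top)
  show ?thesis
    by (rule tendsto_sandwich[OF eventually_mono[OF ev lo'] eventually_mono[OF ev up']])
       (use lim1 lim2 in simp_all)
qed

end

section \<open>Noether normalization in the filtered coordinate ring\<close>

lemma binomial_growth: "(\<lambda>k. real ((k + m) choose m) / real k ^ m) \<longlonglongrightarrow> 1 / fact m"
proof -
  have "(\<lambda>k. \<Prod>i<m. ((real k + real m - real i) / real k) / real (m - i)) \<longlonglongrightarrow> (\<Prod>i<m. 1 / real (m - i))"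
    by (intro tendsto_prod tendsto_divide tendsto_const) (real_asymp, auto)
  moreover have "(\<Prod>i<m. 1 / real (m - i)) = 1 / fact m"
  proof -
    have "(\<Prod>i<m. real (m - i)) = fact m"
      by (simp add: fact_prod_rev atLeast0LessThan)
    then show ?thesis by (simp add: prod_dividef)
  qed
  moreover have "(\<Prod>i<m. ((real k + real m - real i) / real k) / real (m - i)) = real ((k + m) choose m) / real k ^ m" for k
  proof -
    have "real ((k + m) choose m) = (\<Prod>i<m. (real k + real m - real i) / real (m - i))"
      by (simp add: binomial_gbinomial gbinomial_altdef_of_nat atLeast0LessThan) 
    moreover have "(\<Prod>i<m. ((real k + real m - real i) / real k) / real (m - i))
        = (\<Prod>i<m. ((real k + real m - real i) / real (m - i)) / real k)"
      by (intro prod.cong) auto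
    ultimately show ?thesis
      using prod_dividef[of "\<lambda>i. (real k + real m - real i) / real (m - i)" "\<lambda>_. real k" "{..<m}"] by simp
  qed
  ultimately show ?thesis by simp
qed

text \<open>Independence of a family rather than of a set: repeated members count as dependent, so
  cardinalities of index sets can be compared.\<close>

definition family_independent :: "'i set \<Rightarrow> ('i \<Rightarrow> 'u \<Rightarrow> complex) \<Rightarrow> bool" where
  "family_independent I f \<longleftrightarrow> (\<forall>c. (\<Sum>i\<in>I. fscale (c i) (f i)) = 0 \<longrightarrow> (\<forall>i\<in>I. c i = 0))"

lemma family_independent_card_le:
  assumes "finite I" "finite V" "family_independent I f" "\<And>i. i \<in> I \<Longrightarrow> f i \<in> fs.span (g ` V)"
  shows "card I \<le> card V"
proof (rule ccontr)
  assume "\<not> ?thesis"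
  then have less: "card V < card I" by simp
  have "\<exists>m. f i - (\<Sum>v\<in>V. fscale (m v) (g v)) \<in> {0}" if "i \<in> I" for i
    using span_image_finite_iff[OF assms(2), of "f i" g] assms(4)[OF that] by auto
  from dependent_mod_subspace[where f = f, OF _ assms(2,1) less this]
  obtain c where "\<exists>i\<in>I. c i \<noteq> 0" "(\<Sum>i\<in>I. fscale (c i) (f i)) \<in> {0}" by auto
  then show False using assms(3) unfolding family_independent_def by blast
qed

section \<open>The coordinate ring and its filtration\<close>

locale lissajous_setup = full_rank_matrix A for A :: "int ^ 'n ^ 'd" +
  fixes b :: "complex ^ 'n"
begin

definition \<beta> :: "'n \<Rightarrow> complex" where
  "\<beta> j = exp (- \<i> * b $ j * of_real pi / 2)"

lemma \<beta>_nonzero [simp]: "\<beta> j \<noteq> 0"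
  by (simp add: \<beta>_def)

definition xf :: "'n \<Rightarrow> complex ^ 'd \<Rightarrow> complex" where
  "xf j = fscale (\<beta> j / 2) (expo (column j A)) + fscale (inverse (\<beta> j) / 2) (expo (- column j A))"

definition zf :: "(nat \<Rightarrow> complex ^ 'n) \<Rightarrow> nat \<Rightarrow> complex ^ 'd \<Rightarrow> complex" where
  "zf M i = (\<Sum>j\<in>UNIV. fscale (M i $ j) (xf j))"

definition S :: "nat \<Rightarrow> (complex ^ 'd \<Rightarrow> complex) set" where
  "S k = fs.span (expo ` layer k)"

definition coord_ring :: "(complex ^ 'd \<Rightarrow> complex) set" where
  "coord_ring = fs.span (expo ` col_lattice A)"

lemma subspace_S: "fs.subspace (S k)"
  unfolding S_def by (rule fs.subspace_span)

lemma S_closed: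
  shows "0 \<in> S k" "f \<in> S k \<Longrightarrow> g \<in> S k \<Longrightarrow> f + g \<in> S k" "f \<in> S k \<Longrightarrow> g \<in> S k \<Longrightarrow> f - g \<in> S k"
    "f \<in> S k \<Longrightarrow> fscale c f \<in> S k" "(\<And>i. i \<in> I \<Longrightarrow> h i \<in> S k) \<Longrightarrow> (\<Sum>i\<in>I. h i) \<in> S k"
  by (rule fs.subspace_0[OF subspace_S])
     (rule fs.subspace_add[OF subspace_S] fs.subspace_diff[OF subspace_S] fs.subspace_scale[OF subspace_S]
       fs.subspace_sum[OF subspace_S]; assumption)+

lemma S_mono: "k \<le> l \<Longrightarrow> S k \<subseteq> S l"
  unfolding S_def by (intro fs.span_mono image_mono layer_mono)

lemma expo_in_S: "v \<in> layer k \<Longrightarrow> expo v \<in> S k"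
  unfolding S_def by (intro fs.span_base imageI)

lemma one_in_S: "1 \<in> S k"
  using expo_in_S[OF layer_0] by simp

lemma S_mult:
  assumes "f \<in> S k" "g \<in> S l"
  shows "f * g \<in> S (k + l)"
  unfolding S_def
proof (rule span_mult[OF fs.subspace_span _ assms[unfolded S_def]])
  fix x y assume "x \<in> expo ` layer k" "y \<in> expo ` layer l"
  then obtain v w where vw: "x = expo v" "v \<in> layer k" "y = expo w" "w \<in> layer l" by blast
  have "expo (v + w) \<in> fs.span (expo ` layer (k + l))"
    using layer_add[OF vw(2,4)] by (intro fs.span_base imageI)
  then show "x * y \<in> fs.span (expo ` layer (k + l))" unfolding vw expo_add .
qed

lemma S_power: "f \<in> S k \<Longrightarrow> f ^ n \<in> S (n * k)"
proof (induction n)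
  case 0
  show ?case unfolding power_0 by (rule one_in_S)
next
  case (Suc n)
  then have "f * f ^ n \<in> S (k + n * k)" by (intro S_mult)
  then show ?case unfolding power_Suc mult_Suc .
qed

lemma xf_in_S: "xf j \<in> S 1"
  unfolding xf_def by (intro S_closed expo_in_S col_in_layer)

lemma zf_in_S: "zf M i \<in> S 1"
  unfolding zf_def by (intro S_closed xf_in_S)

lemma expo_family_independent: "finite V \<Longrightarrow> family_independent V expo"
  unfolding family_independent_def using expo_independent by blast

lemma coord_ring_iff: "f \<in> coord_ring \<longleftrightarrow> (\<exists>k. f \<in> S k)"
proof
  assume "f \<in> coord_ring"
  moreover have "fs.subspace {f. \<exists>k. f \<in> S k}"
  proof (rule fs.subspaceI)
    show "0 \<in> {f. \<exists>k. f \<in> S k}" using S_closed(1) by blast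
    show "x + y \<in> {f. \<exists>k. f \<in> S k}" if xy: "x \<in> {f. \<exists>k. f \<in> S k}" "y \<in> {f. \<exists>k. f \<in> S k}" for x y
    proof -
      obtain k l where "x \<in> S k" "y \<in> S l" using xy by blast
      then have "x \<in> S (k + l)" "y \<in> S (k + l)" using S_mono[of k "k + l"] S_mono[of l "k + l"] by auto
      then show ?thesis using S_closed(2) by blast
    qed
    show "fscale c x \<in> {f. \<exists>k. f \<in> S k}" if "x \<in> {f. \<exists>k. f \<in> S k}" for c x
      using that S_closed(4) by blast
  qed
  then have "coord_ring \<subseteq> {f. \<exists>k. f \<in> S k}"
    unfolding coord_ring_def
  proof (rule fs.span_minimal[rotated])
    show "expo ` col_lattice A \<subseteq> {f. \<exists>k. f \<in> S k}" using col_lattice_layer expo_in_S by blast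
  qed
  ultimately show "\<exists>k. f \<in> S k" by blast
next
  assume "\<exists>k. f \<in> S k"
  moreover have "S k \<subseteq> coord_ring" for k
    unfolding S_def coord_ring_def using col_lattice_layer by (intro fs.span_mono) auto
  ultimately show "f \<in> coord_ring" by blast
qed

lemma S_coord_ring: "S k \<subseteq> coord_ring"
  using coord_ring_iff by blast

lemma subalgebra_coord_ring: "subalgebra coord_ring"
  unfolding subalgebra_def
proof (intro conjI ballI)
  show "fs.subspace coord_ring" unfolding coord_ring_def by (rule fs.subspace_span)
  show "1 \<in> coord_ring" using one_in_S coord_ring_iff by blast
  fix f g assume "f \<in> coord_ring" "g \<in> coord_ring"
  then show "f * g \<in> coord_ring" using S_mult unfolding coord_ring_iff by blast
qed

lemma coord_ring_exp_span: "coord_ring \<subseteq> exp_span"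
  unfolding coord_ring_def exp_span_def by (intro fs.span_mono) auto

lemma coord_ring_domain: "f \<in> coord_ring \<Longrightarrow> g \<in> coord_ring \<Longrightarrow> f * g = 0 \<Longrightarrow> f = 0 \<or> g = 0"
  using exp_span_domain coord_ring_exp_span by blast

text \<open>\<open>good m M D\<close> says that beyond step \<open>D\<close> the filtration is generated by multiplication with the
  forms \<open>zf M i\<close>, \<open>i < m\<close>; this makes the coordinate ring finite over the polynomials in these forms.\<close>

definition W :: "nat \<Rightarrow> (nat \<Rightarrow> complex ^ 'n) \<Rightarrow> nat \<Rightarrow> (complex ^ 'd \<Rightarrow> complex) set" where
  "W m M k = fs.span (S k \<union> {zf M i * f | i f. i < m \<and> f \<in> S k})"

definition good :: "nat \<Rightarrow> (nat \<Rightarrow> complex ^ 'n) \<Rightarrow> nat \<Rightarrow> bool" where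
  "good m M D \<longleftrightarrow> S (Suc D) \<subseteq> W m M D"

lemma subspace_W: "fs.subspace (W m M k)"
  unfolding W_def by (rule fs.subspace_span)

lemma S_W: "S k \<subseteq> W m M k"
  unfolding W_def by (auto intro: fs.span_base)

lemma zf_mult_W: "i < m \<Longrightarrow> f \<in> S k \<Longrightarrow> zf M i * f \<in> W m M k"
  unfolding W_def by (rule fs.span_base) blast

lemma W_mult:
  assumes "f \<in> W m M k" "g \<in> S l"
  shows "f * g \<in> W m M (k + l)"
proof (rule span_mult_right[OF subspace_W _ assms(1)[unfolded W_def]])
  fix x assume "x \<in> S k \<union> {zf M i * f | i f. i < m \<and> f \<in> S k}"
  then consider "x \<in> S k" | i f where "x = zf M i * f" "i < m" "f \<in> S k" by blast
  then show "x * g \<in> W m M (k + l)"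
  proof cases
    case 1
    then show ?thesis using S_mult[OF 1 assms(2)] S_W by blast
  next
    case 2
    have "zf M i * (f * g) \<in> W m M (k + l)" using 2 assms(2) by (intro zf_mult_W S_mult)
    then show ?thesis unfolding 2(1) mult.assoc .
  qed
qed

text \<open>The condition propagates upward because each frequency of the next layer arises by
  adding or subtracting one column, and \<open>W\<close> is compatible with multiplication by that
  exponential.\<close>

lemma good_step:
  assumes "good m M D" "D \<le> k"
  shows "S (Suc k) \<subseteq> W m M k"
proof -
  have "expo v \<in> W m M k" if "v \<in> layer (Suc k)" for v
    using assms(2) that
  proof (induction k arbitrary: v rule: dec_induct)
    case base
    then show ?case using expo_in_S assms(1) unfolding good_def by blast
  next
    case (step k)
    from step.prems show ?case
    proof (cases rule: layer_Suc_cases)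
      case 1
      then show ?thesis using expo_in_S S_W by blast
    next
      case (2 w j)
      have "expo w * expo (column j A) \<in> W m M (k + 1)"
        by (intro W_mult step.IH 2 expo_in_S col_in_layer)
      then show ?thesis unfolding 2 expo_add Suc_eq_plus1 .
    next
      case (3 w j)
      have "expo w * expo (- column j A) \<in> W m M (k + 1)"
        by (intro W_mult step.IH 3 expo_in_S col_in_layer)
      then show ?thesis unfolding 3 diff_conv_add_uminus expo_add Suc_eq_plus1 .
    qed
  qed
  then show ?thesis unfolding S_def by (intro fs.span_minimal subspace_W) auto
qed

text \<open>Start of the normalization: all \<open>n\<close> coordinates as forms and
  \<open>D = n\<close>. A frequency of weight at most \<open>n + 1\<close> that is not in layer
  \<open>n\<close> uses some column twice by the pigeonhole principle, and the quadratic equation of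
  that torus coordinate over its cosine reduces it.\<close>

lemma good_exists: "\<exists>m M D. good m M D"
proof -
  obtain e :: "nat \<Rightarrow> 'n" where e: "bij_betw e {..<CARD('n)} UNIV"
    using ex_bij_betw_nat_finite[of "UNIV :: 'n set"] by (auto simp: atLeast0LessThan)
  define M where "M = (\<lambda>i. axis (e i) 1 :: complex ^ 'n)"
  let ?n = "CARD('n)"
  have zfM: "\<exists>i<?n. zf M i = xf j" for j
  proof -
    have "j \<in> e ` {..<?n}" using e unfolding bij_betw_def by simp
    then obtain i where i: "i < ?n" "e i = j" by auto
    have "zf M i = xf j" unfolding zf_def M_def
      by (subst sum.remove[of _ j]) (auto simp: i axis_def)
    then show ?thesis using i by blast
  qed
  have "expo v \<in> W ?n M ?n" if "v \<in> layer (Suc ?n)" for v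
  proof -
    from that obtain l where l: "v = comb l" "(\<Sum>j\<in>UNIV. nat \<bar>l j\<bar>) \<le> Suc ?n" unfolding layer_def by blast
    show ?thesis
    proof (cases "\<exists>j. nat \<bar>l j\<bar> \<ge> 2")
      case False
      then have "nat \<bar>l j\<bar> \<le> 1" for j by (metis Suc_1 not_less_eq_eq One_nat_def)
      then have "(\<Sum>j\<in>UNIV. nat \<bar>l j\<bar>) \<le> (\<Sum>j\<in>(UNIV::'n set). 1)" by (intro sum_mono)
      then have "v \<in> layer ?n" unfolding l layer_def by auto
      then show ?thesis using expo_in_S S_W by blast
    next
      case True
      then obtain j where "nat \<bar>l j\<bar> \<ge> 2" by blast
      then have j: "\<bar>l j\<bar> \<ge> 2" by linarith
      define s where "s = sgn (l j)"
      define a where "a = s *s column j A"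
      \<comment> \<open>Since \<open>l j\<close> has absolute value at least 2, removing one or two
        copies of the signed column \<open>a\<close> lowers the weight by exactly that
        number.\<close>
      have layer_sub: "v - c *s a \<in> layer (Suc ?n - nat c)" if c: "c \<in> {1, 2}" for c
      proof -
        define l' where "l' = (\<lambda>i. l i - (if i = j then c * s else 0))"
        have "v - c *s a = comb l'" unfolding l'_def comb_diff comb_unit l a_def
          by (simp add: vec_eq_iff)
        moreover have "(\<Sum>i\<in>UNIV. nat \<bar>l' i\<bar>) \<le> Suc ?n - nat c"
        proof -
          have "(\<Sum>i\<in>UNIV. nat \<bar>l i\<bar>) = nat \<bar>l j\<bar> + (\<Sum>i\<in>UNIV - {j}. nat \<bar>l i\<bar>)"
            by (simp add: sum.remove)
          moreover have "(\<Sum>i\<in>UNIV. nat \<bar>l' i\<bar>) = nat \<bar>l' j\<bar> + (\<Sum>i\<in>UNIV - {j}. nat \<bar>l' i\<bar>)"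
            by (simp add: sum.remove)
          moreover have "(\<Sum>i\<in>UNIV - {j}. nat \<bar>l' i\<bar>) = (\<Sum>i\<in>UNIV - {j}. nat \<bar>l i\<bar>)"
            by (intro sum.cong) (auto simp: l'_def)
          moreover have "nat \<bar>l' j\<bar> + nat c = nat \<bar>l j\<bar>" using j c
            by (auto simp: l'_def s_def sgn_if)
          ultimately show ?thesis using l(2) by linarith
        qed
        ultimately show ?thesis unfolding layer_def by blast
      qed
      have s: "s = 1 \<or> s = -1" using j by (auto simp: s_def sgn_if)
      \<comment> \<open>The cosine coordinate is symmetric under inversion of the torus coordinate,
        so both signs of \<open>l j\<close> lead to the same shape.\<close>
      obtain \<gamma> where \<gamma>: "\<gamma> \<noteq> 0" "xf j = fscale (\<gamma> / 2) (expo a) + fscale (inverse \<gamma> / 2) (expo (- a))"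
      proof (cases "s = 1")
        case True
        then show ?thesis using that[of "\<beta> j"] by (simp add: a_def xf_def)
      next
        case False
        then have "a = - column j A" using s by (simp add: a_def vec_eq_iff)
        then show ?thesis using that[of "inverse (\<beta> j)"] by (simp add: xf_def add.commute)
      qed
      obtain i where i: "i < ?n" "zf M i = xf j" using zfM by blast
      have v1: "v - a \<in> layer ?n" using layer_sub[of 1] by simp
      have v2: "v - 2 *s a \<in> layer ?n" using layer_sub[of 2] layer_mono[of "Suc ?n - nat 2" ?n] by auto
      \<comment> \<open>With \<open>y = \<gamma> * expo a\<close> the definition of
        \<open>xf j\<close> reads \<open>y^2 = 2 * xf j * y - 1\<close>; multiply by
        \<open>expo (v - 2 a) / \<gamma>^2\<close>.\<close>
      have "expo v = fscale (2 / \<gamma>) (zf M i * expo (v - a)) - fscale (1 / \<gamma>\<^sup>2) (expo (v - 2 *s a))"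
      proof
        fix u
        have "expo (2 *s a) u = expo a u * expo a u" by (simp add: expo_scale power2_eq_square)
        then show "expo v u = (fscale (2 / \<gamma>) (zf M i * expo (v - a)) - fscale (1 / \<gamma>\<^sup>2) (expo (v - 2 *s a))) u"
          unfolding i(2) \<gamma>(2) using \<gamma>(1) by (simp add: expo_diff expo_minus field_simps power2_eq_square)
      qed
      also have "\<dots> \<in> W ?n M ?n"
        by (intro fs.subspace_diff[OF subspace_W] fs.subspace_scale[OF subspace_W] zf_mult_W i expo_in_S v1
          subsetD[OF S_W] v2)
      finally show ?thesis .
    qed
  qed
  then have "S (Suc ?n) \<subseteq> W ?n M ?n"
    unfolding S_def by (intro fs.span_minimal subspace_W) auto
  then show ?thesis unfolding good_def by blast
qed

lemma mon_in_S:
  assumes "\<And>i. i < m \<Longrightarrow> \<zeta> i \<in> S e"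
  shows "mon m \<zeta> \<alpha> \<in> S ((\<Sum>i<m. \<alpha> i) * e)"
  using assms
proof (induction m)
  case 0
  show ?case unfolding mon_def lessThan_0 prod.empty by (rule one_in_S)
next
  case (Suc m)
  have "mon m \<zeta> \<alpha> * \<zeta> m ^ \<alpha> m \<in> S ((\<Sum>i<m. \<alpha> i) * e + \<alpha> m * e)"
    by (intro S_mult S_power Suc.IH Suc.prems less_SucI lessI)
  then show ?case unfolding mon_Suc sum.lessThan_Suc distrib_right .
qed

text \<open>One step of Noether normalization: after a linear change of the forms that makes the top
  degree part of a relation nonzero in the last direction, the last form becomes integral.\<close>

lemma good_eliminate:
  assumes good: "good (Suc m) M D"
    and rel: "(\<Sum>\<alpha>\<in>exps (Suc m) e. fscale (c \<alpha>) (mon (Suc m) (zf M) \<alpha>)) = 0"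
    and nz: "\<alpha>0 \<in> exps (Suc m) e" "c \<alpha>0 \<noteq> 0"
  shows "\<exists>M' D'. good m M' D'"
proof -
  define deg where "deg = (\<lambda>\<alpha> :: nat \<Rightarrow> nat. \<Sum>i<Suc m. \<alpha> i)"
  define X where "X = {\<alpha>\<in>exps (Suc m) e. c \<alpha> \<noteq> 0}"
  have finX: "finite X" unfolding X_def using finite_exps by simp
  have "\<alpha>0 \<in> X" using nz by (simp add: X_def)
  define e0 where "e0 = Max (deg ` X)"
  have deg_le: "deg \<alpha> \<le> e0" if "\<alpha> \<in> X" for \<alpha> unfolding e0_def using finX that by simp
  have "e0 \<in> deg ` X" unfolding e0_def using finX \<open>\<alpha>0 \<in> X\<close> by (intro Max_in) auto
  then obtain \<alpha>1 where \<alpha>1: "\<alpha>1 \<in> X" "deg \<alpha>1 = e0" by blast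
  define X0 where "X0 = {\<alpha>\<in>X. deg \<alpha> = e0}"
  have finX0: "finite X0" and X0X: "X0 \<subseteq> X" using finX by (auto simp: X0_def)
  have relX: "(\<Sum>\<alpha>\<in>X. fscale (c \<alpha>) (mon (Suc m) (zf M) \<alpha>)) = 0"
    unfolding rel[symmetric] X_def by (intro sum.mono_neutral_left finite_exps) auto
  define top where "top = (\<lambda>t :: nat \<Rightarrow> complex. \<Sum>\<alpha>\<in>X0. c \<alpha> * mon (Suc m) t \<alpha>)"
  have "\<exists>t. top t \<noteq> 0"
  proof (rule ccontr)
    assume "\<nexists>t. top t \<noteq> 0"
    then have "(\<Sum>\<alpha>\<in>X0. c \<alpha> * mon (Suc m) t \<alpha>) = 0" for t unfolding top_def by blast
    moreover have "\<forall>i\<ge>Suc m. \<alpha> i = 0" if "\<alpha> \<in> X0" for \<alpha> using that X0X by (auto simp: X_def exps_def)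
    moreover have "\<alpha>1 \<in> X0" using \<alpha>1 by (simp add: X0_def)
    ultimately have "c \<alpha>1 = 0" using mon_independent[OF finX0, of "Suc m" c \<alpha>1] by blast
    then show False using \<alpha>1 by (simp add: X_def)
  qed
  then obtain t1 where "top t1 \<noteq> 0" by blast
  moreover have "top \<in> poly_funs (tuple_coords (Suc m))"
    unfolding top_def by (intro poly_funs_intros mon_in_poly_funs)
  moreover have "(\<lambda>t. t m) \<in> poly_funs (tuple_coords (Suc m))"
    by (rule poly_funs.coord) (auto simp: tuple_coords_def)
  ultimately obtain w where w: "top w \<noteq> 0" "w m \<noteq> 0"
    using poly_funs_nonzero_common[OF line_coords_tuple, of top "Suc m" t1 "\<lambda>t. t m" "\<lambda>_. 1"] by auto
  \<comment> \<open>The top form is homogeneous of degree \<open>e0\<close>, so its nonvanishing at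
    \<open>w\<close> survives rescaling the last coordinate to 1.\<close>
  define s where "s = (\<lambda>i. w i / w m)"
  have "top w = top s * w m ^ e0"
  proof -
    have "mon (Suc m) w \<alpha> = mon (Suc m) s \<alpha> * w m ^ deg \<alpha>" for \<alpha>
    proof -
      have "mon (Suc m) w \<alpha> = (\<Prod>i<Suc m. s i ^ \<alpha> i * w m ^ \<alpha> i)"
        unfolding mon_def using w(2) by (intro prod.cong refl) (simp add: s_def power_divide)
      then show ?thesis by (simp only: mon_def deg_def prod.distrib power_sum)
    qed
    then show ?thesis unfolding top_def sum_distrib_right
      by (intro sum.cong) (auto simp: X0_def)
  qed
  then have top_s: "top s \<noteq> 0" using w by auto
  have s_m: "s m = 1" using w by (simp add: s_def)
  \<comment> \<open>In the new forms \<open>z'_i = z_i - s_i z_m\<close> each old \<open>z_i\<close>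
    is congruent to \<open>s_i z_m\<close>, so the top part of the relation turns into
    \<open>top s\<close> times \<open>z_m ^ e0\<close>.\<close>
  define M' where "M' = (\<lambda>i. M i - s i *s M m)"
  have zfM': "zf M' i = zf M i - fscale (s i) (zf M m)" for i
    by (simp add: fun_eq_iff zf_def M'_def algebra_simps sum_subtractf sum_distrib_left)
  \<comment> \<open>Multiples of the new forms counted with their filtration degree. Plain ideal
    membership would lose the degree, which is needed to fit \<open>U e0\<close> into
    \<open>W m M' (e0 - 1)\<close>.\<close>
  define U where "U = (\<lambda>e. fs.span {zf M' i * f | i f k. i < m \<and> f \<in> S k \<and> Suc k \<le> e})"
  have subU: "fs.subspace (U e)" for e unfolding U_def by (rule fs.subspace_span)
  have U_mult: "f * g \<in> U (e + l)" if "f \<in> U e" "g \<in> S l" for f g e l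
  proof (rule span_mult_right[OF subU _ that(1)[unfolded U_def]])
    fix x assume "x \<in> {zf M' i * f | i f k. i < m \<and> f \<in> S k \<and> Suc k \<le> e}"
    then obtain i f k where x: "x = zf M' i * f" "i < m" "f \<in> S k" "Suc k \<le> e" by blast
    have "zf M' i * (f * g) \<in> U (e + l)" unfolding U_def
    proof (rule fs.span_base)
      have "f * g \<in> S (k + l)" "Suc (k + l) \<le> e + l" using x that(2) by (auto intro: S_mult)
      then show "zf M' i * (f * g) \<in> {zf M' i * f | i f k. i < m \<and> f \<in> S k \<and> Suc k \<le> e + l}"
        using x(2) by blast
    qed
    then show "x * g \<in> U (e + l)" unfolding x(1) mult.assoc .
  qed
  \<comment> \<open>\<open>p\<close> has degree at most \<open>e\<close> and is congruent to
    \<open>a * z_m ^ e\<close> within degree \<open>e\<close>. This relation is multiplicative, so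
    monomials are evaluated at \<open>s\<close>.\<close>
  define R where "R = (\<lambda>e p a. p \<in> S e \<and> p - fscale a (zf M m ^ e) \<in> U e)"
  have R_mult: "R (e1 + e2) (p * q) (a1 * a2)" if "R e1 p a1" "R e2 q a2" for e1 e2 p q a1 a2
  proof -
    have "zf M m ^ e1 \<in> S e1" using S_power[OF zf_in_S, of M m e1] by simp
    then have "(p - fscale a1 (zf M m ^ e1)) * q + (q - fscale a2 (zf M m ^ e2)) * fscale a1 (zf M m ^ e1) \<in> U (e1 + e2)"
      using that U_mult[of "p - fscale a1 (zf M m ^ e1)" e1 q e2]
        U_mult[of "q - fscale a2 (zf M m ^ e2)" e2 "fscale a1 (zf M m ^ e1)" e1]
      unfolding R_def by (intro fs.subspace_add[OF subU]) (auto simp: add.commute S_closed)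
    moreover have "(p - fscale a1 (zf M m ^ e1)) * q + (q - fscale a2 (zf M m ^ e2)) * fscale a1 (zf M m ^ e1)
        = p * q - fscale (a1 * a2) (zf M m ^ (e1 + e2))"
      by (simp add: fun_eq_iff algebra_simps power_add)
    ultimately show ?thesis using that S_mult unfolding R_def by auto
  qed
  have R_one: "R 0 1 1"
  proof -
    have "(1 :: complex ^ 'd \<Rightarrow> complex) - fscale 1 (zf M m ^ 0) = 0" by (simp add: fun_eq_iff)
    then show ?thesis unfolding R_def using one_in_S fs.subspace_0[OF subU] by metis
  qed
  have R_zf: "R 1 (zf M i) (s i)" if "i < Suc m" for i
  proof (cases "i = m")
    case True
    have "zf M m - fscale 1 (zf M m ^ 1) = 0" by (simp add: fun_eq_iff)
    then show ?thesis unfolding R_def True s_m using zf_in_S fs.subspace_0[OF subU] by metis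
  next
    case False
    have "zf M' i * 1 \<in> U 1" unfolding U_def
      by (rule fs.span_base) (use that False one_in_S[of 0] in force)
    then show ?thesis unfolding R_def zfM' using zf_in_S by simp
  qed
  have R_pow: "R k (zf M i ^ k) (s i ^ k)" if "i < Suc m" for i k
  proof (induction k)
    case 0
    show ?case unfolding power_0 by (rule R_one)
  next
    case (Suc k)
    show ?case using R_mult[OF R_zf[OF that] Suc] unfolding power_Suc plus_1_eq_Suc .
  qed
  have R_mon: "R (\<Sum>i<k. \<alpha> i) (mon k (zf M) \<alpha>) (mon k s \<alpha>)" if "k \<le> Suc m" for k \<alpha>
    using that
  proof (induction k)
    case 0
    show ?case unfolding mon_def lessThan_0 prod.empty sum.empty by (rule R_one)
  next
    case (Suc k)
    then have "k \<le> Suc m" "k < Suc m" by auto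
    from R_mult[OF Suc.IH[OF this(1)] R_pow[OF this(2), of "\<alpha> k"]]
    show ?case unfolding mon_Suc sum.lessThan_Suc .
  qed
  have e0: "e0 \<ge> 1"
  proof (rule ccontr)
    assume "\<not> e0 \<ge> 1"
    then have "deg \<alpha> = 0" if "\<alpha> \<in> X" for \<alpha> using deg_le[OF that] by simp
    then have deg0: "\<forall>i\<in>{..<Suc m}. \<alpha> i = 0" if "\<alpha> \<in> X" for \<alpha>
      using that unfolding deg_def by (metis finite_lessThan sum_eq_0_iff)
    have "\<alpha> = (\<lambda>_. 0)" if "\<alpha> \<in> X" for \<alpha>
    proof
      fix i
      show "\<alpha> i = 0" using deg0[OF that] that by (cases "i < Suc m") (auto simp: X_def exps_def)
    qed
    then have X: "X = {\<lambda>_. 0}" using \<open>\<alpha>0 \<in> X\<close> by auto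
    have "(\<Sum>\<alpha>\<in>X. fscale (c \<alpha>) (mon (Suc m) (zf M) \<alpha>)) 0 = 0" unfolding relX by simp
    then have "c (\<lambda>_. 0) = 0" unfolding X by (simp add: mon_apply mon_def)
    then show False using X by (auto simp: X_def)
  qed
  have U_W: "U e0 \<subseteq> W m M' (e0 - 1)" unfolding U_def
  proof (intro fs.span_minimal subspace_W subsetI)
    fix x assume "x \<in> {zf M' i * f | i f k. i < m \<and> f \<in> S k \<and> Suc k \<le> e0}"
    then obtain i f k where x: "x = zf M' i * f" "i < m" "f \<in> S k" "Suc k \<le> e0" by blast
    from x(4) have "k \<le> e0 - 1" by linarith
    then have "f \<in> S (e0 - 1)" using S_mono x(3) by blast
    then show "x \<in> W m M' (e0 - 1)" unfolding x(1) using x(2) by (intro zf_mult_W)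
  qed
  have low: "mon (Suc m) (zf M) \<alpha> \<in> W m M' (e0 - 1)" if "\<alpha> \<in> X - X0" for \<alpha>
  proof -
    have "deg \<alpha> \<le> e0 - 1" using that deg_le[of \<alpha>] by (auto simp: X0_def)
    moreover have "mon (Suc m) (zf M) \<alpha> \<in> S (deg \<alpha>)"
      using mon_in_S[of "Suc m" "zf M" 1 \<alpha>] zf_in_S by (simp add: deg_def)
    ultimately show ?thesis using S_mono S_W by blast
  qed
  have top_W: "zf M m ^ e0 \<in> W m M' (e0 - 1)"
  proof -
    have hi: "mon (Suc m) (zf M) \<alpha> - fscale (mon (Suc m) s \<alpha>) (zf M m ^ e0) \<in> W m M' (e0 - 1)" if "\<alpha> \<in> X0" for \<alpha>
      using R_mon[of "Suc m" \<alpha>] that U_W unfolding R_def X0_def deg_def by auto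
    have "(\<Sum>\<alpha>\<in>X0. fscale (c \<alpha>) (mon (Suc m) (zf M) \<alpha> - fscale (mon (Suc m) s \<alpha>) (zf M m ^ e0)))
      + (\<Sum>\<alpha>\<in>X - X0. fscale (c \<alpha>) (mon (Suc m) (zf M) \<alpha>)) \<in> W m M' (e0 - 1)"
      using hi low by (intro fs.subspace_add[OF subspace_W] fs.subspace_sum[OF subspace_W] fs.subspace_scale[OF subspace_W])
    moreover have "(\<Sum>\<alpha>\<in>X0. fscale (c \<alpha>) (mon (Suc m) (zf M) \<alpha> - fscale (mon (Suc m) s \<alpha>) (zf M m ^ e0)))
      + (\<Sum>\<alpha>\<in>X - X0. fscale (c \<alpha>) (mon (Suc m) (zf M) \<alpha>)) = fscale (- top s) (zf M m ^ e0)"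
    proof -
      have "(\<Sum>\<alpha>\<in>X0. fscale (c \<alpha>) (mon (Suc m) (zf M) \<alpha>)) + (\<Sum>\<alpha>\<in>X - X0. fscale (c \<alpha>) (mon (Suc m) (zf M) \<alpha>)) = 0"
        using relX sum.subset_diff[OF X0X finX, of "\<lambda>\<alpha>. fscale (c \<alpha>) (mon (Suc m) (zf M) \<alpha>)"]
        by (simp only: add.commute)
      moreover have "(\<Sum>\<alpha>\<in>X0. fscale (c \<alpha>) (fscale (mon (Suc m) s \<alpha>) (zf M m ^ e0))) = fscale (top s) (zf M m ^ e0)"
        by (simp add: top_def fun_eq_iff sum_distrib_right mult.assoc)
      ultimately show ?thesis
        unfolding fs.scale_right_diff_distrib sum_subtractf fs.scale_minus_left
        by (simp only: algebra_simps add.right_inverse)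
    qed
    ultimately have "fscale (- top s) (zf M m ^ e0) \<in> W m M' (e0 - 1)" by (simp only:)
    then have "fscale (- 1 / top s) (fscale (- top s) (zf M m ^ e0)) \<in> W m M' (e0 - 1)"
      by (rule fs.subspace_scale[OF subspace_W])
    moreover have "fscale (- 1 / top s) (fscale (- top s) (zf M m ^ e0)) = zf M m ^ e0"
      using top_s by (auto simp: fun_eq_iff)
    ultimately show ?thesis by (simp only:)
  qed
  \<comment> \<open>Writing \<open>z_i = z'_i + s_i z_m\<close>, the only generators of
    \<open>W (Suc m) M k\<close> not absorbed by the new forms are multiples of
    \<open>z_m\<close>.\<close>
  have step1: "\<exists>g\<in>S k. f - zf M m * g \<in> W m M' k" if k: "D \<le> k" and f: "f \<in> S (Suc k)" for f k
  proof -
    let ?T = "{f. \<exists>g\<in>S k. f - zf M m * g \<in> W m M' k}"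
    have "fs.subspace ?T"
    proof (rule fs.subspaceI)
      have "0 - zf M m * 0 \<in> W m M' k" using fs.subspace_0[OF subspace_W] by simp
      then show "0 \<in> ?T" using S_closed(1) by blast
      show "x + y \<in> ?T" if xy: "x \<in> ?T" "y \<in> ?T" for x y
      proof -
        obtain g h where gh: "g \<in> S k" "h \<in> S k" "x - zf M m * g \<in> W m M' k" "y - zf M m * h \<in> W m M' k"
          using xy by blast
        have "(x - zf M m * g) + (y - zf M m * h) \<in> W m M' k" using gh by (intro fs.subspace_add[OF subspace_W])
        moreover have "(x - zf M m * g) + (y - zf M m * h) = (x + y) - zf M m * (g + h)" by (simp add: algebra_simps)
        ultimately show ?thesis using S_closed(2)[OF gh(1,2)] by auto
      qed
      show "fscale a x \<in> ?T" if "x \<in> ?T" for a x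
      proof -
        from that obtain g where g: "g \<in> S k" "x - zf M m * g \<in> W m M' k" by blast
        have "fscale a (x - zf M m * g) \<in> W m M' k" using g by (intro fs.subspace_scale[OF subspace_W])
        moreover have "fscale a (x - zf M m * g) = fscale a x - zf M m * fscale a g"
          by (simp add: fun_eq_iff algebra_simps)
        ultimately show ?thesis using S_closed(4)[OF g(1), of a] by auto
      qed
    qed
    moreover have "S k \<union> {zf M i * f | i f. i < Suc m \<and> f \<in> S k} \<subseteq> ?T"
    proof
      fix x assume "x \<in> S k \<union> {zf M i * f | i f. i < Suc m \<and> f \<in> S k}"
      then consider "x \<in> S k" | f where "x = zf M m * f" "f \<in> S k" | i f where "x = zf M i * f" "i < m" "f \<in> S k"
        by (auto simp: less_Suc_eq)
      then show "x \<in> ?T"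
      proof cases
        case 1
        have "x - zf M m * 0 \<in> W m M' k" using S_W 1 by auto
        then show ?thesis using S_closed(1) by blast
      next
        case 2
        have "x - zf M m * f \<in> W m M' k" unfolding 2 using fs.subspace_0[OF subspace_W] by simp
        then show ?thesis using 2 by blast
      next
        case 3
        have "x - zf M m * fscale (s i) f = zf M' i * f"
          unfolding 3 zfM' by (simp add: fun_eq_iff algebra_simps)
        then have "x - zf M m * fscale (s i) f \<in> W m M' k" using zf_mult_W[OF 3(2,3)] by simp
        then show ?thesis using S_closed(4)[OF 3(3)] by blast
      qed
    qed
    ultimately have "W (Suc m) M k \<subseteq> ?T" unfolding W_def by (rule fs.span_minimal[rotated])
    then show ?thesis using good_step[OF good k] f by blast
  qed
  \<comment> \<open>Iterating \<open>step1\<close> extracts one factor \<open>z_m\<close> per degree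
    until the cofactor is down in \<open>S D\<close>.\<close>
  have stepj: "\<exists>g\<in>S D. f - zf M m ^ Suc j * g \<in> W m M' (D + j)" if "f \<in> S (D + Suc j)" for f j
    using that
  proof (induction j arbitrary: f)
    case 0
    then have "f \<in> S (Suc D)" by simp
    from step1[OF order_refl this] show ?case
      unfolding power_Suc power_0 mult_1_right add_0_right .
  next
    case (Suc j)
    then obtain g where g: "g \<in> S (D + Suc j)" "f - zf M m * g \<in> W m M' (D + Suc j)"
      using step1[of "D + Suc j" f] by auto
    obtain h where h: "h \<in> S D" "g - zf M m ^ Suc j * h \<in> W m M' (D + j)" using Suc.IH[OF g(1)] by blast
    have "(g - zf M m ^ Suc j * h) * zf M m \<in> W m M' (D + j + 1)" using W_mult[OF h(2) zf_in_S] .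
    then have "(f - zf M m * g) + (g - zf M m ^ Suc j * h) * zf M m \<in> W m M' (D + Suc j)"
      using g(2) by (intro fs.subspace_add[OF subspace_W]) auto
    moreover have "(f - zf M m * g) + (g - zf M m ^ Suc j * h) * zf M m = f - zf M m ^ Suc (Suc j) * h"
      by (simp add: algebra_simps)
    ultimately have "f - zf M m ^ Suc (Suc j) * h \<in> W m M' (D + Suc j)" by (simp only:)
    then show ?case by (rule bexI[OF _ h(1)])
  qed
  \<comment> \<open>Starting \<open>e0 - 1\<close> degrees above \<open>D\<close>, exactly
    \<open>e0\<close> factors \<open>z_m\<close> come out, and \<open>top_W\<close> absorbs that
    power.\<close>
  have "S (Suc (D + (e0 - 1))) \<subseteq> W m M' (D + (e0 - 1))"
  proof
    fix f assume "f \<in> S (Suc (D + (e0 - 1)))"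
    then obtain g where g: "g \<in> S D" "f - zf M m ^ e0 * g \<in> W m M' (D + (e0 - 1))"
      using stepj[of f "e0 - 1"] e0 by auto
    have "zf M m ^ e0 * g \<in> W m M' (e0 - 1 + D)" by (rule W_mult[OF top_W g(1)])
    then have "(f - zf M m ^ e0 * g) + zf M m ^ e0 * g \<in> W m M' (D + (e0 - 1))"
      using g(2) by (intro fs.subspace_add[OF subspace_W]) (simp_all add: add.commute)
    then show "f \<in> W m M' (D + (e0 - 1))" by simp
  qed
  then show ?thesis unfolding good_def by blast
qed

end

abbreviation polys :: "nat \<Rightarrow> ((nat \<Rightarrow> complex) \<Rightarrow> complex) set" where
  "polys m \<equiv> poly_funs (tuple_coords m)"

context lissajous_setup
begin

subsection \<open>Comparison with the growth of the layers\<close>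

lemma one_div_power_tendsto_0: "n > 0 \<Longrightarrow> (\<lambda>k. (1 / real k) ^ n) \<longlonglongrightarrow> 0"
  by (rule tendsto_null_power) (use lim_1_over_n in simp_all)

lemma shifted_ratio_tendsto: "(\<lambda>k. ((real k + real e) / real k) ^ n) \<longlonglongrightarrow> 1"
proof -
  have "(\<lambda>k. (real k + real e) / real k) \<longlonglongrightarrow> 1" by real_asymp
  then show ?thesis using tendsto_power[of _ 1 sequentially n] by fastforce
qed

lemma shifted_layer_growth: "(\<lambda>k. real (card (layer (k + e))) / real k ^ CARD('d)) \<longlonglongrightarrow> growth"
proof -
  have "(\<lambda>k. real (card (layer (k + e))) / real (k + e) ^ CARD('d) * ((real k + real e) / real k) ^ CARD('d)) \<longlonglongrightarrow> growth * 1"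
    by (intro tendsto_mult LIMSEQ_ignore_initial_segment[OF layer_growth] shifted_ratio_tendsto)
  moreover have "eventually (\<lambda>k. real (card (layer (k + e))) / real (k + e) ^ CARD('d) * ((real k + real e) / real k) ^ CARD('d)
      = real (card (layer (k + e))) / real k ^ CARD('d)) sequentially"
    using eventually_gt_at_top[of 0] by eventually_elim (simp add: power_divide)
  ultimately show ?thesis using Lim_transform_eventually by fastforce
qed

lemma shifted_binomial_growth: "(\<lambda>k. real ((k + e + m) choose m) / real k ^ m) \<longlonglongrightarrow> 1 / fact m"
proof -
  have "(\<lambda>k. real ((k + e + m) choose m) / real (k + e) ^ m * ((real k + real e) / real k) ^ m) \<longlonglongrightarrow> 1 / fact m * 1"
    by (intro tendsto_mult LIMSEQ_ignore_initial_segment[OF binomial_growth] shifted_ratio_tendsto)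
  moreover have "eventually (\<lambda>k. real ((k + e + m) choose m) / real (k + e) ^ m * ((real k + real e) / real k) ^ m
      = real ((k + e + m) choose m) / real k ^ m) sequentially"
    using eventually_gt_at_top[of 0] by eventually_elim (simp add: power_divide)
  ultimately show ?thesis using Lim_transform_eventually by fastforce
qed

text \<open>The layers grow like a positive multiple of \<open>k ^ CARD('d)\<close>, which cannot be
  dominated by a polynomial of degree \<open>m\<close> below \<open>CARD('d)\<close>.\<close>

lemma dim_le_of_layer_bound:
  assumes "\<And>k. card (layer (k + e)) \<le> L * ((k + m) choose m)"
  shows "CARD('d) \<le> m"
proof (rule ccontr)
  assume "\<not> ?thesis"
  then have m: "CARD('d) = m + (CARD('d) - m)" "CARD('d) - m > 0" by auto
  have "(\<lambda>k. real L * (real ((k + m) choose m) / real k ^ m) * (1 / real k) ^ (CARD('d) - m)) \<longlonglongrightarrow> real L * (1 / fact m) * 0"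
    by (intro tendsto_intros binomial_growth one_div_power_tendsto_0 m(2))
  moreover have "real (card (layer (k + e))) / real k ^ CARD('d)
      \<le> real L * (real ((k + m) choose m) / real k ^ m) * (1 / real k) ^ (CARD('d) - m)" for k
  proof -
    have "real (card (layer (k + e))) \<le> real L * real ((k + m) choose m)"
      using assms[of k] by (metis of_nat_le_iff of_nat_mult)
    then have "real (card (layer (k + e))) / real k ^ CARD('d) \<le> real L * real ((k + m) choose m) / real k ^ CARD('d)"
      by (intro divide_right_mono) auto
    also have "\<dots> = real L * (real ((k + m) choose m) / real k ^ m) * (1 / real k) ^ (CARD('d) - m)"
      by (subst m(1)) (simp add: power_add power_divide)
    finally show ?thesis .
  qed
  ultimately have "growth \<le> real L * (1 / fact m) * 0"
    using LIMSEQ_le[OF shifted_layer_growth] by blast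
  then show False using growth_pos by simp
qed

text \<open>The opposite comparison. The factor \<open>e\<close> allows independent elements of any
  filtration degree, as the dimension of the variety requires; it only changes the constant of the
  growth.\<close>

lemma dim_ge_of_layer_bound:
  assumes "e > 0" "\<And>k. ((k + m) choose m) \<le> card (layer (k * e))"
  shows "m \<le> CARD('d)"
proof (rule ccontr)
  assume "\<not> ?thesis"
  then have m: "m = CARD('d) + (m - CARD('d))" "m - CARD('d) > 0" by auto
  have "filterlim (\<lambda>k. k * e) at_top sequentially"
    using assms(1) by (intro filterlim_subseq) (simp add: strict_mono_def)
  then have lim: "(\<lambda>k. real (card (layer (k * e))) / real (k * e) ^ CARD('d)) \<longlonglongrightarrow> growth"
    using filterlim_compose[OF layer_growth] by fastforce
  have "(\<lambda>k. real (card (layer (k * e))) / real (k * e) ^ CARD('d) * real e ^ CARD('d) * (1 / real k) ^ (m - CARD('d)))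
      \<longlonglongrightarrow> growth * real e ^ CARD('d) * 0"
    by (intro tendsto_intros lim one_div_power_tendsto_0 m(2))
  moreover have "real ((k + m) choose m) / real k ^ m \<le>
      real (card (layer (k * e))) / real (k * e) ^ CARD('d) * real e ^ CARD('d) * (1 / real k) ^ (m - CARD('d))" for k
  proof -
    have "real ((k + m) choose m) / real k ^ m \<le> real (card (layer (k * e))) / real k ^ m"
      using assms(2)[of k] by (intro divide_right_mono) auto
    also have "\<dots> = real (card (layer (k * e))) / real (k * e) ^ CARD('d) * real e ^ CARD('d) * (1 / real k) ^ (m - CARD('d))"
      using assms(1) by (subst (1) m(1)) (simp add: power_add power_divide power_mult_distrib)
    finally show ?thesis .
  qed
  ultimately have "1 / fact m \<le> growth * real e ^ CARD('d) * 0"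
    using LIMSEQ_le[OF binomial_growth] by blast
  moreover have "(0::real) < 1 / fact m" by simp
  ultimately show False by linarith
qed

text \<open>Comparison of leading coefficients: \<open>q\<close> free summands contribute
  \<open>q\<close> times the Hilbert function of a polynomial ring, with leading coefficient
  \<open>1 / d!\<close> each, and the shift by \<open>e\<close> is invisible in the limit.\<close>

lemma rank_le_growth:
  assumes "\<And>k. q * ((k + CARD('d)) choose CARD('d)) \<le> card (layer (k + e))"
  shows "real q \<le> fact CARD('d) * growth"
proof -
  have "(\<lambda>k. real q * (real ((k + CARD('d)) choose CARD('d)) / real k ^ CARD('d))) \<longlonglongrightarrow> real q * (1 / fact CARD('d))"
    by (intro tendsto_intros binomial_growth)
  moreover have "real q * (real ((k + CARD('d)) choose CARD('d)) / real k ^ CARD('d))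
      \<le> real (card (layer (k + e))) / real k ^ CARD('d)" for k
    using assms[of k] by (metis divide_right_mono of_nat_0_le_iff of_nat_le_iff of_nat_mult times_divide_eq_right zero_le_power)
  ultimately have "real q * (1 / fact CARD('d)) \<le> growth"
    using LIMSEQ_le[OF _ shifted_layer_growth] by blast
  then show ?thesis by (simp add: field_simps)
qed

lemma growth_le_rank:
  assumes "\<And>k. card (layer (k + D)) \<le> q * ((k + e + CARD('d)) choose CARD('d))"
  shows "fact CARD('d) * growth \<le> real q"
proof -
  have "(\<lambda>k. real q * (real ((k + e + CARD('d)) choose CARD('d)) / real k ^ CARD('d))) \<longlonglongrightarrow> real q * (1 / fact CARD('d))"
    by (intro tendsto_intros shifted_binomial_growth)
  moreover have "real (card (layer (k + D))) / real k ^ CARD('d)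
     \<le> real q * (real ((k + e + CARD('d)) choose CARD('d)) / real k ^ CARD('d))" for k
    using assms[of k] by (metis divide_right_mono of_nat_0_le_iff of_nat_le_iff of_nat_mult times_divide_eq_right zero_le_power)
  ultimately have "growth \<le> real q * (1 / fact CARD('d))"
    using LIMSEQ_le[OF shifted_layer_growth] by blast
  then show ?thesis by (simp add: field_simps)
qed

subsection \<open>Generic linear forms are parameters\<close>

lemma mon_unit_mult:
  assumes "i < m"
  shows "mon m \<zeta> (\<alpha>(i := Suc (\<alpha> i))) = \<zeta> i * mon m \<zeta> \<alpha>"
proof -
  have "mon m \<zeta> (\<alpha>(i := Suc (\<alpha> i))) = \<zeta> i ^ Suc (\<alpha> i) * (\<Prod>j\<in>{..<m} - {i}. \<zeta> j ^ \<alpha> j)"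
    unfolding mon_def using assms by (subst prod.remove[of _ i]) auto
  moreover have "mon m \<zeta> \<alpha> = \<zeta> i ^ \<alpha> i * (\<Prod>j\<in>{..<m} - {i}. \<zeta> j ^ \<alpha> j)"
    unfolding mon_def using assms by (subst prod.remove[of _ i]) auto
  ultimately show ?thesis by (simp add: mult.assoc)
qed

lemma exps_unit: "i < m \<Longrightarrow> \<alpha> \<in> exps m k \<Longrightarrow> \<alpha>(i := Suc (\<alpha> i)) \<in> exps m (Suc k)"
proof -
  assume i: "i < m" and a: "\<alpha> \<in> exps m k"
  have "(\<Sum>j<m. (\<alpha>(i := Suc (\<alpha> i))) j) = Suc (\<alpha> i) + (\<Sum>j\<in>{..<m} - {i}. \<alpha> j)"
    using i by (subst sum.remove[of _ i]) auto
  moreover have "(\<Sum>j<m. \<alpha> j) = \<alpha> i + (\<Sum>j\<in>{..<m} - {i}. \<alpha> j)"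
    using i by (subst sum.remove[of _ i]) auto
  ultimately show ?thesis using a i by (auto simp: exps_def)
qed

definition mon_expo :: "nat \<Rightarrow> (nat \<Rightarrow> complex ^ 'n) \<Rightarrow> (nat \<Rightarrow> nat) \<times> (int ^ 'd) \<Rightarrow> complex ^ 'd \<Rightarrow> complex" where
  "mon_expo m M = (\<lambda>(\<alpha>, v). mon m (zf M) \<alpha> * expo v)"

text \<open>The exponentials of layer \<open>D\<close> generate the ring as a module over the
  polynomials in the forms, with control of degrees. Each step of \<open>good_step\<close> costs one
  more factor \<open>zf M i\<close>.\<close>

lemma good_generation:
  assumes "good m M D"
  shows "S (k + D) \<subseteq> fs.span (mon_expo m M ` (exps m k \<times> layer D))"
proof (induction k)
  case 0
  have "expo v \<in> fs.span (mon_expo m M ` (exps m 0 \<times> layer D))" if "v \<in> layer D" for v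
  proof -
    have "mon_expo m M ((\<lambda>_. 0), v) = expo v" by (simp add: mon_expo_def mon_def)
    moreover have "((\<lambda>_. 0), v) \<in> exps m 0 \<times> layer D" using that zero_in_exps by blast
    ultimately show ?thesis using fs.span_base by (metis imageI)
  qed
  then have "S D \<subseteq> fs.span (mon_expo m M ` (exps m 0 \<times> layer D))"
    unfolding S_def by (intro fs.span_minimal fs.subspace_span image_subsetI)
  then show ?case unfolding add_0 .
next
  case (Suc k)
  let ?T = "fs.span (mon_expo m M ` (exps m (Suc k) \<times> layer D))"
  have mono: "fs.span (mon_expo m M ` (exps m k \<times> layer D)) \<subseteq> ?T"
    using exps_mono[of k "Suc k" m] by (intro fs.span_mono image_mono Sigma_mono) auto
  have zf: "f * zf M i \<in> ?T" if i: "i < m" and f: "f \<in> S (k + D)" for i f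
  proof (rule span_mult_right[OF fs.subspace_span])
    show "f \<in> fs.span (mon_expo m M ` (exps m k \<times> layer D))" using f Suc by blast
    fix x assume "x \<in> mon_expo m M ` (exps m k \<times> layer D)"
    then obtain \<alpha> v where x: "x = mon m (zf M) \<alpha> * expo v" "\<alpha> \<in> exps m k" "v \<in> layer D"
      unfolding mon_expo_def by auto
    have "x * zf M i = mon_expo m M (\<alpha>(i := Suc (\<alpha> i)), v)"
      unfolding x(1) mon_expo_def by (simp add: mon_unit_mult[OF i] mult_ac)
    moreover have "(\<alpha>(i := Suc (\<alpha> i)), v) \<in> exps m (Suc k) \<times> layer D"
      using exps_unit[OF i x(2)] x(3) by blast
    ultimately show "x * zf M i \<in> ?T" using fs.span_base by (metis imageI)
  qed
  have "W m M (k + D) \<subseteq> ?T" unfolding W_def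
  proof (intro fs.span_minimal fs.subspace_span Un_least subsetI)
    show "x \<in> ?T" if "x \<in> S (k + D)" for x using that Suc mono by blast
    fix x assume "x \<in> {zf M i * f | i f. i < m \<and> f \<in> S (k + D)}"
    then obtain i f where x: "x = zf M i * f" "i < m" "f \<in> S (k + D)" by blast
    show "x \<in> ?T" using zf[OF x(2,3)] unfolding x(1) by (subst mult.commute)
  qed
  moreover have "S (Suc (k + D)) \<subseteq> W m M (k + D)" by (rule good_step[OF assms]) simp
  ultimately show ?case unfolding add_Suc by blast
qed

lemma good_layer_bound:
  assumes "good m M D"
  shows "card (layer (k + D)) \<le> card (layer D) * ((k + m) choose m)"
proof -
  have "card (layer (k + D)) \<le> card (exps m k \<times> layer D)"
  proof (rule family_independent_card_le[OF finite_layer _ expo_family_independent[OF finite_layer]])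
    show "finite (exps m k \<times> layer D)" using finite_exps finite_layer by blast
    show "expo v \<in> fs.span (mon_expo m M ` (exps m k \<times> layer D))" if "v \<in> layer (k + D)" for v
      using expo_in_S[OF that] good_generation[OF assms] by blast
  qed
  then show ?thesis by (simp add: card_cartesian_product card_exps mult.commute)
qed

definition alg_indep :: "nat \<Rightarrow> (nat \<Rightarrow> complex ^ 'd \<Rightarrow> complex) \<Rightarrow> bool" where
  "alg_indep m \<zeta> \<longleftrightarrow> (\<forall>k. family_independent (exps m k) (mon m \<zeta>))"

lemma alg_indep_layer_bound:
  assumes "alg_indep m \<zeta>" "\<And>i. i < m \<Longrightarrow> \<zeta> i \<in> S e"
  shows "((k + m) choose m) \<le> card (layer (k * e))"
proof -
  have "card (exps m k) \<le> card (layer (k * e))"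
  proof (rule family_independent_card_le[OF finite_exps finite_layer])
    show "family_independent (exps m k) (mon m \<zeta>)" using assms(1) by (simp add: alg_indep_def)
    show "mon m \<zeta> \<alpha> \<in> fs.span (expo ` layer (k * e))" if "\<alpha> \<in> exps m k" for \<alpha>
    proof -
      have "(\<Sum>i<m. \<alpha> i) * e \<le> k * e" using that by (auto simp: exps_def)
      then show ?thesis using mon_in_S[of m \<zeta> e \<alpha>, OF assms(2)] S_mono unfolding S_def by blast
    qed
  qed
  then show ?thesis by (simp add: card_exps)
qed

lemma good_dependent_reduces:
  assumes "good m M D" "\<not> alg_indep m (zf M)"
  obtains m' M' D' where "m' < m" "good m' M' D'"
proof -
  from assms(2) obtain k c \<alpha>0 where c: "(\<Sum>\<alpha>\<in>exps m k. fscale (c \<alpha>) (mon m (zf M) \<alpha>)) = 0"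
    and \<alpha>0: "\<alpha>0 \<in> exps m k" "c \<alpha>0 \<noteq> 0" unfolding alg_indep_def family_independent_def by blast
  show ?thesis
  proof (cases m)
    case 0
    have "(\<Sum>\<alpha>\<in>exps m k. fscale (c \<alpha>) (mon m (zf M) \<alpha>)) 0 = 0" unfolding c by simp
    then show ?thesis using \<alpha>0 unfolding 0 by (simp add: exps_0 mon_apply mon_def)
  next
    case (Suc m')
    from good_eliminate[OF assms(1)[unfolded Suc] c[unfolded Suc] \<alpha>0(1)[unfolded Suc] \<alpha>0(2)]
    show ?thesis using that[of m'] Suc by auto
  qed
qed

lemma good_dim_le: "good m M D \<Longrightarrow> CARD('d) \<le> m"
  using good_layer_bound by (intro dim_le_of_layer_bound) blast

text \<open>Take the least possible number of forms. A relation among them would allow elimination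
  of one more, so they are independent; the growth of the layers then forces their number to be
  \<open>CARD('d)\<close> from both sides.\<close>

lemma noether_normalization: "\<exists>M D. good CARD('d) M D"
proof -
  define m where "m = (LEAST m. \<exists>M D. good m M D)"
  have "\<exists>M D. good m M D" unfolding m_def using good_exists by (rule LeastI_ex)
  then obtain M D where M: "good m M D" by blast
  have "alg_indep m (zf M)"
  proof (rule ccontr)
    assume "\<not> alg_indep m (zf M)"
    then obtain m' M' D' where "m' < m" "good m' M' D'" using good_dependent_reduces[OF M] by blast
    then show False using not_less_Least[of m' "\<lambda>m. \<exists>M D. good m M D"] unfolding m_def by blast
  qed
  then have "m \<le> CARD('d)"
    using alg_indep_layer_bound[of m "zf M" 1] zf_in_S by (intro dim_ge_of_layer_bound[of 1]) simp_all
  with good_dim_le[OF M] M show ?thesis by (metis le_antisym)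
qed

text \<open>A relation among these forms would make fewer than \<open>CARD('d)\<close> of them
  suffice, which is too few for the growth of the layers.\<close>

lemma good_alg_indep: "good CARD('d) M D \<Longrightarrow> alg_indep CARD('d) (zf M)"
  using good_dependent_reduces good_dim_le by (metis not_le)

section \<open>The coordinate ring as a module over the polynomials in the linear forms\<close>

definition pz :: "(nat \<Rightarrow> complex ^ 'n) \<Rightarrow> ((nat \<Rightarrow> complex) \<Rightarrow> complex) \<Rightarrow> complex ^ 'd \<Rightarrow> complex" where
  "pz M p = (\<lambda>u. p (\<lambda>i. zf M i u))"

lemma pz_apply [simp]: "pz M p u = p (\<lambda>i. zf M i u)"
  by (simp add: pz_def)

lemma pz_expand:
  assumes "p \<in> polys CARD('d)"
  shows "\<exists>k c. pz M p = (\<Sum>\<alpha>\<in>exps CARD('d) k. fscale (c \<alpha>) (mon CARD('d) (zf M) \<alpha>)) \<and>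
    (\<forall>t. p t = (\<Sum>\<alpha>\<in>exps CARD('d) k. c \<alpha> * mon CARD('d) t \<alpha>))"
proof -
  obtain k c where c: "\<And>t. p t = (\<Sum>\<alpha>\<in>exps CARD('d) k. c \<alpha> * mon CARD('d) t \<alpha>)"
    using poly_funs_tuple_expand[OF assms] by blast
  then have "pz M p = (\<Sum>\<alpha>\<in>exps CARD('d) k. fscale (c \<alpha>) (mon CARD('d) (zf M) \<alpha>))"
    by (simp add: fun_eq_iff mon_apply)
  then show ?thesis using c by blast
qed

lemma pz_in_coord_ring:
  assumes "p \<in> polys CARD('d)"
  shows "pz M p \<in> coord_ring"
proof -
  obtain k c where c: "pz M p = (\<Sum>\<alpha>\<in>exps CARD('d) k. fscale (c \<alpha>) (mon CARD('d) (zf M) \<alpha>))"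
    using pz_expand[OF assms, of M] by blast
  have "mon CARD('d) (zf M) \<alpha> \<in> coord_ring" for \<alpha>
    using mon_in_S[of "CARD('d)" "zf M" 1 \<alpha>] zf_in_S S_coord_ring by blast
  then show ?thesis unfolding c
    by (intro subalgebra_closed(8)[OF subalgebra_coord_ring] subalgebra_closed(5)[OF subalgebra_coord_ring])
qed

lemma pz_zero:
  assumes "alg_indep CARD('d) (zf M)" "p \<in> polys CARD('d)" "pz M p = 0"
  shows "p t = 0"
proof -
  obtain k c where c: "pz M p = (\<Sum>\<alpha>\<in>exps CARD('d) k. fscale (c \<alpha>) (mon CARD('d) (zf M) \<alpha>))"
    "\<And>t. p t = (\<Sum>\<alpha>\<in>exps CARD('d) k. c \<alpha> * mon CARD('d) t \<alpha>)" using pz_expand[OF assms(2), of M] by blast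
  have "\<forall>\<alpha>\<in>exps CARD('d) k. c \<alpha> = 0"
    using assms(1,3) unfolding c(1) alg_indep_def family_independent_def by blast
  then show ?thesis unfolding c(2) by simp
qed

text \<open>Linear independence over the ring of polynomials in the forms. The conclusion speaks of
  the coefficients as polynomials, not of their values at the forms, so that they may be evaluated
  at any point.\<close>

definition mod_indep :: "(nat \<Rightarrow> complex ^ 'n) \<Rightarrow> nat \<Rightarrow> (nat \<Rightarrow> complex ^ 'd \<Rightarrow> complex) \<Rightarrow> bool" where
  "mod_indep M q g \<longleftrightarrow> (\<forall>p. (\<forall>l<q. p l \<in> polys CARD('d)) \<longrightarrow> (\<Sum>l<q. pz M (p l) * g l) = 0 \<longrightarrow> (\<forall>l<q. \<forall>t. p l t = 0))"

lemma common_layer: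
  assumes "finite I" "\<And>i. i \<in> I \<Longrightarrow> f i \<in> coord_ring"
  obtains e where "\<And>i. i \<in> I \<Longrightarrow> f i \<in> S e"
proof -
  have "\<forall>i\<in>I. \<exists>e. f i \<in> S e" using assms(2) coord_ring_iff by blast
  then obtain e where e: "\<And>i. i \<in> I \<Longrightarrow> f i \<in> S (e i)" by metis
  have "f i \<in> S (\<Sum>i\<in>I. e i)" if "i \<in> I" for i
    using e[OF that] S_mono[OF member_le_sum[of i I e]] assms(1) that by auto
  then show ?thesis using that by blast
qed

text \<open>Monomials of degree at most \<open>k\<close> times the \<open>g l\<close> are linearly
  independent and lie in the step \<open>k + e\<close>; the growth of the layers limits how many
  such free summands fit.\<close>

lemma mod_indep_bound:
  assumes "mod_indep M q g" "\<And>l. l < q \<Longrightarrow> g l \<in> coord_ring"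
  shows "real q \<le> fact CARD('d) * growth"
proof -
  obtain e where e: "\<And>l. l \<in> {..<q} \<Longrightarrow> g l \<in> S e"
    using common_layer[of "{..<q}" g] assms(2) by auto
  show ?thesis
  proof (rule rank_le_growth[where e = e])
    fix k
    define F where "F = (\<lambda>(l, \<alpha>). mon CARD('d) (zf M) \<alpha> * g l)"
    have "card ({..<q} \<times> exps CARD('d) k) \<le> card (layer (k + e))"
    proof (rule family_independent_card_le[of _ _ F expo, OF _ finite_layer])
      show "finite ({..<q} \<times> exps CARD('d) k)" using finite_exps by blast
      show "family_independent ({..<q} \<times> exps CARD('d) k) F" unfolding family_independent_def
      proof (intro allI impI)
        fix c assume c: "(\<Sum>i\<in>{..<q} \<times> exps CARD('d) k. fscale (c i) (F i)) = 0"
        define p where "p = (\<lambda>l t. \<Sum>\<alpha>\<in>exps CARD('d) k. c (l, \<alpha>) * mon CARD('d) t \<alpha>)"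
        have p: "\<forall>l<q. p l \<in> polys CARD('d)"
          unfolding p_def by (intro allI impI poly_funs_intros mon_in_poly_funs)
        have "(\<Sum>l<q. pz M (p l) * g l) = (\<Sum>i\<in>{..<q} \<times> exps CARD('d) k. fscale (c i) (F i))"
        proof -
          have "(\<Sum>i\<in>{..<q} \<times> exps CARD('d) k. fscale (c i) (F i))
              = (\<Sum>l<q. \<Sum>\<alpha>\<in>exps CARD('d) k. fscale (c (l, \<alpha>)) (F (l, \<alpha>)))"
            using sum.cartesian_product[of "\<lambda>l \<alpha>. fscale (c (l, \<alpha>)) (F (l, \<alpha>))" "exps CARD('d) k" "{..<q}"]
            by simp
          then show ?thesis
            by (simp add: fun_eq_iff p_def F_def mon_apply sum_distrib_right mult.assoc)
        qed
        then have "(\<Sum>l<q. pz M (p l) * g l) = 0" unfolding c .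
        then have "\<forall>l<q. \<forall>t. p l t = 0" using p assms(1) unfolding mod_indep_def by blast
        then have "c (l, \<alpha>) = 0" if "l < q" "\<alpha> \<in> exps CARD('d) k" for l \<alpha>
          using exps_independent[of "\<lambda>\<alpha>. c (l, \<alpha>)" "CARD('d)" k] that unfolding p_def by blast
        then show "\<forall>i\<in>{..<q} \<times> exps CARD('d) k. c i = 0" by auto
      qed
      fix i assume "i \<in> {..<q} \<times> exps CARD('d) k"
      then obtain l \<alpha> where i: "i = (l, \<alpha>)" "l < q" "\<alpha> \<in> exps CARD('d) k" by auto
      have "mon CARD('d) (zf M) \<alpha> \<in> S ((\<Sum>i<CARD('d). \<alpha> i) * 1)" using mon_in_S zf_in_S by blast
      then have "mon CARD('d) (zf M) \<alpha> \<in> S k" using i(3) S_mono[of "\<Sum>i<CARD('d). \<alpha> i" k] by (auto simp: exps_def)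
      then have "mon CARD('d) (zf M) \<alpha> * g l \<in> S (k + e)" using e i(2) by (intro S_mult) auto
      then show "F i \<in> fs.span (expo ` layer (k + e))" unfolding i(1) F_def S_def by simp
    qed
    then show "q * ((k + CARD('d)) choose CARD('d)) \<le> card (layer (k + e))"
      by (simp add: card_cartesian_product card_exps)
  qed
qed

text \<open>A basis over the field of fractions, expressed without fractions: adjoining
  \<open>s\<close> to a maximal independent family gives a relation in which \<open>s\<close> has a
  nonzero coefficient, the denominator \<Delta>.\<close>

lemma maximal_mod_indep:
  obtains q g where "mod_indep M q g" "\<And>l. l < q \<Longrightarrow> g l \<in> coord_ring"
    "\<And>s. s \<in> coord_ring \<Longrightarrow> \<exists>\<Delta>\<in>polys CARD('d). (\<exists>t. \<Delta> t \<noteq> 0) \<and>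
       (\<exists>p. (\<forall>l<q. p l \<in> polys CARD('d)) \<and> pz M \<Delta> * s = (\<Sum>l<q. pz M (p l) * g l))"
proof -
  let ?P = "\<lambda>q. \<exists>g. mod_indep M q g \<and> (\<forall>l<q. g l \<in> coord_ring)"
  define B where "B = nat \<lceil>fact CARD('d) * growth\<rceil>"
  have bound: "q \<le> B" if "?P q" for q
  proof -
    have "real q \<le> fact CARD('d) * growth" using that mod_indep_bound by blast
    then show ?thesis unfolding B_def by linarith
  qed
  have "?P 0" by (auto simp: mod_indep_def)
  define q where "q = (GREATEST q. ?P q)"
  have "?P q" unfolding q_def using \<open>?P 0\<close> bound by (intro GreatestI_nat[of ?P 0 B]) blast+
  have max: "k \<le> q" if "?P k" for k
    unfolding q_def using that bound by (intro Greatest_le_nat[of ?P k B]) blast+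
  obtain g where g: "mod_indep M q g" "\<And>l. l < q \<Longrightarrow> g l \<in> coord_ring" using \<open>?P q\<close> by blast
  have "\<exists>\<Delta>\<in>polys CARD('d). (\<exists>t. \<Delta> t \<noteq> 0) \<and> (\<exists>p. (\<forall>l<q. p l \<in> polys CARD('d)) \<and> pz M \<Delta> * s = (\<Sum>l<q. pz M (p l) * g l))"
    if s: "s \<in> coord_ring" for s
  proof -
    define g' where "g' = g(q := s)"
    have "\<forall>l<Suc q. g' l \<in> coord_ring" using g(2) s by (auto simp: g'_def less_Suc_eq)
    then have "\<not> mod_indep M (Suc q) g'" using max[of "Suc q"] by auto
    then obtain p where p: "\<forall>l<Suc q. p l \<in> polys CARD('d)" "(\<Sum>l<Suc q. pz M (p l) * g' l) = 0"
      "\<not> (\<forall>l<Suc q. \<forall>t. p l t = 0)" unfolding mod_indep_def by blast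
    have sum: "(\<Sum>l<q. pz M (p l) * g l) + pz M (p q) * s = 0"
      using p(2) by (simp add: g'_def)
    have "\<exists>t. p q t \<noteq> 0"
    proof (rule ccontr)
      assume no: "\<not> ?thesis"
      then have "pz M (p q) * s = 0" by (simp add: fun_eq_iff)
      then have "(\<Sum>l<q. pz M (p l) * g l) = 0" using sum by (simp only: add_0_right)
      then have "\<forall>l<q. \<forall>t. p l t = 0" using g(1) p(1) unfolding mod_indep_def by (meson less_SucI)
      then show False using no p(3) by (auto simp: less_Suc_eq)
    qed
    moreover have "p q \<in> polys CARD('d)" using p(1) by blast
    moreover have "\<forall>l<q. (\<lambda>t. - 1 * p l t) \<in> polys CARD('d)"
      using p(1) by (intro allI impI poly_funs_cmult) (meson less_SucI)
    moreover have "pz M (p q) * s = (\<Sum>l<q. pz M (\<lambda>t. - 1 * p l t) * g l)"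
    proof -
      have "(\<Sum>l<q. pz M (\<lambda>t. - 1 * p l t) * g l) = - (\<Sum>l<q. pz M (p l) * g l)"
        by (simp add: fun_eq_iff sum_negf)
      moreover have "pz M (p q) * s = - (\<Sum>l<q. pz M (p l) * g l)"
        unfolding eq_neg_iff_add_eq_0 using sum by (simp only: add.commute)
      ultimately show ?thesis by (simp only:)
    qed
    ultimately show ?thesis by (intro bexI[of _ "p q"] conjI exI[of _ "\<lambda>l t. - 1 * p l t"])
  qed
  then show ?thesis using that g by blast
qed

end

lemma poly_funs_prod_nonzero:
  assumes "line_coords F" "finite I" "\<And>i. i \<in> I \<Longrightarrow> p i \<in> poly_funs F" "\<And>i. i \<in> I \<Longrightarrow> \<exists>x. p i x \<noteq> 0"
  shows "\<exists>x. (\<Prod>i\<in>I. p i x) \<noteq> 0"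
  using assms(2-4)
proof (induction I rule: finite_induct)
  case (insert i I)
  then obtain x y where x: "p i x \<noteq> 0" and y: "(\<Prod>i\<in>I. p i y) \<noteq> 0" by blast
  have "(\<lambda>x. \<Prod>i\<in>I. p i x) \<in> poly_funs F" using insert.prems by (intro poly_funs_prod) auto
  then obtain z where "p i z \<noteq> 0" "(\<Prod>i\<in>I. p i z) \<noteq> 0"
    using poly_funs_nonzero_common[OF assms(1), of "p i" x "\<lambda>x. \<Prod>i\<in>I. p i x" y] insert.prems(1) x y by blast
  then have "(\<Prod>i\<in>insert i I. p i z) \<noteq> 0" using insert.hyps by simp
  then show ?case by blast
qed simp

context lissajous_setup
begin

text \<open>One denominator serves all \<open>s\<close>, because the ring is generated over the
  polynomials by the finitely many exponentials of layer \<open>D\<close>. Multiplication by it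
  embeds each step of the filtration into a free module of rank \<open>q\<close> with a bounded
  shift in degree, which yields the missing inequality for \<open>q\<close>.\<close>

lemma module_basis:
  assumes good: "good CARD('d) M D"
  obtains q g \<Delta> where "real q = fact CARD('d) * growth" "\<And>l. l < q \<Longrightarrow> g l \<in> coord_ring" "mod_indep M q g"
    "\<Delta> \<in> polys CARD('d)" "\<exists>t. \<Delta> t \<noteq> 0"
    "\<And>s. s \<in> coord_ring \<Longrightarrow> \<exists>p. (\<forall>l<q. p l \<in> polys CARD('d)) \<and> pz M \<Delta> * s = (\<Sum>l<q. pz M (p l) * g l)"
proof -
  let ?d = "CARD('d)"
  obtain q g where g: "mod_indep M q g" "\<And>l. l < q \<Longrightarrow> g l \<in> coord_ring"
    and max: "\<And>s. s \<in> coord_ring \<Longrightarrow> \<exists>\<Delta>\<in>polys ?d. (\<exists>t. \<Delta> t \<noteq> 0) \<and>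
       (\<exists>p. (\<forall>l<q. p l \<in> polys ?d) \<and> pz M \<Delta> * s = (\<Sum>l<q. pz M (p l) * g l))"
    by (rule maximal_mod_indep[of M]) blast
  define Q where "Q = (\<lambda>v \<Delta> p. \<Delta> \<in> polys ?d \<and> (\<exists>t. \<Delta> t \<noteq> 0) \<and>
     (\<forall>l<q. p l \<in> polys ?d) \<and> pz M \<Delta> * expo v = (\<Sum>l<q. pz M (p l) * g l))"
  have "\<forall>v\<in>layer D. \<exists>\<Delta>. \<exists>p. Q v \<Delta> p"
  proof
    fix v assume "v \<in> layer D"
    then have "expo v \<in> coord_ring" using expo_in_S S_coord_ring by blast
    from max[OF this] show "\<exists>\<Delta>. \<exists>p. Q v \<Delta> p" unfolding Q_def by blast
  qed
  from bchoice[OF this] obtain \<Delta>v where "\<forall>v\<in>layer D. \<exists>p. Q v (\<Delta>v v) p" by blast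
  from bchoice[OF this] obtain pv where Q: "\<And>v. v \<in> layer D \<Longrightarrow> Q v (\<Delta>v v) (pv v)" by blast
  have \<Delta>v: "\<Delta>v v \<in> polys ?d" "\<exists>t. \<Delta>v v t \<noteq> 0" and pv: "\<And>l. l < q \<Longrightarrow> pv v l \<in> polys ?d"
    and eqv: "pz M (\<Delta>v v) * expo v = (\<Sum>l<q. pz M (pv v l) * g l)" if "v \<in> layer D" for v
    using Q[OF that] unfolding Q_def by blast+
  \<comment> \<open>Common denominator of the generators; it is nonzero because the polynomial ring
    has no zero divisors.\<close>
  define \<Delta> where "\<Delta> = (\<lambda>t. \<Prod>v\<in>layer D. \<Delta>v v t)"
  have \<Delta>: "\<Delta> \<in> polys ?d" "\<exists>t. \<Delta> t \<noteq> 0" unfolding \<Delta>_def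
    using \<Delta>v by (intro poly_funs_prod poly_funs_prod_nonzero[OF line_coords_tuple finite_layer]; blast)+
  define P where "P = (\<lambda>v l t. (\<Prod>w\<in>layer D - {v}. \<Delta>v w t) * pv v l t)"
  have P: "P v l \<in> polys ?d" if "v \<in> layer D" "l < q" for v l
    unfolding P_def using that \<Delta>v pv by (intro poly_funs.mult poly_funs_prod) auto
  have P_eq: "pz M \<Delta> * expo v = (\<Sum>l<q. pz M (P v l) * g l)" if v: "v \<in> layer D" for v
  proof
    fix u
    let ?t = "\<lambda>i. zf M i u"
    have "\<Delta> ?t = (\<Prod>w\<in>layer D - {v}. \<Delta>v w ?t) * \<Delta>v v ?t"
      unfolding \<Delta>_def by (subst prod.remove[OF finite_layer v]) (simp add: mult.commute)
    moreover have "\<Delta>v v ?t * expo v u = (\<Sum>l<q. pv v l ?t * g l u)"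
      using fun_cong[OF eqv[OF v], of u] by simp
    ultimately show "(pz M \<Delta> * expo v) u = (\<Sum>l<q. pz M (P v l) * g l) u"
      by (simp add: P_def sum_distrib_left mult.assoc)
  qed
  have "\<forall>x\<in>layer D \<times> {..<q}. \<exists>k. pz M (P (fst x) (snd x)) \<in> fs.span (mon ?d (zf M) ` exps ?d k)"
  proof
    fix x assume x: "x \<in> layer D \<times> {..<q}"
    then have "P (fst x) (snd x) \<in> polys ?d" by (intro P) auto
    from pz_expand[OF this, of M] show "\<exists>k. pz M (P (fst x) (snd x)) \<in> fs.span (mon ?d (zf M) ` exps ?d k)"
      using span_image_finite_iff[OF finite_exps] by blast
  qed
  from bchoice[OF this] obtain kx where
    kx: "\<And>x. x \<in> layer D \<times> {..<q} \<Longrightarrow> pz M (P (fst x) (snd x)) \<in> fs.span (mon ?d (zf M) ` exps ?d (kx x))" by blast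
  \<comment> \<open>Bounds the degrees of all coefficients \<open>P v l\<close>, and thus the shift
    caused by multiplication with the denominator.\<close>
  define e where "e = (\<Sum>x\<in>layer D \<times> {..<q}. kx x)"
  have P_span: "pz M (P v l) \<in> fs.span (mon ?d (zf M) ` exps ?d e)" if "v \<in> layer D" "l < q" for v l
  proof -
    have x: "(v, l) \<in> layer D \<times> {..<q}" using that by simp
    have "kx (v, l) \<le> e" unfolding e_def using x finite_layer by (intro member_le_sum) auto
    then have "fs.span (mon ?d (zf M) ` exps ?d (kx (v, l))) \<subseteq> fs.span (mon ?d (zf M) ` exps ?d e)"
      by (intro fs.span_mono image_mono exps_mono)
    then show ?thesis using kx[OF x] by auto
  qed
  define G where "G = (\<lambda>(\<gamma>, l). mon ?d (zf M) \<gamma> * g l)"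
  define T where "T = (\<lambda>j. fs.span (G ` (exps ?d j \<times> {..<q})))"
  have subT: "fs.subspace (T j)" for j unfolding T_def by (rule fs.subspace_span)
  have \<Delta>_T: "s * pz M \<Delta> \<in> T (k + e)" if s: "s \<in> S (k + D)" for s k
  proof (rule span_mult_right[OF subT])
    show "s \<in> fs.span (mon_expo ?d M ` (exps ?d k \<times> layer D))" using good_generation[OF good] s by blast
    fix x assume "x \<in> mon_expo ?d M ` (exps ?d k \<times> layer D)"
    then obtain \<alpha> v where x: "x = mon ?d (zf M) \<alpha> * expo v" "\<alpha> \<in> exps ?d k" "v \<in> layer D"
      unfolding mon_expo_def by auto
    have "pz M (P v l) * (mon ?d (zf M) \<alpha> * g l) \<in> T (k + e)" if l: "l < q" for l
    proof (rule span_mult_right[OF subT _ P_span[OF x(3) l]])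
      fix y assume "y \<in> mon ?d (zf M) ` exps ?d e"
      then obtain \<gamma> where \<gamma>: "y = mon ?d (zf M) \<gamma>" "\<gamma> \<in> exps ?d e" by blast
      have "y * (mon ?d (zf M) \<alpha> * g l) = G (\<lambda>i. \<alpha> i + \<gamma> i, l)"
        unfolding \<gamma> G_def by (simp add: mon_add mult_ac)
      moreover have "(\<lambda>i. \<alpha> i + \<gamma> i, l) \<in> exps ?d (k + e) \<times> {..<q}"
        using exps_add[OF x(2) \<gamma>(2)] l by simp
      ultimately show "y * (mon ?d (zf M) \<alpha> * g l) \<in> T (k + e)" unfolding T_def using fs.span_base by (metis imageI)
    qed
    then have "(\<Sum>l<q. pz M (P v l) * (mon ?d (zf M) \<alpha> * g l)) \<in> T (k + e)"
      by (intro fs.subspace_sum[OF subT]) auto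
    moreover have "x * pz M \<Delta> = (\<Sum>l<q. pz M (P v l) * (mon ?d (zf M) \<alpha> * g l))"
    proof -
      have "x * pz M \<Delta> = mon ?d (zf M) \<alpha> * (pz M \<Delta> * expo v)" unfolding x(1) by (simp only: mult_ac)
      then show ?thesis unfolding P_eq[OF x(3)] sum_distrib_left by (simp only: mult_ac)
    qed
    ultimately show "x * pz M \<Delta> \<in> T (k + e)" by (simp only:)
  qed
  have fin: "finite (exps ?d k \<times> {..<q})" for k using finite_exps by blast
  have \<Delta>_nz: "pz M \<Delta> \<noteq> 0" using pz_zero[OF good_alg_indep[OF good] \<Delta>(1)] \<Delta>(2) by blast
  have "card (layer (k + D)) \<le> q * ((k + e + ?d) choose ?d)" for k
  proof -
    have "card (layer (k + D)) \<le> card (exps ?d (k + e) \<times> {..<q})"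
    proof (rule family_independent_card_le[OF finite_layer fin])
      show "expo w * pz M \<Delta> \<in> fs.span (G ` (exps ?d (k + e) \<times> {..<q}))" if "w \<in> layer (k + D)" for w
        using \<Delta>_T[OF expo_in_S[OF that]] unfolding T_def .
      \<comment> \<open>Multiplication by the nonzero denominator is injective, since the coordinate
        ring is a domain.\<close>
      show "family_independent (layer (k + D)) (\<lambda>w. expo w * pz M \<Delta>)"
        unfolding family_independent_def
      proof (intro allI impI)
        fix c assume c: "(\<Sum>w\<in>layer (k + D). fscale (c w) (expo w * pz M \<Delta>)) = 0"
        let ?f = "\<Sum>w\<in>layer (k + D). fscale (c w) (expo w)"
        have "?f * pz M \<Delta> = (\<Sum>w\<in>layer (k + D). fscale (c w) (expo w * pz M \<Delta>))"
          by (simp add: fun_eq_iff sum_distrib_right mult.assoc)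
        then have "?f * pz M \<Delta> = 0" unfolding c .
        moreover have "?f \<in> coord_ring"
          by (rule subsetD[OF S_coord_ring[of "k + D"]]) (intro S_closed expo_in_S)
        ultimately have "?f = 0" using coord_ring_domain pz_in_coord_ring[OF \<Delta>(1)] \<Delta>_nz by blast
        then show "\<forall>w\<in>layer (k + D). c w = 0"
          using expo_family_independent[OF finite_layer] unfolding family_independent_def by blast
      qed
    qed
    then show ?thesis by (simp add: card_cartesian_product card_exps mult.commute)
  qed
  then have "fact ?d * growth \<le> real q" by (rule growth_le_rank)
  with mod_indep_bound[OF g] have rq: "real q = fact ?d * growth" by linarith
  have "\<exists>p. (\<forall>l<q. p l \<in> polys ?d) \<and> pz M \<Delta> * s = (\<Sum>l<q. pz M (p l) * g l)" if s: "s \<in> coord_ring" for s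
  proof -
    obtain k where "s \<in> S k" using s coord_ring_iff by blast
    then have "s \<in> S (k + D)" using S_mono[of k "k + D"] by auto
    from \<Delta>_T[OF this] obtain m where m: "s * pz M \<Delta> = (\<Sum>x\<in>exps ?d (k + e) \<times> {..<q}. fscale (m x) (G x))"
      unfolding T_def span_image_finite_iff[OF fin] by blast
    define p where "p = (\<lambda>l t. \<Sum>\<gamma>\<in>exps ?d (k + e). m (\<gamma>, l) * mon ?d t \<gamma>)"
    have "\<forall>l<q. p l \<in> polys ?d" unfolding p_def by (intro allI impI poly_funs_intros mon_in_poly_funs)
    moreover have "pz M \<Delta> * s = (\<Sum>l<q. pz M (p l) * g l)"
    proof -
      have "(\<Sum>x\<in>exps ?d (k + e) \<times> {..<q}. fscale (m x) (G x))
          = (\<Sum>\<gamma>\<in>exps ?d (k + e). \<Sum>l<q. fscale (m (\<gamma>, l)) (G (\<gamma>, l)))"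
        using sum.cartesian_product[of "\<lambda>\<gamma> l. fscale (m (\<gamma>, l)) (G (\<gamma>, l))" "{..<q}" "exps ?d (k + e)"] by simp
      also have "\<dots> = (\<Sum>l<q. \<Sum>\<gamma>\<in>exps ?d (k + e). fscale (m (\<gamma>, l)) (G (\<gamma>, l)))" by (rule sum.swap)
      also have "\<dots> = (\<Sum>l<q. pz M (p l) * g l)"
        by (simp add: fun_eq_iff p_def G_def mon_apply sum_distrib_right mult.assoc)
      finally show ?thesis using m by (simp only: mult.commute)
    qed
    ultimately show ?thesis by blast
  qed
  then show ?thesis using that[OF rq g(2,1) \<Delta>] by blast
qed

text \<open>The powers of \<open>f\<close> satisfy a relation whose lowest coefficient is the required multiple.\<close>

lemma polynomial_multiple:
  assumes f: "f \<in> coord_ring" "f \<noteq> 0"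
  obtains p g where "p \<in> polys CARD('d)" "\<exists>t. p t \<noteq> 0" "g \<in> coord_ring" "f * g = pz M p"
proof -
  let ?d = "CARD('d)"
  note R = subalgebra_closed[OF subalgebra_coord_ring]
  \<comment> \<open>One more than the rank permits, so the powers of \<open>f\<close> below
    \<open>q\<close> are dependent over the polynomials.\<close>
  define q where "q = Suc (nat \<lceil>fact ?d * growth\<rceil>)"
  have "\<not> mod_indep M q (\<lambda>l. f ^ l)"
  proof
    assume "mod_indep M q (\<lambda>l. f ^ l)"
    then have "real q \<le> fact ?d * growth" by (rule mod_indep_bound) (rule R(7)[OF f(1)])
    then show False unfolding q_def by linarith
  qed
  then obtain p where p: "\<forall>l<q. p l \<in> polys ?d" "(\<Sum>l<q. pz M (p l) * f ^ l) = 0" "\<exists>l<q. \<exists>t. p l t \<noteq> 0"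
    unfolding mod_indep_def by blast
  define k where "k = (LEAST l. l < q \<and> (\<exists>t. p l t \<noteq> 0))"
  have k: "k < q" "\<exists>t. p k t \<noteq> 0" unfolding k_def using LeastI_ex[OF p(3)] by blast+
  have low: "p l t = 0" if "l < k" for l t
    using not_less_Least[OF that[unfolded k_def]] that k(1) by auto
  define h where "h = (\<Sum>l\<in>{k<..<q}. pz M (p l) * f ^ (l - Suc k))"
  have hR: "h \<in> coord_ring" unfolding h_def
    using p(1) by (intro R(8) R(6) R(7) f(1) pz_in_coord_ring) auto
  have "f ^ k * (pz M (p k) + f * h) = (\<Sum>l<q. pz M (p l) * f ^ l)"
  proof
    fix u
    let ?t = "\<lambda>i. zf M i u"
    have "(\<Sum>l<q. p l ?t * f u ^ l) = (\<Sum>l\<in>insert k {k<..<q}. p l ?t * f u ^ l)"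
      using low k(1) by (intro sum.mono_neutral_right) (auto simp: not_less_iff_gr_or_eq)
    also have "\<dots> = p k ?t * f u ^ k + (\<Sum>l\<in>{k<..<q}. p l ?t * f u ^ l)" by (subst sum.insert) auto
    also have "(\<Sum>l\<in>{k<..<q}. p l ?t * f u ^ l) = (\<Sum>l\<in>{k<..<q}. f u ^ k * (f u * (p l ?t * f u ^ (l - Suc k))))"
    proof (intro sum.cong refl)
      fix l assume "l \<in> {k<..<q}"
      then have "f u ^ l = f u ^ (k + Suc (l - Suc k))" by simp
      then show "p l ?t * f u ^ l = f u ^ k * (f u * (p l ?t * f u ^ (l - Suc k)))"
        unfolding power_add power_Suc by (simp only: mult_ac)
    qed
    finally show "(f ^ k * (pz M (p k) + f * h)) u = (\<Sum>l<q. pz M (p l) * f ^ l) u"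
      by (simp add: h_def sum_distrib_left algebra_simps)
  qed
  then have "f ^ k * (pz M (p k) + f * h) = 0" unfolding p(2) .
  moreover have "f ^ k \<noteq> 0"
  proof (induction k)
    case 0
    show ?case unfolding power_0 by (rule one_neq_zero)
  next
    case (Suc k)
    show ?case unfolding power_Suc using coord_ring_domain[OF f(1) R(7)[OF f(1)]] f(2) Suc by blast
  qed
  moreover have pk: "p k \<in> polys ?d" using p(1) k(1) by blast
  ultimately have "pz M (p k) + f * h = 0"
    using coord_ring_domain R(7)[OF f(1)] R(3)[OF pz_in_coord_ring R(6)[OF f(1) hR]] by blast
  then have "pz M (p k) = - (f * h)" unfolding eq_neg_iff_add_eq_0 .
  then have "f * (- h) = pz M (p k)" by (simp only: mult_minus_right)
  moreover have "- h \<in> coord_ring" using R(5)[OF hR, of "- 1"] by (simp add: fscale_def fun_Compl_def)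
  ultimately show ?thesis using that pk k(2) by blast
qed

section \<open>The ideal of a fiber\<close>

definition fiber_ideal :: "(nat \<Rightarrow> complex ^ 'n) \<Rightarrow> (nat \<Rightarrow> complex) \<Rightarrow> (complex ^ 'd \<Rightarrow> complex) set" where
  "fiber_ideal M c = fs.span {(zf M i - fscale (c i) 1) * f | i f. i < CARD('d) \<and> f \<in> coord_ring}"

lemma subspace_fiber_ideal: "fs.subspace (fiber_ideal M c)"
  unfolding fiber_ideal_def by (rule fs.subspace_span)

lemma fiber_ideal_gen: "i < CARD('d) \<Longrightarrow> f \<in> coord_ring \<Longrightarrow> (zf M i - fscale (c i) 1) * f \<in> fiber_ideal M c"
  unfolding fiber_ideal_def by (rule fs.span_base) blast

lemma zf_const_in_coord_ring: "zf M i - fscale a 1 \<in> coord_ring"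
  using zf_in_S[of M i] S_coord_ring[of 1] subalgebra_closed(1,4,5)[OF subalgebra_coord_ring] by blast

lemma ideal_fiber_ideal: "ideal_of coord_ring (fiber_ideal M c)"
  unfolding ideal_of_def
proof (intro conjI ballI subspace_fiber_ideal)
  show "fiber_ideal M c \<subseteq> coord_ring" unfolding fiber_ideal_def
  proof (rule fs.span_minimal)
    show "fs.subspace coord_ring" using subalgebra_coord_ring by (simp add: subalgebra_def)
    show "{(zf M i - fscale (c i) 1) * f | i f. i < CARD('d) \<and> f \<in> coord_ring} \<subseteq> coord_ring"
      using subalgebra_closed(6)[OF subalgebra_coord_ring zf_const_in_coord_ring] by blast
  qed
  fix f g assume f: "f \<in> coord_ring" and g: "g \<in> fiber_ideal M c"
  have "g * f \<in> fiber_ideal M c"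
  proof (rule span_mult_right[OF subspace_fiber_ideal _ g[unfolded fiber_ideal_def]])
    fix x assume "x \<in> {(zf M i - fscale (c i) 1) * f | i f. i < CARD('d) \<and> f \<in> coord_ring}"
    then obtain i h where x: "x = (zf M i - fscale (c i) 1) * h" "i < CARD('d)" "h \<in> coord_ring" by blast
    then show "x * f \<in> fiber_ideal M c" unfolding x(1) mult.assoc
      using f by (intro fiber_ideal_gen subalgebra_closed(6)[OF subalgebra_coord_ring])
  qed
  then show "f * g \<in> fiber_ideal M c" by (subst mult.commute)
qed

lemma fiber_ideal_expand:
  assumes "f \<in> fiber_ideal M c"
  obtains s where "\<And>i. s i \<in> coord_ring" "f = (\<Sum>i<CARD('d). (zf M i - fscale (c i) 1) * s i)"
proof -
  note R = subalgebra_closed[OF subalgebra_coord_ring]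
  let ?T = "{f. \<exists>s. (\<forall>i. s i \<in> coord_ring) \<and> f = (\<Sum>i<CARD('d). (zf M i - fscale (c i) 1) * s i)}"
  have "fs.subspace ?T"
  proof (rule fs.subspaceI)
    have "0 = (\<Sum>i<CARD('d). (zf M i - fscale (c i) 1) * 0)" by simp
    then show "0 \<in> ?T" using R(2) by (auto intro!: exI[of _ "\<lambda>_. 0"])
    show "x + y \<in> ?T" if xy: "x \<in> ?T" "y \<in> ?T" for x y
    proof -
      obtain s t where st: "\<forall>i. s i \<in> coord_ring" "x = (\<Sum>i<CARD('d). (zf M i - fscale (c i) 1) * s i)"
        "\<forall>i. t i \<in> coord_ring" "y = (\<Sum>i<CARD('d). (zf M i - fscale (c i) 1) * t i)" using xy by blast
      have "x + y = (\<Sum>i<CARD('d). (zf M i - fscale (c i) 1) * (s i + t i))"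
        unfolding st(2,4) distrib_left sum.distrib ..
      moreover have "\<forall>i. s i + t i \<in> coord_ring" using st(1,3) R(3) by blast
      ultimately show ?thesis by (intro CollectI exI[of _ "\<lambda>i. s i + t i"] conjI)
    qed
    show "fscale a x \<in> ?T" if x: "x \<in> ?T" for a x
    proof -
      obtain s where s: "\<forall>i. s i \<in> coord_ring" "x = (\<Sum>i<CARD('d). (zf M i - fscale (c i) 1) * s i)" using x by blast
      have "fscale a x = (\<Sum>i<CARD('d). (zf M i - fscale (c i) 1) * fscale a (s i))"
        unfolding s(2) by (simp add: fun_eq_iff sum_distrib_left algebra_simps)
      moreover have "\<forall>i. fscale a (s i) \<in> coord_ring" using s(1) R(5) by blast
      ultimately show ?thesis by (intro CollectI exI[of _ "\<lambda>i. fscale a (s i)"] conjI)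
    qed
  qed
  moreover have "{(zf M i - fscale (c i) 1) * f | i f. i < CARD('d) \<and> f \<in> coord_ring} \<subseteq> ?T"
  proof
    fix x assume "x \<in> {(zf M i - fscale (c i) 1) * f | i f. i < CARD('d) \<and> f \<in> coord_ring}"
    then obtain i h where x: "x = (zf M i - fscale (c i) 1) * h" "i < CARD('d)" "h \<in> coord_ring" by blast
    have "x = (\<Sum>j<CARD('d). (zf M j - fscale (c j) 1) * (if j = i then h else 0))"
      unfolding x(1) using x(2) by (subst sum.remove[of _ i]) auto
    moreover have "\<forall>j. (if j = i then h else 0) \<in> coord_ring" using x(3) R(2) by simp
    ultimately show "x \<in> ?T" by (intro CollectI exI[of _ "\<lambda>j. if j = i then h else 0"] conjI)
  qed
  ultimately have "fiber_ideal M c \<subseteq> ?T" unfolding fiber_ideal_def by (rule fs.span_minimal[rotated])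
  then show ?thesis using assms that by blast
qed

lemma fiber_ideal_zeros:
  "(\<forall>f\<in>fiber_ideal M c. f u = 0) \<longleftrightarrow> (\<forall>i<CARD('d). zf M i u = c i)"
proof
  assume z: "\<forall>f\<in>fiber_ideal M c. f u = 0"
  show "\<forall>i<CARD('d). zf M i u = c i"
  proof (intro allI impI)
    fix i assume "i < CARD('d)"
    then have "(zf M i - fscale (c i) 1) * 1 \<in> fiber_ideal M c"
      by (intro fiber_ideal_gen subalgebra_closed(1)[OF subalgebra_coord_ring])
    then have "((zf M i - fscale (c i) 1) * 1) u = 0" using z by blast
    then show "zf M i u = c i" by simp
  qed
next
  assume z: "\<forall>i<CARD('d). zf M i u = c i"
  show "\<forall>f\<in>fiber_ideal M c. f u = 0"
  proof
    fix f assume "f \<in> fiber_ideal M c"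
    then obtain s where "f = (\<Sum>i<CARD('d). (zf M i - fscale (c i) 1) * s i)" by (rule fiber_ideal_expand)
    then show "f u = 0" using z by simp
  qed
qed

lemma pz_mod_fiber_ideal:
  assumes "p \<in> polys CARD('d)"
  shows "pz M p - fscale (p c) 1 \<in> fiber_ideal M c"
  using assms
proof induction
  case (coord f)
  then obtain i where i: "i < CARD('d)" "f = (\<lambda>t. t i)" by (auto simp: tuple_coords_def)
  have "(zf M i - fscale (c i) 1) * 1 \<in> fiber_ideal M c"
    by (intro fiber_ideal_gen i subalgebra_closed(1)[OF subalgebra_coord_ring])
  moreover have "pz M f = zf M i" unfolding i(2) pz_def ..
  ultimately show ?case unfolding i(2) mult_1_right by (simp only:)
next
  case (const a)
  have "pz M (\<lambda>_. a) - fscale a 1 = 0" by (auto simp: pz_def)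
  then show ?case using fs.subspace_0[OF subspace_fiber_ideal] by (simp only:)
next
  case (add p q)
  have "(pz M p - fscale (p c) 1) + (pz M q - fscale (q c) 1) \<in> fiber_ideal M c"
    by (rule fs.subspace_add[OF subspace_fiber_ideal add.IH])
  moreover have "(pz M p - fscale (p c) 1) + (pz M q - fscale (q c) 1) = pz M (\<lambda>x. p x + q x) - fscale (p c + q c) 1"
    by (rule ext) (simp add: pz_def algebra_simps)
  ultimately show ?case by (simp only:)
next
  case (mult p q)
  have "pz M q * (pz M p - fscale (p c) 1) + fscale (p c) (pz M q - fscale (q c) 1) \<in> fiber_ideal M c"
    by (intro fs.subspace_add[OF subspace_fiber_ideal] fs.subspace_scale[OF subspace_fiber_ideal] mult.IH
      ideal_closed(6)[OF ideal_fiber_ideal] pz_in_coord_ring mult.hyps)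
  moreover have "pz M q * (pz M p - fscale (p c) 1) + fscale (p c) (pz M q - fscale (q c) 1)
      = pz M (\<lambda>x. p x * q x) - fscale (p c * q c) 1"
    by (rule ext) (simp add: pz_def algebra_simps)
  ultimately show ?case by (simp only:)
qed

definition spans_mod :: "(nat \<Rightarrow> complex ^ 'n) \<Rightarrow> (nat \<Rightarrow> complex) \<Rightarrow> 'l set \<Rightarrow> ('l \<Rightarrow> complex ^ 'd \<Rightarrow> complex) \<Rightarrow> bool" where
  "spans_mod M c L h \<longleftrightarrow> (\<forall>s\<in>coord_ring. \<exists>a. s - (\<Sum>l\<in>L. fscale (a l) (h l)) \<in> fiber_ideal M c)"

text \<open>Modulo the fiber ideal a polynomial in the forms becomes its value at \<open>c\<close>.
  Where the denominator is nonzero at \<open>c\<close> it turns into a unit, and the basis over the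
  fraction field becomes a basis of the fiber algebra.\<close>

lemma module_basis_fiber:
  assumes good: "good CARD('d) M D"
  obtains q g \<Delta> where "real q = fact CARD('d) * growth" "\<And>l. l < q \<Longrightarrow> g l \<in> coord_ring"
    "\<Delta> \<in> polys CARD('d)" "\<exists>t. \<Delta> t \<noteq> 0"
    "\<And>c. \<Delta> c \<noteq> 0 \<Longrightarrow> spans_mod M c {..<q} g"
    "\<And>c a. \<Delta> c \<noteq> 0 \<Longrightarrow> (\<Sum>l<q. fscale (a l) (g l)) \<in> fiber_ideal M c \<Longrightarrow> \<forall>l<q. a l = 0"
proof -
  let ?d = "CARD('d)"
  note R = subalgebra_closed[OF subalgebra_coord_ring] and I = ideal_closed[OF ideal_fiber_ideal]
  obtain q g \<Delta> where q: "real q = fact ?d * growth" and g: "\<And>l. l < q \<Longrightarrow> g l \<in> coord_ring"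
    and ind: "mod_indep M q g" and \<Delta>: "\<Delta> \<in> polys ?d" "\<exists>t. \<Delta> t \<noteq> 0"
    and ex: "\<And>s. s \<in> coord_ring \<Longrightarrow> \<exists>p. (\<forall>l<q. p l \<in> polys ?d) \<and> pz M \<Delta> * s = (\<Sum>l<q. pz M (p l) * g l)"
    by (rule module_basis[OF good]) blast
  have span: "spans_mod M c {..<q} g" if c: "\<Delta> c \<noteq> 0" for c
    unfolding spans_mod_def
  proof
    fix s assume s: "s \<in> coord_ring"
    obtain p where p: "\<forall>l<q. p l \<in> polys ?d" "pz M \<Delta> * s = (\<Sum>l<q. pz M (p l) * g l)" using ex[OF s] by blast
    have "fscale (1 / \<Delta> c) ((\<Sum>l<q. g l * (pz M (p l) - fscale (p l c) 1)) - s * (pz M \<Delta> - fscale (\<Delta> c) 1)) \<in> fiber_ideal M c"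
      using p(1) g s by (intro I(5) I(3) I(6) pz_mod_fiber_ideal \<Delta> fs.subspace_sum[OF subspace_fiber_ideal]) auto
    moreover have "fscale (1 / \<Delta> c) ((\<Sum>l<q. g l * (pz M (p l) - fscale (p l c) 1)) - s * (pz M \<Delta> - fscale (\<Delta> c) 1))
        = s - (\<Sum>l<q. fscale (p l c / \<Delta> c) (g l))"
    proof
      fix u
      have "\<Delta> (\<lambda>i. zf M i u) * s u = (\<Sum>l<q. p l (\<lambda>i. zf M i u) * g l u)"
        using fun_cong[OF p(2), of u] by simp
      then show "fscale (1 / \<Delta> c) ((\<Sum>l<q. g l * (pz M (p l) - fscale (p l c) 1)) - s * (pz M \<Delta> - fscale (\<Delta> c) 1)) u
        = (s - (\<Sum>l<q. fscale (p l c / \<Delta> c) (g l))) u"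
        using c by (simp add: algebra_simps sum_subtractf sum_distrib_left sum_divide_distrib diff_divide_distrib)
    qed
    ultimately show "\<exists>a. s - (\<Sum>l<q. fscale (a l) (g l)) \<in> fiber_ideal M c"
      by (intro exI[of _ "\<lambda>l. p l c / \<Delta> c"]) (simp only:)
  qed
  have indep: "\<forall>l<q. a l = 0" if c: "\<Delta> c \<noteq> 0" and a: "(\<Sum>l<q. fscale (a l) (g l)) \<in> fiber_ideal M c" for c a
  proof -
    obtain s where s: "\<And>i. s i \<in> coord_ring" "(\<Sum>l<q. fscale (a l) (g l)) = (\<Sum>i<?d. (zf M i - fscale (c i) 1) * s i)"
      using a by (rule fiber_ideal_expand) blast
    have "\<forall>i. \<exists>p. (\<forall>l<q. p l \<in> polys ?d) \<and> pz M \<Delta> * s i = (\<Sum>l<q. pz M (p l) * g l)" using ex s(1) by blast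
    from choice[OF this] obtain p where p: "\<And>i l. l < q \<Longrightarrow> p i l \<in> polys ?d"
      "\<And>i. pz M \<Delta> * s i = (\<Sum>l<q. pz M (p i l) * g l)" by blast
    \<comment> \<open>Multiply \<open>\<Sum> a_l g_l = \<Sum> (z_i - c_i) s_i\<close> by the
      denominator and expand the \<open>s_i\<close> in the basis. \<open>P l\<close> is the
      resulting coefficient of \<open>g l\<close>; it must vanish, and at \<open>c\<close> it equals
      \<open>a l * \<Delta> c\<close>.\<close>
    define P where "P = (\<lambda>l t. a l * \<Delta> t - (\<Sum>i<?d. (t i - c i) * p i l t))"
    have "\<forall>l<q. P l \<in> polys ?d" unfolding P_def
    proof (intro allI impI)
      fix l assume "l < q"
      then show "(\<lambda>t. a l * \<Delta> t - (\<Sum>i<?d. (t i - c i) * p i l t)) \<in> polys ?d"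
        using p(1) \<Delta>(1) poly_funs.coord[of _ "tuple_coords ?d"]
        by (intro poly_funs_diff poly_funs_cmult poly_funs_sum poly_funs.mult poly_funs.const)
           (auto simp: tuple_coords_def)
    qed
    moreover have "(\<Sum>l<q. pz M (P l) * g l) = 0"
    proof
      fix u
      let ?t = "\<lambda>i. zf M i u"
      have pu: "\<Delta> ?t * s i u = (\<Sum>l<q. p i l ?t * g l u)" for i
        using fun_cong[OF p(2)[of i], of u] by simp
      have su: "(\<Sum>l<q. a l * g l u) = (\<Sum>i<?d. (zf M i u - c i) * s i u)"
        using fun_cong[OF s(2), of u] by simp
      have "(\<Sum>l<q. (\<Sum>i<?d. (?t i - c i) * p i l ?t) * g l u) = (\<Sum>i<?d. (?t i - c i) * (\<Sum>l<q. p i l ?t * g l u))"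
        unfolding sum_distrib_right sum_distrib_left by (subst sum.swap) (simp only: mult.assoc)
      also have "\<dots> = \<Delta> ?t * (\<Sum>i<?d. (?t i - c i) * s i u)"
        unfolding pu[symmetric] sum_distrib_left by (simp only: mult_ac)
      also have "\<dots> = (\<Sum>l<q. a l * \<Delta> ?t * g l u)"
        unfolding su[symmetric] sum_distrib_left by (simp only: mult_ac)
      finally show "(\<Sum>l<q. pz M (P l) * g l) u = 0 u"
        by (simp add: P_def left_diff_distrib sum_subtractf)
    qed
    ultimately have "\<forall>l<q. \<forall>t. P l t = 0" using ind unfolding mod_indep_def by blast
    then have "\<forall>l<q. P l c = 0" by blast
    then show ?thesis using c by (simp add: P_def)
  qed
  show ?thesis by (rule that[OF q g \<Delta> span indep])
qed

end

section \<open>Openness in the coefficients of the linear equations\<close>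

type_synonym 'm equations = "(nat \<Rightarrow> complex ^ 'm) \<times> (nat \<Rightarrow> complex)"

abbreviation eq_polys :: "nat \<Rightarrow> ('m::finite equations \<Rightarrow> complex) set" where
  "eq_polys k \<equiv> poly_funs (equation_coords k)"

context lissajous_setup
begin

text \<open>Elements of one fixed step whose coefficients are polynomial in the equations. Such
  families supply the matrices to which \<open>coord_span_open\<close> applies.\<close>

definition poly_family :: "nat \<Rightarrow> ('n equations \<Rightarrow> complex ^ 'd \<Rightarrow> complex) \<Rightarrow> bool" where
  "poly_family k \<Phi> \<longleftrightarrow> (\<exists>q. (\<forall>v. q v \<in> eq_polys CARD('d)) \<and>
     (\<forall>e. \<Phi> e = (\<Sum>v\<in>layer k. fscale (q v e) (expo v))))"

lemma poly_family_in_S: "poly_family k \<Phi> \<Longrightarrow> \<Phi> e \<in> S k"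
proof -
  assume "poly_family k \<Phi>"
  then obtain q where "\<Phi> e = (\<Sum>v\<in>layer k. fscale (q v e) (expo v))" unfolding poly_family_def by blast
  then show ?thesis by (simp only:) (intro S_closed expo_in_S)
qed

lemma poly_family_const:
  assumes "f \<in> S k"
  shows "poly_family k (\<lambda>_. f)"
proof -
  obtain m where "f = (\<Sum>v\<in>layer k. fscale (m v) (expo v))"
    using assms span_image_finite_iff[OF finite_layer] unfolding S_def by blast
  then show ?thesis unfolding poly_family_def
    by (intro exI[of _ "\<lambda>v _. m v"] conjI allI poly_funs.const)
qed

lemma poly_family_scale:
  assumes "poly_family k \<Phi>" "p \<in> eq_polys CARD('d)"
  shows "poly_family k (\<lambda>e. fscale (p e) (\<Phi> e))"
proof -
  obtain q where q: "\<forall>v. q v \<in> eq_polys CARD('d)" "\<forall>e. \<Phi> e = (\<Sum>v\<in>layer k. fscale (q v e) (expo v))"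
    using assms(1) unfolding poly_family_def by blast
  show ?thesis unfolding poly_family_def
  proof (intro exI[of _ "\<lambda>v e. p e * q v e"] conjI allI)
    show "(\<lambda>e. p e * q v e) \<in> eq_polys CARD('d)" for v using q(1) assms(2) by (intro poly_funs.mult) auto
    show "fscale (p e) (\<Phi> e) = (\<Sum>v\<in>layer k. fscale (p e * q v e) (expo v))" for e
      unfolding q(2)[rule_format] by (simp add: fun_eq_iff sum_distrib_left mult.assoc)
  qed
qed

lemma poly_family_add:
  assumes "poly_family k \<Phi>" "poly_family k \<Psi>"
  shows "poly_family k (\<lambda>e. \<Phi> e + \<Psi> e)"
proof -
  obtain q where q: "\<forall>v. q v \<in> eq_polys CARD('d)" "\<forall>e. \<Phi> e = (\<Sum>v\<in>layer k. fscale (q v e) (expo v))"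
    using assms(1) unfolding poly_family_def by blast
  obtain r where r: "\<forall>v. r v \<in> eq_polys CARD('d)" "\<forall>e. \<Psi> e = (\<Sum>v\<in>layer k. fscale (r v e) (expo v))"
    using assms(2) unfolding poly_family_def by blast
  show ?thesis unfolding poly_family_def
  proof (intro exI[of _ "\<lambda>v e. q v e + r v e"] conjI allI)
    show "(\<lambda>e. q v e + r v e) \<in> eq_polys CARD('d)" for v using q(1) r(1) by (intro poly_funs.add) auto
    show "\<Phi> e + \<Psi> e = (\<Sum>v\<in>layer k. fscale (q v e + r v e) (expo v))" for e
      unfolding q(2)[rule_format] r(2)[rule_format] by (simp add: fs.scale_left_distrib sum.distrib)
  qed
qed

lemma poly_family_sum:
  assumes "\<And>i. i \<in> I \<Longrightarrow> poly_family k (\<Phi> i)"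
  shows "poly_family k (\<lambda>e. \<Sum>i\<in>I. \<Phi> i e)"
  using assms
proof (induction I rule: infinite_finite_induct)
  case (infinite I)
  show ?case unfolding sum.infinite[OF infinite(1)] by (rule poly_family_const[OF S_closed(1)])
next
  case empty
  show ?case unfolding sum.empty by (rule poly_family_const[OF S_closed(1)])
next
  case (insert i I)
  show ?case unfolding sum.insert[OF insert.hyps]
    by (intro poly_family_add insert.IH insert.prems insertI1 insertI2)
qed

lemma poly_family_expo: "v \<in> layer k \<Longrightarrow> poly_family k (\<lambda>_. expo v)"
  by (rule poly_family_const[OF expo_in_S])

lemma poly_family_mono:
  assumes "poly_family k \<Phi>" "k \<le> l"
  shows "poly_family l \<Phi>"
proof -
  obtain q where q: "\<And>v. q v \<in> eq_polys CARD('d)" "\<And>e. \<Phi> e = (\<Sum>v\<in>layer k. fscale (q v e) (expo v))"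
    using assms(1) unfolding poly_family_def by blast
  have "poly_family l (\<lambda>e. \<Sum>v\<in>layer k. fscale (q v e) (expo v))"
    using layer_mono[OF assms(2)] q(1) by (intro poly_family_sum poly_family_scale poly_family_expo) auto
  then show ?thesis unfolding q(2)[symmetric] .
qed

lemma poly_family_mult:
  assumes "poly_family k \<Phi>" "poly_family l \<Psi>"
  shows "poly_family (k + l) (\<lambda>e. \<Phi> e * \<Psi> e)"
proof -
  obtain q where q: "\<And>v. q v \<in> eq_polys CARD('d)" "\<And>e. \<Phi> e = (\<Sum>v\<in>layer k. fscale (q v e) (expo v))"
    using assms(1) unfolding poly_family_def by blast
  obtain r where r: "\<And>v. r v \<in> eq_polys CARD('d)" "\<And>e. \<Psi> e = (\<Sum>v\<in>layer l. fscale (r v e) (expo v))"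
    using assms(2) unfolding poly_family_def by blast
  have "poly_family (k + l) (\<lambda>e. \<Sum>v\<in>layer k. \<Sum>w\<in>layer l. fscale (q v e * r w e) (expo (v + w)))"
    using q(1) r(1) by (intro poly_family_sum poly_family_scale poly_family_expo layer_add poly_funs.mult)
  moreover have "\<Phi> e * \<Psi> e = (\<Sum>v\<in>layer k. \<Sum>w\<in>layer l. fscale (q v e * r w e) (expo (v + w)))" for e
    unfolding q(2) r(2) by (simp add: fun_eq_iff sum_product expo_add mult_ac)
  ultimately show ?thesis by (simp only:)
qed

lemma eq_coord_M: "i < CARD('d) \<Longrightarrow> (\<lambda>e. fst e i $ j) \<in> eq_polys CARD('d)"
  by (rule poly_funs.coord) (auto simp: equation_coords_def case_prod_beta')

lemma eq_coord_c: "i < CARD('d) \<Longrightarrow> (\<lambda>e. snd e i) \<in> eq_polys CARD('d)"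
  by (rule poly_funs.coord) (auto simp: equation_coords_def case_prod_beta')

lemma poly_family_zf: "i < CARD('d) \<Longrightarrow> poly_family 1 (\<lambda>e. zf (fst e) i)"
  unfolding zf_def by (intro poly_family_sum poly_family_scale poly_family_const xf_in_S eq_coord_M)

lemma poly_family_eq: 
  assumes "i < CARD('d)" "v \<in> layer k"
  shows "poly_family (Suc k) (\<lambda>e. (zf (fst e) i - fscale (snd e i) 1) * expo v)"
proof -
  have "poly_family (1 + k) (\<lambda>e. (zf (fst e) i + fscale (- 1 * snd e i) 1) * expo v)"
    using assms by (intro poly_family_mult poly_family_add poly_family_scale poly_family_zf poly_family_expo
      poly_family_const one_in_S poly_funs_cmult eq_coord_c)
  moreover have "zf (fst e) i + fscale (- 1 * snd e i) 1 = zf (fst e) i - fscale (snd e i) 1" for e :: "'n equations"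
    by (simp add: fun_eq_iff)
  ultimately show ?thesis by (simp only: plus_1_eq_Suc)
qed

text \<open>The exponentials of a layer are linearly independent, so spanning \<open>S k\<close> is
  a rank condition on the coefficient matrix.\<close>

lemma poly_family_span_open:
  assumes "finite I" "\<And>i. i \<in> I \<Longrightarrow> poly_family k (\<Phi> i)"
    and "S k \<subseteq> fs.span ((\<lambda>i. \<Phi> i e0) ` I)"
  shows "\<exists>Q\<in>eq_polys CARD('d). Q e0 \<noteq> 0 \<and> (\<forall>e. Q e \<noteq> 0 \<longrightarrow> S k \<subseteq> fs.span ((\<lambda>i. \<Phi> i e) ` I))"
proof -
  have "\<forall>i\<in>I. \<exists>q. (\<forall>v. q v \<in> eq_polys CARD('d)) \<and> (\<forall>e. \<Phi> i e = (\<Sum>v\<in>layer k. fscale (q v e) (expo v)))"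
    using assms(2) unfolding poly_family_def by blast
  from bchoice[OF this] obtain q where q: "\<And>i v. i \<in> I \<Longrightarrow> q i v \<in> eq_polys CARD('d)"
    "\<And>i e. i \<in> I \<Longrightarrow> \<Phi> i e = (\<Sum>v\<in>layer k. fscale (q i v e) (expo v))" by blast
  have swap: "(\<Sum>i\<in>I. fscale (c i) (\<Phi> i e)) = (\<Sum>v\<in>layer k. fscale (\<Sum>i\<in>I. c i * q i v e) (expo v))" for c e
  proof -
    have "(\<Sum>i\<in>I. fscale (c i) (\<Phi> i e)) = (\<Sum>i\<in>I. \<Sum>v\<in>layer k. fscale (c i * q i v e) (expo v))"
      by (intro sum.cong refl) (simp add: q(2) fs.scale_sum_right)
    also have "\<dots> = (\<Sum>v\<in>layer k. \<Sum>i\<in>I. fscale (c i * q i v e) (expo v))" by (rule sum.swap)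
    finally show ?thesis by (simp add: fs.scale_sum_left)
  qed
  have iff: "S k \<subseteq> fs.span ((\<lambda>i. \<Phi> i e) ` I) \<longleftrightarrow> coord_span I (layer k) (\<lambda>i v. q i v e)" for e
  proof
    assume sub: "S k \<subseteq> fs.span ((\<lambda>i. \<Phi> i e) ` I)"
    show "coord_span I (layer k) (\<lambda>i v. q i v e)" unfolding coord_span_def
    proof
      fix h :: "int ^ 'd \<Rightarrow> complex"
      have "(\<Sum>v\<in>layer k. fscale (h v) (expo v)) \<in> S k" by (intro S_closed expo_in_S)
      then obtain c where "(\<Sum>v\<in>layer k. fscale (h v) (expo v)) = (\<Sum>i\<in>I. fscale (c i) (\<Phi> i e))"
        using sub span_image_finite_iff[OF assms(1), of _ "\<lambda>i. \<Phi> i e"] by blast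
      then have "(\<Sum>v\<in>layer k. fscale (h v - (\<Sum>i\<in>I. c i * q i v e)) (expo v)) = 0"
        unfolding swap by (simp add: fs.scale_left_diff_distrib sum_subtractf)
      then have "\<forall>v\<in>layer k. h v - (\<Sum>i\<in>I. c i * q i v e) = 0"
        using expo_independent[OF finite_layer, of "\<lambda>v. h v - (\<Sum>i\<in>I. c i * q i v e)" k] by simp
      then show "\<exists>c. \<forall>v\<in>layer k. h v = (\<Sum>i\<in>I. c i * q i v e)" by (intro exI[of _ c]) simp
    qed
  next
    assume cs: "coord_span I (layer k) (\<lambda>i v. q i v e)"
    show "S k \<subseteq> fs.span ((\<lambda>i. \<Phi> i e) ` I)"
    proof
      fix f assume "f \<in> S k"
      then obtain h where h: "f = (\<Sum>v\<in>layer k. fscale (h v) (expo v))"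
        unfolding S_def span_image_finite_iff[OF finite_layer] by blast
      obtain c where c: "\<forall>v\<in>layer k. h v = (\<Sum>i\<in>I. c i * q i v e)" using cs unfolding coord_span_def by blast
      have "f = (\<Sum>i\<in>I. fscale (c i) (\<Phi> i e))" unfolding swap h using c by (intro sum.cong) auto
      then show "f \<in> fs.span ((\<lambda>i. \<Phi> i e) ` I)" unfolding span_image_finite_iff[OF assms(1)] by blast
    qed
  qed
  obtain Q where "Q \<in> eq_polys CARD('d)" "Q e0 \<noteq> 0" "\<And>e. Q e \<noteq> 0 \<Longrightarrow> coord_span I (layer k) (\<lambda>i v. q i v e)"
  proof (rule coord_span_open[where w = "\<lambda>i e v. q i v e", OF finite_layer assms(1) _ assms(3)[unfolded iff]])
    show "(\<lambda>e. q i v e) \<in> eq_polys CARD('d)" if "i \<in> I" "v \<in> layer k" for i v by (rule q(1)[OF that(1)])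
  qed blast
  then show ?thesis unfolding iff by blast
qed

section \<open>Openness of the Noether condition and of spanning modulo the fiber ideal\<close>

lemma W_eq_span: "W m M k = fs.span (expo ` layer k \<union> {zf M i * expo v | i v. i < m \<and> v \<in> layer k})" (is "_ = ?T")
proof
  show "W m M k \<subseteq> ?T" unfolding W_def
  proof (rule fs.span_minimal[OF _ fs.subspace_span], rule Un_least)
    show "S k \<subseteq> ?T" unfolding S_def by (rule fs.span_mono) blast
    show "{zf M i * f | i f. i < m \<and> f \<in> S k} \<subseteq> ?T"
    proof
      fix x assume "x \<in> {zf M i * f | i f. i < m \<and> f \<in> S k}"
      then obtain i f where x: "x = zf M i * f" "i < m" "f \<in> S k" by blast
      have "f * zf M i \<in> ?T"
      proof (rule span_mult_right[OF fs.subspace_span _ x(3)[unfolded S_def]])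
        fix y assume "y \<in> expo ` layer k"
        then obtain v where v: "y = expo v" "v \<in> layer k" by blast
        have "zf M i * expo v \<in> ?T" using x(2) v(2) by (intro fs.span_base) blast
        then show "y * zf M i \<in> ?T" unfolding v(1) by (subst mult.commute)
      qed
      then show "x \<in> ?T" unfolding x(1) by (subst mult.commute)
    qed
  qed
  show "?T \<subseteq> W m M k"
    by (intro fs.span_minimal subspace_W Un_least)
       (use S_W expo_in_S zf_mult_W in blast)+
qed

lemma good_open:
  assumes "good CARD('d) (fst e0) D"
  shows "\<exists>Q\<in>eq_polys CARD('d). Q e0 \<noteq> 0 \<and> (\<forall>e. Q e \<noteq> 0 \<longrightarrow> good CARD('d) (fst e) D)"
proof -
  define I where "I = Inl ` layer D \<union> Inr ` ({..<CARD('d)} \<times> layer D)"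
  define \<Phi> where "\<Phi> = (\<lambda>x (e :: 'n equations). case x of Inl v \<Rightarrow> expo v | Inr (i, v) \<Rightarrow> zf (fst e) i * expo v)"
  have W: "W CARD('d) (fst e) D = fs.span ((\<lambda>x. \<Phi> x e) ` I)" for e :: "'n equations"
  proof -
    have "(\<lambda>x. \<Phi> x e) ` I = expo ` layer D \<union> {zf (fst e) i * expo v | i v. i < CARD('d) \<and> v \<in> layer D}"
      unfolding I_def \<Phi>_def image_Un image_image by (auto simp: image_def)
    then show ?thesis unfolding W_eq_span by simp
  qed
  have fin: "finite I" unfolding I_def using finite_layer by auto
  have fam: "poly_family (Suc D) (\<Phi> x)" if x: "x \<in> I" for x
  proof -
    from x consider v where "x = Inl v" "v \<in> layer D" | i v where "x = Inr (i, v)" "i < CARD('d)" "v \<in> layer D"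
      unfolding I_def by blast
    then show ?thesis
    proof cases
      case 1
      have "poly_family (Suc D) (\<lambda>_. expo v)" by (rule poly_family_mono[OF poly_family_expo[OF 1(2)]]) simp
      then show ?thesis unfolding 1 \<Phi>_def by simp
    next
      case 2
      have "poly_family (1 + D) (\<lambda>e. zf (fst e) i * expo v)"
        by (intro poly_family_mult poly_family_zf poly_family_expo 2)
      then show ?thesis unfolding 2 \<Phi>_def by simp
    qed
  qed
  show ?thesis unfolding good_def W by (rule poly_family_span_open[OF fin fam assms[unfolded good_def W]])
qed

text \<open>A finite-dimensional truncation of the fiber ideal. The ideal itself is
  infinite-dimensional, so openness can only be argued at a fixed level \<open>k\<close>.\<close>

definition fiber_gens :: "(nat \<Rightarrow> complex ^ 'n) \<Rightarrow> (nat \<Rightarrow> complex) \<Rightarrow> nat \<Rightarrow> (complex ^ 'd \<Rightarrow> complex) set" where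
  "fiber_gens M c k = {(zf M i - fscale (c i) 1) * expo v | i v. i < CARD('d) \<and> v \<in> layer k}"

lemma fiber_gens_mono: "k \<le> l \<Longrightarrow> fiber_gens M c k \<subseteq> fiber_gens M c l"
  unfolding fiber_gens_def using layer_mono[of k l] by blast

lemma fiber_gens_ideal: "fs.span (fiber_gens M c k) \<subseteq> fiber_ideal M c"
  unfolding fiber_gens_def
  using fiber_ideal_gen expo_in_S S_coord_ring by (intro fs.span_minimal subspace_fiber_ideal) blast

lemma fiber_gens_mult:
  assumes "i < CARD('d)" "f \<in> S k"
  shows "(zf M i - fscale (c i) 1) * f \<in> fs.span (fiber_gens M c k)"
proof -
  have "f * (zf M i - fscale (c i) 1) \<in> fs.span (fiber_gens M c k)"
  proof (rule span_mult_right[OF fs.subspace_span _ assms(2)[unfolded S_def]])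
    fix y assume "y \<in> expo ` layer k"
    then obtain v where v: "y = expo v" "v \<in> layer k" by blast
    have "(zf M i - fscale (c i) 1) * expo v \<in> fs.span (fiber_gens M c k)"
      unfolding fiber_gens_def using assms(1) v(2) by (intro fs.span_base) blast
    then show "y * (zf M i - fscale (c i) 1) \<in> fs.span (fiber_gens M c k)" unfolding v(1) by (subst mult.commute)
  qed
  then show ?thesis by (subst mult.commute)
qed

text \<open>Each product \<open>z_i * f\<close> is \<open>c_i * f\<close> plus a generator of the
  ideal, so \<open>good\<close> lowers the degree one by one down to \<open>D\<close>, with
  cofactors of bounded degree.\<close>

lemma good_reduce:
  assumes good: "good CARD('d) M D"
  shows "S (Suc (D + k)) \<subseteq> fs.span (S D \<union> fiber_gens M c (D + k))"
proof (induction k)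
  have step: "S (Suc j) \<subseteq> fs.span (S j \<union> fiber_gens M c j)" if "D \<le> j" for j
  proof -
    let ?T = "fs.span (S j \<union> fiber_gens M c j)"
    have "W CARD('d) M j \<subseteq> ?T" unfolding W_def
    proof (intro fs.span_minimal fs.subspace_span Un_least)
      show "S j \<subseteq> ?T" using fs.span_superset by blast
      show "{zf M i * f | i f. i < CARD('d) \<and> f \<in> S j} \<subseteq> ?T"
      proof
        fix x assume "x \<in> {zf M i * f | i f. i < CARD('d) \<and> f \<in> S j}"
        then obtain i f where x: "x = zf M i * f" "i < CARD('d)" "f \<in> S j" by blast
        have "(zf M i - fscale (c i) 1) * f \<in> ?T"
          using fiber_gens_mult[OF x(2,3), where c = c] fs.span_mono[of "fiber_gens M c j" "S j \<union> fiber_gens M c j"] by blast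
        moreover have "fscale (c i) f \<in> ?T" using x(3) by (intro fs.span_scale fs.span_base) blast
        ultimately have "(zf M i - fscale (c i) 1) * f + fscale (c i) f \<in> ?T" by (rule fs.span_add)
        moreover have "(zf M i - fscale (c i) 1) * f + fscale (c i) f = x"
          unfolding x(1) by (simp add: fun_eq_iff algebra_simps)
        ultimately show "x \<in> ?T" by (simp only:)
      qed
    qed
    then show ?thesis using good_step[OF good that] by blast
  qed
  {
    case 0
    show ?case unfolding add_0_right by (rule step[OF order_refl])
  next
    case (Suc k)
    have "fs.span (S D \<union> fiber_gens M c (D + k)) \<subseteq> fs.span (S D \<union> fiber_gens M c (D + Suc k))"
      using fiber_gens_mono[of "D + k" "D + Suc k" M c] by (intro fs.span_mono) auto
    then have "S (D + Suc k) \<union> fiber_gens M c (D + Suc k) \<subseteq> fs.span (S D \<union> fiber_gens M c (D + Suc k))"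
      using Suc fs.span_superset[of "S D \<union> fiber_gens M c (D + Suc k)"] unfolding add_Suc_right by blast
    then have "fs.span (S (D + Suc k) \<union> fiber_gens M c (D + Suc k)) \<subseteq> fs.span (S D \<union> fiber_gens M c (D + Suc k))"
      by (intro fs.span_minimal fs.subspace_span)
    moreover have "S (Suc (D + Suc k)) \<subseteq> fs.span (S (D + Suc k) \<union> fiber_gens M c (D + Suc k))" by (rule step) simp
    ultimately show ?case by blast
  }
qed

lemma good_coord_ring:
  assumes "good CARD('d) M D"
  shows "coord_ring \<subseteq> fs.span (S D \<union> fiber_ideal M c)"
proof
  fix s assume "s \<in> coord_ring"
  then obtain k where "s \<in> S k" using coord_ring_iff by blast
  then have "s \<in> S (Suc (D + k))" using S_mono[of k "Suc (D + k)"] by auto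
  then have "s \<in> fs.span (S D \<union> fiber_gens M c (D + k))" using good_reduce[OF assms] by blast
  moreover have "S D \<union> fiber_gens M c (D + k) \<subseteq> S D \<union> fiber_ideal M c"
    using fiber_gens_ideal fs.span_superset by blast
  ultimately show "s \<in> fs.span (S D \<union> fiber_ideal M c)" using fs.span_mono by blast
qed

lemma spans_mod_iff:
  assumes "finite L"
  shows "spans_mod M c L h \<longleftrightarrow> coord_ring \<subseteq> fs.span (h ` L \<union> fiber_ideal M c)"
proof -
  have I: "fs.span (fiber_ideal M c) = fiber_ideal M c"
    using subspace_fiber_ideal fs.span_eq_iff by blast
  have "s \<in> fs.span (h ` L \<union> fiber_ideal M c) \<longleftrightarrow> (\<exists>a. s - (\<Sum>l\<in>L. fscale (a l) (h l)) \<in> fiber_ideal M c)" for s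
  proof
    assume "s \<in> fs.span (h ` L \<union> fiber_ideal M c)"
    then obtain x y where x: "x \<in> fs.span (h ` L)" and y: "y \<in> fiber_ideal M c" and s: "s = x + y"
      unfolding fs.span_Un I by blast
    obtain a where a: "x = (\<Sum>l\<in>L. fscale (a l) (h l))" using x span_image_finite_iff[OF assms] by blast
    have "s - (\<Sum>l\<in>L. fscale (a l) (h l)) = y" unfolding s a by simp
    then show "\<exists>a. s - (\<Sum>l\<in>L. fscale (a l) (h l)) \<in> fiber_ideal M c" using y by blast
  next
    assume "\<exists>a. s - (\<Sum>l\<in>L. fscale (a l) (h l)) \<in> fiber_ideal M c"
    then obtain a where a: "s - (\<Sum>l\<in>L. fscale (a l) (h l)) \<in> fiber_ideal M c" by blast
    have "(\<Sum>l\<in>L. fscale (a l) (h l)) + (s - (\<Sum>l\<in>L. fscale (a l) (h l))) \<in> fs.span (h ` L \<union> fiber_ideal M c)"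
      using a by (intro fs.span_add fs.span_sum fs.span_scale) (auto intro: fs.span_base)
    then show "s \<in> fs.span (h ` L \<union> fiber_ideal M c)" by simp
  qed
  then show ?thesis unfolding spans_mod_def by blast
qed

text \<open>At \<open>e0\<close> the finitely many exponentials of layer \<open>D\<close> are
  expressed by \<open>h\<close> and the ideal with cofactors of some finite degree. At this level
  spanning is an open condition. At nearby \<open>e\<close> it again covers \<open>S D\<close>, and
  since \<open>good\<close> is open too, \<open>S D\<close> and the ideal give the whole
  ring.\<close>

lemma spans_mod_open:
  fixes h :: "'l \<Rightarrow> 'n equations \<Rightarrow> complex ^ 'd \<Rightarrow> complex"
  assumes good: "good CARD('d) (fst e0) D" and L: "finite L"
    and h: "\<And>l. l \<in> L \<Longrightarrow> poly_family K (h l)"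
    and spans: "spans_mod (fst e0) (snd e0) L (\<lambda>l. h l e0)"
  shows "\<exists>Q\<in>eq_polys CARD('d). Q e0 \<noteq> 0 \<and>
    (\<forall>e. Q e \<noteq> 0 \<longrightarrow> good CARD('d) (fst e) D \<and> spans_mod (fst e) (snd e) L (\<lambda>l. h l e))"
proof -
  let ?d = "CARD('d)"
  let ?I = "\<lambda>e :: 'n equations. fiber_ideal (fst e) (snd e)"
  let ?G = "\<lambda>e :: 'n equations. fiber_gens (fst e) (snd e)"
  have level: "\<exists>k. expo v \<in> fs.span ((\<lambda>l. h l e0) ` L \<union> ?G e0 k)" if v: "v \<in> layer D" for v
  proof -
    have "expo v \<in> coord_ring" using expo_in_S[OF v] S_coord_ring by blast
    then obtain a where "expo v - (\<Sum>l\<in>L. fscale (a l) (h l e0)) \<in> ?I e0"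
      using spans unfolding spans_mod_def by blast
    then obtain s where s: "\<And>i. s i \<in> coord_ring"
      "expo v - (\<Sum>l\<in>L. fscale (a l) (h l e0)) = (\<Sum>i<?d. (zf (fst e0) i - fscale (snd e0 i) 1) * s i)"
      by (rule fiber_ideal_expand) blast
    obtain k where k: "\<And>i. i \<in> {..<?d} \<Longrightarrow> s i \<in> S k" by (rule common_layer[of "{..<?d}" s]) (use s in auto)
    let ?T = "fs.span ((\<lambda>l. h l e0) ` L \<union> ?G e0 k)"
    have "(zf (fst e0) i - fscale (snd e0 i) 1) * s i \<in> ?T" if i: "i < ?d" for i
      using fiber_gens_mult[OF i k[of i], where M = "fst e0" and c = "snd e0"] i
        fs.span_mono[of "?G e0 k" "(\<lambda>l. h l e0) ` L \<union> ?G e0 k"] by auto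
    then have "(\<Sum>i<?d. (zf (fst e0) i - fscale (snd e0 i) 1) * s i) \<in> ?T" by (intro fs.span_sum) auto
    moreover have "(\<Sum>l\<in>L. fscale (a l) (h l e0)) \<in> ?T"
      by (intro fs.span_sum fs.span_scale fs.span_base) auto
    ultimately have "(expo v - (\<Sum>l\<in>L. fscale (a l) (h l e0))) + (\<Sum>l\<in>L. fscale (a l) (h l e0)) \<in> ?T"
      unfolding s(2) by (rule fs.span_add)
    then show ?thesis unfolding diff_add_cancel by blast
  qed
  then have "\<forall>v\<in>layer D. \<exists>k. expo v \<in> fs.span ((\<lambda>l. h l e0) ` L \<union> ?G e0 k)" by blast
  from bchoice[OF this] obtain kv where kv: "\<And>v. v \<in> layer D \<Longrightarrow> expo v \<in> fs.span ((\<lambda>l. h l e0) ` L \<union> ?G e0 (kv v))" by blast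
  \<comment> \<open>Large enough for the cofactors of all \<open>v\<close> at once; \<open>K\<close>
    is added so that the members of \<open>h\<close> lie in the same step.\<close>
  define k where "k = (\<Sum>v\<in>layer D. kv v) + K"
  have kvk: "kv v \<le> D + k" if "v \<in> layer D" for v
    using member_le_sum[of v "layer D" kv] that finite_layer by (simp add: k_def)
  define J where "J = Inl ` L \<union> Inr ` ({..<?d} \<times> layer (D + k))"
  define \<Phi> where "\<Phi> = (\<lambda>x (e :: 'n equations). case x of Inl l \<Rightarrow> h l e
     | Inr (i, v) \<Rightarrow> (zf (fst e) i - fscale (snd e i) 1) * expo v)"
  have im: "(\<lambda>x. \<Phi> x e) ` J = (\<lambda>l. h l e) ` L \<union> ?G e (D + k)" for e
    unfolding J_def \<Phi>_def fiber_gens_def image_Un image_image by (auto simp: image_def)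
  have finJ: "finite J" unfolding J_def using L finite_layer by auto
  have fam: "poly_family (Suc (D + k)) (\<Phi> x)" if x: "x \<in> J" for x
  proof -
    from x consider l where "x = Inl l" "l \<in> L" | i v where "x = Inr (i, v)" "i < ?d" "v \<in> layer (D + k)"
      unfolding J_def by blast
    then show ?thesis
    proof cases
      case 1
      have "poly_family (Suc (D + k)) (h l)" by (rule poly_family_mono[OF h[OF 1(2)]]) (simp add: k_def)
      then show ?thesis unfolding 1 \<Phi>_def by simp
    next
      case 2
      show ?thesis using poly_family_eq[OF 2(2,3)] unfolding 2 \<Phi>_def by simp
    qed
  qed
  have "S (Suc (D + k)) \<subseteq> fs.span ((\<lambda>x. \<Phi> x e0) ` J)" unfolding im
  proof -
    let ?T = "fs.span ((\<lambda>l. h l e0) ` L \<union> ?G e0 (D + k))"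
    have "expo v \<in> ?T" if v: "v \<in> layer D" for v
    proof -
      have "fs.span ((\<lambda>l. h l e0) ` L \<union> ?G e0 (kv v)) \<subseteq> ?T"
        using fiber_gens_mono[OF kvk[OF v]] by (intro fs.span_mono) blast
      then show ?thesis using kv[OF v] by blast
    qed
    then have "S D \<subseteq> ?T" unfolding S_def by (intro fs.span_minimal fs.subspace_span) blast
    moreover have "?G e0 (D + k) \<subseteq> ?T" using fs.span_superset by blast
    ultimately have "fs.span (S D \<union> ?G e0 (D + k)) \<subseteq> ?T" by (intro fs.span_minimal fs.subspace_span Un_least)
    then show "S (Suc (D + k)) \<subseteq> ?T" using good_reduce[OF good, where c = "snd e0"] by blast
  qed
  from poly_family_span_open[OF finJ fam this] obtain Q1 where Q1: "Q1 \<in> eq_polys CARD('d)" "Q1 e0 \<noteq> 0"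
    "\<And>e. Q1 e \<noteq> 0 \<Longrightarrow> S (Suc (D + k)) \<subseteq> fs.span ((\<lambda>x. \<Phi> x e) ` J)" by blast
  from good_open[OF good] obtain Q2 where Q2: "Q2 \<in> eq_polys CARD('d)" "Q2 e0 \<noteq> 0"
    "\<And>e. Q2 e \<noteq> 0 \<Longrightarrow> good ?d (fst e) D" by blast
  show ?thesis
  proof (intro bexI[of _ "\<lambda>e. Q1 e * Q2 e"] conjI allI impI)
    show "(\<lambda>e. Q1 e * Q2 e) \<in> eq_polys CARD('d)" by (intro poly_funs.mult Q1 Q2)
    show "Q1 e0 * Q2 e0 \<noteq> 0" using Q1 Q2 by simp
    fix e assume e: "Q1 e * Q2 e \<noteq> 0"
    then show goode: "good ?d (fst e) D" using Q2 by simp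
    let ?T = "fs.span ((\<lambda>l. h l e) ` L \<union> ?I e)"
    have "fs.span ((\<lambda>l. h l e) ` L \<union> ?G e (D + k)) \<subseteq> ?T"
    proof (rule fs.span_mono)
      have "?G e (D + k) \<subseteq> ?I e" using fiber_gens_ideal fs.span_superset by blast
      then show "(\<lambda>l. h l e) ` L \<union> ?G e (D + k) \<subseteq> (\<lambda>l. h l e) ` L \<union> ?I e" by blast
    qed
    then have "S (Suc (D + k)) \<subseteq> ?T" using Q1(3)[of e] e unfolding im by auto
    then have "S D \<subseteq> ?T" using S_mono[of D "Suc (D + k)"] by auto
    moreover have "?I e \<subseteq> ?T" using fs.span_superset by blast
    ultimately have "fs.span (S D \<union> ?I e) \<subseteq> ?T" by (intro fs.span_minimal fs.subspace_span Un_least)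
    then have "coord_ring \<subseteq> ?T" using good_coord_ring[OF goode] by blast
    then show "spans_mod (fst e) (snd e) L (\<lambda>l. h l e)" unfolding spans_mod_iff[OF L] .
  qed
qed

lemma eq_polys_fixed_M:
  fixes Q :: "'n equations \<Rightarrow> complex"
  assumes "Q \<in> eq_polys CARD('d)"
  shows "(\<lambda>c. Q (M, c)) \<in> polys CARD('d)"
proof (rule poly_funs_compose[OF assms])
  fix f :: "'n equations \<Rightarrow> complex" assume "f \<in> equation_coords CARD('d)"
  then consider i j where "f = (\<lambda>(M, c). M i $ j)" | i where "i < CARD('d)" "f = (\<lambda>(M, c). c i)"
    unfolding equation_coords_def by blast
  then show "(\<lambda>c. f (M, c)) \<in> polys CARD('d)"
  proof cases
    case 1
    then show ?thesis by (simp add: poly_funs.const)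
  next
    case 2
    then show ?thesis by (auto intro!: poly_funs.coord simp: tuple_coords_def)
  qed
qed

text \<open>The codimension of the fiber ideal never drops below the generic one: a smaller spanning set
  would persist for generic right-hand sides, where the codimension equals the rank.\<close>

lemma spans_mod_card_ge:
  assumes good: "good CARD('d) M D" and L: "finite L" and h: "\<And>l. l \<in> L \<Longrightarrow> h l \<in> coord_ring"
    and spans: "spans_mod M c L h"
  shows "fact CARD('d) * growth \<le> real (card L)"
proof (rule ccontr)
  assume less: "\<not> ?thesis"
  let ?d = "CARD('d)"
  obtain r g \<Delta> where r: "real r = fact ?d * growth" and g: "\<And>l. l < r \<Longrightarrow> g l \<in> coord_ring"
    and \<Delta>: "\<Delta> \<in> polys ?d" "\<exists>t. \<Delta> t \<noteq> 0"
    and ind: "\<And>c a. \<Delta> c \<noteq> 0 \<Longrightarrow> (\<Sum>l<r. fscale (a l) (g l)) \<in> fiber_ideal M c \<Longrightarrow> \<forall>l<r. a l = 0"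
    by (rule module_basis_fiber[OF good]) blast
  obtain K where K: "\<And>l. l \<in> L \<Longrightarrow> h l \<in> S K" by (rule common_layer[of L h]) (use L h in auto)
  have good': "good ?d (fst (M, c)) D" using good by simp
  have spans': "spans_mod (fst (M, c)) (snd (M, c)) L (\<lambda>l. (\<lambda>l (_ :: 'n equations). h l) l (M, c))"
    using spans by simp
  from spans_mod_open[OF good' L poly_family_const[OF K] spans']
  obtain Q where Q: "Q \<in> eq_polys CARD('d)" "Q (M, c) \<noteq> 0"
    "\<And>e. Q e \<noteq> 0 \<Longrightarrow> good ?d (fst e) D \<and> spans_mod (fst e) (snd e) L h" by blast
  obtain t where t: "\<Delta> t \<noteq> 0" using \<Delta> by blast
  obtain c' where c': "Q (M, c') \<noteq> 0" "\<Delta> c' \<noteq> 0"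
    using poly_funs_nonzero_common[OF line_coords_tuple eq_polys_fixed_M[OF Q(1), of M], of c \<Delta> t] Q(2) \<Delta>(1) t
    by blast
  have "card L < card {..<r}" using less r by simp
  moreover have "\<exists>a. g l - (\<Sum>l\<in>L. fscale (a l) (h l)) \<in> fiber_ideal M c'" if "l \<in> {..<r}" for l
    using Q(3)[OF c'(1)] g that unfolding spans_mod_def by auto
  ultimately obtain a where "\<exists>l\<in>{..<r}. a l \<noteq> 0" "(\<Sum>l<r. fscale (a l) (g l)) \<in> fiber_ideal M c'"
    using dependent_mod_subspace[where f = g and V = L and I = "{..<r}" and W = "fiber_ideal M c'" and g = h]
      subspace_fiber_ideal L by blast
  then show False using ind[OF c'(2)] by blast
qed


section \<open>Points, homomorphisms and point derivations of the coordinate ring\<close>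

definition ymap :: "complex ^ 'd \<Rightarrow> complex ^ 'n" where
  "ymap u = (\<chi> j. \<beta> j * expo (column j A) u)"

definition xmap :: "complex ^ 'd \<Rightarrow> complex ^ 'n" where
  "xmap u = (\<chi> j. xf j u)"

lemma ymap_nonzero: "ymap u $ j \<noteq> 0"
  by (simp add: ymap_def)

lemma xmap_ymap: "xmap u $ j = (ymap u $ j + inverse (ymap u $ j)) / 2"
  by (simp add: xmap_def xf_def ymap_def expo_minus add_divide_distrib)

lemma zf_xmap: "zf M i u = (\<Sum>j\<in>UNIV. M i $ j * xmap u $ j)"
  by (simp add: zf_def xmap_def)

lemma col_in_coord_ring: "expo (column j A) \<in> coord_ring"
  unfolding coord_ring_def by (intro fs.span_base imageI col_lattice_closed)

lemma coord_ring_induct: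
  assumes "fs.subspace T" "\<And>v. v \<in> col_lattice A \<Longrightarrow> expo v \<in> T"
  shows "coord_ring \<subseteq> T"
  unfolding coord_ring_def using assms by (intro fs.span_minimal) blast

lemma expo_comb: "expo (comb l) u = (\<Prod>j\<in>UNIV. expo (column j A) u powi l j)"
  by (simp add: comb_def expo_sum expo_scale)

lemma ymap_eq_iff: "ymap u = ymap u' \<longleftrightarrow> (\<forall>f\<in>coord_ring. f u = f u')"
proof
  assume "ymap u = ymap u'"
  then have col: "expo (column j A) u = expo (column j A) u'" for j
    by (auto simp: ymap_def vec_eq_iff)
  have "fs.subspace {f :: complex ^ 'd \<Rightarrow> complex. f u = f u'}" by (rule fs.subspaceI) auto
  then have "coord_ring \<subseteq> {f. f u = f u'}"
    by (rule coord_ring_induct) (auto simp: col_lattice_eq expo_comb col)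
  then show "\<forall>f\<in>coord_ring. f u = f u'" by blast
next
  assume "\<forall>f\<in>coord_ring. f u = f u'"
  then show "ymap u = ymap u'" using col_in_coord_ring by (auto simp: ymap_def vec_eq_iff)
qed

text \<open>On exponentials a homomorphism is a character of the column lattice, and characters are
  evaluations at points of the parametrization. This is the Nullstellensatz for this ring.\<close>

lemma coord_ring_hom_point:
  assumes "\<psi> 1 = 1" "\<And>f h. f \<in> coord_ring \<Longrightarrow> h \<in> coord_ring \<Longrightarrow> \<psi> (f + h) = \<psi> f + \<psi> h"
    "\<And>c f. f \<in> coord_ring \<Longrightarrow> \<psi> (fscale c f) = c * \<psi> f"
    "\<And>f h. f \<in> coord_ring \<Longrightarrow> h \<in> coord_ring \<Longrightarrow> \<psi> (f * h) = \<psi> f * \<psi> h"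
  shows "\<exists>u. \<forall>f\<in>coord_ring. \<psi> f = f u"
proof -
  note R = subalgebra_closed[OF subalgebra_coord_ring]
  have expR: "expo v \<in> coord_ring" if "v \<in> col_lattice A" for v
    unfolding coord_ring_def using that by (intro fs.span_base imageI)
  have "\<exists>u. \<forall>v\<in>col_lattice A. \<psi> (expo v) = expo v u"
  proof (rule character_extension)
    show "\<psi> (expo (v + w)) = \<psi> (expo v) * \<psi> (expo w)" if "v \<in> col_lattice A" "w \<in> col_lattice A" for v w
      unfolding expo_add using that by (intro assms(4) expR)
    show "\<psi> (expo v) \<noteq> 0" if "v \<in> col_lattice A" for v
    proof
      assume 0: "\<psi> (expo v) = 0"
      have "\<psi> (expo v * expo (- v)) = \<psi> (expo v) * \<psi> (expo (- v))"
        using that by (intro assms(4) expR col_lattice_closed)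
      then show False using 0 assms(1) by (simp add: expo_add[symmetric])
    qed
  qed (use col_lattice_closed in auto)
  then obtain u where u: "\<And>v. v \<in> col_lattice A \<Longrightarrow> \<psi> (expo v) = expo v u" by blast
  have "\<psi> 0 = 0"
  proof -
    have "\<psi> (fscale 0 0) = 0 * \<psi> 0" by (rule assms(3)[OF R(2)])
    then show ?thesis by (simp only: fs.scale_zero_left mult_zero_left)
  qed
  have "fs.subspace {f\<in>coord_ring. \<psi> f = f u}"
    by (rule fs.subspaceI) (use R(2,3,5) assms(2,3) \<open>\<psi> 0 = 0\<close> in auto)
  then have "coord_ring \<subseteq> {f\<in>coord_ring. \<psi> f = f u}"
    by (rule coord_ring_induct) (use u expR in blast)
  then show ?thesis by blast
qed

text \<open>The column lattice contains \<open>N\<close> times every unit vector, so the functional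
  is determined by its values there, divided by \<open>N\<close>.\<close>

lemma additive_linear:
  fixes \<mu> :: "int ^ 'd \<Rightarrow> complex"
  assumes add: "\<And>v w. v \<in> col_lattice A \<Longrightarrow> w \<in> col_lattice A \<Longrightarrow> \<mu> (v + w) = \<mu> v + \<mu> w"
  obtains m :: "complex ^ 'd" where "\<And>v. v \<in> col_lattice A \<Longrightarrow> \<mu> v = (\<Sum>k\<in>UNIV. of_int (v $ k) * m $ k)"
proof -
  note L = col_lattice_closed
  have zero: "\<mu> 0 = 0" using add[OF L(1) L(1)] by simp
  have minus: "\<mu> (- v) = - \<mu> v" if "v \<in> col_lattice A" for v
    using add[OF that L(4)[OF that]] zero by (simp add: eq_neg_iff_add_eq_0 add.commute)
  have nat: "\<mu> (int k *s v) = of_nat k * \<mu> v" if v: "v \<in> col_lattice A" for k v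
  proof (induction k)
    case (Suc k)
    have "int (Suc k) *s v = v + int k *s v" by (simp add: vec_eq_iff algebra_simps)
    then have "\<mu> (int (Suc k) *s v) = \<mu> v + \<mu> (int k *s v)" using add[OF v L(5)[OF v]] by simp
    then show ?case using Suc by (simp add: algebra_simps)
  qed (simp add: zero)
  have scale: "\<mu> (k *s v) = of_int k * \<mu> v" if v: "v \<in> col_lattice A" for k v
  proof (cases k)
    case (nonneg n)
    then show ?thesis using nat[OF v] by simp
  next
    case (neg n)
    have "k *s v = - (int (Suc n) *s v)" unfolding neg by (simp add: vec_eq_iff)
    then have "\<mu> (k *s v) = - (of_nat (Suc n) * \<mu> v)" using minus[OF L(5)[OF v]] nat[OF v] by metis
    then show ?thesis unfolding neg by (simp only: of_int_minus of_int_of_nat_eq minus_mult_left)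
  qed
  have sum: "\<mu> (\<Sum>i\<in>I. w i) = (\<Sum>i\<in>I. \<mu> (w i)) \<and> (\<Sum>i\<in>I. w i) \<in> col_lattice A"
    if "\<And>i. i \<in> I \<Longrightarrow> w i \<in> col_lattice A" for w and I :: "'d set"
    using that by (induction I rule: infinite_finite_induct) (auto simp: zero L add)
  obtain N where N: "N > 0" "\<And>v. int N *s v \<in> col_lattice A" using multiple_in_lattice by blast
  define m where "m = (\<chi> k. \<mu> (int N *s axis k 1) / of_nat N)"
  have "\<mu> v = (\<Sum>k\<in>UNIV. of_int (v $ k) * m $ k)" if v: "v \<in> col_lattice A" for v
  proof -
    have "int N *s v = (\<Sum>k\<in>UNIV. v $ k *s (int N *s axis k 1))"
      by (simp add: vec_eq_iff axis_def if_distrib[where f="\<lambda>x. _ * x"] cong: if_cong)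
    then have "of_nat N * \<mu> v = \<mu> (\<Sum>k\<in>UNIV. v $ k *s (int N *s axis k 1))" using nat[OF v] by metis
    also have "\<dots> = (\<Sum>k\<in>UNIV. \<mu> (v $ k *s (int N *s axis k 1)))" by (rule conjunct1[OF sum]) (intro L(5) N(2))
    also have "\<dots> = (\<Sum>k\<in>UNIV. of_int (v $ k) * \<mu> (int N *s axis k 1))" using scale[OF N(2)] by simp
    also have "\<dots> = of_nat N * (\<Sum>k\<in>UNIV. of_int (v $ k) * m $ k)"
      using N(1) by (simp add: m_def sum_distrib_left)
    finally show ?thesis using N(1) by simp
  qed
  then show ?thesis using that by blast
qed

text \<open>Equations are numbered by naturals, while a determinant needs rows indexed by the type
  \<open>'d\<close>; this bijection mediates.\<close>

definition eq_index :: "'d \<Rightarrow> nat" where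
  "eq_index = (SOME f. bij_betw f UNIV {..<CARD('d)})"

lemma bij_eq_index: "bij_betw eq_index UNIV {..<CARD('d)}"
proof -
  have "\<exists>f :: 'd \<Rightarrow> nat. bij_betw f UNIV {..<CARD('d)}"
    by (rule finite_same_card_bij) auto
  then show ?thesis unfolding eq_index_def by (rule someI_ex)
qed

lemma eq_index_less: "eq_index r < CARD('d)"
  using bij_eq_index unfolding bij_betw_def by auto

text \<open>Up to the factor \<open>\<i>\<close>, \<open>dxf j u\<close> is the derivative of \<open>xf j\<close> in the direction of its frequency.\<close>

definition dxf :: "'n \<Rightarrow> complex ^ 'd \<Rightarrow> complex" where
  "dxf j = fscale (\<beta> j / 2) (expo (column j A)) + fscale (- inverse (\<beta> j) / 2) (expo (- column j A))"

text \<open>The partial derivative of the form number \<open>eq_index r\<close> with respect to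
  \<open>u $ k\<close>, divided by \<open>\<i>\<close>. Hence \<open>jac\<close> is the Jacobian
  determinant of the system up to a power of \<open>\<i>\<close>.\<close>

definition jac_entry :: "(nat \<Rightarrow> complex ^ 'n) \<Rightarrow> 'd \<Rightarrow> 'd \<Rightarrow> complex ^ 'd \<Rightarrow> complex" where
  "jac_entry M r k = (\<Sum>j\<in>UNIV. fscale (M (eq_index r) $ j * of_int (A $ k $ j)) (dxf j))"

definition jac :: "(nat \<Rightarrow> complex ^ 'n) \<Rightarrow> complex ^ 'd \<Rightarrow> complex" where
  "jac M u = det (\<chi> r k. jac_entry M r k u)"

text \<open>The logarithmic derivative \<open>\<delta> (expo v) / expo v u\<close> is additive in
  \<open>v\<close>, hence linear; its coefficient vector \<open>m\<close> is the tangent vector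
  behind the derivation.\<close>

lemma derivation_on_expo:
  assumes add: "\<And>f h. f \<in> coord_ring \<Longrightarrow> h \<in> coord_ring \<Longrightarrow> \<delta> (f + h) = \<delta> f + \<delta> h"
    and prod: "\<And>f h. f \<in> coord_ring \<Longrightarrow> h \<in> coord_ring \<Longrightarrow> \<delta> (f * h) = f u * \<delta> h + h u * \<delta> f"
  obtains m :: "complex ^ 'd" where
    "\<And>v. v \<in> col_lattice A \<Longrightarrow> \<delta> (expo v) = expo v u * (\<Sum>k\<in>UNIV. of_int (v $ k) * m $ k)"
proof -
  have expR: "expo v \<in> coord_ring" if "v \<in> col_lattice A" for v
    unfolding coord_ring_def using that by (intro fs.span_base imageI)
  define \<mu> where "\<mu> = (\<lambda>v. \<delta> (expo v) / expo v u)"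
  have "\<mu> (v + w) = \<mu> v + \<mu> w" if "v \<in> col_lattice A" "w \<in> col_lattice A" for v w
  proof -
    have "\<delta> (expo (v + w)) = expo v u * \<delta> (expo w) + expo w u * \<delta> (expo v)"
      unfolding expo_add using that by (intro prod expR)
    then show ?thesis by (simp add: \<mu>_def expo_add field_simps)
  qed
  then obtain m :: "complex ^ 'd" where m: "\<And>v. v \<in> col_lattice A \<Longrightarrow> \<mu> v = (\<Sum>k\<in>UNIV. of_int (v $ k) * m $ k)"
    using additive_linear[of \<mu>] by blast
  have "\<delta> (expo v) = expo v u * \<mu> v" for v by (simp add: \<mu>_def)
  then show ?thesis using that m by metis
qed

text \<open>Killing the generators \<open>z_i - c_i\<close> says that the tangent vector
  \<open>m\<close> lies in the kernel of the Jacobian matrix, so it is 0.\<close>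

lemma derivation_zero:
  assumes jac: "jac M u \<noteq> 0"
    and add: "\<And>f h. f \<in> coord_ring \<Longrightarrow> h \<in> coord_ring \<Longrightarrow> \<delta> (f + h) = \<delta> f + \<delta> h"
    and scale: "\<And>c f. f \<in> coord_ring \<Longrightarrow> \<delta> (fscale c f) = c * \<delta> f"
    and prod: "\<And>f h. f \<in> coord_ring \<Longrightarrow> h \<in> coord_ring \<Longrightarrow> \<delta> (f * h) = f u * \<delta> h + h u * \<delta> f"
    and ideal: "\<forall>f\<in>fiber_ideal M c. \<delta> f = 0"
  shows "\<forall>f\<in>coord_ring. \<delta> f = 0"
proof -
  note R = subalgebra_closed[OF subalgebra_coord_ring]
  have expR: "expo v \<in> coord_ring" if "v \<in> col_lattice A" for v
    unfolding coord_ring_def using that by (intro fs.span_base imageI)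
  obtain m :: "complex ^ 'd" where
    m: "\<And>v. v \<in> col_lattice A \<Longrightarrow> \<delta> (expo v) = expo v u * (\<Sum>k\<in>UNIV. of_int (v $ k) * m $ k)"
    using derivation_on_expo[of \<delta> u, OF add prod] by blast
  have zero: "\<delta> 0 = 0"
  proof -
    have "\<delta> (fscale 0 0) = 0 * \<delta> 0" by (rule scale[OF R(2)])
    then show ?thesis by (simp only: fs.scale_zero_left mult_zero_left)
  qed
  have one: "\<delta> 1 = 0"
    using prod[OF R(1) R(1)] by (simp only: mult_1_right one_fun_apply mult_1_left) simp
  have dsum: "\<delta> (\<Sum>i\<in>I. h i) = (\<Sum>i\<in>I. \<delta> (h i))" if "\<And>i. i \<in> I \<Longrightarrow> h i \<in> coord_ring" for I :: "'n set" and h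
    using finite[of I] that
  proof (induction I rule: finite_induct)
    case (insert i I)
    then show ?case unfolding sum.insert[OF insert.hyps] using add[OF _ R(8)] by (metis insertI1 insertI2)
  qed (simp_all only: sum.empty zero)
  have dxf: "\<delta> (xf j) = dxf j u * (\<Sum>k\<in>UNIV. of_int (A $ k $ j) * m $ k)" for j
  proof -
    have e: "expo (column j A) \<in> coord_ring" "expo (- column j A) \<in> coord_ring"
      by (intro expR col_lattice_closed)+
    have "\<delta> (xf j) = \<beta> j / 2 * \<delta> (expo (column j A)) + inverse (\<beta> j) / 2 * \<delta> (expo (- column j A))"
      unfolding xf_def by (simp only: add[OF R(5)[OF e(1)] R(5)[OF e(2)]] scale[OF e(1)] scale[OF e(2)])
    also have "\<delta> (expo (column j A)) = expo (column j A) u * (\<Sum>k\<in>UNIV. of_int (A $ k $ j) * m $ k)"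
      using m[OF col_lattice_closed(6)] by (simp add: column_def)
    also have "\<delta> (expo (- column j A)) = - expo (- column j A) u * (\<Sum>k\<in>UNIV. of_int (A $ k $ j) * m $ k)"
      using m[OF col_lattice_closed(4)[OF col_lattice_closed(6)]] by (simp add: column_def sum_negf)
    finally show ?thesis unfolding dxf_def by (simp add: algebra_simps)
  qed
  have xfR: "xf j \<in> coord_ring" for j using xf_in_S S_coord_ring by blast
  have dzf: "\<delta> (zf M i) = (\<Sum>j\<in>UNIV. M i $ j * \<delta> (xf j))" for i
    unfolding zf_def by (subst dsum) (simp_all add: R(5) xfR scale)
  have dz0: "\<delta> (zf M i) = 0" if "i < CARD('d)" for i
  proof -
    have "\<delta> ((zf M i - fscale (c i) 1) * 1) = 0" using ideal fiber_ideal_gen[OF that R(1)] by blast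
    moreover have "\<delta> (zf M i) = \<delta> ((zf M i - fscale (c i) 1) + fscale (c i) 1)" by (simp only: diff_add_cancel)
    moreover have "\<dots> = \<delta> (zf M i - fscale (c i) 1) + c i * \<delta> 1"
      using add[OF zf_const_in_coord_ring R(5)[OF R(1)]] scale[OF R(1)] by metis
    ultimately show ?thesis using one by (simp only: mult_1_right) simp
  qed
  define J where "J = (\<chi> r k. jac_entry M r k u)"
  have "J *v m = 0"
  proof -
    have "(J *v m) $ r = \<delta> (zf M (eq_index r))" for r
    proof -
      have "(J *v m) $ r = (\<Sum>k\<in>UNIV. \<Sum>j\<in>UNIV. M (eq_index r) $ j * (of_int (A $ k $ j) * dxf j u * m $ k))"
        by (simp add: matrix_vector_mult_def J_def jac_entry_def sum_distrib_right sum_distrib_left mult_ac)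
      also have "\<dots> = (\<Sum>j\<in>UNIV. \<Sum>k\<in>UNIV. M (eq_index r) $ j * (of_int (A $ k $ j) * dxf j u * m $ k))"
        by (rule sum.swap)
      also have "\<dots> = \<delta> (zf M (eq_index r))"
        unfolding dzf dxf by (simp add: sum_distrib_left mult_ac)
      finally show ?thesis .
    qed
    then show ?thesis using dz0[OF eq_index_less] by (simp add: vec_eq_iff)
  qed
  moreover have "invertible J" unfolding invertible_det_nz using jac by (simp add: J_def jac_def)
  ultimately have "m = 0" using matrix_left_invertible_ker[of J] unfolding invertible_def by blast
  then have "\<delta> (expo v) = 0" if "v \<in> col_lattice A" for v using m[OF that] by simp
  moreover have "fs.subspace {f\<in>coord_ring. \<delta> f = 0}"
    by (rule fs.subspaceI) (use R(2,3,5) add scale zero in auto)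
  ultimately have "coord_ring \<subseteq> {f\<in>coord_ring. \<delta> f = 0}"
    by (intro coord_ring_induct) (use expR in auto)
  then show ?thesis by blast
qed

text \<open>Spanning is assumed, independence follows: in a dependent family one member could be
  dropped, and the rest would span with fewer elements than \<open>spans_mod_card_ge\<close>
  permits.\<close>

theorem fiber_card:
  assumes good: "good CARD('d) M D" and r: "real r = fact CARD('d) * growth"
    and g: "\<And>l. l < r \<Longrightarrow> g l \<in> coord_ring" and spans: "spans_mod M c {..<r} g"
    and jac: "\<And>u. (\<forall>i<CARD('d). zf M i u = c i) \<Longrightarrow> jac M u \<noteq> 0"
  shows "finite (ymap ` {u. \<forall>i<CARD('d). zf M i u = c i}) \<and> card (ymap ` {u. \<forall>i<CARD('d). zf M i u = c i}) = r"
proof -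
  have indep: "\<forall>l<r. a l = 0" if a: "(\<Sum>l<r. fscale (a l) (g l)) \<in> fiber_ideal M c" for a
  proof (rule ccontr)
    assume "\<not> (\<forall>l<r. a l = 0)"
    then obtain l0 where l0: "l0 < r" "a l0 \<noteq> 0" by blast
    have "spans_mod M c ({..<r} - {l0}) g" unfolding spans_mod_def
    proof
      fix s assume "s \<in> coord_ring"
      then obtain b where b: "s - (\<Sum>l<r. fscale (b l) (g l)) \<in> fiber_ideal M c"
        using spans unfolding spans_mod_def by blast
      let ?b = "\<lambda>l. b l - b l0 / a l0 * a l"
      have "(s - (\<Sum>l<r. fscale (b l) (g l))) + fscale (b l0 / a l0) (\<Sum>l<r. fscale (a l) (g l)) \<in> fiber_ideal M c"
        by (intro fs.subspace_add[OF subspace_fiber_ideal] fs.subspace_scale[OF subspace_fiber_ideal] a b)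
      moreover have "(s - (\<Sum>l<r. fscale (b l) (g l))) + fscale (b l0 / a l0) (\<Sum>l<r. fscale (a l) (g l))
          = s - (\<Sum>l<r. fscale (?b l) (g l))"
        by (simp add: fun_eq_iff algebra_simps sum_subtractf sum_distrib_left)
      moreover have "(\<Sum>l<r. fscale (?b l) (g l)) = (\<Sum>l\<in>{..<r} - {l0}. fscale (?b l) (g l))"
        using l0 by (subst sum.remove[of _ l0]) auto
      ultimately show "\<exists>a. s - (\<Sum>l\<in>{..<r} - {l0}. fscale (a l) (g l)) \<in> fiber_ideal M c"
        by (intro exI[of _ ?b]) (simp only:)
    qed
    then have "fact CARD('d) * growth \<le> real (card ({..<r} - {l0}))"
      using g by (intro spans_mod_card_ge[OF good]) auto
    then show False using r l0 by simp
  qed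
  have zeros: "{u. \<forall>f\<in>fiber_ideal M c. f u = 0} = {u. \<forall>i<CARD('d). zf M i u = c i}"
    unfolding fiber_ideal_zeros ..
  show ?thesis unfolding zeros[symmetric]
  proof (rule card_zeros_eq_codimension[OF subalgebra_coord_ring ideal_fiber_ideal g _ indep])
    show "\<exists>a. f - (\<Sum>l<r. fscale (a l) (g l)) \<in> fiber_ideal M c" if "f \<in> coord_ring" for f
      using spans that unfolding spans_mod_def by blast
    show "ymap u = ymap u' \<longleftrightarrow> (\<forall>f\<in>coord_ring. f u = f u')" for u u' by (rule ymap_eq_iff)
    show "\<exists>u. \<forall>f\<in>coord_ring. \<psi> f = f u"
      if "\<psi> 1 = 1" "\<And>f h. f \<in> coord_ring \<Longrightarrow> h \<in> coord_ring \<Longrightarrow> \<psi> (f + h) = \<psi> f + \<psi> h"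
        "\<And>c f. f \<in> coord_ring \<Longrightarrow> \<psi> (fscale c f) = c * \<psi> f"
        "\<And>f h. f \<in> coord_ring \<Longrightarrow> h \<in> coord_ring \<Longrightarrow> \<psi> (f * h) = \<psi> f * \<psi> h" for \<psi>
      using that by (rule coord_ring_hom_point)
    show "\<forall>f\<in>coord_ring. \<delta> f = 0"
      if z: "\<forall>f\<in>fiber_ideal M c. f u = 0"
        and d: "\<And>f h. f \<in> coord_ring \<Longrightarrow> h \<in> coord_ring \<Longrightarrow> \<delta> (f + h) = \<delta> f + \<delta> h"
        "\<And>c f. f \<in> coord_ring \<Longrightarrow> \<delta> (fscale c f) = c * \<delta> f"
        "\<And>f h. f \<in> coord_ring \<Longrightarrow> h \<in> coord_ring \<Longrightarrow> \<delta> (f * h) = f u * \<delta> h + h u * \<delta> f"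
        "\<forall>f\<in>fiber_ideal M c. \<delta> f = 0" for u \<delta>
    proof (rule derivation_zero[OF _ d])
      show "jac M u \<noteq> 0" using z unfolding fiber_ideal_zeros by (rule jac)
    qed
  qed
qed

section \<open>Generic systems of equations\<close>

lemma poly_family_prod:
  assumes "finite I" "\<And>i. i \<in> I \<Longrightarrow> poly_family 1 (\<Phi> i)"
  shows "poly_family (card I) (\<lambda>e. \<Prod>i\<in>I. \<Phi> i e)"
  using assms
proof (induction I rule: finite_induct)
  case empty
  show ?case unfolding prod.empty by (rule poly_family_const[OF one_in_S])
next
  case (insert i I)
  have "poly_family (1 + card I) (\<lambda>e. \<Phi> i e * (\<Prod>i\<in>I. \<Phi> i e))"
    by (intro poly_family_mult insert.IH insert.prems insertI1 insertI2)
  then show ?case unfolding prod.insert[OF insert.hyps] card_insert_disjoint[OF insert.hyps] plus_1_eq_Suc .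
qed

lemma dxf_in_S: "dxf j \<in> S 1"
  unfolding dxf_def by (intro S_closed expo_in_S col_in_layer)

lemma poly_family_jac: "poly_family CARD('d) (\<lambda>e. jac (fst e))"
proof -
  have "poly_family 1 (\<lambda>e. jac_entry (fst e) r k)" for r k
  proof -
    have "(\<lambda>e. fst e (eq_index r) $ j * of_int (A $ k $ j)) \<in> eq_polys CARD('d)" for j
      by (intro poly_funs.mult poly_funs.const eq_coord_M eq_index_less)
    then show ?thesis unfolding jac_entry_def
      by (intro poly_family_sum poly_family_scale poly_family_const dxf_in_S)
  qed
  then have "poly_family CARD('d) (\<lambda>e. \<Prod>r\<in>UNIV. jac_entry (fst e) r (p r))" for p
    by (intro poly_family_prod) auto
  then have "poly_family CARD('d) (\<lambda>e. \<Sum>p\<in>{p. p permutes (UNIV :: 'd set)}.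
      fscale (of_int (sign p)) (\<Prod>r\<in>UNIV. jac_entry (fst e) r (p r)))"
    by (intro poly_family_sum poly_family_scale poly_funs.const)
  moreover have "jac (fst e) = (\<Sum>p\<in>{p. p permutes (UNIV :: 'd set)}.
      fscale (of_int (sign p)) (\<Prod>r\<in>UNIV. jac_entry (fst e) r (p r)))" for e :: "'n equations"
    by (simp add: fun_eq_iff jac_def det_def)
  ultimately show ?thesis by (simp only:)
qed

lemma poly_family_eval:
  assumes "poly_family k \<Phi>"
  shows "(\<lambda>e. \<Phi> e u) \<in> eq_polys CARD('d)"
proof -
  obtain q where q: "\<And>v. q v \<in> eq_polys CARD('d)" "\<And>e. \<Phi> e = (\<Sum>v\<in>layer k. fscale (q v e) (expo v))"
    using assms unfolding poly_family_def by blast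
  have "(\<lambda>e. \<Sum>v\<in>layer k. q v e * expo v u) \<in> eq_polys CARD('d)"
    by (intro poly_funs_sum poly_funs.mult poly_funs.const q(1))
  then show ?thesis unfolding q(2) by simp
qed

text \<open>Use as forms the single coordinates that belong to a nonzero minor. The Jacobian then
  factors into this minor and the derivatives \<open>dxf (J r)\<close>, none of which is the zero
  function.\<close>

lemma jac_nonzero: "\<exists>M u. jac M u \<noteq> 0"
proof -
  obtain J :: "'d \<Rightarrow> 'n" where J: "det (\<chi> i k. A $ i $ J k) \<noteq> 0" using minor_exists by blast
  have "(\<Prod>r\<in>UNIV. dxf (J r)) \<in> exp_span \<and> (\<Prod>r\<in>(UNIV :: 'd set). dxf (J r)) \<noteq> 0"
  proof (rule exp_span_prod_nonzero)
    fix r :: 'd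
    show "dxf (J r) \<in> exp_span" using dxf_in_S S_coord_ring coord_ring_exp_span by blast
    show "dxf (J r) \<noteq> 0"
    proof
      assume 0: "dxf (J r) = 0"
      let ?a = "column (J r) A"
      have "?a \<noteq> 0"
      proof
        assume "?a = 0"
        then have "column r (\<chi> i k. A $ i $ J k) = 0" by (simp add: column_def vec_eq_iff)
        then show False using J det_zero_column by blast
      qed
      \<comment> \<open>The columns of a nonzero minor are nonzero, so the two exponentials in
        \<open>dxf (J r)\<close> have different frequencies and cannot cancel.\<close>
      then have ne: "?a \<noteq> - ?a" by (auto simp: vec_eq_iff)
      define c where "c = (\<lambda>v. if v = ?a then \<beta> (J r) / 2 else - inverse (\<beta> (J r)) / 2)"
      have "(\<Sum>v\<in>{?a, - ?a}. fscale (c v) (expo v)) = dxf (J r)"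
        using ne unfolding dxf_def by (simp add: c_def)
      then have "c ?a = 0" using 0 by (intro expo_independent[of "{?a, - ?a}" c]) auto
      then show False by (simp add: c_def)
    qed
  qed auto
  then obtain u where u: "(\<Prod>r\<in>(UNIV :: 'd set). dxf (J r)) u \<noteq> 0" by (auto simp: fun_eq_iff)
  define M where "M = (\<lambda>i. axis (J (inv_into UNIV eq_index i)) 1 :: complex ^ 'n)"
  have M: "M (eq_index r) = axis (J r) 1" for r
    unfolding M_def using bij_eq_index by (simp add: bij_betw_def inv_into_f_f)
  have entry: "jac_entry M r k u = dxf (J r) u * of_int (A $ k $ J r)" for r k
    unfolding jac_entry_def M by (subst sum.remove[of _ "J r"]) (auto simp: axis_def)
  have "(\<chi> r k. jac_entry M r k u) = (\<chi> r. dxf (J r) u *s (transpose (\<chi> i k. of_int (A $ i $ J k))) $ r)"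
    by (simp add: vec_eq_iff entry transpose_def)
  then have "jac M u = (\<Prod>r\<in>UNIV. dxf (J r) u) * det (transpose (\<chi> i k. complex_of_int (A $ i $ J k)))"
    unfolding jac_def by (simp add: det_rows_mul)
  also have "det (transpose (\<chi> i k. complex_of_int (A $ i $ J k))) = of_int (det (\<chi> i k. A $ i $ J k))"
    using det_of_int[of "\<chi> i k. A $ i $ J k", where 'a = complex] by (simp add: det_transpose)
  finally show ?thesis using u J by (intro exI[of _ M] exI[of _ u]) simp
qed

lemma jac_coord_ring: "jac M \<in> coord_ring"
  using poly_family_in_S[OF poly_family_jac, of "(M, \<lambda>_. 0)"] S_coord_ring by auto

text \<open>All requirements are open, so one system \<open>e0\<close> that meets them is enough. A
  statement about all points of a fiber is not visibly open; therefore nonvanishing of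
  \<open>h\<close> and of the Jacobian is replaced by the condition that multiples of their product
  span the fiber algebra.\<close>

theorem generic_fiber:
  assumes h: "h \<in> coord_ring" "h \<noteq> 0"
  obtains r Q where "real r = fact CARD('d) * growth" "Q \<in> eq_polys CARD('d)" "\<exists>e. Q e \<noteq> 0"
    "\<And>e. Q e \<noteq> 0 \<Longrightarrow> finite (ymap ` {u. \<forall>i<CARD('d). zf (fst e) i u = snd e i}) \<and>
       card (ymap ` {u. \<forall>i<CARD('d). zf (fst e) i u = snd e i}) = r"
    "\<And>e u. Q e \<noteq> 0 \<Longrightarrow> (\<forall>i<CARD('d). zf (fst e) i u = snd e i) \<Longrightarrow> h u \<noteq> 0"
proof -
  let ?d = "CARD('d)"
  note R = subalgebra_closed[OF subalgebra_coord_ring] and I = ideal_closed[OF ideal_fiber_ideal]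
  obtain M0 D where "good ?d M0 D" using noether_normalization by blast
  then have "good ?d (fst (M0, \<lambda>_. 0 :: complex)) D" by simp
  from good_open[OF this] obtain Qa where Qa: "Qa \<in> eq_polys ?d" "Qa (M0, \<lambda>_. 0) \<noteq> 0"
    "\<And>e. Qa e \<noteq> 0 \<Longrightarrow> good ?d (fst e) D" by blast
  obtain M1 u1 where "jac M1 u1 \<noteq> 0" using jac_nonzero by blast
  then have "jac (fst (M1, \<lambda>_ :: nat. 0 :: complex)) u1 \<noteq> 0" by simp
  from poly_funs_nonzero_common[OF line_coords_equation Qa(1,2) poly_family_eval[OF poly_family_jac] this]
  obtain e1 :: "'n equations" where e1: "Qa e1 \<noteq> 0" "jac (fst e1) u1 \<noteq> 0" by blast
  define M where "M = fst e1"
  have good: "good ?d M D" unfolding M_def by (rule Qa(3)[OF e1(1)])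
  have "jac M \<noteq> 0" using e1(2) unfolding M_def by (auto simp: fun_eq_iff)
  define f where "f = h * jac M"
  have f: "f \<in> coord_ring" "f \<noteq> 0" unfolding f_def
    using R(6)[OF h(1) jac_coord_ring] coord_ring_domain[OF h(1) jac_coord_ring] h(2) \<open>jac M \<noteq> 0\<close> by blast+
  obtain p g' where p: "p \<in> polys ?d" "\<exists>t. p t \<noteq> 0" and g': "g' \<in> coord_ring" and fg: "f * g' = pz M p"
    by (rule polynomial_multiple[OF f, of M]) blast
  obtain r g \<Delta> where r: "real r = fact ?d * growth" and g: "\<And>l. l < r \<Longrightarrow> g l \<in> coord_ring"
    and \<Delta>: "\<Delta> \<in> polys ?d" "\<exists>t. \<Delta> t \<noteq> 0" and sp: "\<And>c. \<Delta> c \<noteq> 0 \<Longrightarrow> spans_mod M c {..<r} g"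
    by (rule module_basis_fiber[OF good]) blast
  \<comment> \<open>The right-hand side \<open>c\<close> must avoid two loci: the zeros of the
    denominator, for spanning, and those of the multiple \<open>p\<close> of \<open>f\<close>, to
    make \<open>f\<close> invertible on the fiber.\<close>
  obtain t1 t2 where "p t1 \<noteq> 0" "\<Delta> t2 \<noteq> 0" using p \<Delta> by blast
  then obtain c where c: "p c \<noteq> 0" "\<Delta> c \<noteq> 0"
    using poly_funs_nonzero_common[OF line_coords_tuple p(1), of t1 \<Delta> t2] \<Delta>(1) by blast
  define e0 where "e0 = (M, c)"
  have e0: "fst e0 = M" "snd e0 = c" by (simp_all add: e0_def)
  have good0: "good ?d (fst e0) D" using good e0 by simp
  obtain Kg where Kg: "\<And>l. l \<in> {..<r} \<Longrightarrow> g l \<in> S Kg" by (rule common_layer[of "{..<r}" g]) (use g in auto)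
  have sp0: "spans_mod (fst e0) (snd e0) {..<r} (\<lambda>l. (\<lambda>l (_ :: 'n equations). g l) l e0)"
    using sp[OF c(2)] e0 by simp
  from spans_mod_open[OF good0 finite_lessThan poly_family_const[OF Kg] sp0]
  obtain Q1 where Q1: "Q1 \<in> eq_polys ?d" "Q1 e0 \<noteq> 0"
    "\<And>e. Q1 e \<noteq> 0 \<Longrightarrow> good ?d (fst e) D \<and> spans_mod (fst e) (snd e) {..<r} g" by blast
  obtain kg where kg: "g' \<in> S kg" using g' coord_ring_iff by blast
  obtain kh where kh: "h \<in> S kh" using h(1) coord_ring_iff by blast
  define K where "K = kg + D"
  \<comment> \<open>The Jacobian varies with the equations, so the spanning family must vary, too;
    it is polynomial in \<open>e\<close> and equals \<open>f * expo v\<close> at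
    \<open>e0\<close>.\<close>
  define F where "F = (\<lambda>v (e :: 'n equations). h * jac (fst e) * expo v)"
  have F: "poly_family (kh + ?d + K) (F v)" if "v \<in> layer K" for v
    unfolding F_def using that by (intro poly_family_mult poly_family_const kh poly_family_jac poly_family_expo)
  have "spans_mod (fst e0) (snd e0) (layer K) (\<lambda>v. F v e0)" unfolding spans_mod_def e0
  proof
    fix s assume "s \<in> coord_ring"
    then have "s \<in> fs.span (S D \<union> fiber_ideal M c)" using good_coord_ring[OF good] by blast
    then obtain s' i where s': "s' \<in> S D" and i: "i \<in> fiber_ideal M c" and s: "s = s' + i"
      unfolding fs.span_Un using fs.span_eq_iff subspace_S subspace_fiber_ideal by blast
    have "g' * s' \<in> S K" unfolding K_def by (rule S_mult[OF kg s'])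
    then obtain m where m: "g' * s' = (\<Sum>v\<in>layer K. fscale (m v) (expo v))"
      unfolding S_def span_image_finite_iff[OF finite_layer] by blast
    \<comment> \<open>Modulo the ideal \<open>pz M p\<close> acts as the nonzero number
      \<open>p c\<close>, so \<open>s'\<close> is congruent to \<open>f * (g' * s') / p c\<close>,
      and \<open>g' * s'\<close> lies in \<open>S K\<close>.\<close>
    have "i - fscale (1 / p c) (s' * (pz M p - fscale (p c) 1)) \<in> fiber_ideal M c"
      by (intro I(3) I(5) I(6) i pz_mod_fiber_ideal p(1) subsetD[OF S_coord_ring s'])
    moreover have "i - fscale (1 / p c) (s' * (pz M p - fscale (p c) 1))
        = s - (\<Sum>v\<in>layer K. fscale (m v / p c) (F v e0))"
    proof
      fix u
      have "f u * (g' u * s' u) = pz M p u * s' u" using fun_cong[OF fg, of u] by (simp add: mult.assoc[symmetric])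
      moreover have "g' u * s' u = (\<Sum>v\<in>layer K. m v * expo v u)" using fun_cong[OF m, of u] by simp
      ultimately have "(\<Sum>v\<in>layer K. m v * (f u * expo v u)) = pz M p u * s' u"
        by (simp add: sum_distrib_left mult_ac)
      moreover have "(\<Sum>v\<in>layer K. fscale (m v / p c) (F v e0)) u = (\<Sum>v\<in>layer K. m v * (f u * expo v u)) / p c"
        by (simp add: F_def f_def e0 sum_divide_distrib mult_ac)
      ultimately show "(i - fscale (1 / p c) (s' * (pz M p - fscale (p c) 1))) u
        = (s - (\<Sum>v\<in>layer K. fscale (m v / p c) (F v e0))) u"
        using c(1) unfolding s by (simp add: field_simps)
    qed
    ultimately show "\<exists>a. s - (\<Sum>v\<in>layer K. fscale (a v) (F v e0)) \<in> fiber_ideal M c"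
      by (intro exI[of _ "\<lambda>v. m v / p c"]) (simp only:)
  qed
  from spans_mod_open[OF good0 finite_layer F this]
  obtain Q2 where Q2: "Q2 \<in> eq_polys ?d" "Q2 e0 \<noteq> 0"
    "\<And>e. Q2 e \<noteq> 0 \<Longrightarrow> spans_mod (fst e) (snd e) (layer K) (\<lambda>v. F v e)" by blast
  \<comment> \<open>The constant 1 is a combination of multiples of \<open>h * jac\<close> modulo
    the ideal; at a point of the fiber where the product vanished, this would give
    \<open>1 = 0\<close>.\<close>
  have nz: "h u * jac (fst e) u \<noteq> 0" if e: "Q2 e \<noteq> 0" and u: "\<forall>i<?d. zf (fst e) i u = snd e i" for e u
  proof
    assume 0: "h u * jac (fst e) u = 0"
    obtain a where "1 - (\<Sum>v\<in>layer K. fscale (a v) (F v e)) \<in> fiber_ideal (fst e) (snd e)"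
      using Q2(3)[OF e] R(1) unfolding spans_mod_def by blast
    moreover have "\<forall>f\<in>fiber_ideal (fst e) (snd e). f u = 0" using u unfolding fiber_ideal_zeros .
    ultimately have "(1 - (\<Sum>v\<in>layer K. fscale (a v) (F v e))) u = 0" by blast
    then show False using 0 by (simp add: F_def)
  qed
  show ?thesis
  proof (rule that[of r "\<lambda>e. Q1 e * Q2 e"])
    show "real r = fact ?d * growth" by (rule r)
    show "(\<lambda>e. Q1 e * Q2 e) \<in> eq_polys ?d" by (intro poly_funs.mult Q1 Q2)
    show "\<exists>e. Q1 e * Q2 e \<noteq> 0" using Q1 Q2 by (intro exI[of _ e0]) simp
    fix e assume e: "Q1 e * Q2 e \<noteq> 0"
    show "finite (ymap ` {u. \<forall>i<?d. zf (fst e) i u = snd e i}) \<and>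
       card (ymap ` {u. \<forall>i<?d. zf (fst e) i u = snd e i}) = r"
    proof (rule fiber_card[OF _ r g])
      show "good ?d (fst e) D" "spans_mod (fst e) (snd e) {..<r} g" using Q1(3)[of e] e by auto
      show "jac (fst e) u \<noteq> 0" if "\<forall>i<?d. zf (fst e) i u = snd e i" for u using nz[OF _ that] e by auto
    qed
    show "h u \<noteq> 0" if "\<forall>i<?d. zf (fst e) i u = snd e i" for u using nz[OF _ that] e by auto
  qed
qed

end

section \<open>The Lissajous variety and its cover\<close>

lemma zariski_hull_iff:
  "y \<in> zariski_closed F hull X \<longleftrightarrow> (\<forall>p\<in>poly_funs F. (\<forall>x\<in>X. p x = 0) \<longrightarrow> p y = 0)"
proof
  assume y: "y \<in> zariski_closed F hull X"
  show "\<forall>p\<in>poly_funs F. (\<forall>x\<in>X. p x = 0) \<longrightarrow> p y = 0"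
  proof (intro ballI impI)
    fix p assume p: "p \<in> poly_funs F" "\<forall>x\<in>X. p x = 0"
    then have "zariski_closed F {x. \<forall>q\<in>{p}. q x = 0}" unfolding zariski_closed_def by blast
    moreover have "X \<subseteq> {x. \<forall>q\<in>{p}. q x = 0}" using p(2) by blast
    ultimately have "y \<in> {x. \<forall>q\<in>{p}. q x = 0}" using y hull_minimal[of X _ "zariski_closed F"] by blast
    then show "p y = 0" by simp
  qed
next
  assume y: "\<forall>p\<in>poly_funs F. (\<forall>x\<in>X. p x = 0) \<longrightarrow> p y = 0"
  show "y \<in> zariski_closed F hull X" unfolding hull_def
  proof (rule InterI, elim CollectE conjE)
    fix T assume T: "zariski_closed F T" "X \<subseteq> T"
    then obtain P where "P \<subseteq> poly_funs F" "T = {x. \<forall>p\<in>P. p x = 0}" unfolding zariski_closed_def by blast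
    then show "y \<in> T" using T(2) y by blast
  qed
qed

text \<open>Clears denominators: a Laurent relation becomes a polynomial binomial, to which Zariski
  closure applies.\<close>

lemma prod_powi_eq_1_iff:
  fixes w :: "'n::finite \<Rightarrow> complex"
  assumes "\<And>j. w j \<noteq> 0"
  shows "(\<Prod>j\<in>UNIV. w j powi l j) = 1 \<longleftrightarrow> (\<Prod>j\<in>UNIV. w j ^ nat (l j)) - (\<Prod>j\<in>UNIV. w j ^ nat (- l j)) = 0"
proof -
  have "w j powi l j = w j ^ nat (l j) / w j ^ nat (- l j)" for j
    by (cases "l j \<ge> 0") (auto simp: power_int_def field_simps)
  then have "(\<Prod>j\<in>UNIV. w j powi l j) = (\<Prod>j\<in>UNIV. w j ^ nat (l j)) / (\<Prod>j\<in>UNIV. w j ^ nat (- l j))"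
    by (simp add: prod_dividef)
  moreover have "(\<Prod>j\<in>UNIV. w j ^ nat (- l j)) \<noteq> 0" using assms by simp
  ultimately show ?thesis by simp
qed

lemma generic_onI:
  assumes "p \<in> poly_funs F" "y \<in> Y" "p y \<noteq> 0" "\<And>y. y \<in> Y \<Longrightarrow> p y \<noteq> 0 \<Longrightarrow> P y"
  shows "generic_on F Y P"
proof -
  have "zariski_closed F {x. \<forall>q\<in>{p}. q x = 0}" unfolding zariski_closed_def using assms(1) by blast
  then show ?thesis unfolding generic_on_def using assms by (intro exI[of _ "{x. \<forall>q\<in>{p}. q x = 0}"]) auto
qed

lemma generic_onE:
  assumes "generic_on F Y P"
  obtains p y where "p \<in> poly_funs F" "y \<in> Y" "p y \<noteq> 0" "\<And>y. y \<in> Y \<Longrightarrow> p y \<noteq> 0 \<Longrightarrow> P y"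
proof -
  obtain Z where Z: "zariski_closed F Z" "Y - Z \<noteq> {}" "\<forall>y\<in>Y - Z. P y"
    using assms unfolding generic_on_def by blast
  obtain T where T: "T \<subseteq> poly_funs F" "Z = {x. \<forall>p\<in>T. p x = 0}"
    using Z(1) unfolding zariski_closed_def by blast
  obtain y where y: "y \<in> Y" "y \<notin> Z" using Z(2) by blast
  then obtain p where p: "p \<in> T" "p y \<noteq> 0" unfolding T(2) by blast
  show ?thesis
  proof (rule that[of p y])
    show "p \<in> poly_funs F" using p T by blast
    show "P y'" if "y' \<in> Y" "p y' \<noteq> 0" for y' using that p(1) Z(3) unfolding T(2) by blast
  qed (rule y p)+
qed

section \<open>Exponential parametrization of the variety and of its cover\<close>

context lissajous_setup
begin

definition tmap :: "complex ^ 'd \<Rightarrow> complex ^ 'n" where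
  "tmap u = (\<chi> j. expo (column j A) u)"

text \<open>Points of the row space are the pairings of the columns with \<open>u\<close>, and
  Euler's formula turns the shifted cosine into \<open>(y + 1 / y) / 2\<close>; the shift by
  \<open>b\<close> is absorbed into \<beta>.\<close>

lemma lissajous_eq: "lissajous A b = range xmap"
proof -
  define \<rho> where "\<rho> = (\<lambda>u :: complex ^ 'd. \<chi> j. \<Sum>k\<in>UNIV. of_int (A $ k $ j) * u $ k)"
  have "Row A = range \<rho>"
  proof
    have "vec.subspace (range \<rho>)"
    proof (rule vec.subspaceI)
      show "0 \<in> range \<rho>" by (intro range_eqI[of _ _ 0]) (simp add: \<rho>_def vec_eq_iff)
      show "x + y \<in> range \<rho>" if x: "x \<in> range \<rho>" and y: "y \<in> range \<rho>" for x y
      proof -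
        obtain u v where "x = \<rho> u" "y = \<rho> v" using x y by blast
        then show ?thesis
          by (intro range_eqI[of _ _ "u + v"]) (simp add: \<rho>_def vec_eq_iff algebra_simps sum.distrib)
      qed
      show "c *s x \<in> range \<rho>" if x: "x \<in> range \<rho>" for c x
      proof -
        obtain u where "x = \<rho> u" using x by blast
        then show ?thesis
          by (intro range_eqI[of _ _ "c *s u"]) (simp add: \<rho>_def vec_eq_iff sum_distrib_left mult_ac)
      qed
    qed
    moreover have "rows (map_matrix complex_of_int A) \<subseteq> range \<rho>"
    proof
      fix x assume "x \<in> rows (map_matrix complex_of_int A)"
      then obtain i where "x = row i (map_matrix complex_of_int A)" unfolding rows_def by blast
      then have "x = \<rho> (axis i 1)"
        unfolding \<rho>_def row_def axis_def
        by (simp add: vec_eq_iff if_distrib[where f="\<lambda>x. _ * x"] cong: if_cong)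
      then show "x \<in> range \<rho>" by blast
    qed
    ultimately show "Row A \<subseteq> range \<rho>" unfolding Row_def by (intro vec.span_minimal)
    show "range \<rho> \<subseteq> Row A"
    proof
      fix x assume "x \<in> range \<rho>"
      then obtain u where "x = \<rho> u" by blast
      then have "x = (\<Sum>k\<in>UNIV. u $ k *s row k (map_matrix complex_of_int A))"
        by (simp add: \<rho>_def vec_eq_iff row_def mult_ac)
      moreover have "(\<Sum>k\<in>UNIV. u $ k *s row k (map_matrix complex_of_int A)) \<in> Row A"
        unfolding Row_def by (intro vec.span_sum vec.span_scale vec.span_base) (auto simp: rows_def)
      ultimately show "x \<in> Row A" by simp
    qed
  qed
  moreover have "(\<chi> j. cos (\<rho> u $ j - of_real pi / 2 * b $ j)) = xmap u" for u
  proof -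
    have "exp (\<i> * (\<rho> u $ j - of_real pi / 2 * b $ j)) = \<beta> j * expo (column j A) u" for j
      unfolding \<beta>_def expo_def \<rho>_def exp_add[symmetric] by (simp add: column_def algebra_simps)
    moreover have "exp (- (\<i> * (\<rho> u $ j - of_real pi / 2 * b $ j))) = inverse (\<beta> j * expo (column j A) u)" for j
      unfolding exp_minus using calculation by simp
    ultimately show ?thesis
      by (simp add: xmap_def xf_def cos_exp_eq expo_minus vec_eq_iff add_divide_distrib)
  qed
  ultimately show ?thesis unfolding lissajous_def image_image by (simp add: image_image)
qed

text \<open>The relations say precisely that sending a combination of columns to the corresponding
  product of coordinates of \<open>y\<close> is well defined on the lattice. It is then a character,
  hence an evaluation.\<close>

lemma range_tmap_iff:
  "y \<in> range tmap \<longleftrightarrow> (\<forall>j. y $ j \<noteq> 0) \<and> (\<forall>l. comb l = 0 \<longrightarrow> (\<Prod>j\<in>UNIV. y $ j powi l j) = 1)"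
proof
  assume "y \<in> range tmap"
  then obtain u where "y = tmap u" by blast
  then show "(\<forall>j. y $ j \<noteq> 0) \<and> (\<forall>l. comb l = 0 \<longrightarrow> (\<Prod>j\<in>UNIV. y $ j powi l j) = 1)"
    using expo_comb[of _ u] by (auto simp: tmap_def) (metis expo_0 one_fun_apply)
next
  assume y: "(\<forall>j. y $ j \<noteq> 0) \<and> (\<forall>l. comb l = 0 \<longrightarrow> (\<Prod>j\<in>UNIV. y $ j powi l j) = 1)"
  define \<mu> where "\<mu> l = (\<Prod>j\<in>UNIV. y $ j powi l j)" for l
  define \<psi> where "\<psi> v = \<mu> (SOME l. comb l = v)" for v
  have \<mu>_add: "\<mu> (\<lambda>j. l j + l' j) = \<mu> l * \<mu> l'" for l l'
    unfolding \<mu>_def using y by (simp add: power_int_add prod.distrib)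
  have \<mu>_nz: "\<mu> l \<noteq> 0" for l unfolding \<mu>_def using y by simp
  have \<mu>_cong: "\<mu> l = \<mu> l'" if "comb l = comb l'" for l l'
  proof -
    have "\<mu> (\<lambda>j. l j - l' j) = 1" using y that unfolding \<mu>_def by (auto simp: comb_diff)
    then show ?thesis using \<mu>_add[of "\<lambda>j. l j - l' j" l'] by simp
  qed
  have \<psi>: "\<psi> (comb l) = \<mu> l" for l
    unfolding \<psi>_def by (rule \<mu>_cong) (rule someI[of _ l], rule refl)
  have "\<exists>u. \<forall>v\<in>col_lattice A. \<psi> v = expo v u"
  proof (rule character_extension)
    fix v w assume "v \<in> col_lattice A" "w \<in> col_lattice A"
    then obtain l l' where "v = comb l" "w = comb l'" unfolding col_lattice_eq by blast
    then show "\<psi> (v + w) = \<psi> v * \<psi> w" using \<psi>[of "\<lambda>j. l j + l' j"] by (simp add: comb_add \<mu>_add \<psi>)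
  next
    fix v assume "v \<in> col_lattice A"
    then show "\<psi> v \<noteq> 0" unfolding col_lattice_eq using \<mu>_nz \<psi> by auto
  qed (use col_lattice_closed in auto)
  then obtain u where u: "\<And>v. v \<in> col_lattice A \<Longrightarrow> \<psi> v = expo v u" by blast
  have "y $ j = expo (column j A) u" for j
  proof -
    have c: "comb (\<lambda>i. if i = j then 1 else 0) = column j A" using comb_unit[of j 1] by simp
    have "\<mu> (\<lambda>i. if i = j then 1 else 0) = y $ j"
      unfolding \<mu>_def by (subst prod.remove[of _ j]) auto
    then show ?thesis using \<psi>[of "\<lambda>i. if i = j then 1 else 0"] u[OF col_lattice_closed(6), of j] c by simp
  qed
  then have "y = tmap u" by (simp add: tmap_def vec_eq_iff)
  then show "y \<in> range tmap" by blast
qed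

lemma torus_image:
  "(\<lambda>v. \<chi> j. \<Prod>k\<in>UNIV. (v $ k) powi (A $ k $ j)) ` {v :: complex ^ 'd. \<forall>k. v $ k \<noteq> 0} = range tmap"
    (is "?f ` ?T = _")
proof -
  have f: "(\<lambda>u. \<chi> j. \<Prod>k\<in>UNIV. exp (\<i> * u $ k) powi (A $ k $ j)) = tmap"
    by (simp add: fun_eq_iff vec_eq_iff tmap_def expo_def column_def exp_power_int exp_sum[symmetric] sum_distrib_left mult_ac)
  have "v \<in> range (\<lambda>u. \<chi> k. exp (\<i> * u $ k))" if v: "\<forall>k. v $ k \<noteq> 0" for v :: "complex ^ 'd"
    by (intro range_eqI[of _ _ "\<chi> k. - \<i> * Ln (v $ k)"]) (use v in \<open>simp add: vec_eq_iff exp_Ln\<close>)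
  then have "?T = range (\<lambda>u. \<chi> k. exp (\<i> * u $ k))" by auto
  then show ?thesis by (simp only: image_image vec_lambda_beta f)
qed

text \<open>The image of the torus is already closed within the torus: its defining relations are
  binomial equations, which persist on the closure. So the hull adds only points with some zero
  coordinate.\<close>

lemma toric_torus: "{y \<in> toric A. \<forall>j. y $ j \<noteq> 0} = range tmap"
proof
  show "range tmap \<subseteq> {y \<in> toric A. \<forall>j. y $ j \<noteq> 0}"
    unfolding toric_def torus_image using hull_subset[of "range tmap"] by (auto simp: tmap_def)
  show "{y \<in> toric A. \<forall>j. y $ j \<noteq> 0} \<subseteq> range tmap"
  proof
    fix y assume "y \<in> {y \<in> toric A. \<forall>j. y $ j \<noteq> 0}"
    then have y: "y \<in> zariski_closed vec_coords hull range tmap" and nz: "\<And>j. y $ j \<noteq> 0"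
      unfolding toric_def torus_image by auto
    have "(\<Prod>j\<in>UNIV. y $ j powi l j) = 1" if l: "comb l = 0" for l
    proof -
      let ?p = "\<lambda>w :: complex ^ 'n. (\<Prod>j\<in>UNIV. w $ j ^ nat (l j)) - (\<Prod>j\<in>UNIV. w $ j ^ nat (- l j))"
      have "?p \<in> poly_funs vec_coords"
        by (intro poly_funs_intros poly_funs.coord) (auto simp: vec_coords_def)
      moreover have "\<forall>w\<in>range tmap. ?p w = 0"
      proof
        fix w assume "w \<in> range tmap"
        then have "\<forall>j. w $ j \<noteq> 0" "(\<Prod>j\<in>UNIV. w $ j powi l j) = 1" using l unfolding range_tmap_iff by auto
        then show "?p w = 0" using prod_powi_eq_1_iff[of "\<lambda>j. w $ j" l] by auto
      qed
      ultimately have "?p y = 0" by (rule y[unfolded zariski_hull_iff, THEN bspec, THEN mp])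
      then show ?thesis using prod_powi_eq_1_iff[of "\<lambda>j. y $ j" l] nz by auto
    qed
    then show "y \<in> range tmap" unfolding range_tmap_iff using nz by blast
  qed
qed

lemma ymap_tmap: "ymap u = (\<chi> j. \<beta> j * tmap u $ j)"
  by (simp add: ymap_def tmap_def)

lemma range_ymap_iff: "y \<in> range ymap \<longleftrightarrow> (\<chi> j. y $ j / \<beta> j) \<in> range tmap"
proof
  assume "y \<in> range ymap"
  then obtain u where "y = ymap u" by blast
  then have "(\<chi> j. y $ j / \<beta> j) = tmap u" by (simp add: ymap_tmap vec_eq_iff)
  then show "(\<chi> j. y $ j / \<beta> j) \<in> range tmap" by blast
next
  assume "(\<chi> j. y $ j / \<beta> j) \<in> range tmap"
  then obtain u where "(\<chi> j. y $ j / \<beta> j) = tmap u" by blast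
  then have "y = ymap u" by (simp add: ymap_tmap vec_eq_iff field_simps)
  then show "y \<in> range ymap" by blast
qed

lemma scaled_toric_torus:
  "{y \<in> scaled_toric A (\<chi> j. exp (- \<i> * b $ j * of_real pi / 2)). \<forall>j. y $ j \<noteq> 0} = range ymap"
proof
  show "range ymap \<subseteq> {y \<in> scaled_toric A (\<chi> j. exp (- \<i> * b $ j * of_real pi / 2)). \<forall>j. y $ j \<noteq> 0}"
    unfolding scaled_toric_def using toric_torus ymap_nonzero by (auto simp: ymap_tmap \<beta>_def)
  show "{y \<in> scaled_toric A (\<chi> j. exp (- \<i> * b $ j * of_real pi / 2)). \<forall>j. y $ j \<noteq> 0} \<subseteq> range ymap"
  proof
    fix y assume "y \<in> {y \<in> scaled_toric A (\<chi> j. exp (- \<i> * b $ j * of_real pi / 2)). \<forall>j. y $ j \<noteq> 0}"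
    then obtain w where w: "w \<in> toric A" "y = (\<chi> j. \<beta> j * w $ j)" "\<forall>j. y $ j \<noteq> 0"
      unfolding scaled_toric_def \<beta>_def by auto
    then have "w \<in> range tmap" using toric_torus by auto
    then show "y \<in> range ymap" unfolding w(2) by (auto simp: ymap_tmap)
  qed
qed

lemma lissajous_cover_eq: "lissajous_cover A b = range (\<lambda>u. (xmap u, ymap u))"
proof -
  have "(x, y) \<in> lissajous_cover A b \<longleftrightarrow> y \<in> range ymap \<and> x = (\<chi> j. (y $ j + inverse (y $ j)) / 2)" for x y
    unfolding lissajous_cover_def scaled_toric_torus[symmetric] by (auto simp: vec_eq_iff)
  moreover have "xmap u = (\<chi> j. (ymap u $ j + inverse (ymap u $ j)) / 2)" for u
    by (simp add: vec_eq_iff xmap_ymap)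
  ultimately show ?thesis by (auto simp del: vec_lambda_beta)
qed

section \<open>Fibers of the projection\<close>

definition invert_coords :: "'n set \<Rightarrow> complex ^ 'n \<Rightarrow> complex ^ 'n" where
  "invert_coords s y = (\<chi> j. if j \<in> s then inverse (y $ j) else y $ j)"

text \<open>The equation \<open>a + 1 / a = c + 1 / c\<close> factors as
  \<open>(a - c) * (a * c - 1) = 0\<close>, so equal cosines differ by inverting some
  coordinates.\<close>

lemma xmap_eq_iff: "xmap u' = xmap u \<longleftrightarrow> (\<exists>s. ymap u' = invert_coords s (ymap u))"
proof
  assume eq: "xmap u' = xmap u"
  let ?s = "{j. ymap u' $ j \<noteq> ymap u $ j}"
  have "ymap u' $ j = inverse (ymap u $ j)" if "j \<in> ?s" for j
  proof -
    let ?a = "ymap u' $ j" and ?c = "ymap u $ j"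
    have nz: "?a \<noteq> 0" "?c \<noteq> 0" by (rule ymap_nonzero)+
    have "?a + inverse ?a = ?c + inverse ?c" using xmap_ymap[of u j] xmap_ymap[of u' j] eq by simp
    then have "(?a - ?c) * (?a * ?c - 1) = 0" using nz by (simp add: field_simps)
    then have "?a * ?c = 1" using that by simp
    then show ?thesis using nz by (simp add: field_simps)
  qed
  then have "ymap u' = invert_coords ?s (ymap u)" by (auto simp: invert_coords_def vec_eq_iff)
  then show "\<exists>s. ymap u' = invert_coords s (ymap u)" by blast
next
  assume "\<exists>s. ymap u' = invert_coords s (ymap u)"
  then obtain s where "ymap u' = invert_coords s (ymap u)" by blast
  then show "xmap u' = xmap u" by (auto simp: vec_eq_iff xmap_ymap invert_coords_def add.commute)
qed

lemma expo_comb_in_coord_ring: "fscale a (expo (comb l)) - 1 \<in> coord_ring"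
proof -
  note R = subalgebra_closed[OF subalgebra_coord_ring]
  have "expo (comb l) \<in> coord_ring"
    unfolding coord_ring_def by (intro fs.span_base imageI) (simp add: col_lattice_eq)
  then show ?thesis by (intro R)
qed

text \<open>Whether inverting the coordinates in \<open>s\<close> stays in the scaled torus is
  decided by the relations \<open>l\<close>; the failure of each is a regular function of
  \<open>u\<close>, so it happens for generic \<open>u\<close> or never.\<close>

lemma invert_coords_defect:
  "\<exists>f\<in>coord_ring. \<forall>u. f u = (\<Prod>j\<in>UNIV. (invert_coords s (ymap u) $ j / \<beta> j) powi l j) - 1"
proof -
  define l' where "l' = (\<lambda>j. if j \<in> s then - l j else l j)"
  \<comment> \<open>Inverting \<open>\<beta> * expo\<close> and dividing by \<beta> leaves a factor
    \<open>1 / \<beta>^2\<close> in front of the inverted exponential.\<close>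
  define a where "a = (\<Prod>j\<in>UNIV. if j \<in> s then inverse (\<beta> j ^ 2) powi l j else 1)"
  have "(invert_coords s (ymap u) $ j / \<beta> j) powi l j
      = (if j \<in> s then inverse (\<beta> j ^ 2) powi l j else 1) * expo (column j A) u powi l' j" for j u
    by (auto simp: invert_coords_def ymap_def l'_def power_int_mult_distrib[symmetric] power_int_minus
        power_int_inverse[symmetric] power2_eq_square field_simps)
  then have "(\<Prod>j\<in>UNIV. (invert_coords s (ymap u) $ j / \<beta> j) powi l j) - 1 = (fscale a (expo (comb l')) - 1) u" for u
    by (simp add: a_def expo_comb prod.distrib)
  then show ?thesis using expo_comb_in_coord_ring[of a l'] by (intro bexI[of _ "fscale a (expo (comb l')) - 1"]) auto
qed

text \<open>\<open>G\<close> consists of the inversions that preserve the whole image of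
  \<open>ymap\<close>; any other one leaves it at generic points. \<open>J\<close> collects the
  coordinates whose square is identically 1, where inversion does nothing. A generic fiber therefore
  corresponds to \<open>G\<close> with \<open>J\<close> disregarded, and \<open>h\<close> excludes
  the finitely many exceptional loci.\<close>

lemma generic_projection_fiber:
  obtains h m where "h \<in> coord_ring" "h \<noteq> 0" "m > (0 :: nat)"
    "\<And>u. h u \<noteq> 0 \<Longrightarrow> finite (ymap ` {u'. xmap u' = xmap u}) \<and> card (ymap ` {u'. xmap u' = xmap u}) = m"
proof -
  note R = subalgebra_closed[OF subalgebra_coord_ring]
  define J where "J = {j. \<forall>u. ymap u $ j ^ 2 = 1}"
  define G where "G = {s. \<forall>u. invert_coords s (ymap u) \<in> range ymap}"
  have "\<exists>f. f \<in> coord_ring \<and> f \<noteq> 0 \<and> (\<forall>u. f u \<noteq> 0 \<longrightarrow> ymap u $ j ^ 2 \<noteq> 1)" if "j \<notin> J" for j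
  proof -
    define f where "f = fscale (\<beta> j ^ 2) (expo (comb (\<lambda>i. if i = j then 2 else 0))) - 1"
    have f: "f u = ymap u $ j ^ 2 - 1" for u
      by (simp add: f_def comb_unit expo_scale ymap_def power_mult_distrib)
    from that obtain u where "ymap u $ j ^ 2 \<noteq> 1" unfolding J_def by blast
    then have "f u \<noteq> 0" using f by simp
    then have "f \<noteq> 0" by auto
    moreover have "f \<in> coord_ring" unfolding f_def by (rule expo_comb_in_coord_ring)
    ultimately show ?thesis using f by (intro exI[of _ f]) auto
  qed
  then have "\<forall>j\<in>- J. \<exists>f. f \<in> coord_ring \<and> f \<noteq> 0 \<and> (\<forall>u. f u \<noteq> 0 \<longrightarrow> ymap u $ j ^ 2 \<noteq> 1)" by blast
  from bchoice[OF this] obtain f where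
    f: "\<And>j. j \<notin> J \<Longrightarrow> f j \<in> coord_ring \<and> f j \<noteq> 0 \<and> (\<forall>u. f j u \<noteq> 0 \<longrightarrow> ymap u $ j ^ 2 \<noteq> 1)" by blast
  have "\<exists>g. g \<in> coord_ring \<and> g \<noteq> 0 \<and> (\<forall>u. g u \<noteq> 0 \<longrightarrow> invert_coords s (ymap u) \<notin> range ymap)"
    if "s \<notin> G" for s
  proof -
    from that obtain u where u: "invert_coords s (ymap u) \<notin> range ymap" unfolding G_def by blast
    moreover have "(\<chi> j. invert_coords s (ymap u) $ j / \<beta> j) $ j \<noteq> 0" for j
      by (simp add: invert_coords_def ymap_nonzero)
    ultimately obtain l where l: "comb l = 0" "(\<Prod>j\<in>UNIV. (invert_coords s (ymap u) $ j / \<beta> j) powi l j) \<noteq> 1"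
      unfolding range_ymap_iff range_tmap_iff by auto
    obtain g where g: "g \<in> coord_ring"
      "\<And>u. g u = (\<Prod>j\<in>UNIV. (invert_coords s (ymap u) $ j / \<beta> j) powi l j) - 1"
      using invert_coords_defect[of s l] by blast
    have "g u \<noteq> 0" using l(2) unfolding g(2) by simp
    then have "g \<noteq> 0" by auto
    moreover have "invert_coords s (ymap u') \<notin> range ymap" if "g u' \<noteq> 0" for u'
      using that l(1) unfolding g(2) range_ymap_iff range_tmap_iff by auto
    ultimately show ?thesis using g(1) by blast
  qed
  then have "\<forall>s\<in>- G. \<exists>g. g \<in> coord_ring \<and> g \<noteq> 0 \<and> (\<forall>u. g u \<noteq> 0 \<longrightarrow> invert_coords s (ymap u) \<notin> range ymap)"
    by blast
  from bchoice[OF this] obtain g where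
    g: "\<And>s. s \<notin> G \<Longrightarrow> g s \<in> coord_ring \<and> g s \<noteq> 0 \<and> (\<forall>u. g s u \<noteq> 0 \<longrightarrow> invert_coords s (ymap u) \<notin> range ymap)"
    by blast
  define h1 where "h1 = (\<Prod>j\<in>- J. f j)"
  define h2 where "h2 = (\<Prod>s\<in>- G. g s)"
  have h1: "h1 \<in> coord_ring" "h1 \<noteq> 0"
  proof -
    show "h1 \<in> coord_ring" unfolding h1_def using f by (intro R) auto
    have "(\<Prod>j\<in>- J. f j) \<in> exp_span \<and> (\<Prod>j\<in>- J. f j) \<noteq> 0"
      using f coord_ring_exp_span by (intro exp_span_prod_nonzero) auto
    then show "h1 \<noteq> 0" unfolding h1_def by blast
  qed
  have h2: "h2 \<in> coord_ring" "h2 \<noteq> 0"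
  proof -
    show "h2 \<in> coord_ring" unfolding h2_def using g by (intro R) auto
    have "(\<Prod>s\<in>- G. g s) \<in> exp_span \<and> (\<Prod>s\<in>- G. g s) \<noteq> 0"
      using g coord_ring_exp_span by (intro exp_span_prod_nonzero) auto
    then show "h2 \<noteq> 0" unfolding h2_def by blast
  qed
  show ?thesis
  proof (rule that[of "h1 * h2" "card ((\<lambda>s. s - J) ` G)"])
    show "h1 * h2 \<in> coord_ring" by (intro R h1 h2)
    show "h1 * h2 \<noteq> 0" using coord_ring_domain h1 h2 by blast
    have "{} \<in> G" unfolding G_def invert_coords_def by auto
    then show "card ((\<lambda>s. s - J) ` G) > 0" by (subst card_gt_0_iff) auto
    fix u assume "(h1 * h2) u \<noteq> 0"
    then have "\<And>j. j \<notin> J \<Longrightarrow> f j u \<noteq> 0" "\<And>s. s \<notin> G \<Longrightarrow> g s u \<noteq> 0" unfolding h1_def h2_def by auto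
    then have sq: "\<And>j. j \<notin> J \<Longrightarrow> ymap u $ j ^ 2 \<noteq> 1"
      and out: "\<And>s. s \<notin> G \<Longrightarrow> invert_coords s (ymap u) \<notin> range ymap" using f g by blast+
    have fib: "ymap ` {u'. xmap u' = xmap u} = (\<lambda>s. invert_coords s (ymap u)) ` G"
    proof
      show "ymap ` {u'. xmap u' = xmap u} \<subseteq> (\<lambda>s. invert_coords s (ymap u)) ` G"
        using out unfolding xmap_eq_iff by (auto simp: image_iff) (metis rangeI)
      show "(\<lambda>s. invert_coords s (ymap u)) ` G \<subseteq> ymap ` {u'. xmap u' = xmap u}"
      proof
        fix y assume "y \<in> (\<lambda>s. invert_coords s (ymap u)) ` G"
        then obtain s where s: "s \<in> G" "y = invert_coords s (ymap u)" by blast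
        then obtain u' where u': "y = ymap u'" unfolding G_def by blast
        have "xmap u' = xmap u" unfolding xmap_eq_iff using s(2) u' by metis
        then show "y \<in> ymap ` {u'. xmap u' = xmap u}" using u' by blast
      qed
    qed
    have "invert_coords s (ymap u) = invert_coords s' (ymap u) \<longleftrightarrow> s - J = s' - J" for s s'
    proof -
      have "inverse (ymap u $ j) = ymap u $ j \<longleftrightarrow> j \<in> J" for j
      proof -
        have "inverse (ymap u $ j) = ymap u $ j \<longleftrightarrow> ymap u $ j ^ 2 = 1"
          using ymap_nonzero[of u j] by (auto simp: field_simps power2_eq_square)
        then show ?thesis using sq[of j] unfolding J_def by blast
      qed
      moreover from this have "ymap u $ j = inverse (ymap u $ j) \<longleftrightarrow> j \<in> J" for j by metis
      ultimately show ?thesis by (auto simp: invert_coords_def vec_eq_iff set_eq_iff)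
    qed
    then have "bij_betw (\<lambda>K. invert_coords K (ymap u)) ((\<lambda>s. s - J) ` G) ((\<lambda>s. invert_coords s (ymap u)) ` G)"
      unfolding bij_betw_def inj_on_def by (auto simp: image_image)
    then have "card ((\<lambda>s. invert_coords s (ymap u)) ` G) = card ((\<lambda>s. s - J) ` G)"
      using bij_betw_same_card by metis
    then show "finite (ymap ` {u'. xmap u' = xmap u}) \<and> card (ymap ` {u'. xmap u' = xmap u}) = card ((\<lambda>s. s - J) ` G)"
      unfolding fib by simp
  qed
qed

section \<open>Genericity, dimension and degree\<close>

lemma poly_funs_xmap: "p \<in> poly_funs vec_coords \<Longrightarrow> (\<lambda>u. p (xmap u)) \<in> coord_ring"
proof (induction rule: poly_funs.induct)
  case (coord f)
  then obtain j where "f = (\<lambda>x. x $ j)" unfolding vec_coords_def by blast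
  then have "(\<lambda>u. f (xmap u)) = xf j" by (simp add: xmap_def fun_eq_iff)
  then show ?case using xf_in_S S_coord_ring by auto
next
  case (const c)
  have "fscale c 1 \<in> coord_ring" by (intro subalgebra_closed[OF subalgebra_coord_ring])
  moreover have "fscale c 1 = (\<lambda>u :: complex ^ 'd. c)" by (simp add: fun_eq_iff)
  ultimately show ?case by (simp only:)
next
  case (add p q)
  then have "(\<lambda>u. p (xmap u)) + (\<lambda>u. q (xmap u)) \<in> coord_ring"
    by (intro subalgebra_closed[OF subalgebra_coord_ring])
  then show ?case unfolding plus_fun_def .
next
  case (mult p q)
  then have "(\<lambda>u. p (xmap u)) * (\<lambda>u. q (xmap u)) \<in> coord_ring"
    by (intro subalgebra_closed[OF subalgebra_coord_ring])
  then show ?case unfolding times_fun_def .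
qed

lemma linear_form_xmap: "(\<lambda>x. \<Sum>j\<in>UNIV. M i $ j * x $ j) \<in> poly_funs (vec_coords :: (complex ^ 'n \<Rightarrow> complex) set)"
  by (intro poly_funs_intros poly_funs.coord) (auto simp: vec_coords_def)

text \<open>The condition on \<open>h\<close> lives on the cover and need not depend on
  \<open>x\<close> only. A multiple of \<open>h\<close> is a polynomial in linear forms of
  \<open>x\<close>, and its nonvanishing defines an open set downstairs.\<close>

lemma generic_on_lissajous:
  assumes h: "h \<in> coord_ring" "h \<noteq> 0" and P: "\<And>u. h u \<noteq> 0 \<Longrightarrow> P (xmap u)"
  shows "generic_on vec_coords (range xmap) P"
proof -
  obtain M D where "good CARD('d) M D" using noether_normalization by blast
  then have M: "alg_indep CARD('d) (zf M)" by (rule good_alg_indep)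
  obtain p g where p: "p \<in> polys CARD('d)" "\<exists>t. p t \<noteq> 0" and pz: "h * g = pz M p"
    by (rule polynomial_multiple[OF h, of M]) blast
  define q where "q = (\<lambda>x :: complex ^ 'n. p (\<lambda>i. \<Sum>j\<in>UNIV. M i $ j * x $ j))"
  have q: "q (xmap u) = h u * g u" for u
    using fun_cong[OF pz, of u] by (simp add: q_def zf_xmap)
  have "pz M p \<noteq> 0" using pz_zero[OF M p(1)] p(2) by blast
  then obtain u where "pz M p u \<noteq> 0" unfolding fun_eq_iff by auto
  then have u: "q (xmap u) \<noteq> 0" unfolding q pz[symmetric] by simp
  show ?thesis
  proof (rule generic_onI[of q _ "xmap u"])
    show "q \<in> poly_funs vec_coords" unfolding q_def
      by (rule poly_funs_compose[OF p(1)]) (use linear_form_xmap in \<open>auto simp: tuple_coords_def\<close>)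
    show "P x" if "x \<in> range xmap" "q x \<noteq> 0" for x using that P q by auto
  qed (use u in auto)
qed

text \<open>Nonempty open subsets meet because the coordinate ring is a domain; this makes the
  generic fiber cardinality unique.\<close>

lemma generic_on_lissajous_common:
  assumes "generic_on vec_coords (range xmap) P" "generic_on vec_coords (range xmap) P'"
  shows "\<exists>u. P (xmap u) \<and> P' (xmap u)"
proof -
  obtain p y where p: "p \<in> poly_funs vec_coords" "y \<in> range xmap" "p y \<noteq> 0"
    "\<And>y. y \<in> range xmap \<Longrightarrow> p y \<noteq> 0 \<Longrightarrow> P y" by (rule generic_onE[OF assms(1)]) blast
  obtain q z where q: "q \<in> poly_funs vec_coords" "z \<in> range xmap" "q z \<noteq> 0"
    "\<And>y. y \<in> range xmap \<Longrightarrow> q y \<noteq> 0 \<Longrightarrow> P' y" by (rule generic_onE[OF assms(2)]) blast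
  have "(\<lambda>u. p (xmap u)) \<noteq> 0" "(\<lambda>u. q (xmap u)) \<noteq> 0" using p q by (auto simp: fun_eq_iff)
  then have "(\<lambda>u. p (xmap u)) * (\<lambda>u. q (xmap u)) \<noteq> 0"
    using coord_ring_domain[OF poly_funs_xmap[OF p(1)] poly_funs_xmap[OF q(1)]] by blast
  then obtain u where "p (xmap u) * q (xmap u) \<noteq> 0" unfolding fun_eq_iff by auto
  then show ?thesis using p(4) q(4) by (intro exI[of _ u]) auto
qed

lemma map_degree_eq:
  assumes h: "h \<in> coord_ring" "h \<noteq> 0"
    and m: "\<And>u. h u \<noteq> 0 \<Longrightarrow> finite (ymap ` {u'. xmap u' = xmap u}) \<and> card (ymap ` {u'. xmap u' = xmap u}) = m"
  shows "map_degree fst (lissajous_cover A b) (lissajous A b) = m"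
proof -
  let ?P = "\<lambda>m y. finite {x \<in> lissajous_cover A b. fst x = y} \<and> card {x \<in> lissajous_cover A b. fst x = y} = m"
  have "?P m (xmap u)" if "h u \<noteq> 0" for u
  proof -
    have "{x \<in> lissajous_cover A b. fst x = xmap u} = Pair (xmap u) ` ymap ` {u'. xmap u' = xmap u}"
      unfolding lissajous_cover_eq by (auto simp: image_iff) metis
    moreover have "inj_on (Pair (xmap u)) T" for T :: "(complex ^ 'n) set" by (simp add: inj_on_def)
    ultimately show ?thesis using m[OF that] by (simp add: card_image)
  qed
  then have ex: "generic_on vec_coords (range xmap) (?P m)" by (rule generic_on_lissajous[OF h])
  show ?thesis unfolding map_degree_def lissajous_eq
  proof (rule the_equality)
    show "generic_on vec_coords (range xmap) (?P m)" by (rule ex)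
    fix k assume "generic_on vec_coords (range xmap) (?P k)"
    from generic_on_lissajous_common[OF ex this] show "k = m" by blast
  qed
qed

text \<open>The normalized linear forms give the lower bound. Conversely, independent regular
  functions lie in a common step of the filtration, whose growth limits their number.\<close>

lemma variety_dim_eq: "variety_dim (range xmap) = CARD('d)"
  unfolding variety_dim_def
proof (rule Greatest_equality)
  obtain M D where "good CARD('d) M D" using noether_normalization by blast
  then have M: "alg_indep CARD('d) (zf M)" by (rule good_alg_indep)
  show "\<exists>f. (\<forall>i<CARD('d). f i \<in> poly_funs vec_coords) \<and> alg_independent_on (range xmap) CARD('d) f"
  proof (intro exI conjI allI impI)
    show "(\<lambda>i x. \<Sum>j\<in>UNIV. M i $ j * x $ j) i \<in> poly_funs vec_coords" for i by (rule linear_form_xmap)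
    show "alg_independent_on (range xmap) CARD('d) (\<lambda>i x. \<Sum>j\<in>UNIV. M i $ j * x $ j)"
      unfolding alg_independent_on_def
    proof (intro ballI impI)
      fix p assume p: "p \<in> polys CARD('d)" "\<forall>x\<in>range xmap. p (\<lambda>i. \<Sum>j\<in>UNIV. M i $ j * x $ j) = 0"
      have "pz M p = 0"
      proof
        fix u show "pz M p u = 0 u" using p(2) by (simp add: zf_xmap)
      qed
      then show "\<forall>t. p t = 0" using pz_zero[OF M p(1)] by blast
    qed
  qed
next
  fix k assume "\<exists>f. (\<forall>i<k. f i \<in> poly_funs vec_coords) \<and> alg_independent_on (range xmap) k f"
  then obtain f where f: "\<And>i. i < k \<Longrightarrow> f i \<in> poly_funs vec_coords" "alg_independent_on (range xmap) k f" by blast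
  define \<zeta> where "\<zeta> = (\<lambda>i u. f i (xmap u))"
  obtain e where e: "\<And>i. i \<in> {..<k} \<Longrightarrow> \<zeta> i \<in> S e"
    by (rule common_layer[of "{..<k}" \<zeta>]) (use f(1) poly_funs_xmap in \<open>auto simp: \<zeta>_def\<close>)
  have "alg_indep k \<zeta>" unfolding alg_indep_def family_independent_def
  proof (intro allI impI)
    fix K c assume 0: "(\<Sum>\<alpha>\<in>exps k K. fscale (c \<alpha>) (mon k \<zeta> \<alpha>)) = 0"
    let ?p = "\<lambda>t. \<Sum>\<alpha>\<in>exps k K. c \<alpha> * mon k t \<alpha>"
    have "?p \<in> polys k" by (intro poly_funs_intros mon_in_poly_funs)
    moreover have "?p (\<lambda>i. f i (xmap u)) = 0" for u
      using fun_cong[OF 0, of u] by (simp add: mon_apply \<zeta>_def)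
    ultimately have "\<forall>t. ?p t = 0" using f(2) unfolding alg_independent_on_def by blast
    then show "\<forall>\<alpha>\<in>exps k K. c \<alpha> = 0" using exps_independent by blast
  qed
  moreover have "\<zeta> i \<in> S (Suc e)" if "i < k" for i using e[of i] that S_mono[of e "Suc e"] by auto
  ultimately show "k \<le> CARD('d)" by (intro dim_ge_of_layer_bound[of "Suc e"] alg_indep_layer_bound) auto
qed

lemma variety_degree_eq:
  assumes h: "h \<in> coord_ring" "h \<noteq> 0" and pos: "m > 0"
    and m: "\<And>u. h u \<noteq> 0 \<Longrightarrow> finite (ymap ` {u'. xmap u' = xmap u}) \<and> card (ymap ` {u'. xmap u' = xmap u}) = m"
  shows "real (m * variety_degree (lissajous A b)) = fact CARD('d) * growth"
proof -
  let ?d = "CARD('d)"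
  obtain r Q where r: "real r = fact ?d * growth" and Q: "Q \<in> eq_polys ?d" "\<exists>e. Q e \<noteq> 0"
    and card: "\<And>e. Q e \<noteq> 0 \<Longrightarrow> finite (ymap ` {u. \<forall>i<?d. zf (fst e) i u = snd e i}) \<and>
       card (ymap ` {u. \<forall>i<?d. zf (fst e) i u = snd e i}) = r"
    and nz: "\<And>e u. Q e \<noteq> 0 \<Longrightarrow> (\<forall>i<?d. zf (fst e) i u = snd e i) \<Longrightarrow> h u \<noteq> 0"
    by (rule generic_fiber[OF h]) blast
  \<comment> \<open>The projection written as a function of \<open>y\<close> alone, so that points
    of the cover can be counted as values of \<open>ymap\<close> and grouped by their image.\<close>
  define \<xi> where "\<xi> = (\<lambda>y :: complex ^ 'n. \<chi> j. (y $ j + inverse (y $ j)) / 2)"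
  have \<xi>: "\<xi> (ymap u) = xmap u" for u by (simp add: \<xi>_def vec_eq_iff xmap_ymap)
  have count: "finite (range xmap \<inter> affine_space ?d e) \<and> m * card (range xmap \<inter> affine_space ?d e) = r"
    if e: "Q e \<noteq> 0" for e
  proof -
    define U where "U = {u. \<forall>i<?d. zf (fst e) i u = snd e i}"
    have "range xmap \<inter> affine_space ?d e = xmap ` U"
      unfolding U_def by (auto simp: affine_space_def zf_xmap case_prod_beta)
    then have X: "range xmap \<inter> affine_space ?d e = \<xi> ` ymap ` U" by (simp add: image_image \<xi>)
    have fin: "finite (ymap ` U)" and cr: "card (ymap ` U) = r" using card[OF e] unfolding U_def by blast+
    have fib: "card {y \<in> ymap ` U. \<xi> y = x} = m" if x: "x \<in> \<xi> ` ymap ` U" for x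
    proof -
      obtain u where u: "u \<in> U" "x = xmap u" using x by (auto simp: \<xi>)
      have "u' \<in> U" if "xmap u' = xmap u" for u' using u(1) that unfolding U_def by (simp add: zf_xmap)
      then have "{y \<in> ymap ` U. \<xi> y = x} = ymap ` {u'. xmap u' = xmap u}"
        unfolding u(2) by (auto simp: \<xi>)
      then show ?thesis using m nz[OF e] u(1) unfolding U_def by simp
    qed
    have "r = (\<Sum>y\<in>ymap ` U. 1)" using cr by simp
    also have "\<dots> = (\<Sum>x\<in>\<xi> ` ymap ` U. \<Sum>y\<in>{y \<in> ymap ` U. \<xi> y = x}. 1)"
      by (rule sum.image_gen[OF fin])
    also have "\<dots> = m * card (\<xi> ` ymap ` U)" using fib by simp
    finally show ?thesis unfolding X using fin by simp
  qed
  let ?P = "\<lambda>k e. finite (range xmap \<inter> affine_space ?d e) \<and> card (range xmap \<inter> affine_space ?d e) = k"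
  obtain e0 where e0: "Q e0 \<noteq> 0" using Q(2) by blast
  define k where "k = card (range xmap \<inter> affine_space ?d e0)"
  have mk: "m * k = r" unfolding k_def using count[OF e0] by blast
  have P: "?P k e" if "Q e \<noteq> 0" for e
  proof -
    have "m * card (range xmap \<inter> affine_space ?d e) = m * k" using count[OF that] mk by simp
    then show ?thesis using count[OF that] pos by simp
  qed
  have ex: "generic_on (equation_coords ?d) UNIV (?P k)"
    using Q(1) e0 P by (intro generic_onI[of Q _ e0]) auto
  have "variety_degree (range xmap) = k" unfolding variety_degree_def variety_dim_eq
  proof (rule the_equality)
    show "generic_on (equation_coords ?d) UNIV (?P k)" by (rule ex)
    fix l assume "generic_on (equation_coords ?d) UNIV (?P l)"
    then obtain p e where p: "p \<in> eq_polys ?d" "p e \<noteq> 0" "\<And>e. p e \<noteq> 0 \<Longrightarrow> ?P l e"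
      by (rule generic_onE) blast
    obtain e' where "Q e' \<noteq> 0" "p e' \<noteq> 0"
      by (rule poly_funs_nonzero_common[OF line_coords_equation Q(1) e0 p(1,2)])
    then show "l = k" using P p(3) by blast
  qed
  then show ?thesis using mk r by (simp add: lissajous_eq)
qed

end

theorem theorem2p3:
  fixes A :: "int ^ 'n ^ 'd" and b :: "complex ^ 'n"
  assumes "rank (map_matrix complex_of_int A) = CARD('d)"
  shows "real (variety_degree (lissajous A b)) =
           fact CARD('d) * measure lebesgue (col_polytope A) /
           (real (map_degree fst (lissajous_cover A b) (lissajous A b)) *
            real (col_lattice_index A))"
proof -
  interpret lissajous_setup A b by unfold_locales (rule assms)
  obtain h m where h: "h \<in> coord_ring" "h \<noteq> 0" and pos: "m > 0"
    and m: "\<And>u. h u \<noteq> 0 \<Longrightarrow> finite (ymap ` {u'. xmap u' = xmap u}) \<and> card (ymap ` {u'. xmap u' = xmap u}) = m"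
    by (rule generic_projection_fiber) blast
  have "real m * real (variety_degree (lissajous A b)) = fact CARD('d) * growth"
    using variety_degree_eq[OF h pos m] by simp
  then have "real (variety_degree (lissajous A b)) = fact CARD('d) * growth / real m"
    using pos by (simp add: field_simps)
  moreover have "map_degree fst (lissajous_cover A b) (lissajous A b) = m"
    by (rule map_degree_eq[OF h m])
  ultimately show ?thesis by (simp add: growth_def mult.commute)
qed

end
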